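(* Let $(M,g)$ be a 6-dimensional rigid $h$-space of nonconstant curvature, with fixed tensor $h$. Then the projective motions of $(M,g)$ are exactly the solutions $\xi$ of the equation $$L_{\xi}g_{ij}=\xi_{i,j}+\xi_{j,i}=a_1h_{ij}+a_2g_{ij},$$ where $a_1,a_2$ range over arbitrary real constants; that is, a smooth vector field $\xi$ on $M$ is an infinitesimal projective transformation if and only if there exist constants $a_1,a_2\in\mathbb{R}$ such that this equation holds.
   Context: $(M,g)$ is a connected smooth pseudo-Riemannian manifold of dimension $n=6$ and signature $[++----]$ (two plus signs, four minus signs); a comma denotes covariant differentiation with respect to the Levi-Civita connection of $g$, and $\xi_i=g_{ij}\xi^j$. Eisenhart equation: for a symmetric $(0,2)$-tensor field $h$ and a function $\varphi$, $$h_{ij,k}=2g_{ij}\varphi_{,k}+g_{ik}\varphi_{,j}+g_{jk}\varphi_{,i}.$$ Infinitesimal projective transformation (projective motion): a smooth vector field $X$ on $M$ whose local flow preserves unparametrized geodesics; equivalently, $L_Xg$ satisfies the Eisenhart equation with $\varphi=\frac{1}{n+1}\operatorname{div}X$. $h$-space: a pseudo-Riemannian manifold $(M,g)$ together with a solution $h$ of the Eisenhart equation (for some function $\varphi$) with $h\neq cg$ for every constant $c$. Its type is the Segre characteristic of the $\lambda$-matrix $(h-\lambda g)$, i.e. the list of sizes of the Jordan blocks of the endomorphism $g^{-1}h$, assumed the same at all points of $M$. Rigid $h$-space: an $h$-space for which the bases of the elementary divisors (prime divisors) of $(h-\lambda g)$ are pairwise distinct at every point, i.e. distinct Jordan blocks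 of $g^{-1}h$ have distinct eigenvalues. In the present dimension and signature these are the $h$-spaces of types $[111111]$, $[21111]$, $[2211]$, $[3111]$, $[321]$, $[33]$, $[411]$, $[51]$. Constant curvature means $R^i_{\ jkl}=K(\delta^i_k g_{jl}-\delta^i_l g_{jk})$ on $M$ for some constant $K$ ($K=0$ allowed); nonconstant curvature means that this fails for every constant $K$. *)

theory Defs
  imports "Jordan_Normal_Form.Jordan_Normal_Form" "HOL-Analysis.Analysis"
begin

no_notation Matrix.vec_index (infixl "$" 100)

section \<open>Smooth manifolds, with fields given by their components in charts\<close>

text \<open>
  \<open>Ck_on k S f\<close> is meant for open \<open>S\<close> only. In finite dimension, continuity of every directional
  derivative is the same as continuity of the total derivative.
\<close>

primrec Ck_on :: "nat \<Rightarrow> 'a::euclidean_space set \<Rightarrow> ('a \<Rightarrow> 'b::real_normed_vector) \<Rightarrow> bool" where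
  "Ck_on 0 S f \<longleftrightarrow> continuous_on S f"
| "Ck_on (Suc k) S f \<longleftrightarrow>
     f differentiable_on S \<and> (\<forall>v. Ck_on k S (\<lambda>x. frechet_derivative f (at x) v))"

definition smooth_on :: "'a::euclidean_space set \<Rightarrow> ('a \<Rightarrow> 'b::real_normed_vector) \<Rightarrow> bool" where
  "smooth_on S f \<longleftrightarrow> (\<forall>k. Ck_on k S f)"

text \<open>
  The manifold is the whole type \<open>'m\<close>. A chart is a pair of a domain and a coordinate map. The values
  of the coordinate map outside the domain are irrelevant.
\<close>

type_synonym ('m, 'n) chart = "'m set \<times> ('m \<Rightarrow> real^'n)"

abbreviation dom_of :: "('m, 'n) chart \<Rightarrow> 'm set" where
  "dom_of c \<equiv> fst c"

abbreviation coords :: "('m, 'n) chart \<Rightarrow> 'm \<Rightarrow> real^'n" where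
  "coords c \<equiv> snd c"

definition cod_of :: "('m, 'n) chart \<Rightarrow> (real^'n) set" where
  "cod_of c = coords c ` dom_of c"

definition inv_coords :: "('m, 'n) chart \<Rightarrow> real^'n \<Rightarrow> 'm" where
  "inv_coords c = inv_into (dom_of c) (coords c)"

definition smooth_atlas :: "('m::topological_space, 'n::finite) chart set \<Rightarrow> bool" where
  "smooth_atlas A \<longleftrightarrow>
     (\<Union>c\<in>A. dom_of c) = UNIV \<and>
     (\<forall>c\<in>A. open (dom_of c) \<and> open (cod_of c) \<and>
        homeomorphism (dom_of c) (cod_of c) (coords c) (inv_coords c)) \<and>
     (\<forall>c\<in>A. \<forall>d\<in>A. smooth_on (coords c ` (dom_of c \<inter> dom_of d)) (coords d \<circ> inv_coords c))"

text \<open>The matrix \<open>(\<partial>y\<^sup>i/\<partial>x\<^sup>j)\<close> at \<open>p\<close>, where \<open>x\<close> are the coordinates of \<open>c\<close> and \<open>y\<close> those of \<open>d\<close>.\<close>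

definition jacobian_mat :: "('m, 'n::finite) chart \<Rightarrow> ('m, 'n) chart \<Rightarrow> 'm \<Rightarrow> real^'n^'n" where
  "jacobian_mat c d p =
     matrix (frechet_derivative (coords d \<circ> inv_coords c) (at (coords c p)))"

definition smooth_in_chart :: "('m, 'n::finite) chart \<Rightarrow> ('m \<Rightarrow> 'b::real_normed_vector) \<Rightarrow> bool" where
  "smooth_in_chart c f \<longleftrightarrow> smooth_on (cod_of c) (f \<circ> inv_coords c)"

definition smooth_function :: "('m, 'n::finite) chart set \<Rightarrow> ('m \<Rightarrow> real) \<Rightarrow> bool" where
  "smooth_function A f \<longleftrightarrow> (\<forall>c\<in>A. smooth_in_chart c f)"

text \<open>
  In a field, the first argument is the chart in which the components are taken and the second
  argument is the point. Components are meaningful only at points of the chart domain.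
\<close>

type_synonym ('m, 'n) vfield = "('m, 'n) chart \<Rightarrow> 'm \<Rightarrow> real^'n"
type_synonym ('m, 'n) tensor02 = "('m, 'n) chart \<Rightarrow> 'm \<Rightarrow> real^'n^'n"

definition smooth_vector_field :: "('m, 'n::finite) chart set \<Rightarrow> ('m, 'n) vfield \<Rightarrow> bool" where
  "smooth_vector_field A X \<longleftrightarrow>
     (\<forall>c\<in>A. smooth_in_chart c (X c)) \<and>
     (\<forall>c\<in>A. \<forall>d\<in>A. \<forall>p\<in>dom_of c \<inter> dom_of d. X d p = jacobian_mat c d p *v X c p)"

definition smooth_symmetric_tensor :: "('m, 'n::finite) chart set \<Rightarrow> ('m, 'n) tensor02 \<Rightarrow> bool" where
  "smooth_symmetric_tensor A h \<longleftrightarrow>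
     (\<forall>c\<in>A. smooth_in_chart c (h c)) \<and>
     (\<forall>c\<in>A. \<forall>p\<in>dom_of c. \<forall>i j. h c p $ i $ j = h c p $ j $ i) \<and>
     (\<forall>c\<in>A. \<forall>d\<in>A. \<forall>p\<in>dom_of c \<inter> dom_of d.
        h c p = Finite_Cartesian_Product.transpose (jacobian_mat c d p) ** h d p ** jacobian_mat c d p)"


section \<open>Pseudo-Riemannian geometry\<close>

definition has_signature :: "real^'n^'n::finite \<Rightarrow> nat \<Rightarrow> nat \<Rightarrow> bool" where
  "has_signature G r s \<longleftrightarrow>
     (\<exists>(P :: real^'n^'n) D. invertible P \<and>
        Finite_Cartesian_Product.transpose P ** G ** P = (\<chi> i j. if i = j then D i else 0) \<and>
        (\<forall>i. D i \<noteq> (0::real)) \<and> card {i. D i > 0} = r \<and> card {i. D i < 0} = s)"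

definition pseudo_riemannian_metric ::
    "('m, 'n::finite) chart set \<Rightarrow> ('m, 'n) tensor02 \<Rightarrow> nat \<Rightarrow> nat \<Rightarrow> bool" where
  "pseudo_riemannian_metric A g r s \<longleftrightarrow>
     smooth_symmetric_tensor A g \<and> (\<forall>c\<in>A. \<forall>p\<in>dom_of c. has_signature (g c p) r s)"

text \<open>\<open>partial_deriv c k f p\<close> is \<open>\<partial>f/\<partial>x\<^sup>k\<close> at \<open>p\<close> in the coordinates of \<open>c\<close>.\<close>

definition partial_deriv :: "('m, 'n::finite) chart \<Rightarrow> 'n \<Rightarrow> ('m \<Rightarrow> real) \<Rightarrow> 'm \<Rightarrow> real" where
  "partial_deriv c k f p =
     frechet_derivative (f \<circ> inv_coords c) (at (coords c p)) (axis k 1)"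

text \<open>\<open>christoffel g c i j k\<close> is \<open>\<Gamma>\<^sup>i\<^bsub>jk\<^esub>\<close>.\<close>

definition christoffel :: "('m, 'n::finite) tensor02 \<Rightarrow> ('m, 'n) chart \<Rightarrow> 'n \<Rightarrow> 'n \<Rightarrow> 'n \<Rightarrow> 'm \<Rightarrow> real" where
  "christoffel g c i j k p =
     (\<Sum>l\<in>UNIV. matrix_inv (g c p) $ i $ l *
        (partial_deriv c j (\<lambda>q. g c q $ l $ k) p + partial_deriv c k (\<lambda>q. g c q $ l $ j) p
         - partial_deriv c l (\<lambda>q. g c q $ j $ k) p)) / 2"

text \<open>\<open>cov_deriv2 g h c i j k\<close> is \<open>h\<^bsub>ij,k\<^esub>\<close>, and \<open>cov_deriv1 g \<omega> c i j\<close> is \<open>\<omega>\<^bsub>i,j\<^esub>\<close>.\<close>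

definition cov_deriv2 ::
    "('m, 'n::finite) tensor02 \<Rightarrow> ('m, 'n) tensor02 \<Rightarrow> ('m, 'n) chart \<Rightarrow> 'n \<Rightarrow> 'n \<Rightarrow> 'n \<Rightarrow> 'm \<Rightarrow> real" where
  "cov_deriv2 g h c i j k p =
     partial_deriv c k (\<lambda>q. h c q $ i $ j) p
     - (\<Sum>l\<in>UNIV. christoffel g c l k i p * h c p $ l $ j)
     - (\<Sum>l\<in>UNIV. christoffel g c l k j p * h c p $ i $ l)"

definition cov_deriv1 ::
    "('m, 'n::finite) tensor02 \<Rightarrow> ('m, 'n) vfield \<Rightarrow> ('m, 'n) chart \<Rightarrow> 'n \<Rightarrow> 'n \<Rightarrow> 'm \<Rightarrow> real" where
  "cov_deriv1 g \<omega> c i j p =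
     partial_deriv c j (\<lambda>q. \<omega> c q $ i) p - (\<Sum>l\<in>UNIV. christoffel g c l j i p * \<omega> c p $ l)"

text \<open>The covector field \<open>\<xi>\<^sub>i = g\<^bsub>ij\<^esub> \<xi>\<^sup>j\<close>, stored under the same component type as a vector field.\<close>

definition lower_index :: "('m, 'n::finite) tensor02 \<Rightarrow> ('m, 'n) vfield \<Rightarrow> ('m, 'n) vfield" where
  "lower_index g X c p = g c p *v X c p"

definition lie_deriv ::
    "('m, 'n::finite) vfield \<Rightarrow> ('m, 'n) tensor02 \<Rightarrow> ('m, 'n) chart \<Rightarrow> 'n \<Rightarrow> 'n \<Rightarrow> 'm \<Rightarrow> real" where
  "lie_deriv X g c i j p =
     (\<Sum>k\<in>UNIV. X c p $ k * partial_deriv c k (\<lambda>q. g c q $ i $ j) p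
        + g c p $ k $ j * partial_deriv c i (\<lambda>q. X c q $ k) p
        + g c p $ i $ k * partial_deriv c j (\<lambda>q. X c q $ k) p)"

text \<open>
  \<open>riemann g c i j k l\<close> is \<open>R\<^sup>i\<^bsub>jkl\<^esub>\<close>, with the sign for which round spheres have \<open>K > 0\<close> in the
  definition of constant curvature below.
\<close>

definition riemann ::
    "('m, 'n::finite) tensor02 \<Rightarrow> ('m, 'n) chart \<Rightarrow> 'n \<Rightarrow> 'n \<Rightarrow> 'n \<Rightarrow> 'n \<Rightarrow> 'm \<Rightarrow> real" where
  "riemann g c i j k l p =
     partial_deriv c k (christoffel g c i l j) p - partial_deriv c l (christoffel g c i k j) p
     + (\<Sum>m\<in>UNIV. christoffel g c i k m p * christoffel g c m l j p
                 - christoffel g c i l m p * christoffel g c m k j p)"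

definition constant_curvature :: "('m, 'n::finite) chart set \<Rightarrow> ('m, 'n) tensor02 \<Rightarrow> bool" where
  "constant_curvature A g \<longleftrightarrow>
     (\<exists>K::real. \<forall>c\<in>A. \<forall>p\<in>dom_of c. \<forall>i j k l.
        riemann g c i j k l p =
          K * ((if i = k then 1 else 0) * g c p $ j $ l - (if i = l then 1 else 0) * g c p $ j $ k))"


section \<open>Geodesics and projective motions\<close>

definition smooth_curve ::
    "('m::topological_space, 'n::finite) chart set \<Rightarrow> real set \<Rightarrow> (real \<Rightarrow> 'm) \<Rightarrow> bool" where
  "smooth_curve A I \<gamma> \<longleftrightarrow>
     continuous_on I \<gamma> \<and> (\<forall>c\<in>A. smooth_on {t\<in>I. \<gamma> t \<in> dom_of c} (coords c \<circ> \<gamma>))"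

text \<open>Affinely parametrized geodesics on an open interval. Constant curves are included.\<close>

definition geodesic ::
    "('m::topological_space, 'n::finite) chart set \<Rightarrow> ('m, 'n) tensor02 \<Rightarrow> real set \<Rightarrow> (real \<Rightarrow> 'm) \<Rightarrow> bool" where
  "geodesic A g I \<gamma> \<longleftrightarrow>
     open I \<and> connected I \<and> smooth_curve A I \<gamma> \<and>
     (\<forall>c\<in>A. \<forall>t\<in>I. \<gamma> t \<in> dom_of c \<longrightarrow>
        (let u' = (\<lambda>s. vector_derivative (coords c \<circ> \<gamma>) (at s)) in
         \<forall>i. vector_derivative u' (at t) $ i
               + (\<Sum>j\<in>UNIV. \<Sum>k\<in>UNIV. christoffel g c i j k (\<gamma> t) * u' t $ j * u' t $ k) = 0))"

text \<open>A curve that becomes a geodesic after a regular change of parameter \<open>t = \<tau> s\<close>.\<close>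

definition unparametrized_geodesic ::
    "('m::topological_space, 'n::finite) chart set \<Rightarrow> ('m, 'n) tensor02 \<Rightarrow> real set \<Rightarrow> (real \<Rightarrow> 'm) \<Rightarrow> bool" where
  "unparametrized_geodesic A g I \<sigma> \<longleftrightarrow>
     (\<exists>J \<tau>. open J \<and> connected J \<and> smooth_on J \<tau> \<and> (\<forall>s\<in>J. deriv \<tau> s \<noteq> 0) \<and> \<tau> ` J = I \<and>
        geodesic A g J (\<sigma> \<circ> \<tau>))"

definition local_flow ::
    "('m::topological_space, 'n::finite) chart set \<Rightarrow> ('m, 'n) vfield \<Rightarrow> real \<Rightarrow> 'm set \<Rightarrow>
     (real \<Rightarrow> 'm \<Rightarrow> 'm) \<Rightarrow> bool" where
  "local_flow A X \<epsilon> V \<theta> \<longleftrightarrow>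
     \<epsilon> > 0 \<and> open V \<and>
     continuous_on ({-\<epsilon><..<\<epsilon>} \<times> V) (\<lambda>(t, p). \<theta> t p) \<and>
     (\<forall>c\<in>A. \<forall>d\<in>A.
        smooth_on {(t, x). t \<in> {-\<epsilon><..<\<epsilon>} \<and> x \<in> coords c ` (dom_of c \<inter> V) \<and>
                           \<theta> t (inv_coords c x) \<in> dom_of d}
                  (\<lambda>(t, x). coords d (\<theta> t (inv_coords c x)))) \<and>
     (\<forall>p\<in>V. \<theta> 0 p = p) \<and>
     (\<forall>p\<in>V. \<forall>t\<in>{-\<epsilon><..<\<epsilon>}. \<forall>c\<in>A. \<theta> t p \<in> dom_of c \<longrightarrow>
        ((\<lambda>s. coords c (\<theta> s p)) has_vector_derivative X c (\<theta> t p)) (at t))"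

definition projective_motion ::
    "('m::topological_space, 'n::finite) chart set \<Rightarrow> ('m, 'n) tensor02 \<Rightarrow> ('m, 'n) vfield \<Rightarrow> bool" where
  "projective_motion A g X \<longleftrightarrow>
     smooth_vector_field A X \<and>
     (\<forall>\<epsilon> V \<theta>. local_flow A X \<epsilon> V \<theta> \<longrightarrow>
        (\<forall>t\<in>{-\<epsilon><..<\<epsilon>}. \<forall>I \<gamma>. geodesic A g I \<gamma> \<and> \<gamma> ` I \<subseteq> V \<longrightarrow>
           unparametrized_geodesic A g I (\<lambda>s. \<theta> t (\<gamma> s))))"


section \<open>$h$-spaces\<close>

definition eisenhart_equation ::
    "('m, 'n::finite) chart set \<Rightarrow> ('m, 'n) tensor02 \<Rightarrow> ('m, 'n) tensor02 \<Rightarrow> ('m \<Rightarrow> real) \<Rightarrow> bool" where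
  "eisenhart_equation A g h \<phi> \<longleftrightarrow>
     (\<forall>c\<in>A. \<forall>p\<in>dom_of c. \<forall>i j k.
        cov_deriv2 g h c i j k p =
          2 * g c p $ i $ j * partial_deriv c k \<phi> p
          + g c p $ i $ k * partial_deriv c j \<phi> p
          + g c p $ j $ k * partial_deriv c i \<phi> p)"

text \<open>
  The rows and columns of \<open>g\<inverse>h\<close> are renumbered by an enumeration of the index type. A different
  enumeration gives a similar matrix. Jordan blocks are taken over the complex numbers.
\<close>

definition endo_mat :: "('m, 'n::finite) tensor02 \<Rightarrow> ('m, 'n) tensor02 \<Rightarrow> ('m, 'n) chart \<Rightarrow> 'm \<Rightarrow> complex mat" where
  "endo_mat g h c p =
     Matrix.mat CARD('n) CARD('n)
       (\<lambda>(i, j). complex_of_real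
          ((matrix_inv (g c p) ** h c p) $ from_nat_into UNIV i $ from_nat_into UNIV j))"

definition h_space ::
    "('m, 'n::finite) chart set \<Rightarrow> ('m, 'n) tensor02 \<Rightarrow> ('m, 'n) tensor02 \<Rightarrow> bool" where
  "h_space A g h \<longleftrightarrow>
     smooth_symmetric_tensor A h \<and>
     (\<exists>\<phi>. smooth_function A \<phi> \<and> eisenhart_equation A g h \<phi>) \<and>
     \<not> (\<exists>a::real. \<forall>c\<in>A. \<forall>p\<in>dom_of c. h c p = a *\<^sub>R g c p) \<and>
     (\<exists>sizes. \<forall>c\<in>A. \<forall>p\<in>dom_of c. \<exists>n_as.
        jordan_nf (endo_mat g h c p) n_as \<and> mset (map fst n_as) = sizes)"

definition rigid_h_space ::
    "('m, 'n::finite) chart set \<Rightarrow> ('m, 'n) tensor02 \<Rightarrow> ('m, 'n) tensor02 \<Rightarrow> bool" where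
  "rigid_h_space A g h \<longleftrightarrow>
     h_space A g h \<and>
     (\<forall>c\<in>A. \<forall>p\<in>dom_of c. \<exists>n_as.
        jordan_nf (endo_mat g h c p) n_as \<and> distinct (map snd n_as))"

end

theory Submission
  imports Defs "HOL-Computational_Algebra.Fundamental_Theorem_Algebra"
begin

text \<open>
  A vector field \<open>X\<close> is projective if and only if \<open>L\<^sub>X g\<close> solves the Eisenhart equation: along the flow,
  the acceleration of a transported geodesic stays proportional to its velocity exactly when the Lie
  derivative of the connection is \<open>\<psi> \<otimes> id + id \<otimes> \<psi>\<close>. This already settles one direction, because
  \<open>a\<^sub>1 h + a\<^sub>2 g\<close> solves the equation.

  For the other direction, the Ricci identity turns the equation for \<open>h\<close> into an algebraic identity between
  the curvature, \<open>L = g\<^sup>-\<^sup>1 h\<close> and the Hessian of \<open>\<phi>\<close>. Rigidity says that \<open>L\<close> has one Jordan block per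
  eigenvalue, so \<open>L\<close> has a cyclic vector. The identity then leaves two cases at each point: the Hessian of
  \<open>\<phi>\<close> is a combination of \<open>g\<close> and \<open>h\<close>, or every solution of the equation is such a combination. If the
  first case holds everywhere, the curvature tensor has the form of constant curvature, with a coefficient
  that is constant by an argument like Schur's lemma. Otherwise the second case holds on some open set,
  where \<open>L\<^sub>X g = a\<^sub>1 h + a\<^sub>2 g\<close> with constants \<open>a\<^sub>1, a\<^sub>2\<close>. The difference \<open>T\<close> of the two sides solves the
  equation with some potential \<open>\<phi>'\<close>, and \<open>T(u, u) - 4 \<phi>' g(u, u)\<close> is conserved along geodesics with
  velocity \<open>u\<close>. Hence \<open>T\<close>, which vanishes on an open set, vanishes everywhere.
\<close>

no_notation Matrix.scalar_prod (infix "\<bullet>" 70)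
no_notation Matrix.mult_mat_vec (infixl "*\<^sub>v" 70)

section \<open>Smooth functions\<close>

text \<open>No case distinction by Segre type occurs: rigidity enters only through the cyclic
  vector, and the algebra needs v, Lv, L^2 v, L^3 v to be independent. A self-adjoint L with a
  cyclic vector commutes with no nonzero skew operator; both curvature formulas come from this. One
  of them expresses R(Lu, u) through u and \<Lambda> u, with \<Lambda> the endomorphism of the
  Hessian, and turns the Ricci identity of a second solution into the two cases.

  The data are smooth, not analytic, so equality on an open set has to be carried along geodesics.
  The potential has a free additive constant; what travels is therefore T = 4 (\<phi>' - c) g rather
  than T = 0, and the equation is used once more to make \<phi>' constant.

  A projective motion comes with no potential. In each chart its covector is read off the Lie
  derivative of the connection, and a trace shows that the covector is a gradient. Projectivity
  speaks about all local flows, so smooth flows are constructed, both for this and for the geodesic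
  equation.\<close>

abbreviation dd :: "('a::euclidean_space \<Rightarrow> 'b::real_normed_vector) \<Rightarrow> 'a \<Rightarrow> 'a \<Rightarrow> 'b" where
  "dd f x \<equiv> frechet_derivative f (at x)"

lemma dd_eq: "(f has_derivative f') (at x) \<Longrightarrow> dd f x = f'"
  by (rule frechet_derivative_at[symmetric])

text \<open>\<open>frechet_derivative\<close> is a choice among the maps that are derivatives at
  \<open>x\<close>, and functions agreeing near \<open>x\<close> have the same candidates; so the
  equality holds without differentiability.\<close>

lemma dd_cong_open:
  assumes "open S" "x \<in> S" "\<And>y. y \<in> S \<Longrightarrow> f y = g y"
  shows "dd f x = dd g x"
proof -
  have *: "(f has_derivative f') (at x) = (g has_derivative f') (at x)" for f'
    using assms has_derivative_transform_within_open[of f f' x UNIV S g]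
      has_derivative_transform_within_open[of g f' x UNIV S f] by auto
  show ?thesis unfolding frechet_derivative_def by (simp add: *)
qed

lemma Ck_on_cong:
  assumes "open S" "\<And>y. y \<in> S \<Longrightarrow> f y = g y" "Ck_on k S f"
  shows "Ck_on k S g"
  using assms(2,3)
proof (induction k arbitrary: f g)
  case 0
  then show ?case by (metis Ck_on.simps(1) continuous_on_eq)
next
  case (Suc k)
  have "g differentiable_on S"
  proof -
    have "f differentiable_on S" using Suc.prems(2) by simp
    then show ?thesis unfolding differentiable_on_def
      using differentiable_transform_within[of f _ S 1 g] Suc.prems(1) by auto
  qed
  moreover have "Ck_on k S (\<lambda>x. dd g x v)" for v
    by (rule Suc.IH[of "\<lambda>x. dd f x v"])
      (use Suc.prems assms(1) dd_cong_open[of S _ f g] in auto)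
  ultimately show ?case by simp
qed

text \<open>Smoothness is proved throughout by exhibiting a derivative \<open>f'\<close>; this rule
  lets it stand in for the chosen \<open>frechet_derivative\<close> of the definition.\<close>

lemma Ck_on_SucI:
  assumes S: "open S" and f: "\<And>x. x \<in> S \<Longrightarrow> (f has_derivative f' x) (at x)"
    and k: "\<And>v. Ck_on k S (\<lambda>x. f' x v)"
  shows "Ck_on (Suc k) S f"
proof -
  have "f differentiable_on S"
    unfolding differentiable_on_def using f
    by (meson differentiable_at_withinI differentiable_def)
  moreover have "Ck_on k S (\<lambda>x. dd f x v)" for v
    by (rule Ck_on_cong[OF S _ k]) (use dd_eq[OF f] in auto)
  ultimately show ?thesis by simp
qed

lemma Ck_on_SucD:
  assumes "open S" "Ck_on (Suc k) S f" "x \<in> S"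
  shows "(f has_derivative dd f x) (at x)"
proof -
  have "f differentiable at x within S"
    using assms by (auto simp: differentiable_on_def)
  then have "f differentiable at x" using assms
    by (metis at_within_open)
  then show ?thesis by (simp add: frechet_derivative_works)
qed

lemma Ck_on_SucD2: "Ck_on (Suc k) S f \<Longrightarrow> Ck_on k S (\<lambda>x. dd f x v)"
  by simp

lemma Ck_on_subset: "Ck_on k S f \<Longrightarrow> T \<subseteq> S \<Longrightarrow> Ck_on k T f"
proof (induction k arbitrary: f)
  case 0
  then show ?case by (auto intro: continuous_on_subset)
next
  case (Suc k)
  then show ?case using differentiable_on_subset by auto
qed

lemma Ck_on_SucD1: "Ck_on (Suc k) S f \<Longrightarrow> Ck_on k S f"
proof (induction k arbitrary: f)
  case 0
  then show ?case by (auto intro: differentiable_imp_continuous_on)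
next
  case (Suc k)
  then show ?case by (auto simp del: Ck_on.simps(1))
qed

lemma Ck_on_le: assumes "k \<le> l" "Ck_on l S f" shows "Ck_on k S f"
  using assms by (induction l rule: dec_induct) (auto dest: Ck_on_SucD1 simp del: Ck_on.simps)

lemma Ck_on_continuous: "Ck_on k S f \<Longrightarrow> continuous_on S f"
  using Ck_on_le[of 0 k S f] by simp

lemma Ck_on_const: assumes "open S" shows "Ck_on k S (\<lambda>x. c)"
proof (induction k arbitrary: c)
  case (Suc k)
  show ?case by (rule Ck_on_SucI[OF assms, where f'="\<lambda>x v. 0"]) (use Suc in auto)
qed auto

lemma Ck_on_bounded_linear:
  assumes "open S" "bounded_linear f" shows "Ck_on k S f"
proof (cases k)
  case 0
  then show ?thesis using assms by (simp add: linear_continuous_on)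
next
  case (Suc l)
  show ?thesis unfolding Suc
    by (rule Ck_on_SucI[OF assms(1), where f'="\<lambda>x. f"])
      (use assms Ck_on_const bounded_linear_imp_has_derivative in auto)
qed

lemma Ck_on_linear_compose:
  assumes S: "open S" and L: "bounded_linear L" and "Ck_on k S f"
  shows "Ck_on k S (\<lambda>x. L (f x))"
  using assms(3)
proof (induction k arbitrary: f)
  case 0
  then show ?case using continuous_on_compose2[OF linear_continuous_on[OF L, of UNIV]] by auto
next
  case (Suc k)
  show ?case
    by (rule Ck_on_SucI[OF S, where f'="\<lambda>x v. L (dd f x v)"])
      (use Suc Ck_on_SucD[OF S Suc.prems] in \<open>auto intro: bounded_linear.has_derivative[OF L]\<close>)
qed

lemma Ck_on_add:
  assumes S: "open S" and "Ck_on k S f" "Ck_on k S g"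
  shows "Ck_on k S (\<lambda>x. f x + g x)"
  using assms(2,3)
proof (induction k arbitrary: f g)
  case 0
  then show ?case by (auto intro: continuous_on_add)
next
  case (Suc k)
  show ?case
    by (rule Ck_on_SucI[OF S, where f'="\<lambda>x v. dd f x v + dd g x v"])
      (use Suc Ck_on_SucD[OF S Suc.prems(1)] Ck_on_SucD[OF S Suc.prems(2)] in
        \<open>auto intro: has_derivative_add\<close>)
qed

lemma Ck_on_bilinear:
  assumes S: "open S" and B: "bounded_bilinear B" and "Ck_on k S f" "Ck_on k S g"
  shows "Ck_on k S (\<lambda>x. B (f x) (g x))"
  using assms(3,4)
proof (induction k arbitrary: f g)
  case 0
  then show ?case by (auto intro: bounded_bilinear.continuous_on[OF B])
next
  case (Suc k)
  show ?case
  proof (rule Ck_on_SucI[OF S, where f'="\<lambda>x v. B (f x) (dd g x v) + B (dd f x v) (g x)"])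
    show "Ck_on k S (\<lambda>x. B (f x) (dd g x v) + B (dd f x v) (g x))" for v
      by (intro Ck_on_add[OF S] Suc.IH) (use Suc.prems Ck_on_SucD1 in auto)
  qed (use Ck_on_SucD[OF S Suc.prems(1)] Ck_on_SucD[OF S Suc.prems(2)] in
        \<open>auto intro: bounded_bilinear.FDERIV[OF B]\<close>)
qed

lemma Ck_on_sum:
  assumes "open S" "\<And>i. i \<in> I \<Longrightarrow> Ck_on k S (f i)"
  shows "Ck_on k S (\<lambda>x. \<Sum>i\<in>I. f i x)"
  using assms(2)
  by (induction I rule: infinite_finite_induct)
    (auto intro: Ck_on_const[OF assms(1)] Ck_on_add[OF assms(1)])

lemma bounded_linear_PairL: "bounded_linear (\<lambda>x. (x, 0))" 
  by (intro bounded_linear_intros)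
lemma bounded_linear_PairR: "bounded_linear (\<lambda>x. (0, x))" 
  by (intro bounded_linear_intros)

lemma Ck_on_Pair:
  assumes S: "open S" and "Ck_on k S f" "Ck_on k S g"
  shows "Ck_on k S (\<lambda>x. (f x, g x))"
  using Ck_on_add[OF S Ck_on_linear_compose[OF S bounded_linear_PairL assms(2)]
      Ck_on_linear_compose[OF S bounded_linear_PairR assms(3)]] by simp

lemma Ck_on_compose:
  fixes f :: "'a::euclidean_space \<Rightarrow> 'b::euclidean_space"
  assumes S: "open S" and T: "open T" and "Ck_on k S f" "Ck_on k T g" and sub: "f ` S \<subseteq> T"
  shows "Ck_on k S (\<lambda>x. g (f x))"
  using assms(3,4)
proof (induction k arbitrary: g)
  case 0
  then show ?case using sub continuous_on_compose2 by auto
next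
  case (Suc k)
  have fd: "(f has_derivative dd f x) (at x)" if "x \<in> S" for x
    using Ck_on_SucD[OF S Suc.prems(1)] that .
  have gd: "(g has_derivative dd g (f x)) (at (f x))" if "x \<in> S" for x
    using Ck_on_SucD[OF T Suc.prems(2)] that sub by auto
  show ?case
  \<comment> \<open>The derivative \<open>dd g (f x) (dd f x v)\<close> is expanded in the basis so
    that each factor is a function of \<open>x\<close> alone: the induction hypothesis covers
    \<open>dd g (f x) i\<close> with fixed \<open>i\<close>.\<close>
  proof (rule Ck_on_SucI[OF S, where f'="\<lambda>x v. \<Sum>i\<in>Basis. (dd f x v \<bullet> i) *\<^sub>R dd g (f x) i"])
    fix x assume x: "x \<in> S"
    have eq: "dd g (f x) w = (\<Sum>i\<in>Basis. (w \<bullet> i) *\<^sub>R dd g (f x) i)" for w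
      using linear_sum[OF has_derivative_linear[OF gd[OF x]], of "\<lambda>i. (w \<bullet> i) *\<^sub>R i" Basis]
        linear_scale[OF has_derivative_linear[OF gd[OF x]]]
      by (simp add: euclidean_representation)
    show "((\<lambda>x. g (f x)) has_derivative (\<lambda>v. \<Sum>i\<in>Basis. (dd f x v \<bullet> i) *\<^sub>R dd g (f x) i)) (at x)"
      unfolding eq[symmetric] by (rule has_derivative_compose[OF fd[OF x] gd[OF x]])
  next
    fix v
    have f': "Ck_on k S f" using Suc.prems(1) by (rule Ck_on_SucD1)
    have "Ck_on k S (\<lambda>x. dd f x v \<bullet> i)" for i
      by (intro Ck_on_linear_compose[OF S bounded_linear_inner_left]) (use Suc.prems(1) in simp)
    moreover have "Ck_on k S (\<lambda>x. dd g (f x) i)" for i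
      by (rule Suc.IH[OF f']) (use Suc.prems(2) in simp)
    ultimately show "Ck_on k S (\<lambda>x. \<Sum>i\<in>Basis. (dd f x v \<bullet> i) *\<^sub>R dd g (f x) i)"
      by (intro Ck_on_sum[OF S] Ck_on_bilinear[OF S bounded_bilinear_scaleR])
  qed
qed

lemma Ck_on_inverse:
  fixes f :: "'a::euclidean_space \<Rightarrow> real"
  assumes S: "open S" and "Ck_on k S f" and nz: "\<And>x. x \<in> S \<Longrightarrow> f x \<noteq> 0"
  shows "Ck_on k S (\<lambda>x. inverse (f x))"
  using assms(2)
proof (induction k)
  case 0
  then show ?case using nz by (auto intro!: continuous_intros)
next
  case (Suc k)
  have f': "Ck_on k S f" using Suc.prems by (rule Ck_on_SucD1)
  show ?case
  proof (rule Ck_on_SucI[OF S, where f'="\<lambda>x v. (inverse (f x) * inverse (f x)) * ((-1) * dd f x v)"])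
    show "((\<lambda>x. inverse (f x)) has_derivative
        (\<lambda>v. inverse (f x) * inverse (f x) * ((-1) * dd f x v))) (at x)" if "x \<in> S" for x
      using Deriv.has_derivative_inverse[OF nz[OF that] Ck_on_SucD[OF S Suc.prems that]]
      by (simp add: algebra_simps)
    show "Ck_on k S (\<lambda>x. (inverse (f x) * inverse (f x)) * ((-1) * dd f x v))" for v
      by (intro Ck_on_bilinear[OF S bounded_bilinear_mult] Suc.IH f' Ck_on_const[OF S])
        (use Suc.prems in simp)
  qed
qed

lemma smooth_on_cong: "open S \<Longrightarrow> (\<And>y. y \<in> S \<Longrightarrow> f y = g y) \<Longrightarrow> smooth_on S f \<Longrightarrow> smooth_on S g"
  unfolding smooth_on_def using Ck_on_cong by blast

lemma smooth_on_subset: "smooth_on S f \<Longrightarrow> T \<subseteq> S \<Longrightarrow> smooth_on T f"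
  unfolding smooth_on_def using Ck_on_subset by blast

lemma smooth_on_continuous: "smooth_on S f \<Longrightarrow> continuous_on S f"
  unfolding smooth_on_def using Ck_on_continuous by blast

lemma smooth_on_deriv:
  "smooth_on S f \<Longrightarrow> open S \<Longrightarrow> x \<in> S \<Longrightarrow> (f has_derivative dd f x) (at x)"
  unfolding smooth_on_def using Ck_on_SucD by blast

lemma smooth_on_dd: "smooth_on S f \<Longrightarrow> smooth_on S (\<lambda>x. dd f x v)"
  unfolding smooth_on_def using Ck_on_SucD2 by blast

lemma smooth_on_const: "open S \<Longrightarrow> smooth_on S (\<lambda>x. c)"
  by (simp add: smooth_on_def Ck_on_const)

lemma smooth_on_linear: "open S \<Longrightarrow> bounded_linear f \<Longrightarrow> smooth_on S f"
  by (simp add: smooth_on_def Ck_on_bounded_linear)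

lemma smooth_on_id: "open S \<Longrightarrow> smooth_on S (\<lambda>x. x)"
  by (simp add: smooth_on_linear)

lemma smooth_on_linear_compose:
  "open S \<Longrightarrow> bounded_linear L \<Longrightarrow> smooth_on S f \<Longrightarrow> smooth_on S (\<lambda>x. L (f x))"
  by (simp add: smooth_on_def Ck_on_linear_compose)

lemma smooth_on_add: "open S \<Longrightarrow> smooth_on S f \<Longrightarrow> smooth_on S g \<Longrightarrow> smooth_on S (\<lambda>x. f x + g x)"
  by (simp add: smooth_on_def Ck_on_add)

lemma smooth_on_bilinear:
  "open S \<Longrightarrow> bounded_bilinear B \<Longrightarrow> smooth_on S f \<Longrightarrow> smooth_on S g \<Longrightarrow> smooth_on S (\<lambda>x. B (f x) (g x))"
  by (simp add: smooth_on_def Ck_on_bilinear)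

lemma smooth_on_sum:
  "open S \<Longrightarrow> (\<And>i. i \<in> I \<Longrightarrow> smooth_on S (f i)) \<Longrightarrow> smooth_on S (\<lambda>x. \<Sum>i\<in>I. f i x)"
  by (simp add: smooth_on_def Ck_on_sum)

lemma smooth_on_Pair: "open S \<Longrightarrow> smooth_on S f \<Longrightarrow> smooth_on S g \<Longrightarrow> smooth_on S (\<lambda>x. (f x, g x))"
  by (simp add: smooth_on_def Ck_on_Pair)

lemma smooth_on_compose:
  fixes f :: "'a::euclidean_space \<Rightarrow> 'b::euclidean_space"
  shows "open S \<Longrightarrow> open T \<Longrightarrow> smooth_on S f \<Longrightarrow> smooth_on T g \<Longrightarrow> f ` S \<subseteq> T \<Longrightarrow> smooth_on S (\<lambda>x. g (f x))"
  by (simp add: smooth_on_def Ck_on_compose)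

lemma smooth_on_inverse:
  fixes f :: "'a::euclidean_space \<Rightarrow> real"
  shows "open S \<Longrightarrow> smooth_on S f \<Longrightarrow> (\<And>x. x \<in> S \<Longrightarrow> f x \<noteq> 0) \<Longrightarrow> smooth_on S (\<lambda>x. inverse (f x))"
  by (simp add: smooth_on_def Ck_on_inverse)

lemma smooth_on_SucI:
  assumes "open S" "\<And>x. x \<in> S \<Longrightarrow> (f has_derivative f' x) (at x)" "\<And>v. smooth_on S (\<lambda>x. f' x v)"
  shows "smooth_on S f"
  unfolding smooth_on_def
proof
  fix k show "Ck_on k S f"
    using Ck_on_SucD1[OF Ck_on_SucI[OF assms(1,2)]] assms(3) unfolding smooth_on_def by blast
qed

text \<open>Serves functions whose smoothness is visible only in a chart that changes from point to
  point.\<close>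

lemma smooth_on_locally:
  assumes "open S" "\<And>x. x \<in> S \<Longrightarrow> \<exists>T. open T \<and> x \<in> T \<and> smooth_on T f"
  shows "smooth_on S f"
  unfolding smooth_on_def
proof
  fix k
  from assms(2) have "\<And>x. x \<in> S \<Longrightarrow> \<exists>T. open T \<and> x \<in> T \<and> Ck_on k T f"
    unfolding smooth_on_def by blast
  then show "Ck_on k S f"
  proof (induction k arbitrary: f)
    case 0
    have "continuous (at x) f" if "x \<in> S" for x
      using 0[OF that] by (auto simp: continuous_on_eq_continuous_at)
    then show ?case by (auto intro: continuous_at_imp_continuous_on)
  next
    case (Suc k)
    have *: "f differentiable_on S" unfolding differentiable_on_def
    proof
      fix x assume "x \<in> S"
      then obtain T where "open T" "x \<in> T" "Ck_on (Suc k) T f" using Suc.prems by blast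
      then have "(f has_derivative dd f x) (at x)" by (metis Ck_on_SucD)
      then show "f differentiable at x within S"
        by (meson differentiable_at_withinI differentiable_def)
    qed
    have "Ck_on k S (\<lambda>x. dd f x v)" for v
    proof (rule Suc.IH)
      fix x assume "x \<in> S"
      then obtain T where "open T" "x \<in> T" "Ck_on (Suc k) T f" using Suc.prems by blast
      then show "\<exists>T. open T \<and> x \<in> T \<and> Ck_on k T (\<lambda>x. dd f x v)" by auto
    qed
    then show ?case using * by simp
  qed
qed

section \<open>Symmetry of second derivatives\<close>

lemma has_derivative_line:
  assumes "(f has_derivative f') (at (x + s *\<^sub>R v))"
  shows "((\<lambda>s. f (x + s *\<^sub>R v)) has_vector_derivative f' v) (at s)"
proof -
  have "((\<lambda>s. x + s *\<^sub>R v) has_derivative (\<lambda>r. r *\<^sub>R v)) (at s)"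
    by (auto intro!: derivative_eq_intros)
  from has_derivative_compose[OF this assms]
  show ?thesis
    using linear_scale[OF has_derivative_linear[OF assms]] by (simp add: has_vector_derivative_def)
qed

text \<open>Two mean value theorems: one in direction \<open>v\<close> for the difference of
  \<open>g\<close> along two parallel segments, one in direction \<open>w\<close> for the derivative
  so obtained. The point found stays in the parallelogram, which is all that the limit
  needs.\<close>

lemma second_difference:
  fixes g :: "'a::euclidean_space \<Rightarrow> real"
  assumes g: "smooth_on U g" and U: "open U" and h: "h > 0"
    and box: "\<And>s t. s \<in> {0..h} \<Longrightarrow> t \<in> {0..h} \<Longrightarrow> x + s *\<^sub>R v + t *\<^sub>R w \<in> U"
  obtains s t where "s \<in> {0..h}" "t \<in> {0..h}"
    "g (x + h *\<^sub>R v + h *\<^sub>R w) - g (x + h *\<^sub>R v) - g (x + h *\<^sub>R w) + g x =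
      h * (h * dd (\<lambda>y. dd g y v) (x + s *\<^sub>R v + t *\<^sub>R w) w)"
proof -
  define G where "G s = g (x + h *\<^sub>R w + s *\<^sub>R v) - g (x + s *\<^sub>R v)" for s
  have dG: "(G has_real_derivative dd g (x + h *\<^sub>R w + s *\<^sub>R v) v - dd g (x + s *\<^sub>R v) v) (at s)"
    if "s \<in> {0..h}" for s
  proof -
    have "x + h *\<^sub>R w + s *\<^sub>R v \<in> U" "x + s *\<^sub>R v \<in> U"
      using box[of s h] box[of s 0] that h by (auto simp: algebra_simps)
    from this[THEN smooth_on_deriv[OF g U], THEN has_derivative_line]
    show ?thesis unfolding G_def
      by (auto simp: has_real_derivative_iff_has_vector_derivative intro!: has_vector_derivative_diff)
  qed
  have "\<exists>s>0. s < h \<and> G h - G 0 = (h - 0) * (dd g (x + h *\<^sub>R w + s *\<^sub>R v) v - dd g (x + s *\<^sub>R v) v)"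
    by (rule MVT2[OF h]) (auto intro: dG)
  then obtain s where s: "0 < s" "s < h"
    "G h - G 0 = h * (dd g (x + h *\<^sub>R w + s *\<^sub>R v) v - dd g (x + s *\<^sub>R v) v)" by auto
  define H where "H t = dd g (x + s *\<^sub>R v + t *\<^sub>R w) v" for t
  have dH: "(H has_real_derivative dd (\<lambda>y. dd g y v) (x + s *\<^sub>R v + t *\<^sub>R w) w) (at t)"
    if "t \<in> {0..h}" for t
  proof -
    have "x + s *\<^sub>R v + t *\<^sub>R w \<in> U"
      using box[of s t] that s by auto
    from has_derivative_line[OF smooth_on_deriv[OF smooth_on_dd[OF g, of v] U this]]
    show ?thesis unfolding H_def by (simp add: has_real_derivative_iff_has_vector_derivative)
  qed
  have "\<exists>t>0. t < h \<and> H h - H 0 = (h - 0) * (dd (\<lambda>y. dd g y v) (x + s *\<^sub>R v + t *\<^sub>R w) w)"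
    by (rule MVT2[OF h]) (auto intro: dH)
  then obtain t where t: "0 < t" "t < h"
    "H h - H 0 = h * (dd (\<lambda>y. dd g y v) (x + s *\<^sub>R v + t *\<^sub>R w) w)" by auto
  have "G h - G 0 = h * (H h - H 0)" using s(3) by (simp add: H_def algebra_simps)
  moreover have "G h - G 0 = g (x + h *\<^sub>R v + h *\<^sub>R w) - g (x + h *\<^sub>R v) - g (x + h *\<^sub>R w) + g x"
    by (simp add: G_def algebra_simps)
  ultimately show ?thesis using that[of s t] s(1,2) t by auto
qed

text \<open>The second difference does not change when \<open>v\<close> and \<open>w\<close> are
  exchanged, so the two mixed derivatives take a common value at two points arbitrarily near
  \<open>x\<close>; continuity moves both to \<open>x\<close>.\<close>

lemma dd_commute_real:
  fixes g :: "'a::euclidean_space \<Rightarrow> real"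
  assumes g: "smooth_on U g" and U: "open U" and x: "x \<in> U"
  shows "dd (\<lambda>y. dd g y v) x w = dd (\<lambda>y. dd g y w) x v"
proof -
  define A where "A y = dd (\<lambda>y. dd g y v) y w" for y
  define B where "B y = dd (\<lambda>y. dd g y w) y v" for y
  have "continuous_on U A" "continuous_on U B" unfolding A_def B_def
    by (intro smooth_on_continuous smooth_on_dd g)+
  then have cA: "continuous (at x) A" and cB: "continuous (at x) B"
    using U x by (auto simp: continuous_on_eq_continuous_at)
  have "\<bar>A x - B x\<bar> < e" if e: "e > 0" for e
  proof -
    obtain d1 where d1: "d1 > 0" "\<And>y. dist y x < d1 \<Longrightarrow> dist (A y) (A x) < e / 2"
      using cA e unfolding continuous_at_eps_delta by (meson half_gt_zero)
    obtain d2 where d2: "d2 > 0" "\<And>y. dist y x < d2 \<Longrightarrow> dist (B y) (B x) < e / 2"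
      using cB e unfolding continuous_at_eps_delta by (meson half_gt_zero)
    obtain d3 where d3: "d3 > 0" "ball x d3 \<subseteq> U" using U x openE by blast
    define d where "d = min d1 (min d2 d3)"
    have d: "d > 0" using d1 d2 d3 by (simp add: d_def)
    \<comment> \<open>A parallelogram of this size stays within \<open>d / 2\<close> of
      \<open>x\<close>; the summand 1 covers \<open>v = w = 0\<close>.\<close>
    define h where "h = d / (norm v + norm w + 1) / 2"
    have pos: "norm v + norm w + 1 > 0" by (simp add: add_nonneg_pos)
    have h: "h > 0" using d pos by (simp add: h_def)
    have near: "dist (x + s *\<^sub>R v + t *\<^sub>R w) x < d" if "s \<in> {0..h}" "t \<in> {0..h}" for s t
    proof -
      have "norm (s *\<^sub>R v + t *\<^sub>R w) \<le> s * norm v + t * norm w"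
        using norm_triangle_ineq[of "s *\<^sub>R v" "t *\<^sub>R w"] that by simp
      also have "\<dots> \<le> h * norm v + h * norm w"
        using that by (intro add_mono mult_right_mono) auto
      also have "\<dots> \<le> h * (norm v + norm w + 1)" using h by (simp add: algebra_simps)
      also have "\<dots> = d / 2" unfolding h_def using pos by (simp add: divide_simps)
      also have "\<dots> < d" using d by simp
      finally show ?thesis by (simp add: dist_norm algebra_simps)
    qed
    then have inU: "x + s *\<^sub>R v + t *\<^sub>R w \<in> U" if "s \<in> {0..h}" "t \<in> {0..h}" for s t
      using d3 that by (force simp: d_def dist_commute)
    obtain s t where st: "s \<in> {0..h}" "t \<in> {0..h}"
      "g (x + h *\<^sub>R v + h *\<^sub>R w) - g (x + h *\<^sub>R v) - g (x + h *\<^sub>R w) + g x =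
       h * (h * A (x + s *\<^sub>R v + t *\<^sub>R w))"
      using second_difference[OF g U h inU] unfolding A_def by blast
    have inU': "x + s *\<^sub>R w + t *\<^sub>R v \<in> U" if "s \<in> {0..h}" "t \<in> {0..h}" for s t
      using inU[OF that(2,1)] by (simp add: algebra_simps)
    obtain s' t' where st': "s' \<in> {0..h}" "t' \<in> {0..h}"
      "g (x + h *\<^sub>R w + h *\<^sub>R v) - g (x + h *\<^sub>R w) - g (x + h *\<^sub>R v) + g x =
       h * (h * B (x + s' *\<^sub>R w + t' *\<^sub>R v))"
      using second_difference[OF g U h inU'] unfolding B_def by blast
    have "h * (h * A (x + s *\<^sub>R v + t *\<^sub>R w)) = h * (h * B (x + s' *\<^sub>R w + t' *\<^sub>R v))"
      using st(3) st'(3) by (simp add: algebra_simps)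
    then have "A (x + s *\<^sub>R v + t *\<^sub>R w) = B (x + s' *\<^sub>R w + t' *\<^sub>R v)" using h by simp
    moreover have "dist (A (x + s *\<^sub>R v + t *\<^sub>R w)) (A x) < e / 2"
      using near[OF st(1,2)] d1 by (auto simp: d_def)
    moreover have "dist (B (x + s' *\<^sub>R w + t' *\<^sub>R v)) (B x) < e / 2"
      using near[OF st'(2,1)] d2 by (auto simp: d_def algebra_simps)
    ultimately show ?thesis unfolding dist_real_def by linarith
  qed
  from this[of "\<bar>A x - B x\<bar>"] have "A x = B x" by force
  then show ?thesis by (simp add: A_def B_def)
qed

lemma dd_linear_compose:
  assumes "bounded_linear L" "smooth_on U f" "open U" "x \<in> U"
  shows "dd (\<lambda>y. L (f y)) x v = L (dd f x v)"
  using dd_eq[OF bounded_linear.has_derivative[OF assms(1) smooth_on_deriv[OF assms(2-4)]]]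
  by simp

lemma dd_commute:
  fixes f :: "'a::euclidean_space \<Rightarrow> 'b::euclidean_space"
  assumes f: "smooth_on U f" and U: "open U" and x: "x \<in> U"
  shows "dd (\<lambda>y. dd f y v) x w = dd (\<lambda>y. dd f y w) x v"
proof (rule euclidean_eqI)
  fix i :: 'b
  have L: "bounded_linear (\<lambda>z::'b. z \<bullet> i)" by (rule bounded_linear_inner_left)
  have *: "dd (\<lambda>y. dd f y v) x w \<bullet> i = dd (\<lambda>y. dd (\<lambda>y. f y \<bullet> i) y v) x w" for v w
  proof -
    have "dd (\<lambda>y. dd (\<lambda>y. f y \<bullet> i) y v) x w = dd (\<lambda>y. dd f y v \<bullet> i) x w"
      by (rule fun_cong[OF dd_cong_open[OF U x]]) (rule dd_linear_compose[OF L f U])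
    also have "\<dots> = dd (\<lambda>y. dd f y v) x w \<bullet> i"
      by (rule dd_linear_compose[OF L smooth_on_dd[OF f] U x])
    finally show ?thesis by simp
  qed
  show "dd (\<lambda>y. dd f y v) x w \<bullet> i = dd (\<lambda>y. dd f y w) x v \<bullet> i"
    unfolding * by (rule dd_commute_real[OF smooth_on_linear_compose[OF U L f] U x])
qed

section \<open>Smooth dependence of flows on initial values\<close>

text \<open>The squared norm is used since the norm is not differentiable at 0. By
  \<open>2 B |y| \<le> |y|^2 + B^2\<close>, the function \<open>exp (- m t) |y|^2 - B^2 t\<close>
  does not increase for \<open>m = 2 A + 1\<close>; the square root of \<open>exp m\<close> is the
  factor in the bound.\<close>

lemma gronwall_unit:
  fixes y :: "real \<Rightarrow> 'a::real_inner"
  assumes d: "\<And>t. t \<in> {0..1} \<Longrightarrow> (y has_vector_derivative y' t) (at t within {0..1})"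
    and b: "\<And>t. t \<in> {0..1} \<Longrightarrow> norm (y' t) \<le> A * norm (y t) + B" and "A \<ge> 0" "B \<ge> 0"
  shows "norm (y 1) \<le> exp (A + 1/2) * (norm (y 0) + B)"
proof -
  define m where "m = 2 * A + 1"
  have m: "m \<ge> 0" using assms by (simp add: m_def)
  define N where "N t = exp (- m * t) * (y t \<bullet> y t) - B\<^sup>2 * t" for t
  define N' where "N' t = exp (- m * t) * (2 * (y t \<bullet> y' t) - m * (y t \<bullet> y t)) - B\<^sup>2" for t
  have dN: "(N has_derivative (\<lambda>r. r * N' t)) (at t within {0..1})" if "t \<in> {0..1}" for t
    unfolding N_def N'_def
    by (rule derivative_eq_intros d[OF that, unfolded has_vector_derivative_def] refl)+
      (auto simp: algebra_simps inner_commute)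
  have neg: "N' t \<le> 0" if t: "t \<in> {0..1}" for t
  proof -
    have "2 * (y t \<bullet> y' t) \<le> 2 * (norm (y t) * (A * norm (y t) + B))"
      using Cauchy_Schwarz_ineq2[of "y t" "y' t"] mult_left_mono[OF b[OF t], of "norm (y t)"] by simp
    also have "\<dots> \<le> 2 * A * (norm (y t))\<^sup>2 + ((norm (y t))\<^sup>2 + B\<^sup>2)"
      using sum_squares_bound[of "norm (y t)" B] by (simp add: algebra_simps power2_eq_square)
    also have "\<dots> = m * (y t \<bullet> y t) + B\<^sup>2" by (simp add: m_def algebra_simps power2_norm_eq_inner)
    finally have 1: "2 * (y t \<bullet> y' t) - m * (y t \<bullet> y t) \<le> B\<^sup>2" by simp
    have e: "exp (- m * t) \<le> 1" using m t by simp
    have "exp (- m * t) * (2 * (y t \<bullet> y' t) - m * (y t \<bullet> y t)) \<le> exp (- m * t) * B\<^sup>2"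
      using 1 by (intro mult_left_mono) auto
    also have "\<dots> \<le> 1 * B\<^sup>2" using e by (intro mult_right_mono) auto
    finally show ?thesis by (simp add: N'_def)
  qed
  have "\<exists>t\<in>{0..1}. N 1 - N 0 = (1 - 0) * N' t"
    by (rule mvt_very_simple[where f'="\<lambda>t r. r * N' t"]) (auto intro: dN)
  then have "N 1 \<le> N 0" using neg by force
  then have "exp (- m) * (norm (y 1))\<^sup>2 \<le> (norm (y 0))\<^sup>2 + B\<^sup>2"
    by (simp add: N_def power2_norm_eq_inner)
  then have "(norm (y 1))\<^sup>2 \<le> exp m * ((norm (y 0))\<^sup>2 + B\<^sup>2)"
    by (simp add: exp_minus field_simps)
  also have "\<dots> \<le> exp m * (norm (y 0) + B)\<^sup>2"
    using \<open>B \<ge> 0\<close> by (intro mult_left_mono) (auto simp: power2_sum)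
  also have "\<dots> = (exp (A + 1/2) * (norm (y 0) + B))\<^sup>2"
  proof -
    have "exp m = (exp (A + 1/2))\<^sup>2"
      unfolding power2_eq_square exp_add[symmetric] by (simp add: m_def)
    then show ?thesis by (simp only: power_mult_distrib)
  qed
  finally show ?thesis using \<open>B \<ge> 0\<close> by (auto intro: power2_le_imp_le)
qed

text \<open>The segment from \<open>s\<close> to \<open>t\<close> is rescaled to the unit interval,
  which treats both time directions at once; the bound \<open>l\<close> of its length is absorbed in
  both constants.\<close>

lemma gronwall:
  fixes y :: "real \<Rightarrow> 'a::real_inner"
  assumes d: "\<And>t. t \<in> S \<Longrightarrow> (y has_vector_derivative y' t) (at t within S)"
    and b: "\<And>t. t \<in> S \<Longrightarrow> norm (y' t) \<le> A * norm (y t) + B" and A: "A \<ge> 0" and B: "B \<ge> 0"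
    and S: "convex S" "s \<in> S" "t \<in> S" and l: "\<bar>t - s\<bar> \<le> l"
  shows "norm (y t) \<le> exp (A * l + 1/2) * (norm (y s) + B * l)"
proof -
  define f where "f r = s + r * (t - s)" for r
  have f: "f r \<in> S" if "r \<in> {0..1}" for r
  proof -
    have "f r = (1 - r) *\<^sub>R s + r *\<^sub>R t" by (simp add: f_def algebra_simps)
    then show ?thesis using S that by (auto simp: convex_alt)
  qed
  have l0: "l \<ge> 0" using l by simp
  have df: "((y \<circ> f) has_vector_derivative (t - s) *\<^sub>R y' (f r)) (at r within {0..1})" if "r \<in> {0..1}" for r
  proof (rule vector_diff_chain_within)
    show "(f has_vector_derivative t - s) (at r within {0..1})"
      unfolding f_def by (auto intro!: derivative_eq_intros)
    show "(y has_vector_derivative y' (f r)) (at (f r) within f ` {0..1})"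
      using has_vector_derivative_within_subset[OF d[OF f[OF that]]] f by blast
  qed
  have "norm ((y \<circ> f) 1) \<le> exp (A * l + 1/2) * (norm ((y \<circ> f) 0) + B * l)"
  proof (rule gronwall_unit[OF df])
    fix r :: real assume r: "r \<in> {0..1}"
    have "norm ((t - s) *\<^sub>R y' (f r)) = \<bar>t - s\<bar> * norm (y' (f r))" by simp
    also have "\<dots> \<le> l * (A * norm (y (f r)) + B)"
      using l l0 b[OF f[OF r]] A B by (intro mult_mono) auto
    finally show "norm ((t - s) *\<^sub>R y' (f r)) \<le> A * l * norm ((y \<circ> f) r) + B * l"
      by (simp add: algebra_simps)
  qed (use A B l0 in auto)
  then show ?thesis by (simp add: f_def)
qed

text \<open>Banach's fixed point theorem for the integral operator on bounded continuous functions;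
  \<open>L * e \<le> 1/2\<close> makes it a contraction with factor 1/2.\<close>

lemma picard_closed:
  fixes \<Phi> :: "real \<Rightarrow> 'a::euclidean_space \<Rightarrow> 'a"
  assumes e: "e > 0" and cont: "continuous_on ({-e..e} \<times> UNIV) (\<lambda>(t, y). \<Phi> t y)"
    and lip: "\<And>t y z. t \<in> {-e..e} \<Longrightarrow> norm (\<Phi> t y - \<Phi> t z) \<le> L * norm (y - z)"
    and L: "L \<ge> 0" "L * e \<le> 1/2"
  obtains y where "y 0 = y0"
    "\<And>t. t \<in> {-e..e} \<Longrightarrow> (y has_vector_derivative \<Phi> t (y t)) (at t within {-e..e})"
proof -
  define J where "J = {-e..e}"
  \<comment> \<open>Clamping the time to \<open>[-e, e]\<close> turns functions on the interval into
    elements of the Banach space of bounded continuous functions on the whole line.\<close>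
  define cl where "cl t = max (-e) (min e t)" for t :: real
  have cl: "cl t \<in> J" for t using e by (auto simp: cl_def J_def)
  have cl_id: "cl t = t" if "t \<in> J" for t using that by (auto simp: cl_def J_def)
  have cl_cont: "continuous_on UNIV cl" unfolding cl_def by (intro continuous_intros)
  \<comment> \<open>The integral from 0 to \<open>t\<close>, written with lower limit
    \<open>-e\<close> so that one formula covers both signs of \<open>t\<close>.\<close>
  define P where "P u t = y0 + integral {-e..t} (\<lambda>s. \<Phi> s (u s)) - integral {-e..0} (\<lambda>s. \<Phi> s (u s))"
    for u t
  have P0: "P u 0 = y0" for u by (simp add: P_def)
  have Pd: "(P u has_vector_derivative \<Phi> t (u t)) (at t within J)"
    if "continuous_on J u" "t \<in> J" for u t
  proof -
    have "continuous_on J (\<lambda>s. (s, u s))" using that by (intro continuous_intros)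
    then have "continuous_on J (\<lambda>s. (\<lambda>(t, y). \<Phi> t y) (s, u s))"
      by (rule continuous_on_compose2[OF cont]) (auto simp: J_def)
    then have c: "continuous_on {-e..e} (\<lambda>s. \<Phi> s (u s))" by (simp add: J_def)
    show ?thesis unfolding P_def J_def
      using integral_has_vector_derivative[OF c, of t] that(2)
      by (auto simp: J_def intro!: derivative_eq_intros)
  qed
  have Pc: "continuous_on J (P u)" if "continuous_on J u" for u
    using Pd[OF that] by (meson continuous_on_eq_continuous_within has_vector_derivative_continuous)
  have Pb: "(\<lambda>t. P u (cl t)) \<in> bcontfun" if "continuous_on J u" for u
  proof -
    have "compact (P u ` J)" using Pc[OF that] by (intro compact_continuous_image) (auto simp: J_def)
    then have "bounded (range (\<lambda>t. P u (cl t)))"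
      using cl by (meson bounded_subset compact_imp_bounded image_subset_iff image_eqI)
    moreover have "continuous_on UNIV (\<lambda>t. P u (cl t))"
      by (rule continuous_on_compose2[OF Pc[OF that] cl_cont]) (use cl in auto)
    ultimately show ?thesis by (simp add: bcontfun_def)
  qed
  define T where "T u = Bcontfun (\<lambda>t. P (apply_bcontfun u) (cl t))" for u :: "real \<Rightarrow>\<^sub>C 'a"
  have uc: "continuous_on J (apply_bcontfun u)" for u :: "real \<Rightarrow>\<^sub>C 'a"
    by (meson apply_bcontfun bcontfun_def continuous_on_subset mem_Collect_eq subset_UNIV continuous_on_apply_bcontfun)
  have T: "apply_bcontfun (T u) t = P (apply_bcontfun u) (cl t)" for u t
    unfolding T_def using Bcontfun_inverse[OF Pb[OF uc]] by simp
  have "\<exists>!u. T u = u"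
  proof (rule banach_fix_type[of "1/2"])
    show "\<forall>u v. dist (T u) (T v) \<le> 1/2 * dist u v"
    proof (intro allI dist_bound)
      fix u v and t :: real
      define D where "D t = P (apply_bcontfun u) t - P (apply_bcontfun v) t" for t
      have Dd: "(D has_derivative (\<lambda>r. r *\<^sub>R (\<Phi> t (u t) - \<Phi> t (v t)))) (at t within J)" if "t \<in> J" for t
        using has_vector_derivative_diff[OF Pd[OF uc that] Pd[OF uc that]] 
        unfolding has_vector_derivative_def D_def .
      have "norm (D (cl t) - D 0) \<le> (L * dist u v) * norm (cl t - 0)"
      proof (rule differentiable_bound[OF _ Dd])
        show "convex J" by (simp add: J_def)
        fix s assume s: "s \<in> J"
        have "norm (\<Phi> s (u s) - \<Phi> s (v s)) \<le> L * norm (u s - v s)"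
          using lip s by (simp add: J_def)
        also have "\<dots> \<le> L * dist u v"
          using L dist_bounded[of u s v] by (intro mult_left_mono) (auto simp: dist_norm)
        finally show "onorm (\<lambda>r. r *\<^sub>R (\<Phi> s (u s) - \<Phi> s (v s))) \<le> L * dist u v"
          by (intro onorm_le) (metis mult.commute mult_left_mono norm_ge_zero norm_scaleR real_norm_def)
      qed (use cl e in \<open>auto simp: J_def\<close>)
      also have "\<dots> \<le> (L * dist u v) * e"
        using cl[of t] L by (intro mult_left_mono) (auto simp: J_def)
      also have "\<dots> \<le> 1/2 * dist u v"
        using mult_right_mono[OF L(2), of "dist u v"] by (simp add: algebra_simps)
      finally show "dist (T u t) (T v t) \<le> 1/2 * dist u v"
        by (simp add: dist_norm T D_def P0)
    qed
  qed auto
  then obtain u where u: "T u = u" by auto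
  have ueq: "apply_bcontfun u t = P (apply_bcontfun u) t" if "t \<in> J" for t
    using T[of u t] cl_id[OF that] u by simp
  show ?thesis
  proof (rule that[of "apply_bcontfun u"])
    show "apply_bcontfun u 0 = y0" using ueq[of 0] P0 e by (simp add: J_def)
    show "(apply_bcontfun u has_vector_derivative \<Phi> t (u t)) (at t within {-e..e})"
      if "t \<in> {-e..e}" for t
      using has_vector_derivative_transform[of t J "apply_bcontfun u" "P (apply_bcontfun u)"]
        Pd[OF uc, of t u] that ueq by (auto simp: J_def)
  qed
qed

lemma ode_unique:
  fixes y z :: "real \<Rightarrow> 'a::euclidean_space"
  assumes y: "\<And>t. t \<in> S \<Longrightarrow> (y has_vector_derivative \<Phi> t (y t)) (at t within S)"
    and z: "\<And>t. t \<in> S \<Longrightarrow> (z has_vector_derivative \<Phi> t (z t)) (at t within S)"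
    and lip: "\<And>t y z. t \<in> S \<Longrightarrow> norm (\<Phi> t y - \<Phi> t z) \<le> L * norm (y - z)" and L: "L \<ge> 0"
    and S: "convex S" "s \<in> S" "t \<in> S" and eq: "y s = z s"
  shows "y t = z t"
proof -
  have "norm (y t - z t) \<le> exp (L * \<bar>t - s\<bar> + 1/2) * (norm (y s - z s) + 0 * \<bar>t - s\<bar>)"
    by (rule gronwall[where y="\<lambda>t. y t - z t" and y'="\<lambda>t. \<Phi> t (y t) - \<Phi> t (z t)" and S=S])
      (use assms in \<open>auto intro!: has_vector_derivative_diff\<close>)
  then show ?thesis using eq by simp
qed

text \<open>Solutions on the closed intervals \<open>[-d, d]\<close> with \<open>d < e\<close> agree
  where both are defined, so they glue; at time \<open>t\<close> the radius midway between
  \<open>|t|\<close> and \<open>e\<close> is used.\<close>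

lemma picard_open:
  fixes \<Phi> :: "real \<Rightarrow> 'a::euclidean_space \<Rightarrow> 'a"
  assumes e: "e > 0" and cont: "continuous_on ({-e<..<e} \<times> UNIV) (\<lambda>(t, y). \<Phi> t y)"
    and lip: "\<And>t y z. t \<in> {-e<..<e} \<Longrightarrow> norm (\<Phi> t y - \<Phi> t z) \<le> L * norm (y - z)"
    and L: "L \<ge> 0" "L * e \<le> 1/2"
  obtains y where "y 0 = y0"
    "\<And>t. t \<in> {-e<..<e} \<Longrightarrow> (y has_vector_derivative \<Phi> t (y t)) (at t)"
proof -
  have "\<exists>y. y 0 = y0 \<and> (\<forall>t\<in>{-d..d}. (y has_vector_derivative \<Phi> t (y t)) (at t within {-d..d}))"
    if d: "0 < d" "d < e" for d
  proof -
    have sub: "{-d..d} \<subseteq> {-e<..<e}" using d by auto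
    have "L * d \<le> L * e" using d L by (intro mult_left_mono) auto
    then have "L * d \<le> 1/2" using L by simp
    show ?thesis
    proof (rule picard_closed[of d \<Phi> L y0])
      show "continuous_on ({-d..d} \<times> UNIV) (\<lambda>(t, y). \<Phi> t y)"
        by (rule continuous_on_subset[OF cont]) (use sub in auto)
      show "norm (\<Phi> t y - \<Phi> t z) \<le> L * norm (y - z)" if "t \<in> {-d..d}" for t y z
        using lip sub that by blast
    next
      fix y assume "y 0 = y0"
        "\<And>t. t \<in> {-d..d} \<Longrightarrow> (y has_vector_derivative \<Phi> t (y t)) (at t within {-d..d})"
      then show ?thesis by blast
    qed (fact d(1) L(1) \<open>L * d \<le> 1/2\<close>)+
  qed
  then obtain Y where Y: "\<And>d. 0 < d \<Longrightarrow> d < e \<Longrightarrow> Y d 0 = y0"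
    "\<And>d t. 0 < d \<Longrightarrow> d < e \<Longrightarrow> t \<in> {-d..d} \<Longrightarrow> (Y d has_vector_derivative \<Phi> t (Y d t)) (at t within {-d..d})"
    by metis
  have agree: "Y d t = Y d' t" if "0 < d" "d \<le> d'" "d' < e" "t \<in> {-d..d}" for d d' t
  proof (rule ode_unique[where \<Phi>=\<Phi> and S="{-d..d}" and s=0 and L=L])
    show "(Y d has_vector_derivative \<Phi> s (Y d s)) (at s within {-d..d})" if "s \<in> {-d..d}" for s
      using Y(2)[of d s] that \<open>0 < d\<close> \<open>d \<le> d'\<close> \<open>d' < e\<close> by auto
    show "(Y d' has_vector_derivative \<Phi> s (Y d' s)) (at s within {-d..d})" if "s \<in> {-d..d}" for s
      using has_vector_derivative_within_subset[OF Y(2)[of d' s], of "{-d..d}"] that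
        \<open>0 < d\<close> \<open>d \<le> d'\<close> \<open>d' < e\<close> by auto
  qed (use that lip L Y(1) in auto)
  define r where "r t = (\<bar>t\<bar> + e) / 2" for t
  have r: "0 < r t" "r t < e" "t \<in> {-r t<..<r t}" if "t \<in> {-e<..<e}" for t
    using that e by (auto simp: r_def abs_if field_simps)
  define y where "y t = Y (r t) t" for t
  have yY: "y s = Y d s" if "s \<in> {-d..d}" "0 < d" "d < e" for s d
  proof -
    have s: "s \<in> {-e<..<e}" using that by auto
    show ?thesis
    proof (cases "d \<le> r s")
      case True
      show ?thesis unfolding y_def using agree[OF that(2) True r(2)[OF s] that(1)] by simp
    next
      case False
      show ?thesis unfolding y_def
        by (rule agree[OF r(1)[OF s] _ that(3)]) (use False r(3)[OF s] in auto)
    qed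
  qed
  show ?thesis
  proof (rule that[of y])
    show "y 0 = y0" using Y(1) r[of 0] e by (auto simp: y_def)
    fix t assume t: "t \<in> {-e<..<e}"
    have eq: "Y (r t) s = y s" if "s \<in> {-r t<..<r t}" for s
      using yY[of s "r t"] that r(1,2)[OF t] by simp
    have "(Y (r t) has_vector_derivative \<Phi> t (Y (r t) t)) (at t within {-r t<..<r t})"
      by (rule has_vector_derivative_within_subset[OF Y(2)[OF r(1)[OF t] r(2)[OF t]]]) (use r(3)[OF t] in auto)
    then have "(Y (r t) has_vector_derivative \<Phi> t (y t)) (at t)"
      using r(3)[OF t] by (simp add: at_within_open[of t "{-r t<..<r t}"] y_def)
    then show "(y has_vector_derivative \<Phi> t (y t)) (at t)"
      by (rule has_vector_derivative_transform_within_open[where S="{-r t<..<r t}"])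
        (use r(3)[OF t] eq in auto)
  qed
qed

text \<open>Gronwall applied to \<open>y (t, x) - y (t, x0)\<close>: changing the parameter under
  the fixed solution through \<open>x0\<close> disturbs the right-hand side by at most
  \<open>b\<close>, uniformly on a compact time interval.\<close>

lemma solution_continuous:
  fixes \<Phi> :: "real \<Rightarrow> 'p::metric_space \<Rightarrow> 'a::euclidean_space \<Rightarrow> 'a"
  assumes cont: "continuous_on (({-e<..<e} \<times> B) \<times> UNIV) (\<lambda>((t, x), y). \<Phi> t x y)"
    and lip: "\<And>t x y z. t \<in> {-e<..<e} \<Longrightarrow> x \<in> B \<Longrightarrow> norm (\<Phi> t x y - \<Phi> t x z) \<le> L * norm (y - z)"
    and L: "L \<ge> 0" and B: "open B" and y0: "continuous_on B (\<lambda>x. y (0, x))"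
    and ode: "\<And>t x. t \<in> {-e<..<e} \<Longrightarrow> x \<in> B \<Longrightarrow> ((\<lambda>s. y (s, x)) has_vector_derivative \<Phi> t x (y (t, x))) (at t)"
  shows "continuous_on ({-e<..<e} \<times> B) y"
proof (rule continuous_at_imp_continuous_on, clarify)
  fix t0 x0 assume t0: "t0 \<in> {-e<..<e}" and x0: "x0 \<in> B"
  define d where "d = (\<bar>t0\<bar> + e) / 2"
  have d: "0 < d" "d < e" "t0 \<in> {-d<..<d}" using t0 by (auto simp: d_def abs_if field_simps)
  have sub: "{-d..d} \<subseteq> {-e<..<e}" using d by auto
  have yc: "continuous_on {-d..d} (\<lambda>s. y (s, x0))"
    using ode x0 sub by (meson continuous_at_imp_continuous_on has_vector_derivative_continuous subsetD)
  have "continuous_on (B \<times> {-d..d}) (\<lambda>p. (\<lambda>((t, x), y). \<Phi> t x y) ((snd p, fst p), y (snd p, x0)))"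
    by (rule continuous_on_compose2[OF cont])
      (use sub in \<open>auto intro!: continuous_intros continuous_on_compose2[OF yc]\<close>)
  then have c: "continuous_on (B \<times> {-d..d}) (\<lambda>(x, t). \<Phi> t x (y (t, x0)))"
    by (simp add: case_prod_unfold)
  show "continuous (at (t0, x0)) y"
    unfolding continuous_at_eps_delta
  proof (intro allI impI)
    fix \<eta> :: real assume \<eta>: "\<eta> > 0"
    define E where "E = exp (L * (2*d) + 1/2)"
    have E: "E > 0" by (simp add: E_def)
    define X where "X = E * (1 + 2 * d)"
    have X: "X > 0" using E d by (simp add: X_def)
    \<comment> \<open>Initial error \<open>b\<close> and disturbance \<open>b\<close> over time
      \<open>2 * d\<close> give \<open>E * (b + b * (2 * d)) = X * b\<close>, a quarter of
      \<open>\<eta>\<close>.\<close>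
    define b where "b = \<eta> / (4 * X)"
    have b: "b > 0" using \<eta> X by (simp add: b_def)
    obtain X0 where X0': "x0 \<in> X0" "open X0"
      "\<forall>x\<in>X0 \<inter> B. \<forall>t\<in>{-d..d}. dist ((\<lambda>(x, t). \<Phi> t x (y (t, x0))) (x, t)) ((\<lambda>(x, t). \<Phi> t x (y (t, x0))) (x0, t)) \<le> b"
      by (rule continuous_on_prod_compactE[OF c compact_Icc x0 b])
    then have X0: "x0 \<in> X0" "open X0"
      "\<And>x t. x \<in> X0 \<inter> B \<Longrightarrow> t \<in> {-d..d} \<Longrightarrow> dist (\<Phi> t x (y (t, x0))) (\<Phi> t x0 (y (t, x0))) \<le> b"
      unfolding case_prod_conv by blast+
    obtain r1 where r1: "r1 > 0" "ball x0 r1 \<subseteq> X0 \<inter> B"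
      using openE[OF open_Int[OF X0(2) B], of x0] X0(1) x0 by blast
    obtain r2 where r2: "r2 > 0" "\<And>x. x \<in> B \<Longrightarrow> dist x x0 < r2 \<Longrightarrow> dist (y (0, x)) (y (0, x0)) < b"
      using y0[unfolded continuous_on_iff, rule_format, OF x0 b] by auto
    obtain r3 where r3: "r3 > 0" "\<And>t. t \<in> {-d..d} \<Longrightarrow> dist t t0 < r3 \<Longrightarrow> dist (y (t, x0)) (y (t0, x0)) < \<eta>/2"
      using yc[unfolded continuous_on_iff, rule_format, of t0 "\<eta>/2"] d(3) \<eta> by auto
    define r where "r = min (min r1 r2) (min r3 (d - \<bar>t0\<bar>))"
    have r: "r > 0" using r1 r2 r3 d by (auto simp: r_def)
    show "\<exists>r>0. \<forall>p. dist p (t0, x0) < r \<longrightarrow> dist (y p) (y (t0, x0)) < \<eta>"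
    proof (intro exI conjI allI impI, rule r, clarify)
      fix t x assume "dist (t, x) (t0, x0) < r"
      then have tr: "dist t t0 < r" and xr: "dist x x0 < r"
        using dist_fst_le[of "(t, x)" "(t0, x0)"] dist_snd_le[of "(t, x)" "(t0, x0)"] by auto
      have t: "t \<in> {-d..d}" using tr by (auto simp: r_def dist_real_def abs_if split: if_splits)
      have x: "x \<in> X0 \<inter> B" using xr r1 by (auto simp: r_def dist_commute)
      have "norm (y (t, x) - y (t, x0)) \<le> E * (norm (y (0, x) - y (0, x0)) + b * (2*d))"
        unfolding E_def
      proof (rule gronwall[where S="{-d..d}" and y="\<lambda>t. y (t, x) - y (t, x0)" and A=L and B=b and l="2*d" and t=t
          and y'="\<lambda>t. \<Phi> t x (y (t, x)) - \<Phi> t x0 (y (t, x0))" and s=0])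
        show "((\<lambda>t. y (t, x) - y (t, x0)) has_vector_derivative
            \<Phi> s x (y (s, x)) - \<Phi> s x0 (y (s, x0))) (at s within {-d..d})" if "s \<in> {-d..d}" for s
          by (rule has_vector_derivative_at_within, intro has_vector_derivative_diff ode)
            (use that sub x x0 in auto)
        show "norm (\<Phi> s x (y (s, x)) - \<Phi> s x0 (y (s, x0))) \<le> L * norm (y (s, x) - y (s, x0)) + b"
          if s: "s \<in> {-d..d}" for s
        proof -
          have "norm (\<Phi> s x (y (s, x)) - \<Phi> s x (y (s, x0))) \<le> L * norm (y (s, x) - y (s, x0))"
            using lip[of s x] s sub x by auto
          moreover have "norm (\<Phi> s x (y (s, x0)) - \<Phi> s x0 (y (s, x0))) \<le> b"
            using X0(3)[OF x s] by (simp add: dist_norm)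
          ultimately show ?thesis
            using norm_triangle_ineq[of "\<Phi> s x (y (s, x)) - \<Phi> s x (y (s, x0))" "\<Phi> s x (y (s, x0)) - \<Phi> s x0 (y (s, x0))"]
            by simp
        qed
      qed (use L b d t in auto)
      also have "\<dots> \<le> E * (b + b * (2*d))"
        using r2(2)[of x] x xr E by (intro mult_left_mono) (auto simp: dist_norm r_def)
      also have "\<dots> = X * b" by (simp add: X_def algebra_simps)
      also have "\<dots> = \<eta> / 4" using X by (simp add: b_def)
      finally have "dist (y (t, x)) (y (t, x0)) \<le> \<eta>/4" by (simp add: dist_norm)
      moreover have "dist (y (t, x0)) (y (t0, x0)) < \<eta>/2" using r3(2)[OF t] tr by (simp add: r_def)
      ultimately show "dist (y (t, x)) (y (t0, x0)) < \<eta>"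
        using dist_triangle[of "y (t, x)" "y (t0, x0)" "y (t, x0)"] \<eta> by linarith
    qed
  qed
qed

text \<open>In finite dimension, continuity of all directional derivatives is continuity in operator
  norm. The \<open>blinfun\<close> form opens the derivative to compactness and uniform
  continuity.\<close>

lemma dd_blinfun:
  fixes F :: "'q::euclidean_space \<Rightarrow> 'r::real_normed_vector"
  assumes U: "open U" and F: "Ck_on (Suc 0) U F"
  shows "continuous_on U (\<lambda>u. Blinfun (dd F u))"
    and "u \<in> U \<Longrightarrow> blinfun_apply (Blinfun (dd F u)) = dd F u"
proof -
  show *: "blinfun_apply (Blinfun (dd F u)) = dd F u" if "u \<in> U" for u
    by (rule bounded_linear_Blinfun_apply)
      (rule has_derivative_bounded_linear[OF Ck_on_SucD[OF U F that]])
  show "continuous_on U (\<lambda>u. Blinfun (dd F u))"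
  proof (rule continuous_on_blinfun_componentwise)
    fix i :: 'q
    have "continuous_on U (\<lambda>u. dd F u i)" using F by simp
    then show "continuous_on U (\<lambda>u. blinfun_apply (Blinfun (dd F u)) i)"
      by (rule continuous_on_eq) (simp add: *)
  qed
qed

text \<open>The derivative is uniformly continuous on the compact thickening \<open>K'\<close> of
  \<open>K\<close>, and the mean value theorem on balls inside \<open>K'\<close> turns this into one
  radius \<open>d\<close> valid for all points of \<open>K\<close>.\<close>

lemma uniform_linearization:
  fixes F :: "'q::euclidean_space \<Rightarrow> 'r::real_normed_vector"
  assumes U: "open U" and F: "Ck_on (Suc 0) U F" and K: "compact K" "K \<subseteq> U" and e: "e > 0"
  obtains d where "d > 0"
    "\<And>u h. u \<in> K \<Longrightarrow> norm h < d \<Longrightarrow> u + h \<in> U \<and> norm (F (u + h) - F u - dd F u h) \<le> e * norm h"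
proof -
  obtain r where r: "r > 0" "(\<Union>x\<in>K. ball x r) \<subseteq> U"
    using compact_subset_open_imp_ball_epsilon_subset[OF K(1) U K(2)] by blast
  define K' where "K' = {x + y |x y. x \<in> K \<and> y \<in> cball 0 (r/2)}"
  have K': "compact K'" unfolding K'_def by (rule compact_sums) (use K in auto)
  have K'_U: "K' \<subseteq> U"
  proof
    fix p assume "p \<in> K'"
    then obtain x y where "p = x + y" "x \<in> K" "norm y \<le> r/2" by (auto simp: K'_def)
    then have "p \<in> ball x r" using r by (simp add: dist_norm)
    then show "p \<in> U" using r \<open>x \<in> K\<close> by blast
  qed
  define D where "D u = Blinfun (dd F u)" for u
  have D: "blinfun_apply (D u) = dd F u" if "u \<in> U" for u
    unfolding D_def by (rule dd_blinfun(2)[OF U F that])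
  have "continuous_on K' D" unfolding D_def
    using dd_blinfun(1)[OF U F] K'_U by (rule continuous_on_subset)
  then have "uniformly_continuous_on K' D" using K' by (rule compact_uniformly_continuous)
  then obtain d1 where d1: "d1 > 0" "\<And>u v. u \<in> K' \<Longrightarrow> v \<in> K' \<Longrightarrow> dist v u < d1 \<Longrightarrow> dist (D v) (D u) < e"
    using e unfolding uniformly_continuous_on_def by meson
  define d where "d = min d1 (r/2)"
  have d: "d > 0" using d1 r by (simp add: d_def)
  show ?thesis
  proof (rule that[OF d])
    fix u h :: 'q assume u: "u \<in> K" and h: "norm h < d"
    have ball: "ball u d \<subseteq> K'"
    proof
      fix p assume "p \<in> ball u d"
      then have "p = u + (p - u)" "p - u \<in> cball 0 (r/2)" by (auto simp: dist_norm norm_minus_commute d_def)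
      then show "p \<in> K'" using u unfolding K'_def by blast
    qed
    have seg: "u + t *\<^sub>R (u + h - u) \<in> ball u d" if "t \<in> {0..1}" for t
    proof -
      have "t * norm h \<le> 1 * norm h" using that by (intro mult_right_mono) auto
      then show ?thesis using h that by (simp add: dist_norm)
    qed
    have "norm (F (u + h) - F u - dd F u (u + h - u)) \<le> norm (u + h - u) * e"
    proof (rule differentiable_bound_linearization[OF seg, where f'="dd F"])
      show "(F has_derivative dd F x) (at x within ball u d)" if "x \<in> ball u d" for x
        using Ck_on_SucD[OF U F] ball K'_U that by (blast intro: has_derivative_at_withinI)
      show "onorm (dd F x - dd F u) \<le> e" if x: "x \<in> ball u d" for x
      proof -
        have "x \<in> U" "u \<in> U" using x ball K'_U d u K by auto
        moreover have "dist (D x) (D u) < e"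
        proof (rule d1(2))
          show "u \<in> K'" "x \<in> K'" using ball x d by auto
          show "dist x u < d1" using x by (simp add: d_def dist_commute)
        qed
        ultimately show ?thesis
          by (simp add: dist_norm norm_blinfun.rep_eq minus_blinfun.rep_eq D fun_diff_def)
      qed
    qed (use d in auto)
    moreover have "u + h \<in> U"
      using seg[of 1] ball K'_U by auto
    ultimately show "u + h \<in> U \<and> norm (F (u + h) - F u - dd F u h) \<le> e * norm h"
      by (simp add: mult.commute)
  qed
qed

lemma dd_bound_compact:
  fixes F :: "'q::euclidean_space \<Rightarrow> 'r::real_normed_vector"
  assumes U: "open U" and F: "Ck_on (Suc 0) U F" and K: "compact K" "K \<subseteq> U"
  obtains A where "A \<ge> 0" "\<And>u v. u \<in> K \<Longrightarrow> norm (dd F u v) \<le> A * norm v"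
proof -
  have "continuous_on K (\<lambda>u. Blinfun (dd F u))"
    using dd_blinfun(1)[OF U F] K(2) by (rule continuous_on_subset)
  then have "bounded ((\<lambda>u. Blinfun (dd F u)) ` K)"
    using K(1) by (intro compact_imp_bounded compact_continuous_image)
  then obtain A where A: "A > 0" "\<And>u. u \<in> K \<Longrightarrow> norm (Blinfun (dd F u)) \<le> A"
    unfolding bounded_pos by auto
  show ?thesis
  proof (rule that[of A])
    fix u v assume "u \<in> K"
    then have "norm (blinfun_apply (Blinfun (dd F u)) v) \<le> A * norm v"
      using A(2) norm_blinfun[of "Blinfun (dd F u)" v] mult_right_mono[of _ A "norm v"]
      by (meson norm_ge_zero order_trans)
    then show "norm (dd F u v) \<le> A * norm v" using dd_blinfun(2)[OF U F] K(2) \<open>u \<in> K\<close> by auto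
  qed (use A in simp)
qed

text \<open>The solution \<open>z\<close> of the linearized equation turns out to be the derivative
  in the parameter. Gronwall is used twice: it bounds the difference \<open>h\<close> of two
  neighbouring solutions by a multiple of the parameter increment, and then \<open>h - z w\<close>,
  which solves the linearized equation up to a small multiple of \<open>h\<close>.\<close>

lemma flow_param_derivative:
  fixes F :: "'q::euclidean_space \<Rightarrow> 'q" and c :: "real \<times> 'p::euclidean_space \<Rightarrow> 'q"
  assumes U: "open U" and F: "Ck_on (Suc 0) U F" and B: "open B" "x \<in> B"
    and cc: "continuous_on ({-e<..<e} \<times> B) c"
    and cU: "\<And>t x. t \<in> {-e<..<e} \<Longrightarrow> x \<in> B \<Longrightarrow> c (t, x) \<in> U"
    and ode: "\<And>t x. t \<in> {-e<..<e} \<Longrightarrow> x \<in> B \<Longrightarrow> ((\<lambda>s. c (s, x)) has_vector_derivative F (c (t, x))) (at t)"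
    and c0: "((\<lambda>x. c (0, x)) has_derivative z 0) (at x)"
    and zl: "\<And>t. t \<in> {-e<..<e} \<Longrightarrow> linear (z t)"
    and zode: "\<And>t w. t \<in> {-e<..<e} \<Longrightarrow> ((\<lambda>s. z s w) has_vector_derivative dd F (c (t, x)) (z t w)) (at t)"
    and t: "t \<in> {-e<..<e}"
  shows "((\<lambda>x. c (t, x)) has_derivative z t) (at x)"
proof -
  define d where "d = (\<bar>t\<bar> + e) / 2"
  have d: "0 < d" "d < e" "t \<in> {-d..d}" using t by (auto simp: d_def abs_if field_simps)
  have sub: "{-d..d} \<subseteq> {-e<..<e}" using d by auto
  have "continuous_on {-d..d} (\<lambda>s. c (s, x))"
    by (rule continuous_on_compose2[OF cc]) (use sub B in \<open>auto intro!: continuous_intros\<close>)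
  then have K: "compact ((\<lambda>s. c (s, x)) ` {-d..d})" (is "compact ?K")
    by (rule compact_continuous_image) simp
  have KU: "?K \<subseteq> U" using cU sub B by auto
  obtain A where A: "A \<ge> 0" "\<And>u v. u \<in> ?K \<Longrightarrow> norm (dd F u v) \<le> A * norm v"
    using dd_bound_compact[OF U F K KU] by blast
  define E1 where "E1 = exp (A * (2*d) + 1/2)"
  define E2 where "E2 = exp ((A + 1) * (2*d) + 1/2)"
  have bl0: "bounded_linear (z 0)" using c0 by (rule has_derivative_bounded_linear)
  define C0 where "C0 = onorm (z 0) + 1"
  have pos: "E1 > 0" "E2 > 0" "C0 > 0"
    using onorm_pos_le[OF bl0] by (simp_all add: E1_def E2_def C0_def add_nonneg_pos)
  have c0': "\<exists>d>0. \<forall>y. norm (y - x) < d \<longrightarrow> norm (c (0, y) - c (0, x) - z 0 (y - x)) \<le> e * norm (y - x)"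
    if "e > 0" for e using c0 that unfolding has_derivative_at_alt by blast
  show ?thesis unfolding has_derivative_at_alt
  proof (intro conjI allI impI)
    show "bounded_linear (z t)" using zl[OF t] by (simp add: linear_conv_bounded_linear)
    fix \<eta> :: real assume \<eta>: "\<eta> > 0"
    \<comment> \<open>\<open>e0\<close> bounds the error of the initial values and \<open>e1\<close>
      the error of linearization; each contributes half of \<open>\<eta>\<close> to the final
      estimate.\<close>
    define e1 where "e1 = min 1 (\<eta> / (2 * E1 * (2 * d) * (E2 * C0)))"
    define e0 where "e0 = min 1 (\<eta> / (2 * E1))"
    have e1: "e1 > 0" and e0: "e0 > 0" using \<eta> pos d by (auto simp: e1_def e0_def)
    obtain \<delta> where \<delta>: "\<delta> > 0" "\<And>u h. u \<in> ?K \<Longrightarrow> norm h < \<delta> \<Longrightarrow>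
        u + h \<in> U \<and> norm (F (u + h) - F u - dd F u h) \<le> e1 * norm h"
      using uniform_linearization[OF U F K KU e1] by blast
    obtain r0 where r0: "r0 > 0" "\<And>y. norm (y - x) < r0 \<Longrightarrow>
        norm (c (0, y) - c (0, x) - z 0 (y - x)) \<le> e0 * norm (y - x)"
      using c0'[OF e0] by blast
    have "continuous_on (B \<times> {-d..d}) (\<lambda>p. c (snd p, fst p))"
      by (rule continuous_on_compose2[OF cc]) (use sub in \<open>auto intro!: continuous_intros\<close>)
    then obtain X0 where X0': "x \<in> X0" "open X0"
      "\<forall>y\<in>X0 \<inter> B. \<forall>t\<in>{-d..d}. dist (c (snd (y, t), fst (y, t))) (c (snd (x, t), fst (x, t))) \<le> \<delta>/2"
      by (rule continuous_on_prod_compactE[OF _ compact_Icc B(2), of _ _ _ "\<delta>/2"]) (use \<delta>(1) in simp)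
    then have X0: "x \<in> X0" "open X0"
      "\<forall>y\<in>X0 \<inter> B. \<forall>t\<in>{-d..d}. dist (c (t, y)) (c (t, x)) \<le> \<delta>/2"
      by simp_all
    obtain r1 where r1: "r1 > 0" "ball x r1 \<subseteq> X0 \<inter> B"
      using openE[OF open_Int[OF X0(2) B(1)], of x] X0(1) B(2) by blast
    show "\<exists>d>0. \<forall>y. norm (y - x) < d \<longrightarrow> norm (c (t, y) - c (t, x) - z t (y - x)) \<le> \<eta> * norm (y - x)"
    proof (intro exI[of _ "min r0 r1"] conjI allI impI)
      fix y assume yr: "norm (y - x) < min r0 r1"
      define w where "w = y - x"
      have y: "y \<in> X0 \<inter> B" using yr r1 by (auto simp: dist_norm norm_minus_commute)
      define h where "h s = c (s, y) - c (s, x)" for s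
      have h: "norm (h s) < \<delta>" if "s \<in> {-d..d}" for s
      proof -
        have "dist (c (s, y)) (c (s, x)) \<le> \<delta>/2" using X0(3) y that by blast
        then show ?thesis using \<delta>(1) by (simp add: h_def dist_norm)
      qed
      have lin: "norm (F (c (s, y)) - F (c (s, x)) - dd F (c (s, x)) (h s)) \<le> e1 * norm (h s)"
        if "s \<in> {-d..d}" for s
        using \<delta>(2)[of "c (s, x)" "h s"] that h[OF that] by (simp add: h_def)
      have hd: "(h has_vector_derivative F (c (s, y)) - F (c (s, x))) (at s within {-d..d})"
        if "s \<in> {-d..d}" for s unfolding h_def
        by (rule has_vector_derivative_at_within, intro has_vector_derivative_diff ode) (use that sub y B in auto)
      have r0y: "norm (h 0 - z 0 w) \<le> e0 * norm w" using r0(2)[of y] yr by (simp add: h_def w_def)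
      have "norm (h 0) \<le> norm (z 0 w) + norm (h 0 - z 0 w)"
        using norm_triangle_ineq[of "z 0 w" "h 0 - z 0 w"] by simp
      also have "\<dots> \<le> onorm (z 0) * norm w + 1 * norm w"
        using r0y onorm[OF bl0, of w] mult_right_mono[of e0 1 "norm w"] by (simp add: e0_def)
      finally have h0: "norm (h 0) \<le> C0 * norm w" by (simp add: C0_def algebra_simps)
      \<comment> \<open>The linearization error is relative to \<open>h\<close>; this Lipschitz
        bound makes it relative to the increment \<open>w\<close>.\<close>
      have hb: "norm (h s) \<le> E2 * (C0 * norm w)" if s: "s \<in> {-d..d}" for s
      proof -
        have "norm (h s) \<le> E2 * (norm (h 0) + 0 * (2*d))" unfolding E2_def
        proof (rule gronwall[OF hd, where B=0 and A="A+1"])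
          fix s assume s: "s \<in> {-d..d}"
          have "norm (F (c (s, y)) - F (c (s, x))) \<le> norm (dd F (c (s, x)) (h s)) + e1 * norm (h s)"
            using lin[OF s] norm_triangle_ineq2[of "F (c (s, y)) - F (c (s, x))" "dd F (c (s, x)) (h s)"]
            by simp
          also have "\<dots> \<le> A * norm (h s) + 1 * norm (h s)"
            using A(2)[of "c (s, x)" "h s"] s by (intro add_mono mult_right_mono) (auto simp: e1_def)
          finally show "norm (F (c (s, y)) - F (c (s, x))) \<le> (A + 1) * norm (h s) + 0"
            by (simp add: algebra_simps)
        qed (use A d s in auto)
        also have "\<dots> \<le> E2 * (C0 * norm w)" using h0 pos by simp
        finally show ?thesis .
      qed
      have "norm (h t - z t w) \<le> E1 * (norm (h 0 - z 0 w) + (e1 * (E2 * (C0 * norm w))) * (2*d))"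
        unfolding E1_def
      proof (rule gronwall[where S="{-d..d}" and s=0 and t=t and A=A and l="2*d" and B="e1 * (E2 * (C0 * norm w))"
            and y="\<lambda>s. h s - z s w" and y'="\<lambda>s. F (c (s, y)) - F (c (s, x)) - dd F (c (s, x)) (z s w)"])
        show "((\<lambda>s. h s - z s w) has_vector_derivative
            F (c (s, y)) - F (c (s, x)) - dd F (c (s, x)) (z s w)) (at s within {-d..d})"
          if "s \<in> {-d..d}" for s
          by (intro has_vector_derivative_diff hd that has_vector_derivative_at_within[OF zode])
            (use that sub in auto)
        show "norm (F (c (s, y)) - F (c (s, x)) - dd F (c (s, x)) (z s w))
           \<le> A * norm (h s - z s w) + e1 * (E2 * (C0 * norm w))" if s: "s \<in> {-d..d}" for s
        proof -
          have "c (s, x) \<in> U" using s cU sub B by auto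
          then have "linear (dd F (c (s, x)))" using Ck_on_SucD[OF U F] has_derivative_linear by blast
          then have "F (c (s, y)) - F (c (s, x)) - dd F (c (s, x)) (z s w) =
             (F (c (s, y)) - F (c (s, x)) - dd F (c (s, x)) (h s)) + dd F (c (s, x)) (h s - z s w)"
            by (simp add: linear_diff)
          also have "norm \<dots> \<le> e1 * norm (h s) + A * norm (h s - z s w)"
            using norm_triangle_mono[OF lin[OF s] A(2)[of "c (s, x)" "h s - z s w"]] s by simp
          also have "\<dots> \<le> e1 * (E2 * (C0 * norm w)) + A * norm (h s - z s w)"
            using hb[OF s] e1 by (intro add_right_mono mult_left_mono) auto
          finally show ?thesis by simp
        qed
      qed (use A d e1 pos in auto)
      also have "\<dots> \<le> E1 * (e0 * norm w + (e1 * (E2 * (C0 * norm w))) * (2*d))"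
        using r0y pos by simp
      also have "\<dots> = (E1 * e0 + E1 * e1 * (2*d) * (E2 * C0)) * norm w"
        by (simp add: algebra_simps)
      also have "\<dots> \<le> (\<eta> / 2 + \<eta> / 2) * norm w"
      proof (intro mult_right_mono add_mono)
        have "E1 * e0 \<le> E1 * (\<eta> / (2 * E1))" using pos by (intro mult_left_mono) (auto simp: e0_def)
        then show "E1 * e0 \<le> \<eta> / 2" using pos by simp
        have "(E1 * (2*d) * (E2 * C0)) * e1 \<le> (E1 * (2*d) * (E2 * C0)) * (\<eta> / (2 * E1 * (2 * d) * (E2 * C0)))"
          using pos d by (intro mult_left_mono) (auto simp: e1_def)
        also have "\<dots> = \<eta> / 2" using pos d by (simp add: divide_simps)
        finally show "E1 * e1 * (2*d) * (E2 * C0) \<le> \<eta> / 2" by (simp add: algebra_simps)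
      qed simp
      finally show "norm (c (t, y) - c (t, x) - z t (y - x)) \<le> \<eta> * norm (y - x)"
        by (simp add: h_def w_def)
    qed (use r0 r1 in simp)
  qed
qed

text \<open>Continuous partial derivatives give the total derivative. The derivative in the second
  factor is assembled from its values \<open>z b\<close> on the basis, so that the class of
  \<open>y\<close> can be read off from \<open>g\<close> and the \<open>z b\<close>.\<close>

lemma Ck_on_SucI_partials:
  fixes y :: "real \<times> 'p::euclidean_space \<Rightarrow> 'a::euclidean_space"
  assumes T: "open T" and B: "open B"
    and dt: "\<And>t x. t \<in> T \<Longrightarrow> x \<in> B \<Longrightarrow> ((\<lambda>s. y (s, x)) has_vector_derivative g (t, x)) (at t)"
    and dx: "\<And>t x. t \<in> T \<Longrightarrow> x \<in> B \<Longrightarrow>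
        ((\<lambda>x. y (t, x)) has_derivative (\<lambda>w. \<Sum>b\<in>Basis. (w \<bullet> b) *\<^sub>R z b (t, x))) (at x)"
    and g: "Ck_on k (T \<times> B) g" and z: "\<And>b. b \<in> Basis \<Longrightarrow> Ck_on k (T \<times> B) (z b)"
  shows "Ck_on (Suc k) (T \<times> B) y"
proof -
  have TB: "open (T \<times> B)" using T B by (rule open_Times)
  define Z where "Z t x w = (\<Sum>b\<in>Basis. (w \<bullet> b) *\<^sub>R z b (t, x))" for t x w
  have blZ: "bounded_linear (Z t x)" for t x unfolding Z_def
    by (intro bounded_linear_sum bounded_linear_scaleR_const bounded_linear_inner_left)
  have Zapp: "blinfun_apply (Blinfun (Z t x)) = Z t x" for t x
    by (rule bounded_linear_Blinfun_apply[OF blZ])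
  have contZ: "continuous_on (T \<times> B) (\<lambda>(t, x). Blinfun (Z t x))"
    unfolding case_prod_unfold
  proof (rule continuous_on_blinfun_componentwise)
    fix i :: 'p assume "i \<in> Basis"
    then have "z i p = Z (fst p) (snd p) i" for p
      by (simp add: Z_def inner_Basis if_distrib[of "\<lambda>c. c *\<^sub>R _"] cong: if_cong)
    then show "continuous_on (T \<times> B) (\<lambda>p. blinfun_apply (Blinfun (Z (fst p) (snd p))) i)"
      using Ck_on_continuous[OF z[OF \<open>i \<in> Basis\<close>]] by (simp add: Zapp)
  qed
  have der: "(y has_derivative (\<lambda>(\<tau>, w). \<tau> *\<^sub>R g (t, x) + Z t x w)) (at (t, x))"
    if t: "t \<in> T" and x: "x \<in> B" for t x
  proof -
    obtain r where r: "r > 0" "ball x r \<subseteq> B" using B x openE by blast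
    have opn: "open (T \<times> ball x r)" using T by (simp add: open_Times)
    have "((\<lambda>(t, x). y (t, x)) has_derivative
       (\<lambda>(\<tau>, w). \<tau> *\<^sub>R g (t, x) + blinfun_apply (Blinfun (Z t x)) w)) (at (t, x) within T \<times> ball x r)"
    proof (rule has_derivative_partialsI)
      show "((\<lambda>t. y (t, x)) has_derivative (\<lambda>\<tau>. \<tau> *\<^sub>R g (t, x))) (at t within T)"
        using has_derivative_at_withinI[OF dt[OF t x, unfolded has_vector_derivative_def]] .
      show "((\<lambda>x. y (t', x)) has_derivative blinfun_apply (Blinfun (Z t' x'))) (at x' within ball x r)"
        if "t' \<in> T" "x' \<in> ball x r" for t' x'
        using has_derivative_at_withinI[OF dx[OF that(1), of x']] that r unfolding Zapp Z_def by auto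
      have "continuous_on (T \<times> ball x r) (\<lambda>(t, x). Blinfun (Z t x))"
        using contZ by (rule continuous_on_subset) (use r in auto)
      then show "continuous (at (t, x) within T \<times> ball x r) (\<lambda>(t, x). Blinfun (Z t x))"
        using t r unfolding continuous_on_eq_continuous_within by auto
    qed (use r in auto)
    then show ?thesis using t r opn
      by (simp add: at_within_open[of "(t, x)" "T \<times> ball x r"] Zapp case_prod_unfold)
  qed
  show ?thesis
  proof (rule Ck_on_SucI[OF TB, where f'="\<lambda>p v. fst v *\<^sub>R g p + (\<Sum>b\<in>Basis. (snd v \<bullet> b) *\<^sub>R z b p)"])
    show "(y has_derivative (\<lambda>v. fst v *\<^sub>R g p + (\<Sum>b\<in>Basis. (snd v \<bullet> b) *\<^sub>R z b p))) (at p)"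
      if "p \<in> T \<times> B" for p
      using der[of "fst p" "snd p"] that by (auto simp: Z_def case_prod_unfold)
    show "Ck_on k (T \<times> B) (\<lambda>p. fst v *\<^sub>R g p + (\<Sum>b\<in>Basis. (snd v \<bullet> b) *\<^sub>R z b p))" for v
      by (intro Ck_on_add[OF TB] Ck_on_sum[OF TB] g z
          Ck_on_linear_compose[OF TB bounded_linear_scaleR_right])
  qed
qed

lemma linear_Pair0_expand:
  fixes f :: "'b::real_vector \<times> 'p::euclidean_space \<Rightarrow> 'a::real_vector"
  assumes "linear f"
  shows "f (0, w) = (\<Sum>b\<in>Basis. (w \<bullet> b) *\<^sub>R f (0, b))"
proof -
  have "linear (\<lambda>w. f (0, w))"
    by (rule linearI) (metis assms linear_add linear_scale add_0 add_Pair scaleR_Pair scaleR_zero_right)+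
  from linear_sum[OF this, of "\<lambda>b. (w \<bullet> b) *\<^sub>R b" Basis] linear_scale[OF this]
  show ?thesis by (simp add: euclidean_representation)
qed

text \<open>Differentiating in a parameter direction \<open>b\<close> gives an equation for
  \<open>z b\<close> with the same matrix \<open>M\<close> and a new inhomogeneity
  \<open>fb b\<close>. So the statement for \<open>k\<close> applies to \<open>y\<close> and to
  \<open>z b\<close>, and neither the bound \<open>L\<close> nor the time \<open>e\<close> changes
  along the induction.\<close>

lemma linear_ode_Ck:
  fixes M :: "'a::euclidean_space \<Rightarrow> real \<times> 'p::euclidean_space \<Rightarrow> 'a"
  assumes B: "open B" and e: "e > 0" and L: "L \<ge> 0" "L * e \<le> 1/2"
    and bd: "\<And>p w. p \<in> {-e<..<e} \<times> B \<Longrightarrow> norm (\<Sum>i\<in>Basis. (w \<bullet> i) *\<^sub>R M i p) \<le> L * norm w"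
    and M: "\<And>i. i \<in> Basis \<Longrightarrow> Ck_on k ({-e<..<e} \<times> B) (M i)"
    and f: "Ck_on k ({-e<..<e} \<times> B) f" and y0: "Ck_on k B (\<lambda>x. y (0, x))"
    and ode: "\<And>t x. t \<in> {-e<..<e} \<Longrightarrow> x \<in> B \<Longrightarrow> ((\<lambda>s. y (s, x)) has_vector_derivative
        (\<Sum>i\<in>Basis. (y (t, x) \<bullet> i) *\<^sub>R M i (t, x)) + f (t, x)) (at t)"
  shows "Ck_on k ({-e<..<e} \<times> B) y"
  using M f y0 ode
proof (induction k arbitrary: y f)
  let ?J = "{-e<..<e}"
  have opn: "open (?J \<times> B)" using B by (intro open_Times) auto
  have lip: "norm (((\<Sum>i\<in>Basis. (u \<bullet> i) *\<^sub>R M i p) + c) - ((\<Sum>i\<in>Basis. (v \<bullet> i) *\<^sub>R M i p) + c))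
      \<le> L * norm (u - v)" if "p \<in> ?J \<times> B" for u v p c
    using bd[OF that, of "u - v"] by (simp add: inner_diff_left scaleR_diff_left sum_subtractf)
  {
    case (0 y f)
    have "continuous_on ((?J \<times> B) \<times> UNIV) (\<lambda>q. (\<Sum>i\<in>Basis. (snd q \<bullet> i) *\<^sub>R M i (fst q)) + f (fst q))"
      using 0(1,2) by (intro continuous_intros) (auto intro!: continuous_intros
          intro: continuous_on_compose2[of "?J \<times> B" _ _ fst])
    then show ?case unfolding Ck_on.simps(1)
      by (intro solution_continuous[where \<Phi>="\<lambda>t x u. (\<Sum>i\<in>Basis. (u \<bullet> i) *\<^sub>R M i (t, x)) + f (t, x)" and L=L])
        (use 0 lip L B in \<open>auto simp: case_prod_unfold\<close>)
  next
    case (Suc k y f)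
    have M': "Ck_on k (?J \<times> B) (M i)" if "i \<in> Basis" for i
      using Suc.prems(1)[OF that] by (rule Ck_on_SucD1)
    have f': "Ck_on k (?J \<times> B) f" using Suc.prems(2) by (rule Ck_on_SucD1)
    have yk: "Ck_on k (?J \<times> B) y"
      by (rule Suc.IH[OF M' f' Ck_on_SucD1[OF Suc.prems(3)] Suc.prems(4)])
    \<comment> \<open>The parameter derivative of the right-hand side with \<open>y\<close> held
      fixed.\<close>
    define fb where "fb b p = (\<Sum>i\<in>Basis. (y p \<bullet> i) *\<^sub>R dd (M i) p (0, b)) + dd f p (0, b)" for b p
    have fb: "Ck_on k (?J \<times> B) (fb b)" for b
      unfolding fb_def
      by (intro Ck_on_add[OF opn] Ck_on_sum[OF opn] Ck_on_bilinear[OF opn bounded_bilinear_scaleR]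
          Ck_on_linear_compose[OF opn bounded_linear_inner_left] yk Ck_on_SucD2 Suc.prems(1,2))
    have "\<exists>u. u 0 = dd (\<lambda>x. y (0, x)) x b \<and> (\<forall>t\<in>?J. (u has_vector_derivative
        (\<Sum>i\<in>Basis. (u t \<bullet> i) *\<^sub>R M i (t, x)) + fb b (t, x)) (at t))" if x: "x \<in> B" for x b
    proof -
      have inj: "continuous_on (?J \<times> UNIV) (\<lambda>q::real \<times> 'a. h (fst q, x))"
        if "continuous_on (?J \<times> B) h" for h :: "real \<times> 'p \<Rightarrow> 'a"
        by (rule continuous_on_compose2[OF that]) (use x in \<open>auto intro!: continuous_intros\<close>)
      have "continuous_on (?J \<times> UNIV) (\<lambda>q. (\<Sum>i\<in>Basis. (snd q \<bullet> i) *\<^sub>R M i (fst q, x)) + fb b (fst q, x))"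
        by (intro continuous_intros inj Ck_on_continuous[OF fb] Ck_on_continuous[OF M']) auto
      then have c: "continuous_on (?J \<times> UNIV) (\<lambda>(t, u). (\<Sum>i\<in>Basis. (u \<bullet> i) *\<^sub>R M i (t, x)) + fb b (t, x))"
        by (simp add: case_prod_unfold)
      show ?thesis
        by (rule picard_open[OF e c _ L, of "dd (\<lambda>x. y (0, x)) x b"]) (use lip x in auto)
    qed
    note ex = this
    define Zf where "Zf b x = (SOME u. u 0 = dd (\<lambda>x. y (0, x)) x b \<and> (\<forall>t\<in>?J. (u has_vector_derivative
        (\<Sum>i\<in>Basis. (u t \<bullet> i) *\<^sub>R M i (t, x)) + fb b (t, x)) (at t)))" for b x
    have Zf: "Zf b x 0 = dd (\<lambda>x. y (0, x)) x b"
      "t \<in> ?J \<Longrightarrow> (Zf b x has_vector_derivative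
        (\<Sum>i\<in>Basis. (Zf b x t \<bullet> i) *\<^sub>R M i (t, x)) + fb b (t, x)) (at t)" if "x \<in> B" for x b t
      using someI_ex[OF ex[OF that, of b], folded Zf_def] by simp_all
    define z where "z b p = Zf b (snd p) (fst p)" for b p
    have zode: "((\<lambda>s. z b (s, x)) has_vector_derivative
        (\<Sum>i\<in>Basis. (z b (t, x) \<bullet> i) *\<^sub>R M i (t, x)) + fb b (t, x)) (at t)"
      if "t \<in> ?J" "x \<in> B" for t x b
      using Zf(2)[OF that(2,1), of b] by (simp add: z_def)
    have zk: "Ck_on k (?J \<times> B) (z b)" for b
    proof (rule Suc.IH[OF M' fb _ zode])
      show "Ck_on k B (\<lambda>x. z b (0, x))"
        by (rule Ck_on_cong[OF B _ Ck_on_SucD2[OF Suc.prems(3), of b]]) (simp add: z_def Zf(1))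
    qed auto
    have dx: "((\<lambda>x. y (t, x)) has_derivative (\<lambda>w. \<Sum>b\<in>Basis. (w \<bullet> b) *\<^sub>R z b (t, x))) (at x)"
      if t: "t \<in> ?J" and x: "x \<in> B" for t x
    proof -
      \<comment> \<open>Time and parameter join the state \<open>(t, x, u)\<close>, so that the
        equation becomes autonomous and \<open>flow_param_derivative\<close> applies to the field
        \<open>(1, 0, \<Phi>)\<close>.\<close>
      define Q where "Q = {q :: real \<times> 'p \<times> 'a. (fst q, fst (snd q)) \<in> ?J \<times> B}"
      have Qo: "open Q" unfolding Q_def
        using open_vimage[OF opn, of "\<lambda>q::real \<times> 'p \<times> 'a. (fst q, fst (snd q))"]
        by (simp add: vimage_def continuous_intros)
      have prl: "bounded_linear (\<lambda>q::real \<times> 'p \<times> 'a. (fst q, fst (snd q)))"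
        by (intro bounded_linear_Pair bounded_linear_fst bounded_linear_compose[OF bounded_linear_fst bounded_linear_snd])
      have pr2l: "bounded_linear (\<lambda>q::real \<times> 'p \<times> 'a. snd (snd q))"
        by (intro bounded_linear_compose[OF bounded_linear_snd bounded_linear_snd])
      have lift: "Ck_on (Suc 0) Q (\<lambda>q. h (fst q, fst (snd q)))" if "Ck_on (Suc k) (?J \<times> B) h" for h :: "real \<times> 'p \<Rightarrow> 'a"
        by (rule Ck_on_compose[OF Qo opn Ck_on_bounded_linear[OF Qo prl] Ck_on_le[OF _ that]])
          (auto simp: Q_def)
      define \<Phi> where "\<Phi> q = (\<Sum>i\<in>Basis. (snd (snd q) \<bullet> i) *\<^sub>R M i (fst q, fst (snd q))) + f (fst q, fst (snd q))"
        for q :: "real \<times> 'p \<times> 'a"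
      define F where "F q = (1 :: real, 0 :: 'p, \<Phi> q)" for q
      have F1: "Ck_on (Suc 0) Q F" unfolding F_def \<Phi>_def
        by (intro Ck_on_Pair[OF Qo] Ck_on_const[OF Qo] Ck_on_add[OF Qo] Ck_on_sum[OF Qo] lift Suc.prems(1,2)
            Ck_on_bilinear[OF Qo bounded_bilinear_scaleR] Ck_on_linear_compose[OF Qo bounded_linear_inner_left]
            Ck_on_bounded_linear[OF Qo pr2l])
      have ddF: "dd F (s, x, u) (0, w, \<eta>) = (0, 0, (\<Sum>i\<in>Basis. (\<eta> \<bullet> i) *\<^sub>R M i (s, x)) +
          ((\<Sum>i\<in>Basis. (u \<bullet> i) *\<^sub>R dd (M i) (s, x) (0, w)) + dd f (s, x) (0, w)))"
        if s: "s \<in> ?J" for s u w \<eta>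
      proof -
        have sx: "(s, x) \<in> ?J \<times> B" using s x by simp
        have h: "((\<lambda>q::real \<times> 'p \<times> 'a. h (fst q, fst (snd q))) has_derivative
            (\<lambda>v. dd h (s, x) (fst v, fst (snd v)))) (at (s, x, u))" if "Ck_on (Suc k) (?J \<times> B) h" for h :: "real \<times> 'p \<Rightarrow> 'a"
          using has_derivative_compose[OF bounded_linear_imp_has_derivative[OF prl], of h "dd h (s, x)" "(s, x, u)"]
            Ck_on_SucD[OF opn that sx] by simp
        have "(F has_derivative (\<lambda>v. (0, 0, (\<Sum>i\<in>Basis. (u \<bullet> i) *\<^sub>R dd (M i) (s, x) (fst v, fst (snd v)) +
            (snd (snd v) \<bullet> i) *\<^sub>R M i (s, x)) + dd f (s, x) (fst v, fst (snd v))))) (at (s, x, u))"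
          unfolding F_def \<Phi>_def
          by (rule derivative_eq_intros h Suc.prems(1,2) refl bounded_linear_imp_has_derivative[OF pr2l] | assumption)+
             simp
        from dd_eq[OF this] show ?thesis by (simp add: sum.distrib algebra_simps)
      qed
      define c where "c p = (fst p, snd p, y p)" for p :: "real \<times> 'p"
      define \<zeta> where "\<zeta> s w = (0 :: real, w, \<Sum>b\<in>Basis. (w \<bullet> b) *\<^sub>R z b (s, x))" for s w
      have blS: "bounded_linear (\<lambda>w. \<Sum>b\<in>Basis. (w \<bullet> b) *\<^sub>R z b (s, x))" for s
        by (intro bounded_linear_sum bounded_linear_scaleR_const bounded_linear_inner_left)
      have "((\<lambda>x. c (t, x)) has_derivative \<zeta> t) (at x)"
      proof (rule flow_param_derivative[OF Qo F1 B x _ _ _ _ _ _ t])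
        show "continuous_on (?J \<times> B) c" unfolding c_def
          using Ck_on_continuous[OF yk] by (intro continuous_intros)
        show "c (t, x) \<in> Q" if "t \<in> ?J" "x \<in> B" for t x using that by (simp add: c_def Q_def)
        show "((\<lambda>s. c (s, x)) has_vector_derivative F (c (t, x))) (at t)" if "t \<in> ?J" "x \<in> B" for t x
          using Suc.prems(4)[OF that] unfolding c_def F_def \<Phi>_def
          by (auto intro!: has_vector_derivative_Pair derivative_eq_intros)
        have "((\<lambda>x. y (0, x)) has_derivative dd (\<lambda>x. y (0, x)) x) (at x)"
          by (rule Ck_on_SucD[OF B Suc.prems(3) x])
        moreover have "dd (\<lambda>x. y (0, x)) x w = (\<Sum>b\<in>Basis. (w \<bullet> b) *\<^sub>R z b (0, x))" for w
          using linear_sum[OF has_derivative_linear[OF calculation], of "\<lambda>b. (w \<bullet> b) *\<^sub>R b" Basis]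
            linear_scale[OF has_derivative_linear[OF calculation]] x
          by (simp add: euclidean_representation z_def Zf(1))
        ultimately show "((\<lambda>x. c (0, x)) has_derivative \<zeta> 0) (at x)"
          unfolding c_def \<zeta>_def by (auto intro!: derivative_eq_intros)
        show "linear (\<zeta> s)" for s unfolding \<zeta>_def
          by (intro bounded_linear.linear bounded_linear_Pair bounded_linear_zero bounded_linear_ident blS)
        fix s w assume s: "s \<in> ?J"
        have sx: "(s, x) \<in> ?J \<times> B" using s x by simp
        have e1: "dd f (s, x) (0, w) = (\<Sum>b\<in>Basis. (w \<bullet> b) *\<^sub>R dd f (s, x) (0, b))"
          by (rule linear_Pair0_expand[OF has_derivative_linear[OF Ck_on_SucD[OF opn Suc.prems(2) sx]]])
        have e2: "dd (M i) (s, x) (0, w) = (\<Sum>b\<in>Basis. (w \<bullet> b) *\<^sub>R dd (M i) (s, x) (0, b))" if "i \<in> Basis" for i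
          by (rule linear_Pair0_expand[OF has_derivative_linear[OF Ck_on_SucD[OF opn Suc.prems(1)[OF that] sx]]])
        have "((\<lambda>s. \<Sum>b\<in>Basis. (w \<bullet> b) *\<^sub>R z b (s, x)) has_vector_derivative
            (\<Sum>b\<in>Basis. (w \<bullet> b) *\<^sub>R ((\<Sum>i\<in>Basis. (z b (s, x) \<bullet> i) *\<^sub>R M i (s, x)) + fb b (s, x)))) (at s)"
          by (intro has_vector_derivative_sum bounded_linear.has_vector_derivative[OF bounded_linear_scaleR_right] zode s x)
        moreover have "(\<Sum>b\<in>Basis. (w \<bullet> b) *\<^sub>R ((\<Sum>i\<in>Basis. (z b (s, x) \<bullet> i) *\<^sub>R M i (s, x)) + fb b (s, x)))
            = snd (snd (dd F (c (s, x)) (\<zeta> s w)))"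
        proof -
          have "(\<Sum>b\<in>Basis. (w \<bullet> b) *\<^sub>R (\<Sum>i\<in>Basis. (z b (s, x) \<bullet> i) *\<^sub>R M i (s, x)))
            = (\<Sum>i\<in>Basis. ((\<Sum>b\<in>Basis. (w \<bullet> b) *\<^sub>R z b (s, x)) \<bullet> i) *\<^sub>R M i (s, x))"
            unfolding scaleR_sum_right inner_sum_left scaleR_sum_left
            by (subst sum.swap) simp
          moreover have "(\<Sum>b\<in>Basis. (w \<bullet> b) *\<^sub>R (\<Sum>i\<in>Basis. (y (s, x) \<bullet> i) *\<^sub>R dd (M i) (s, x) (0, b)))
            = (\<Sum>i\<in>Basis. (y (s, x) \<bullet> i) *\<^sub>R dd (M i) (s, x) (0, w))"
            unfolding scaleR_sum_right by (subst sum.swap) (simp add: e2 scaleR_sum_right mult.commute)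
          ultimately show ?thesis
            unfolding c_def \<zeta>_def fst_conv snd_conv ddF[OF s] e1
            by (simp add: fb_def scaleR_add_right sum.distrib)
        qed
        ultimately have "((\<lambda>s. \<Sum>b\<in>Basis. (w \<bullet> b) *\<^sub>R z b (s, x)) has_vector_derivative
            snd (snd (dd F (c (s, x)) (\<zeta> s w)))) (at s)" by simp
        then show "((\<lambda>s. \<zeta> s w) has_vector_derivative dd F (c (s, x)) (\<zeta> s w)) (at s)"
          unfolding c_def \<zeta>_def fst_conv snd_conv ddF[OF s]
          by (auto intro!: has_vector_derivative_Pair derivative_eq_intros)
      qed
      from has_derivative_snd[OF has_derivative_snd[OF this]]
      show ?thesis by (simp add: c_def \<zeta>_def)
    qed
    show ?case
    proof (rule Ck_on_SucI_partials[OF _ B Suc.prems(4) dx])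
      show "Ck_on k (?J \<times> B) (\<lambda>p. (\<Sum>i\<in>Basis. (y p \<bullet> i) *\<^sub>R M i p) + f p)"
        by (intro Ck_on_add[OF opn] Ck_on_sum[OF opn] Ck_on_bilinear[OF opn bounded_bilinear_scaleR]
            Ck_on_linear_compose[OF opn bounded_linear_inner_left] yk M' f')
    qed (use zk in auto)
  }
qed

text \<open>The closest point projection \<open>pr\<close> onto a closed ball makes
  \<open>F \<circ> pr\<close> globally Lipschitz, hence solvable for all starting points on one time
  interval; from the half ball the solutions never leave the ball, so they solve the original
  equation. Smoothness follows by induction on the class: the derivatives in the initial value solve
  a linear equation whose coefficients are as smooth as the flow.\<close>

theorem smooth_local_flow:
  fixes F :: "'a::euclidean_space \<Rightarrow> 'a"
  assumes U: "open U" and F: "smooth_on U F" and x0: "x0 \<in> U"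
  obtains e r \<theta> where "e > 0" "r > 0" "smooth_on ({-e<..<e} \<times> ball x0 r) \<theta>"
    "\<And>x. x \<in> ball x0 r \<Longrightarrow> \<theta> (0, x) = x"
    "\<And>t x. t \<in> {-e<..<e} \<Longrightarrow> x \<in> ball x0 r \<Longrightarrow> \<theta> (t, x) \<in> U"
    "\<And>t x. t \<in> {-e<..<e} \<Longrightarrow> x \<in> ball x0 r \<Longrightarrow>
       ((\<lambda>s. \<theta> (s, x)) has_vector_derivative F (\<theta> (t, x))) (at t)"
proof -
  have Fk: "Ck_on k U F" for k using F by (simp add: smooth_on_def)
  obtain q where q: "q > 0" "cball x0 q \<subseteq> U" using U x0 open_contains_cball by blast
  define r where "r = q / 2"
  have r: "r > 0" using q by (simp add: r_def)
  let ?K = "cball x0 q"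
  have K: "compact ?K" "convex ?K" "closed ?K" "?K \<noteq> {}" using q by auto
  obtain L where L: "L \<ge> 0" "\<And>u v. u \<in> ?K \<Longrightarrow> norm (dd F u v) \<le> L * norm v"
    using dd_bound_compact[OF U Fk K(1) q(2)] by blast
  have Fc: "continuous_on ?K F" using smooth_on_continuous[OF F] q(2) by (rule continuous_on_subset)
  then have "bounded (F ` ?K)" using K(1) by (intro compact_imp_bounded compact_continuous_image)
  then obtain N where N: "N > 0" "\<And>u. u \<in> ?K \<Longrightarrow> norm (F u) \<le> N" unfolding bounded_pos by auto
  \<comment> \<open>The first bound serves the Picard contraction; under the second a solution of
    speed at most \<open>N\<close> moves by at most \<open>r\<close>, half the radius of
    \<open>?K\<close>.\<close>
  define e where "e = min (1 / (2 * (L + 1))) (r / N)"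
  have e: "e > 0" using L N r by (simp add: e_def add_nonneg_pos)
  have "L * e \<le> L * (1 / (2 * (L + 1)))" using L by (intro mult_left_mono) (auto simp: e_def)
  also have "\<dots> \<le> 1/2" using L by (simp add: divide_simps)
  finally have Le: "L * e \<le> 1/2" .
  have "N * e \<le> N * (r / N)" using N by (intro mult_left_mono) (auto simp: e_def)
  then have Ne: "N * e \<le> r" using N by simp
  let ?J = "{-e<..<e}" and ?B = "ball x0 r"
  have opn: "open (?J \<times> ?B)" by (intro open_Times) auto
  define pr where "pr = closest_point ?K"
  have pr: "pr u \<in> ?K" for u unfolding pr_def by (rule closest_point_in_set) (use K in auto)
  have pr_id: "pr u = u" if "u \<in> ?K" for u unfolding pr_def by (rule closest_point_self[OF that])
  have pr_cont: "continuous_on UNIV pr"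
    unfolding pr_def by (intro continuous_on_closest_point K)
  have Flip: "norm (F u - F v) \<le> L * norm (u - v)" if "u \<in> ?K" "v \<in> ?K" for u v
  proof (rule differentiable_bound[OF K(2) _ _ that, where f'="dd F"])
    show "(F has_derivative dd F x) (at x within ?K)" if "x \<in> ?K" for x
      using smooth_on_deriv[OF F U] that q by (blast intro: has_derivative_at_withinI)
    show "onorm (dd F x) \<le> L" if "x \<in> ?K" for x using L(2)[OF that] by (rule onorm_le)
  qed
  have lip: "norm (F (pr u) - F (pr v)) \<le> L * norm (u - v)" for u v
  proof -
    have "norm (F (pr u) - F (pr v)) \<le> L * norm (pr u - pr v)" by (rule Flip[OF pr pr])
    also have "\<dots> \<le> L * norm (u - v)"
      using closest_point_lipschitz[of ?K u v] K L by (intro mult_left_mono) (auto simp: pr_def dist_norm)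
    finally show ?thesis .
  qed
  have Fpr: "continuous_on UNIV (\<lambda>u. F (pr u))"
    by (rule continuous_on_compose2[OF Fc pr_cont]) (use pr in auto)
  have Fpr': "continuous_on S (\<lambda>w. F (pr (snd w)))" for S :: "('b::topological_space \<times> 'a) set"
    by (rule continuous_on_compose2[OF Fpr]) (auto intro: continuous_intros)
  have "\<exists>y. y 0 = x \<and> (\<forall>t\<in>?J. (y has_vector_derivative F (pr (y t))) (at t))" for x
    by (rule picard_open[OF e _ _ L(1) Le, of "\<lambda>t u. F (pr u)" x])
      (use lip Fpr' in \<open>auto simp: case_prod_unfold\<close>)
  note ex = this
  define Y where "Y x = (SOME y. y 0 = x \<and> (\<forall>t\<in>?J. (y has_vector_derivative F (pr (y t))) (at t)))" for x
  have Y: "Y x 0 = x" "t \<in> ?J \<Longrightarrow> (Y x has_vector_derivative F (pr (Y x t))) (at t)" for x t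
    using someI_ex[OF ex[of x], folded Y_def] by simp_all
  define \<theta> where "\<theta> p = Y (snd p) (fst p)" for p
  have \<theta>0: "\<theta> (0, x) = x" for x by (simp add: \<theta>_def Y)
  have ode': "((\<lambda>s. \<theta> (s, x)) has_vector_derivative F (pr (\<theta> (t, x)))) (at t)" if "t \<in> ?J" for t x
    using Y(2)[OF that, of x] by (simp add: \<theta>_def)
  have inK: "\<theta> (t, x) \<in> ?K" if t: "t \<in> ?J" and x: "x \<in> ?B" for t x
  proof -
    have "norm (\<theta> (t, x) - \<theta> (0, x)) \<le> N * norm (t - 0)"
    proof (rule differentiable_bound[of ?J "\<lambda>s. \<theta> (s, x)" "\<lambda>s h. h *\<^sub>R F (pr (\<theta> (s, x)))"])
      show "((\<lambda>s. \<theta> (s, x)) has_derivative (\<lambda>h. h *\<^sub>R F (pr (\<theta> (s, x))))) (at s within ?J)" if "s \<in> ?J" for s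
        using ode'[OF that, of x] unfolding has_vector_derivative_def by (rule has_derivative_at_withinI)
      show "onorm (\<lambda>h. h *\<^sub>R F (pr (\<theta> (s, x)))) \<le> N" for s
        by (rule onorm_le) (metis N(2) pr mult.commute mult_left_mono norm_ge_zero norm_scaleR real_norm_def)
    qed (use t e in auto)
    also have "\<dots> \<le> N * e" using t N by (intro mult_left_mono) auto
    finally have "norm (\<theta> (t, x) - x) \<le> r" using Ne by (simp add: \<theta>0)
    then show ?thesis using x norm_triangle_ineq[of "\<theta> (t, x) - x" "x - x0"]
      by (simp add: dist_norm norm_minus_commute r_def)
  qed
  have ode: "((\<lambda>s. \<theta> (s, x)) has_vector_derivative F (\<theta> (t, x))) (at t)" if "t \<in> ?J" "x \<in> ?B" for t x
    using ode'[OF that(1), of x] pr_id[OF inK[OF that]] by simp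
  have \<theta>c: "continuous_on (?J \<times> ?B) \<theta>"
    by (rule solution_continuous[where \<Phi>="\<lambda>t x u. F (pr u)" and L=L])
      (use lip L ode' \<theta>0 Fpr' in \<open>auto simp: case_prod_unfold\<close>)
  have bd: "norm (\<Sum>i\<in>Basis. (w \<bullet> i) *\<^sub>R dd F (\<theta> p) i) \<le> L * norm w"
    and ddS: "dd F (\<theta> p) w = (\<Sum>i\<in>Basis. (w \<bullet> i) *\<^sub>R dd F (\<theta> p) i)" if "p \<in> ?J \<times> ?B" for p w
  proof -
    have p: "\<theta> p \<in> ?K" using inK that by (cases p) auto
    then have l: "linear (dd F (\<theta> p))"
      using smooth_on_deriv[OF F U] q has_derivative_linear by blast
    show eq: "dd F (\<theta> p) w = (\<Sum>i\<in>Basis. (w \<bullet> i) *\<^sub>R dd F (\<theta> p) i)"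
      using linear_sum[OF l, of "\<lambda>b. (w \<bullet> b) *\<^sub>R b" Basis] linear_scale[OF l]
      by (simp add: euclidean_representation)
    show "norm (\<Sum>i\<in>Basis. (w \<bullet> i) *\<^sub>R dd F (\<theta> p) i) \<le> L * norm w"
      using L(2)[OF p, of w] eq by simp
  qed
  have "Ck_on k (?J \<times> ?B) \<theta>" for k
  proof (induction k)
    case 0
    show ?case using \<theta>c by simp
  next
    case (Suc k)
    have \<theta>U: "\<theta> ` (?J \<times> ?B) \<subseteq> U" using inK q by auto
    have M: "Ck_on k (?J \<times> ?B) (\<lambda>p. dd F (\<theta> p) i)" for i
      by (rule Ck_on_compose[OF opn U Suc Ck_on_SucD2[OF Fk] \<theta>U])
    have "\<exists>u. u 0 = b \<and> (\<forall>t\<in>?J. (u has_vector_derivative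
        (\<Sum>i\<in>Basis. (u t \<bullet> i) *\<^sub>R dd F (\<theta> (t, x)) i)) (at t))" if x: "x \<in> ?B" for x b
    proof (rule picard_open[OF e _ _ L(1) Le, of "\<lambda>t u. \<Sum>i\<in>Basis. (u \<bullet> i) *\<^sub>R dd F (\<theta> (t, x)) i" b])
      have "continuous_on (?J \<times> UNIV) (\<lambda>q::real \<times> 'a. dd F (\<theta> (fst q, x)) i)" for i
        by (rule continuous_on_compose2[OF Ck_on_continuous[OF M]])
          (use x in \<open>auto intro!: continuous_intros\<close>)
      then show "continuous_on (?J \<times> UNIV) (\<lambda>(t, u). \<Sum>i\<in>Basis. (u \<bullet> i) *\<^sub>R dd F (\<theta> (t, x)) i)"
        unfolding case_prod_unfold by (intro continuous_intros)
      show "norm ((\<Sum>i\<in>Basis. (u \<bullet> i) *\<^sub>R dd F (\<theta> (t, x)) i) - (\<Sum>i\<in>Basis. (v \<bullet> i) *\<^sub>R dd F (\<theta> (t, x)) i))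
          \<le> L * norm (u - v)" if "t \<in> ?J" for t u v
        using bd[of "(t, x)" "u - v"] that x by (simp add: inner_diff_left scaleR_diff_left sum_subtractf)
    qed auto
    note ex = this
    define Zf where "Zf b x = (SOME u. u 0 = b \<and> (\<forall>t\<in>?J. (u has_vector_derivative
        (\<Sum>i\<in>Basis. (u t \<bullet> i) *\<^sub>R dd F (\<theta> (t, x)) i)) (at t)))" for b x
    have Zf: "Zf b x 0 = b"
      "t \<in> ?J \<Longrightarrow> (Zf b x has_vector_derivative
        (\<Sum>i\<in>Basis. (Zf b x t \<bullet> i) *\<^sub>R dd F (\<theta> (t, x)) i)) (at t)" if "x \<in> ?B" for x b t
      using someI_ex[OF ex[OF that, of b], folded Zf_def] by simp_all
    define z where "z b p = Zf b (snd p) (fst p)" for b p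
    have zode: "((\<lambda>s. z b (s, x)) has_vector_derivative
        (\<Sum>i\<in>Basis. (z b (t, x) \<bullet> i) *\<^sub>R dd F (\<theta> (t, x)) i) + 0) (at t)" if "t \<in> ?J" "x \<in> ?B" for t x b
      using Zf(2)[OF that(2,1), of b] by (simp add: z_def)
    have zk: "Ck_on k (?J \<times> ?B) (z b)" for b
    proof (rule linear_ode_Ck[OF _ e L(1) Le bd M Ck_on_const[OF opn] _ zode])
      show "Ck_on k ?B (\<lambda>x. z b (0, x))"
        by (rule Ck_on_cong[OF _ _ Ck_on_const[where c=b]]) (auto simp: z_def Zf(1))
    qed auto
    have dx: "((\<lambda>x. \<theta> (t, x)) has_derivative (\<lambda>w. \<Sum>b\<in>Basis. (w \<bullet> b) *\<^sub>R z b (t, x))) (at x)"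
      if t: "t \<in> ?J" and x: "x \<in> ?B" for t x
    proof (rule flow_param_derivative[OF U Fk _ x \<theta>c _ ode _ _ _ t, where z="\<lambda>t w. \<Sum>b\<in>Basis. (w \<bullet> b) *\<^sub>R z b (t, x)"])
      show "\<theta> (t, x) \<in> U" if "t \<in> ?J" "x \<in> ?B" for t x using inK[OF that] q by auto
      have "(\<lambda>w. \<Sum>b\<in>Basis. (w \<bullet> b) *\<^sub>R z b (0, x)) = (\<lambda>w. w)"
        using x by (simp add: z_def Zf(1) euclidean_representation)
      then show "((\<lambda>x. \<theta> (0, x)) has_derivative (\<lambda>w. \<Sum>b\<in>Basis. (w \<bullet> b) *\<^sub>R z b (0, x))) (at x)"
        by (simp add: \<theta>0)
      show "linear (\<lambda>w. \<Sum>b\<in>Basis. (w \<bullet> b) *\<^sub>R z b (s, x))" for s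
        by (intro bounded_linear.linear bounded_linear_sum bounded_linear_scaleR_const bounded_linear_inner_left)
      fix s w assume s: "s \<in> ?J"
      have "((\<lambda>s. \<Sum>b\<in>Basis. (w \<bullet> b) *\<^sub>R z b (s, x)) has_vector_derivative
          (\<Sum>b\<in>Basis. (w \<bullet> b) *\<^sub>R ((\<Sum>i\<in>Basis. (z b (s, x) \<bullet> i) *\<^sub>R dd F (\<theta> (s, x)) i) + 0))) (at s)"
        by (intro has_vector_derivative_sum bounded_linear.has_vector_derivative[OF bounded_linear_scaleR_right] zode s x)
      moreover have "(\<Sum>b\<in>Basis. (w \<bullet> b) *\<^sub>R ((\<Sum>i\<in>Basis. (z b (s, x) \<bullet> i) *\<^sub>R dd F (\<theta> (s, x)) i) + 0))
          = dd F (\<theta> (s, x)) (\<Sum>b\<in>Basis. (w \<bullet> b) *\<^sub>R z b (s, x))"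
        using s x ddS[of "(s, x)" "\<Sum>b\<in>Basis. (w \<bullet> b) *\<^sub>R z b (s, x)"]
        unfolding add_0_right scaleR_sum_right inner_sum_left scaleR_sum_left
        by (subst sum.swap) simp
      ultimately show "((\<lambda>s. \<Sum>b\<in>Basis. (w \<bullet> b) *\<^sub>R z b (s, x)) has_vector_derivative
          dd F (\<theta> (s, x)) (\<Sum>b\<in>Basis. (w \<bullet> b) *\<^sub>R z b (s, x))) (at s)" by simp
    qed auto
    show ?case
    proof (rule Ck_on_SucI_partials[OF _ _ ode dx])
      show "Ck_on k (?J \<times> ?B) (\<lambda>p. F (\<theta> p))" by (rule Ck_on_compose[OF opn U Suc Fk \<theta>U])
    qed (use zk in auto)
  qed
  then show ?thesis
    using that[of e r \<theta>] e r \<theta>0 ode inK q unfolding smooth_on_def by blast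
qed

section \<open>Self-adjoint endomorphisms with a cyclic vector\<close>

definition cyclic_for :: "('a::euclidean_space \<Rightarrow> 'a) \<Rightarrow> 'a \<Rightarrow> bool" where
  "cyclic_for L v \<longleftrightarrow> span (range (\<lambda>k. (L ^^ k) v)) = UNIV"

lemma linear_funpow: "linear L \<Longrightarrow> linear (L ^^ k)" for L :: "'a::real_vector \<Rightarrow> 'a"
proof (induction k)
  case 0
  then show ?case by (simp add: linear_id[unfolded id_def] id_def)
next
  case (Suc k)
  then show ?case using linear_compose[of "L ^^ k" L] by (simp add: comp_def)
qed

lemma cyclic_eq_0:
  assumes v: "cyclic_for L v" and S: "linear S" and "\<And>k. S ((L ^^ k) v) = 0"
  shows "S x = (0 :: 'b::real_vector)"
proof -
  have "x \<in> span (range (\<lambda>k. (L ^^ k) v))" using v by (simp add: cyclic_for_def)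
  then show ?thesis
    by (rule linear_eq_0_on_span[OF S, rotated]) (use assms(3) in auto)
qed

lemma commute_funpow: "(\<And>x. S (L x) = L (S x)) \<Longrightarrow> S ((L ^^ k) x) = (L ^^ k) (S x)"
  by (induction k) auto

lemma cyclic_commute_eq_0:
  assumes v: "cyclic_for L v" and L: "linear L" and S: "linear S"
    and c: "\<And>x. S (L x) = L (S x)" and 0: "S v = 0"
  shows "S x = 0"
  by (rule cyclic_eq_0[OF v S]) (simp add: commute_funpow[of S L, OF c] 0 linear_0[OF linear_funpow[OF L]])

text \<open>Once \<open>(L ^^ m) v\<close> depends on the earlier powers, their span is invariant
  under \<open>L\<close> and contains the whole Krylov space.\<close>

lemma krylov_dim:
  assumes v: "cyclic_for L (v::'a::euclidean_space)" and L: "linear L"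
    and m: "(L ^^ m) v \<in> span ((\<lambda>j. (L ^^ j) v) ` {..<m})"
  shows "DIM('a) \<le> m"
proof -
  let ?W = "span ((\<lambda>j. (L ^^ j) v) ` {..<m})"
  have inv: "L x \<in> ?W" if "x \<in> ?W" for x
  proof -
    have "L x \<in> span (L ` (\<lambda>j. (L ^^ j) v) ` {..<m})"
      using that linear_span_image[OF L] by blast
    moreover have "L ((L ^^ j) v) \<in> ?W" if "j < m" for j
    proof (cases "Suc j = m")
      case True
      then show ?thesis using m by (simp flip: True)
    next
      case False
      then have "(L ^^ Suc j) v \<in> ?W" using that by (intro span_base image_eqI[of _ _ "Suc j"]) auto
      then show ?thesis by simp
    qed
    then have "L ` (\<lambda>j. (L ^^ j) v) ` {..<m} \<subseteq> ?W" by auto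
    ultimately show ?thesis using span_mono span_span by blast
  qed
  have "(L ^^ k) v \<in> ?W" for k
  proof (induction k)
    case 0
    show ?case
    proof (cases "m = 0")
      case False
      then show ?thesis by (intro span_base image_eqI[of _ _ 0]) auto
    qed (use m in simp)
  next
    case (Suc k)
    then show ?case using inv by simp
  qed
  then have "span (range (\<lambda>k. (L ^^ k) v)) \<subseteq> ?W" by (metis image_subsetI span_minimal subspace_span)
  then have "?W = UNIV" using v by (auto simp: cyclic_for_def)
  then have "DIM('a) = dim ?W" by (metis dim_UNIV)
  also have "\<dots> \<le> card ((\<lambda>j. (L ^^ j) v) ` {..<m})" by (simp add: dim_le_card')
  also have "\<dots> \<le> m" using card_image_le[of "{..<m}" "\<lambda>j. (L ^^ j) v"] by simp
  finally show ?thesis .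
qed

lemma krylov_independent:
  assumes v: "cyclic_for L (v::'a::euclidean_space)" and L: "linear L"
  shows "m \<le> DIM('a) \<Longrightarrow> (\<Sum>j<m. c j *\<^sub>R (L ^^ j) v) = 0 \<Longrightarrow> j < m \<Longrightarrow> c j = 0"
proof (induction m)
  case (Suc m)
  have "c m = 0"
  proof (rule ccontr)
    assume cm: "c m \<noteq> 0"
    have "(L ^^ m) v = (\<Sum>j<m. (- c j / c m) *\<^sub>R (L ^^ j) v)"
    proof -
      have "c m *\<^sub>R (L ^^ m) v = - (\<Sum>j<m. c j *\<^sub>R (L ^^ j) v)"
        using Suc.prems(2) by (simp add: eq_neg_iff_add_eq_0 add.commute)
      then have "(1 / c m) *\<^sub>R (c m *\<^sub>R (L ^^ m) v) = (1 / c m) *\<^sub>R (- (\<Sum>j<m. c j *\<^sub>R (L ^^ j) v))" by simp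
      then show ?thesis using cm
        by (simp add: scaleR_sum_right sum_negf[symmetric] del: sum_negf)
    qed
    also have "\<dots> \<in> span ((\<lambda>j. (L ^^ j) v) ` {..<m})"
      by (intro span_sum span_scale span_base) auto
    finally show False using krylov_dim[OF v L] Suc.prems(1) by force
  qed
  then show ?case using Suc by (cases "j = m") auto
qed simp

lemma krylov4:
  assumes v: "cyclic_for L (v::'a::euclidean_space)" and L: "linear L" and d: "4 \<le> DIM('a)"
    and "a *\<^sub>R v + b *\<^sub>R L v + c *\<^sub>R L (L v) + d *\<^sub>R L (L (L v)) = 0"
  shows "a = 0 \<and> b = 0 \<and> c = 0 \<and> d = 0"
proof -
  define f where "f = (\<lambda>j::nat. if j = 0 then a else if j = 1 then b else if j = 2 then c else d)"
  have "(\<Sum>j<4. f j *\<^sub>R (L ^^ j) v) = 0"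
    using assms(4) by (simp add: f_def eval_nat_numeral algebra_simps)
  from krylov_independent[OF v L assms(3) this]
  have "f 0 = 0" "f 1 = 0" "f 2 = 0" "f 3 = 0" by auto
  then show ?thesis by (simp add: f_def)
qed

lemma separating_vector:
  fixes x :: "'a::euclidean_space"
  assumes "x \<notin> span S"
  obtains z where "z \<bullet> x = 1" "\<And>y. y \<in> span S \<Longrightarrow> z \<bullet> y = 0"
proof -
  obtain y z where yz: "y \<in> span S" "\<And>w. w \<in> span S \<Longrightarrow> orthogonal z w" "x = y + z"
    using orthogonal_subspace_decomp_exists[of S x] by blast
  have "z \<noteq> 0" using assms yz by auto
  then have zz: "z \<bullet> z \<noteq> 0" by simp
  show ?thesis
  proof (rule that[of "(1 / (z \<bullet> z)) *\<^sub>R z"])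
    show "((1 / (z \<bullet> z)) *\<^sub>R z) \<bullet> x = 1"
      using yz zz by (auto simp: inner_add_right orthogonal_def)
    show "((1 / (z \<bullet> z)) *\<^sub>R z) \<bullet> y = 0" if "y \<in> span S" for y
      using yz(2)[OF that] by (simp add: orthogonal_def)
  qed
qed

lemma span_2: "x \<in> span {u, w} \<longleftrightarrow> (\<exists>a b. x = a *\<^sub>R u + b *\<^sub>R w)" for x :: "'a::real_vector"
proof
  assume "x \<in> span {u, w}"
  then obtain a where "x - a *\<^sub>R u \<in> span {w}" using span_breakdown_eq by blast
  then obtain b where "x - a *\<^sub>R u - b *\<^sub>R w \<in> span {}" using span_breakdown_eq by blast
  then show "\<exists>a b. x = a *\<^sub>R u + b *\<^sub>R w"
    by (intro exI[of _ a] exI[of _ b]) (simp add: algebra_simps)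
next
  have "u \<in> span {u, w}" "w \<in> span {u, w}" by (auto intro: span_base)
  then show "\<exists>a b. x = a *\<^sub>R u + b *\<^sub>R w \<Longrightarrow> x \<in> span {u, w}" by (auto intro: span_add span_scale)
qed

text \<open>Each basis vector \<open>i\<close> is the value at \<open>v\<close> of a polynomial
  \<open>Q i\<close> in \<open>L\<close>. For \<open>u\<close> near \<open>v\<close> the map sending
  \<open>i\<close> to \<open>Q i u\<close> is a small perturbation of the identity, hence onto, and
  its range lies in the Krylov space of \<open>u\<close>.\<close>

lemma cyclic_open:
  assumes v: "cyclic_for L (v::'a::euclidean_space)" and L: "linear L"
  obtains d where "d > 0" "\<And>u. norm (u - v) < d \<Longrightarrow> cyclic_for L u"
proof -
  have ex: "\<exists>Q. linear Q \<and> Q v = i \<and> (\<forall>u. Q u \<in> span (range (\<lambda>k. (L ^^ k) u)))" for i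
  proof -
    have "i \<in> span (range (\<lambda>k. (L ^^ k) v))" using v by (simp add: cyclic_for_def)
    then obtain t r where tr: "finite t" "t \<subseteq> range (\<lambda>k. (L ^^ k) v)" "i = (\<Sum>a\<in>t. r a *\<^sub>R a)"
      unfolding span_explicit by blast
    define k where "k a = (SOME k. a = (L ^^ k) v)" for a
    have k: "(L ^^ k a) v = a" if "a \<in> t" for a
    proof -
      have "\<exists>k. a = (L ^^ k) v" using tr(2) that by auto
      from someI_ex[OF this, folded k_def] show ?thesis by simp
    qed
    define Q where "Q u = (\<Sum>a\<in>t. r a *\<^sub>R (L ^^ k a) u)" for u
    have "linear Q" unfolding Q_def
      by (intro linear_compose_sum ballI linear_compose_scale_right linear_funpow L)
    moreover have "Q v = i" unfolding Q_def tr(3) by (rule sum.cong) (simp_all add: k)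
    moreover have "Q u \<in> span (range (\<lambda>k. (L ^^ k) u))" for u
      unfolding Q_def by (intro span_sum span_scale span_base) auto
    ultimately show ?thesis by blast
  qed
  define Q where "Q i = (SOME Q. linear Q \<and> Q v = i \<and> (\<forall>u. Q u \<in> span (range (\<lambda>k. (L ^^ k) u))))" for i
  have Q: "linear (Q i)" "Q i v = i" "Q i u \<in> span (range (\<lambda>k. (L ^^ k) u))" for i u
    using someI_ex[OF ex[of i], folded Q_def] by auto
  \<comment> \<open>\<open>C * norm (v - u)\<close> dominates the operator norm of the perturbation;
    the summand 1 keeps \<open>C\<close> positive.\<close>
  define C where "C = (\<Sum>i\<in>Basis. onorm (Q i)) + 1"
  have on: "0 \<le> onorm (Q i)" for i
    using Q(1) by (intro onorm_pos_le) (simp add: linear_conv_bounded_linear)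
  have C: "C > 0" by (simp add: C_def add_nonneg_pos sum_nonneg on)
  show ?thesis
  proof (rule that[of "1 / C"])
    fix u assume u: "norm (u - v) < 1 / C"
    define T where "T x = (\<Sum>i\<in>Basis. (x \<bullet> i) *\<^sub>R Q i u)" for x
    have linT: "linear T" unfolding T_def
      by (intro linear_compose_sum ballI) (simp add: linear_iff algebra_simps inner_add_left)
    have "x = 0" if "T x = 0" for x
    proof (rule ccontr)
      assume x: "x \<noteq> 0"
      have "x - T x = (\<Sum>i\<in>Basis. (x \<bullet> i) *\<^sub>R Q i (v - u))"
        unfolding T_def by (simp add: linear_diff[OF Q(1)] Q(2) scaleR_diff_right sum_subtractf euclidean_representation)
      also have "norm \<dots> \<le> (\<Sum>i\<in>Basis. norm x * (onorm (Q i) * norm (v - u)))"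
        by (rule sum_norm_le) (use Q(1) in \<open>auto intro!: mult_mono Basis_le_norm onorm simp: linear_conv_bounded_linear\<close>)
      also have "\<dots> = norm x * (norm (v - u) * (\<Sum>i\<in>Basis. onorm (Q i)))"
        by (simp add: sum_distrib_left sum_distrib_right algebra_simps)
      also have "\<dots> \<le> norm x * (norm (v - u) * C)"
        by (intro mult_left_mono) (auto simp: C_def)
      also have "\<dots> < norm x * 1"
        using u C x by (intro mult_strict_left_mono) (auto simp: norm_minus_commute divide_simps split: if_splits)
      finally show False using that by simp
    qed
    then have "inj T" using linT by (simp add: linear_injective_0)
    then have "surj T" using linT linear_injective_imp_surjective by blast
    moreover have "T x \<in> span (range (\<lambda>k. (L ^^ k) u))" for x
      unfolding T_def by (intro span_sum span_scale Q(3))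
    ultimately show "cyclic_for L u" unfolding cyclic_for_def by (metis UNIV_eq_I surjD)
  qed (use C in simp)
qed

text \<open>If \<open>K\<close> kills \<open>v\<close> and maps every cyclic \<open>u\<close> into the plane of \<open>u, L u\<close>, then for \<open>w\<close> near \<open>L\<^sup>2 v\<close>
  the vector \<open>K w\<close> lies in two planes (through \<open>v + t w\<close> for two values of \<open>t\<close>) meeting only in \<open>0\<close>.\<close>

lemma local_linear_dependence:
  assumes v: "cyclic_for L (v::'a::euclidean_space)" and L: "linear L" and T: "linear T" and dim: "4 \<le> DIM('a)"
    and loc: "\<And>u. cyclic_for L u \<Longrightarrow> T u \<in> span {u, L u}"
  obtains a b where "\<And>x. T x = a *\<^sub>R x + b *\<^sub>R L x"
proof -
  obtain a b where ab: "T v = a *\<^sub>R v + b *\<^sub>R L v" using loc[OF v] by (auto simp: span_2)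
  define K where "K x = T x - a *\<^sub>R x - b *\<^sub>R L x" for x
  have K: "linear K" unfolding K_def
    by (intro linear_compose_sub linear_compose_scale_right T L linear_ident)
  have Kv: "K v = 0" by (simp add: K_def ab)
  have Kloc: "\<exists>p q. K u = p *\<^sub>R u + q *\<^sub>R L u" if u: "cyclic_for L u" for u
  proof -
    obtain p q where "T u = p *\<^sub>R u + q *\<^sub>R L u" using loc[OF u] by (auto simp: span_2)
    then have "K u = (p - a) *\<^sub>R u + (q - b) *\<^sub>R L u" by (simp add: K_def algebra_simps)
    then show ?thesis by blast
  qed
  obtain d where d: "d > 0" "\<And>u. norm (u - v) < d \<Longrightarrow> cyclic_for L u" using cyclic_open[OF v L] by blast
  have key: "K w = 0" if ind: "\<And>c0 c1 c2 c3. c0 *\<^sub>R v + c1 *\<^sub>R L v + c2 *\<^sub>R w + c3 *\<^sub>R L w = 0 \<Longrightarrow> c2 = 0 \<and> c3 = 0" for w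
  proof -
    define t where "t = d / (norm w + 1) / 2"
    have nw: "norm w + 1 > 0" by (simp add: add_nonneg_pos)
    have t: "t > 0" using d nw by (simp add: t_def)
    have tn: "t * norm w < d"
    proof -
      have "t * norm w \<le> t * (norm w + 1)" using t by simp
      also have "\<dots> = d / 2" unfolding t_def using nw by (simp add: divide_simps)
      finally show ?thesis using d by simp
    qed
    have "cyclic_for L (v + s *\<^sub>R w)" if "0 < s" "s \<le> t" for s
    proof (rule d(2))
      have "s * norm w \<le> t * norm w" using that by (intro mult_right_mono) auto
      then show "norm (v + s *\<^sub>R w - v) < d" using tn that by simp
    qed
    from Kloc[OF this[of t]] Kloc[OF this[of "t/2"]] t
    obtain p q p' q' where 1: "K (v + t *\<^sub>R w) = p *\<^sub>R (v + t *\<^sub>R w) + q *\<^sub>R L (v + t *\<^sub>R w)"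
      and 2: "K (v + (t/2) *\<^sub>R w) = p' *\<^sub>R (v + (t/2) *\<^sub>R w) + q' *\<^sub>R L (v + (t/2) *\<^sub>R w)" by auto
    have L1: "L (v + s *\<^sub>R w) = L v + s *\<^sub>R L w" and K1: "K (v + s *\<^sub>R w) = s *\<^sub>R K w" for s
      by (simp_all add: linear_add[OF L] linear_scale[OF L] linear_add[OF K] linear_scale[OF K] Kv)
    have "K (v + t *\<^sub>R w) = 2 *\<^sub>R K (v + (t/2) *\<^sub>R w)" by (simp add: K1)
    then have eq: "(p - 2 * p') *\<^sub>R v + (q - 2 * q') *\<^sub>R L v + (t * (p - p')) *\<^sub>R w + (t * (q - q')) *\<^sub>R L w = 0"
      unfolding 1 2 L1 by (simp add: algebra_simps)
    from ind[OF eq] t have pq: "p' = p" "q' = q" by auto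
    have "(- p) *\<^sub>R v + (- q) *\<^sub>R L v + 0 *\<^sub>R L (L v) + 0 *\<^sub>R L (L (L v)) = 0"
      using eq unfolding pq by (simp add: algebra_simps)
    from krylov4[OF v L dim this] have "p = 0" "q = 0" by auto
    then show ?thesis using 1 K1[of t] t by simp
  qed
  have nsp: "L (L v) \<notin> span {v, L v, L (L (L v))}" "L (L (L v)) \<notin> span {v, L v, L (L v)}"
  proof -
    show "L (L v) \<notin> span {v, L v, L (L (L v))}"
    proof
      assume "L (L v) \<in> span {v, L v, L (L (L v))}"
      then obtain c where "L (L v) - c *\<^sub>R v \<in> span {L v, L (L (L v))}" using span_breakdown_eq by blast
      then obtain e f where "L (L v) - c *\<^sub>R v = e *\<^sub>R L v + f *\<^sub>R L (L (L v))" by (auto simp: span_2)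
      then have "(-c) *\<^sub>R v + (-e) *\<^sub>R L v + 1 *\<^sub>R L (L v) + (-f) *\<^sub>R L (L (L v)) = 0" by (simp add: algebra_simps)
      from krylov4[OF v L dim this] show False by simp
    qed
    show "L (L (L v)) \<notin> span {v, L v, L (L v)}"
    proof
      assume "L (L (L v)) \<in> span {v, L v, L (L v)}"
      then obtain c where "L (L (L v)) - c *\<^sub>R v \<in> span {L v, L (L v)}" using span_breakdown_eq by blast
      then obtain e f where "L (L (L v)) - c *\<^sub>R v = e *\<^sub>R L v + f *\<^sub>R L (L v)" by (auto simp: span_2)
      then have "(-c) *\<^sub>R v + (-e) *\<^sub>R L v + (-f) *\<^sub>R L (L v) + 1 *\<^sub>R L (L (L v)) = 0" by (simp add: algebra_simps)
      from krylov4[OF v L dim this] show False by simp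
    qed
  qed
  \<comment> \<open>Functionals dual to \<open>L (L v)\<close> and \<open>L (L (L v))\<close>: they
    read off the coefficients \<open>c2\<close> and \<open>c3\<close> below, up to terms that are
    small with \<open>r\<close>.\<close>
  obtain z2 where z2: "z2 \<bullet> L (L v) = 1" "\<And>y. y \<in> span {v, L v, L (L (L v))} \<Longrightarrow> z2 \<bullet> y = 0"
    using separating_vector[OF nsp(1)] by blast
  obtain z3 where z3: "z3 \<bullet> L (L (L v)) = 1" "\<And>y. y \<in> span {v, L v, L (L v)} \<Longrightarrow> z3 \<bullet> y = 0"
    using separating_vector[OF nsp(2)] by blast
  have zv: "z2 \<bullet> v = 0" "z2 \<bullet> L v = 0" "z2 \<bullet> L (L (L v)) = 0" "z3 \<bullet> v = 0" "z3 \<bullet> L v = 0" "z3 \<bullet> L (L v) = 0"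
    by (auto intro!: z2(2) z3(2) span_base)
  have "K w = 0" for w
  proof -
    define N where "N = \<bar>z2 \<bullet> w\<bar> + \<bar>z2 \<bullet> L w\<bar> + \<bar>z3 \<bullet> w\<bar> + \<bar>z3 \<bullet> L w\<bar> + 1"
    have N: "N > 0" by (simp add: N_def add_nonneg_pos)
    \<comment> \<open>The independence required by \<open>key\<close> holds at
      \<open>L (L v)\<close> and survives a small step in any direction \<open>w\<close>; linearity
      of \<open>K\<close> then isolates \<open>K w\<close>.\<close>
    have "K (L (L v) + r *\<^sub>R w) = 0" if r: "0 \<le> r" "r * N \<le> 1/3" for r
    proof (rule key)
      fix c0 c1 c2 c3
      assume 0: "c0 *\<^sub>R v + c1 *\<^sub>R L v + c2 *\<^sub>R (L (L v) + r *\<^sub>R w) + c3 *\<^sub>R L (L (L v) + r *\<^sub>R w) = 0"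
      have e2: "c2 + c2 * (r * (z2 \<bullet> w)) + c3 * (r * (z2 \<bullet> L w)) = 0"
        using arg_cong[OF 0, of "\<lambda>y. z2 \<bullet> y"]
        by (simp add: inner_add_right z2(1) zv linear_add[OF L] linear_scale[OF L] algebra_simps)
      have e3: "c3 + c2 * (r * (z3 \<bullet> w)) + c3 * (r * (z3 \<bullet> L w)) = 0"
        using arg_cong[OF 0, of "\<lambda>y. z3 \<bullet> y"]
        by (simp add: inner_add_right z3(1) zv linear_add[OF L] linear_scale[OF L] algebra_simps)
      have sm: "\<bar>c * (r * s)\<bar> \<le> \<bar>c\<bar> / 3" if "\<bar>s\<bar> \<le> N" for c s
      proof -
        have "r * \<bar>s\<bar> \<le> r * N" using r that by (intro mult_left_mono) auto
        then have "r * \<bar>s\<bar> \<le> 1/3" using r by simp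
        then have "\<bar>c\<bar> * (r * \<bar>s\<bar>) \<le> \<bar>c\<bar> * (1/3)" by (intro mult_left_mono) auto
        then show ?thesis using r by (simp add: abs_mult)
      qed
      have "\<bar>c2\<bar> \<le> \<bar>c2\<bar> / 3 + \<bar>c3\<bar> / 3" "\<bar>c3\<bar> \<le> \<bar>c2\<bar> / 3 + \<bar>c3\<bar> / 3"
      proof -
        have n: "\<bar>z2 \<bullet> w\<bar> \<le> N" "\<bar>z2 \<bullet> L w\<bar> \<le> N" "\<bar>z3 \<bullet> w\<bar> \<le> N" "\<bar>z3 \<bullet> L w\<bar> \<le> N"
          by (simp_all add: N_def)
        show "\<bar>c2\<bar> \<le> \<bar>c2\<bar> / 3 + \<bar>c3\<bar> / 3"
          using e2 sm[OF n(1), of c2] sm[OF n(2), of c3] by arith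
        show "\<bar>c3\<bar> \<le> \<bar>c2\<bar> / 3 + \<bar>c3\<bar> / 3"
          using e3 sm[OF n(3), of c2] sm[OF n(4), of c3] by arith
      qed
      then show "c2 = 0 \<and> c3 = 0" by linarith
    qed
    from this[of 0] this[of "1 / (3 * N)"] N
    have "K (L (L v)) = 0" "K (L (L v) + (1 / (3 * N)) *\<^sub>R w) = 0" by auto
    then show "K w = 0" using N by (simp add: linear_add[OF K] linear_scale[OF K])
  qed
  then show ?thesis using that[of a b] by (simp add: K_def algebra_simps)
qed

text \<open>A nonzero \<open>a L + b\<close> is injective on the span of \<open>v\<close>,
  \<open>L v\<close>, \<open>L (L v)\<close>, because its values there are combinations of the first
  four Krylov vectors, which are independent. So its rank is at least three and its range cannot fit
  into a plane.\<close>

lemma plane_range_eq_0: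
  assumes v: "cyclic_for L (v::'a::euclidean_space)" and L: "linear L" and dim: "4 \<le> DIM('a)"
    and r: "\<And>x. a *\<^sub>R L x + b *\<^sub>R x \<in> span {p, q}"
  shows "a = 0 \<and> b = 0"
proof (rule ccontr)
  assume ab: "\<not> (a = 0 \<and> b = 0)"
  define T where "T x = a *\<^sub>R L x + b *\<^sub>R x" for x
  have T: "linear T" unfolding T_def
    by (intro linear_compose_add linear_compose_scale_right L linear_ident)
  let ?S = "{v, L v, L (L v)}"
  have dep: "\<alpha> = 0 \<and> \<beta> = 0 \<and> \<gamma> = 0" if "\<alpha> *\<^sub>R v + \<beta> *\<^sub>R L v + \<gamma> *\<^sub>R L (L v) = 0" for \<alpha> \<beta> \<gamma>
    using krylov4[OF v L dim, of \<alpha> \<beta> \<gamma> 0] that by simp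
  have d1: "v \<noteq> L v" using dep[of 1 "-1" 0] by auto
  have d2: "v \<noteq> L (L v)" using dep[of 1 0 "-1"] by auto
  have d3: "L v \<noteq> L (L v)" using dep[of 0 1 "-1"] by auto
  have indep: "independent ?S"
  proof (rule independent_if_scalars_zero)
    fix f x assume 0: "(\<Sum>x\<in>?S. f x *\<^sub>R x) = 0" and x: "x \<in> ?S"
    from 0 have "f v *\<^sub>R v + f (L v) *\<^sub>R L v + f (L (L v)) *\<^sub>R L (L v) = 0"
      using d1 d2 d3 by (simp add: add.assoc)
    from dep[OF this] x show "f x = 0" by auto
  qed simp
  have span3: "\<exists>\<alpha> \<beta> \<gamma>. x = \<alpha> *\<^sub>R v + \<beta> *\<^sub>R L v + \<gamma> *\<^sub>R L (L v)" if x: "x \<in> span ?S" for x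
  proof -
    from x obtain \<alpha> where "x - \<alpha> *\<^sub>R v \<in> span {L v, L (L v)}" using span_breakdown_eq by blast
    then obtain \<beta> \<gamma> where "x - \<alpha> *\<^sub>R v = \<beta> *\<^sub>R L v + \<gamma> *\<^sub>R L (L v)" by (auto simp: span_2)
    then show ?thesis by (metis add.assoc add.commute diff_add_cancel)
  qed
  have "inj_on T (span ?S)"
  proof (rule inj_onI)
    fix x y assume "x \<in> span ?S" "y \<in> span ?S" and e: "T x = T y"
    then have "x - y \<in> span ?S" by (intro span_diff)
    then obtain \<alpha> \<beta> \<gamma> where xy: "x - y = \<alpha> *\<^sub>R v + \<beta> *\<^sub>R L v + \<gamma> *\<^sub>R L (L v)" using span3 by blast
    have "T (x - y) = 0" using e by (simp add: linear_diff[OF T])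
    then have "(b * \<alpha>) *\<^sub>R v + (a * \<alpha> + b * \<beta>) *\<^sub>R L v + (a * \<beta> + b * \<gamma>) *\<^sub>R L (L v) + (a * \<gamma>) *\<^sub>R L (L (L v)) = 0"
      unfolding xy T_def by (simp add: linear_add[OF L] linear_scale[OF L] algebra_simps)
    from krylov4[OF v L dim this] ab have "\<alpha> = 0 \<and> \<beta> = 0 \<and> \<gamma> = 0" by (cases "a = 0") auto
    then show "x = y" using xy by simp
  qed
  then have "dim (T ` ?S) = dim ?S" using T by (rule dim_image_eq[rotated])
  also have "\<dots> = 3" using indep d1 d2 d3 by (simp add: dim_eq_card_independent)
  finally have "dim (T ` ?S) = 3" .
  moreover have "dim (T ` ?S) \<le> dim {p, q}"
    by (rule dim_mono) (use r in \<open>auto simp: T_def\<close>) 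
  moreover have "dim {p, q} \<le> card {p, q}" by (rule dim_le_card') simp
  moreover have "card {p, q} \<le> 2" by (simp add: card_insert_if)
  ultimately show False by linarith
qed

section \<open>Curvature with a self-adjoint cyclic endomorphism\<close>

definition trace_of :: "('a::euclidean_space \<Rightarrow> 'a) \<Rightarrow> real" where
  "trace_of f = (\<Sum>i\<in>Basis. f i \<bullet> i)"

lemma diff_eq_flip: "a - b = c \<Longrightarrow> b = a - (c::'v::ab_group_add)"
  by auto

lemma linear_basis_expansion:
  fixes x :: "'a::euclidean_space"
  assumes "linear f" shows "f x = (\<Sum>j\<in>Basis. (x \<bullet> j) *\<^sub>R f j)"
  using linear_sum[OF assms, of "\<lambda>b. (x \<bullet> b) *\<^sub>R b" Basis] linear_scale[OF assms]
  by (simp add: euclidean_representation)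

lemma trace_of_commute:
  fixes f g :: "'a::euclidean_space \<Rightarrow> 'a"
  assumes f: "linear f" and g: "linear g"
  shows "trace_of (\<lambda>x. f (g x)) = trace_of (\<lambda>x. g (f x))"
proof -
  have *: "trace_of (\<lambda>x. f (g x)) = (\<Sum>i\<in>Basis. \<Sum>j\<in>Basis. (g i \<bullet> j) * (f j \<bullet> i))" if "linear f" for f g :: "'a \<Rightarrow> 'a"
    unfolding trace_of_def
    by (rule sum.cong[OF refl], subst linear_basis_expansion[OF that]) (simp add: inner_sum_left)
  show ?thesis unfolding *[OF f] *[OF g] by (subst sum.swap) (simp add: mult.commute)
qed

locale nondeg_form =
  fixes g :: "'a::euclidean_space \<Rightarrow> 'a \<Rightarrow> real"
  assumes bil: "bilinear g" and sym: "g x y = g y x" and nondeg: "(\<And>y. g x y = 0) \<Longrightarrow> x = 0"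
begin

lemma g_linear_right: "linear (g x)" and g_linear_left: "linear (\<lambda>x. g x y)"
  using bil by (auto simp: bilinear_def)

lemmas g_simps = bilinear_ladd[OF bil] bilinear_radd[OF bil] bilinear_lmul[OF bil] bilinear_rmul[OF bil]
  bilinear_lneg[OF bil] bilinear_rneg[OF bil] bilinear_lzero[OF bil] bilinear_rzero[OF bil]
  bilinear_lsub[OF bil] bilinear_rsub[OF bil]

lemma g_eqI: "(\<And>z. g x z = g y z) \<Longrightarrow> x = y"
  using nondeg[of "x - y"] by (simp add: g_simps)

lemma riesz:
  assumes f: "linear (f :: 'a \<Rightarrow> real)"
  obtains z where "\<And>v. g z v = f v"
proof -
  define \<Phi> where "\<Phi> x = (\<Sum>b\<in>Basis. g x b *\<^sub>R b)" for x
  have lin: "linear \<Phi>" unfolding \<Phi>_def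
    by (intro linear_compose_sum ballI) (simp add: linear_iff g_simps algebra_simps)
  have "\<Phi> x \<bullet> b = g x b" if "b \<in> Basis" for x b using that by (simp add: \<Phi>_def inner_sum_left_Basis)
  have "inj \<Phi>" unfolding linear_injective_0[OF lin]
  proof (intro allI impI)
    fix x assume 0: "\<Phi> x = 0"
    show "x = 0"
    proof (rule nondeg)
      fix y
      have "g x b = 0" if "b \<in> Basis" for b
        using arg_cong[OF 0, of "\<lambda>u. u \<bullet> b"] that by (simp add: \<Phi>_def inner_sum_left_Basis)
      then show "g x y = 0" using linear_basis_expansion[OF g_linear_right, of x y] by simp
    qed
  qed
  then obtain z where z: "\<Phi> z = (\<Sum>b\<in>Basis. f b *\<^sub>R b)"
    using linear_injective_imp_surjective[OF lin] by (metis surjD)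
  have "g z b = f b" if "b \<in> Basis" for b
    using arg_cong[OF z, of "\<lambda>u. u \<bullet> b"] that by (simp add: \<Phi>_def inner_sum_left_Basis)
  then have "g z v = f v" for v
    using linear_basis_expansion[OF g_linear_right, of z v] linear_basis_expansion[OF f, of v] by simp
  then show ?thesis using that by blast
qed

text \<open>Moving \<open>S\<close> and the power of \<open>L\<close> across the form shows that
  \<open>g (S v) ((L ^^ k) v)\<close> equals its own negative. So \<open>S v\<close> is orthogonal
  to all Krylov vectors and vanishes; commutation spreads this from \<open>v\<close> to the whole
  space.\<close>

lemma skew_commuting_eq_0:
  assumes v: "cyclic_for L v" and L: "linear L" "\<And>x y. g (L x) y = g x (L y)"
    and S: "linear S" "\<And>x y. g (S x) y = - g x (S y)" and c: "\<And>x. S (L x) = L (S x)"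
  shows "S x = 0"
proof (rule cyclic_commute_eq_0[OF v L(1) S(1) c])
  have Lk: "g ((L ^^ k) x) y = g x ((L ^^ k) y)" for k x y
    by (induction k arbitrary: x y) (auto simp: L(2) funpow_swap1)
  have "g (S v) ((L ^^ k) v) = 0" for k
    using S(2)[of "(L ^^ k) v" v] commute_funpow[of S L k v, OF c] Lk[of k "S v" v] Lk[of k v "S v"]
      sym[of "(L ^^ k) v" "S v"] by simp
  then have "g (S v) y = 0" for y
    by (rule cyclic_eq_0[OF v g_linear_right])
  then show "S v = 0" by (rule nondeg)
qed

lemma trace_rank_one: "trace_of (\<lambda>v. g a v *\<^sub>R b) = g a b"
proof -
  have "g a b = (\<Sum>i\<in>Basis. (b \<bullet> i) * g a i)" using linear_basis_expansion[OF g_linear_right, of a b] by simp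
  then show ?thesis by (simp add: trace_of_def mult.commute)
qed

end

text \<open>The situation at one point: \<open>L\<close> and \<open>\<Lambda>\<close> are the
  endomorphisms belonging to \<open>h\<close> and to the Hessian of \<phi>, \<open>R\<close> is the
  curvature, and \<open>ric\<close> is the Ricci identity after inserting the Eisenhart
  equation.\<close>

locale cyclic_curvature = nondeg_form g for g :: "'a::euclidean_space \<Rightarrow> 'a \<Rightarrow> real" +
  fixes L \<Lambda> :: "'a \<Rightarrow> 'a" and R :: "'a \<Rightarrow> 'a \<Rightarrow> 'a \<Rightarrow> 'a" and v0 :: 'a
  assumes dim4: "4 \<le> DIM('a)" and cyc: "cyclic_for L v0"
    and L: "linear L" and Lsym: "g (L x) y = g x (L y)"
    and \<Lambda>: "linear \<Lambda>" and \<Lambda>sym: "g (\<Lambda> x) y = g x (\<Lambda> y)"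
    and R: "linear (R z u)" and Rskew: "g (R z u x) y = - g x (R z u y)"
    and ric: "g (L (R z u x)) w + g (L x) (R z u w) + g u w * g (\<Lambda> z) x - g z w * g (\<Lambda> u) x
      + g u x * g (\<Lambda> z) w - g z x * g (\<Lambda> u) w = 0"
begin

text \<open>The Ricci identity as a formula for the commutator of \<open>M\<close> with the
  curvature operator. The pair \<open>M\<close>, \<open>\<Theta>\<close> is general since a second
  solution shares \<open>R\<close> with the first.\<close>

lemma ric':
  fixes M \<Theta> :: "'a \<Rightarrow> 'a"
  assumes Msym: "\<And>x y. g (M x) y = g x (M y)"
    and r: "\<And>z u x w. g (M (R z u x)) w + g (M x) (R z u w) + g u w * g (\<Theta> z) x - g z w * g (\<Theta> u) x
      + g u x * g (\<Theta> z) w - g z x * g (\<Theta> u) w = 0"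
  shows "M (R z u x) - R z u (M x) =
    g z x *\<^sub>R \<Theta> u - g u x *\<^sub>R \<Theta> z + g (\<Theta> u) x *\<^sub>R z - g (\<Theta> z) x *\<^sub>R u"
  by (rule g_eqI) (use r[of z u x] Rskew[of z u "M x"] in \<open>simp add: g_simps algebra_simps\<close>)

lemmas ricL = ric'[OF Lsym ric]

text \<open>Multiply the commutator of \<open>L\<close> and \<open>R z u\<close> by \<open>L\<close>
  and take the trace: this vanishes by cyclicity of the trace, while the Ricci side is a sum of four
  rank one traces, which add up to twice the commutator of \<open>L\<close> and
  \<open>\<Lambda>\<close> paired with \<open>u\<close> and \<open>z\<close>.\<close>

lemma L_\<Lambda>_commute: "\<Lambda> (L u) = L (\<Lambda> u)"
proof (rule g_eqI)
  fix z
  have lin1: "linear (\<lambda>x. R z u (L x))" and lin2: "linear (\<lambda>x. L (R z u x))"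
    using linear_compose[OF L R[of z u]] linear_compose[OF R[of z u] L] by (simp_all add: o_def)
  have tadd: "trace_of (\<lambda>x. p x + q x) = trace_of p + trace_of q"
    and tsub: "trace_of (\<lambda>x. p x - q x) = trace_of p - trace_of q" for p q :: "'a \<Rightarrow> 'a"
    by (simp_all add: trace_of_def inner_add_left inner_diff_left sum.distrib sum_subtractf)
  have "trace_of (\<lambda>x. L (L (R z u x) - R z u (L x))) = trace_of (\<lambda>x. L (L (R z u x))) - trace_of (\<lambda>x. L (R z u (L x)))"
    by (simp add: linear_diff[OF L] tsub)
  also have "\<dots> = 0" using trace_of_commute[OF L lin2] by simp
  finally have "0 = trace_of (\<lambda>x. g z x *\<^sub>R L (\<Lambda> u) - g u x *\<^sub>R L (\<Lambda> z) + g (\<Lambda> u) x *\<^sub>R L z - g (\<Lambda> z) x *\<^sub>R L u)"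
    by (simp add: ricL linear_diff[OF L] linear_add[OF L] linear_scale[OF L])
  also have "\<dots> = g z (L (\<Lambda> u)) - g u (L (\<Lambda> z)) + g (\<Lambda> u) (L z) - g (\<Lambda> z) (L u)"
    by (simp add: tadd tsub trace_rank_one)
  also have "\<dots> = 2 * (g (L (\<Lambda> u)) z - g (\<Lambda> (L u)) z)"
  proof -
    have e1: "g z (L (\<Lambda> u)) = g (\<Lambda> u) (L z)" using sym[of z "L (\<Lambda> u)"] Lsym[of "\<Lambda> u" z] by (rule trans)
    have e2: "g u (L (\<Lambda> z)) = g (\<Lambda> z) (L u)" using sym[of u "L (\<Lambda> z)"] Lsym[of "\<Lambda> z" u] by (rule trans)
    have e4: "g (\<Lambda> (L u)) z = g (\<Lambda> z) (L u)" using \<Lambda>sym[of "L u" z] sym[of "L u" "\<Lambda> z"] by (rule trans)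
    show ?thesis unfolding e1 e2 e4 Lsym[of "\<Lambda> u" z] by simp
  qed
  finally show "g (\<Lambda> (L u)) z = g (L (\<Lambda> u)) z" by simp
qed

text \<open>For \<open>z = L u\<close> the right side of the commutator formula is itself a
  commutator with \<open>L\<close>, because \<open>\<Lambda>\<close> and \<open>L\<close> commute.
  The difference \<open>S\<close> of the two operators is then skew and commutes with
  \<open>L\<close>, so it is zero.\<close>

lemma R_bivector: "R (L u) u x = g (\<Lambda> u) x *\<^sub>R u - g u x *\<^sub>R \<Lambda> u"
proof -
  define S where "S x = R (L u) u x + g u x *\<^sub>R \<Lambda> u - g (\<Lambda> u) x *\<^sub>R u" for x
  have "S x = 0" for x
  proof (rule skew_commuting_eq_0[OF cyc L Lsym, where S=S])
    show "linear S" unfolding S_def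
      by (intro linear_compose_add linear_compose_sub R) (simp_all add: linear_iff g_simps algebra_simps)
    show "g (S x) y = - g x (S y)" for x y
      unfolding S_def using Rskew[of "L u" u x y] sym[of x u] sym[of x "\<Lambda> u"]
      by (simp add: g_simps)
    show "S (L x) = L (S x)" for x
    proof -
      have r: "R (L u) u (L x) = L (R (L u) u x) - (g u (L x) *\<^sub>R \<Lambda> u - g u x *\<^sub>R L (\<Lambda> u)
          + g (\<Lambda> u) x *\<^sub>R L u - g (\<Lambda> u) (L x) *\<^sub>R u)"
        using ricL[of "L u" u x] unfolding L_\<Lambda>_commute Lsym by (rule diff_eq_flip)
      show ?thesis unfolding S_def r linear_diff[OF L] linear_add[OF L] linear_scale[OF L] by simp
    qed
  qed
  from this[of x] show ?thesis by (simp add: S_def algebra_simps)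
qed

text \<open>The part \<open>a\<close> of \<open>\<Lambda>\<close> drops out of the commutator
  formula, and the part \<open>b L\<close> leaves the commutator of \<open>L\<close> with an
  operator of constant curvature form. The curvature differs from that operator by a skew one
  commuting with \<open>L\<close>.\<close>

lemma constant_type:
  assumes "\<And>x. \<Lambda> x = a *\<^sub>R x + b *\<^sub>R L x"
  shows "R z u x = (- b) *\<^sub>R (g u x *\<^sub>R z - g z x *\<^sub>R u)"
proof -
  define S where "S x = R z u x + b *\<^sub>R (g u x *\<^sub>R z - g z x *\<^sub>R u)" for x
  have "S x = 0" for x
  proof (rule skew_commuting_eq_0[OF cyc L Lsym, where S=S])
    show "linear S" unfolding S_def
      by (intro linear_compose_add R) (simp add: linear_iff g_simps algebra_simps)
    show "g (S x) y = - g x (S y)" for x y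
      unfolding S_def using Rskew[of z u x y] sym[of x u] sym[of x z]
      by (simp add: g_simps algebra_simps)
    show "S (L x) = L (S x)" for x
    proof -
      have "L (R z u x) - R z u (L x) =
          b *\<^sub>R (g z x *\<^sub>R L u - g u x *\<^sub>R L z + g u (L x) *\<^sub>R z - g z (L x) *\<^sub>R u)"
        unfolding ricL assms g_simps Lsym by (simp add: algebra_simps)
      then have r: "R z u (L x) = L (R z u x) -
          b *\<^sub>R (g z x *\<^sub>R L u - g u x *\<^sub>R L z + g u (L x) *\<^sub>R z - g z (L x) *\<^sub>R u)"
        by (rule diff_eq_flip)
      show ?thesis unfolding S_def r linear_diff[OF L] linear_add[OF L] linear_scale[OF L]
        by (simp add: algebra_simps)
    qed
  qed
  from this[of x] show ?thesis by (simp add: S_def algebra_simps)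
qed

text \<open>\<open>R_bivector\<close> makes the curvature explicit on the pairs
  \<open>(L u, u)\<close>, which turns the commutator formula of \<open>M\<close> into the vector
  identity \<open>star\<close>. It forces \<open>\<Lambda> u\<close> or \<open>M u\<close> into the
  plane of \<open>u\<close> and \<open>L u\<close>. One cyclic \<open>u\<close> of the first kind
  determines \<open>\<Lambda>\<close>, since \<open>\<Lambda>\<close> commutes with
  \<open>L\<close>; otherwise all cyclic \<open>u\<close> are of the second kind.\<close>

theorem second_solution:
  fixes M \<Theta> :: "'a \<Rightarrow> 'a"
  assumes M: "linear M" and Msym: "\<And>x y. g (M x) y = g x (M y)"
    and \<Theta>: "linear \<Theta>" and \<Theta>sym: "\<And>x y. g (\<Theta> x) y = g x (\<Theta> y)"
    and r: "\<And>z u x w. g (M (R z u x)) w + g (M x) (R z u w) + g u w * g (\<Theta> z) x - g z w * g (\<Theta> u) x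
      + g u x * g (\<Theta> z) w - g z x * g (\<Theta> u) w = 0"
  shows "(\<exists>a b. \<forall>x. \<Lambda> x = a *\<^sub>R x + b *\<^sub>R L x) \<or> (\<exists>a b. \<forall>x. M x = a *\<^sub>R x + b *\<^sub>R L x)"
proof -
  have star: "g (\<Lambda> u) v *\<^sub>R M u + g (M u) v *\<^sub>R \<Lambda> u - g (\<Theta> u) v *\<^sub>R L u - g (L u) v *\<^sub>R \<Theta> u
     = g u v *\<^sub>R (M (\<Lambda> u) - \<Theta> (L u)) + (g (M (\<Lambda> u)) v - g (\<Theta> (L u)) v) *\<^sub>R u" for u v
    using ric'[OF Msym r, of "L u" u v]
    unfolding R_bivector linear_diff[OF M] linear_scale[OF M] Msym by (simp add: algebra_simps)
  have alt: "\<Lambda> u \<in> span {u, L u} \<or> M u \<in> span {u, L u}" for u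
  proof (cases "\<Lambda> u \<in> span {u, L u}")
    case False
    then obtain z where z: "z \<bullet> \<Lambda> u = 1" "\<And>y. y \<in> span {u, L u} \<Longrightarrow> z \<bullet> y = 0"
      using separating_vector by blast
    have z0: "z \<bullet> u = 0" "z \<bullet> L u = 0" by (auto intro!: z(2) span_base)
    have "linear (\<lambda>x. z \<bullet> x)" by (simp add: bounded_linear.linear bounded_linear_inner_right)
    \<comment> \<open>Pairing with this \<open>v\<close> is the functional \<open>z\<close>, which
      kills \<open>u\<close> and \<open>L u\<close> and is 1 on \<open>\<Lambda> u\<close>;
      \<open>star\<close> is left with four terms.\<close>
    then obtain v where v: "\<And>x. g v x = z \<bullet> x" using riesz by blast
    have v': "g x v = z \<bullet> x" for x using v[of x] sym[of x v] by simp
    define c where "c = g (M (\<Lambda> u)) v - g (\<Theta> (L u)) v"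
    have eq: "M u + (z \<bullet> M u) *\<^sub>R \<Lambda> u - (z \<bullet> \<Theta> u) *\<^sub>R L u = c *\<^sub>R u"
      using star[of u v] by (simp add: v' z z0 c_def)
    \<comment> \<open>Applying \<open>z\<close> once more yields
      \<open>2 * (z \<bullet> M u) = 0\<close>.\<close>
    have "z \<bullet> M u = 0"
      using arg_cong[OF eq, of "\<lambda>x. z \<bullet> x"] by (simp add: inner_add_right inner_diff_right z z0)
    then have "M u = c *\<^sub>R u + (z \<bullet> \<Theta> u) *\<^sub>R L u" using eq by (simp add: algebra_simps)
    then show ?thesis by (auto simp: span_2)
  qed simp
  have const: "\<exists>a b. \<forall>x. \<Lambda> x = a *\<^sub>R x + b *\<^sub>R L x" if u: "cyclic_for L u" and u': "\<Lambda> u \<in> span {u, L u}" for u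
  proof -
    obtain a b where ab: "\<Lambda> u = a *\<^sub>R u + b *\<^sub>R L u" using u' by (auto simp: span_2)
    have "\<Lambda> x - a *\<^sub>R x - b *\<^sub>R L x = 0" for x
      by (rule cyclic_commute_eq_0[OF u L, where S="\<lambda>x. \<Lambda> x - a *\<^sub>R x - b *\<^sub>R L x"])
        (auto intro!: linear_compose_sub linear_compose_scale_right \<Lambda> L linear_ident
          simp: ab L_\<Lambda>_commute linear_diff[OF L] linear_scale[OF L])
    then show ?thesis by (intro exI[of _ a] exI[of _ b]) (simp add: algebra_simps)
  qed
  show ?thesis
  proof (cases "\<exists>a b. \<forall>x. \<Lambda> x = a *\<^sub>R x + b *\<^sub>R L x")
    case False
    have loc: "M u \<in> span {u, L u}" if u: "cyclic_for L u" for u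
      using alt[of u] const[OF u] False by blast
    obtain a b where "\<And>x. M x = a *\<^sub>R x + b *\<^sub>R L x"
      using local_linear_dependence[OF cyc L M dim4 loc] by blast
    then show ?thesis by blast
  qed simp
qed

end

section \<open>Cyclic vectors from distinct eigenvalues\<close>

definition cvec :: "real^'n \<Rightarrow> complex^'n" where "cvec x = (\<chi> i. complex_of_real (x $ i))"
definition cmat :: "real^'n^'m \<Rightarrow> complex^'n^'m" where "cmat A = (\<chi> i j. complex_of_real (A $ i $ j))"

text \<open>Records of the Jordan form just what the choice of a cyclic vector uses: finitely many
  complex eigenvalues, each with a one-dimensional eigenspace.\<close>

definition nonderogatory :: "real^'n^'n::finite \<Rightarrow> bool" where
  "nonderogatory A \<longleftrightarrow> finite {z. \<exists>x. x \<noteq> 0 \<and> cmat A *v x = z *s x} \<and>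
     (\<forall>z x y. cmat A *v x = z *s x \<longrightarrow> cmat A *v y = z *s y \<longrightarrow> x \<noteq> 0 \<longrightarrow> (\<exists>c. y = c *s x))"

text \<open>\<open>act B y p\<close> is \<open>p(B) y\<close>, by Horner's rule.\<close>

definition act :: "complex^'n^'n \<Rightarrow> complex^'n \<Rightarrow> complex poly \<Rightarrow> complex^'n::finite" where
  "act B y p = fold_coeffs (\<lambda>a x. a *s y + B *v x) p 0"

lemma act_0 [simp]: "act B y 0 = 0"
  by (simp add: act_def)

lemma act_pCons: "act B y (pCons a p) = a *s y + B *v act B y p"
proof (cases "a = 0 \<and> p = 0")
  case False
  then show ?thesis by (auto simp: act_def fold_coeffs_pCons_not_0_0_eq)
qed (simp add: act_def)

lemma act_smult: "act B y (Polynomial.smult c p) = c *s act B y p"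
  by (induction p)
    (simp_all add: act_pCons vector_add_ldistrib vector_smult_assoc vector_scalar_commute)

lemma act_add: "act B y (p + q) = act B y p + act B y q"
  by (induction p q rule: poly_induct2)
    (auto simp: act_pCons vec.add vector_sadd_rdistrib algebra_simps)

lemma act_linear_factor: "act B y ([:- z, 1:] * p) = B *v act B y p - z *s act B y p"
proof -
  have "[:- z, 1:] * p = Polynomial.smult (- z) p + pCons 0 p" by (simp add: mult_pCons_left)
  then show ?thesis by (simp only: act_add act_smult act_pCons) (simp add: vec_eq_iff)
qed

definition cdot :: "complex^'n \<Rightarrow> complex^'n \<Rightarrow> complex" where "cdot x y = (\<Sum>i\<in>UNIV. x $ i * y $ i)"

lemma cdot_act_eq_0:
  assumes "\<And>k. cdot (((*v) B ^^ k) y) w = 0"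
  shows "cdot (((*v) B ^^ k) (act B y p)) w = 0"
proof (induction p arbitrary: k)
  case 0
  have "((*v) B ^^ k) 0 = 0" by (induction k) auto
  then show ?case by (simp add: cdot_def)
next
  case (pCons a p)
  have add: "((*v) B ^^ k) (x + u) = ((*v) B ^^ k) x + ((*v) B ^^ k) u" for x u
    by (induction k) (auto simp: vec.add)
  have sc: "((*v) B ^^ k) (c *s x) = c *s ((*v) B ^^ k) x" for c x
    by (induction k) (auto simp: vec.scale)
  have "((*v) B ^^ k) (act B y (pCons a p)) = a *s ((*v) B ^^ k) y + ((*v) B ^^ Suc k) (act B y p)"
    by (simp add: act_pCons add sc funpow_swap1)
  moreover have "cdot (a *s x + u) w = a * cdot x w + cdot u w" for x u
    by (simp add: cdot_def algebra_simps sum.distrib sum_distrib_left)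
  ultimately show ?case using assms[of k] pCons.IH[of "Suc k"] by simp
qed

text \<open>An annihilating polynomial of least degree has a root \<open>z\<close>; dividing by the
  linear factor leaves a polynomial of smaller degree, which no longer kills \<open>y\<close> and so
  produces an eigenvector.\<close>

lemma invariant_eigenvector:
  fixes B :: "complex^'n^'n::finite"
  assumes y: "y \<noteq> 0" and p: "p \<noteq> 0" "act B y p = 0"
  obtains q z where "act B y q \<noteq> 0" "B *v act B y q = z *s act B y q"
proof -
  define S where "S n \<longleftrightarrow> (\<exists>q. q \<noteq> 0 \<and> act B y q = 0 \<and> degree q = n)" for n
  have "S (degree p)" using p by (auto simp: S_def)
  then obtain q where q: "q \<noteq> 0" "act B y q = 0" "degree q = (LEAST n. S n)"
    using LeastI[of S] unfolding S_def by blast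
  have "degree q \<noteq> 0"
  proof
    assume "degree q = 0"
    then obtain a where "q = [:a:]" by (meson degree_eq_zeroE)
    then show False using q y by (auto simp: act_pCons vec.zero)
  qed
  then have "\<not> constant (poly q)" by (simp add: constant_degree)
  then obtain z where "poly q z = 0" using fundamental_theorem_of_algebra by blast
  then obtain r where r: "q = [:- z, 1:] * r" using poly_eq_0_iff_dvd by (metis dvdE)
  then have r0: "r \<noteq> 0" using q by auto
  have "degree q = degree r + 1" unfolding r using r0 by (subst degree_mult_eq) auto
  then have "degree r < (LEAST n. S n)" using q by simp
  then have "\<not> S (degree r)" by (rule not_less_Least)
  then have "act B y r \<noteq> 0" using r0 by (auto simp: S_def)
  moreover have "B *v act B y r = z *s act B y r" using q(2) unfolding r act_linear_factor by simp
  ultimately show ?thesis using that by blast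
qed

lemma cvec_simps: "cvec (x + y) = cvec x + cvec y" "cvec (c *\<^sub>R x) = complex_of_real c *s cvec x"
  "cvec 0 = 0" "cvec x = 0 \<longleftrightarrow> x = 0" "cmat A *v cvec x = cvec (A *v x)"
  by (auto simp: cvec_def cmat_def vec_eq_iff matrix_vector_mult_def)

lemma cvec_funpow:
  fixes A :: "real^'n^'n"
  shows "((*v) (cmat A) ^^ k) (cvec x) = cvec (((*v) A ^^ k) x)"
proof (induction k)
  case (Suc k)
  then show ?case by (simp add: cvec_simps(5))
qed simp

lemma cdot_cvec: "cdot (cvec x) (cvec y) = complex_of_real (x \<bullet> y)"
  by (simp add: cdot_def cvec_def inner_vec_def)

lemma real_annihilator:
  fixes A :: "real^'n^'n::finite"
  obtains p where "p \<noteq> 0" "act (cmat A) (cvec y) p = 0"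
proof -
  let ?V = "\<lambda>k. ((*v) A ^^ k) y"
  define N where "N = DIM(real^'n)"
  have act_sum: "act (cmat A) (cvec y) (\<Sum>k\<le>n. Polynomial.monom (complex_of_real (c k)) k) = cvec (\<Sum>k\<le>n. c k *\<^sub>R ?V k)" for c n
  proof -
    have mon: "act (cmat A) (cvec y) (Polynomial.monom a k) = a *s cvec (?V k)" for a k
    proof (induction k)
      case (Suc k)
      then show ?case by (simp add: monom_Suc act_pCons vec.scale cvec_simps)
    qed (simp add: monom_0 act_pCons)
    show ?thesis by (induction n) (simp_all add: act_add mon cvec_simps)
  qed
  have "\<exists>c. (\<exists>k\<le>N. c k \<noteq> 0) \<and> (\<Sum>k\<le>N. c k *\<^sub>R ?V k) = 0"
  proof (cases "inj_on ?V {..N}")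
    case True
    have "card (?V ` {..N}) = Suc N" using card_image[OF True] by simp
    then have "dependent (?V ` {..N})"
      using independent_bound[of "?V ` {..N}"] by (auto simp: N_def)
    then obtain u where u: "\<exists>v\<in>?V ` {..N}. u v \<noteq> 0" "(\<Sum>v\<in>?V ` {..N}. u v *\<^sub>R v) = 0"
      using dependent_finite[of "?V ` {..N}"] by auto
    have "(\<Sum>k\<le>N. u (?V k) *\<^sub>R ?V k) = 0"
      using u(2) by (subst (asm) sum.reindex[OF True]) (simp add: o_def)
    then show ?thesis using u(1) by (intro exI[of _ "\<lambda>k. u (?V k)"]) auto
  next
    \<comment> \<open>If two powers coincide as vectors, the set of powers may still be independent,
      so the relation is written down as their difference.\<close>
    case False
    then obtain i j where ij: "i \<le> N" "j \<le> N" "i \<noteq> j" "?V i = ?V j" by (auto simp: inj_on_def)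
    define c where "c k = (if k = i then 1 else if k = j then -1 else 0 :: real)" for k
    have "(\<Sum>k\<le>N. c k *\<^sub>R ?V k) = (\<Sum>k\<le>N. (if k = i then ?V i else 0) - (if k = j then ?V j else 0))"
      by (rule sum.cong) (use ij in \<open>auto simp: c_def\<close>)
    also have "\<dots> = 0" using ij by (simp add: sum_subtractf)
    finally show ?thesis using ij(1) by (intro exI[of _ c]) (auto simp: c_def)
  qed
  then obtain c where c: "\<exists>k\<le>N. c k \<noteq> 0" "(\<Sum>k\<le>N. c k *\<^sub>R ?V k) = 0" by blast
  show ?thesis
  proof (rule that)
    show "(\<Sum>k\<le>N. Polynomial.monom (complex_of_real (c k)) k) \<noteq> 0"
    proof
      assume 0: "(\<Sum>k\<le>N. Polynomial.monom (complex_of_real (c k)) k) = 0"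
      have "c k = 0" if "k \<le> N" for k
        using arg_cong[OF 0, of "\<lambda>p. coeff p k"] that by (simp add: coeff_sum)
      then show False using c(1) by auto
    qed
    show "act (cmat A) (cvec y) (\<Sum>k\<le>N. Polynomial.monom (complex_of_real (c k)) k) = 0"
      by (simp add: act_sum c(2) cvec_simps)
  qed
qed

text \<open>The vector is taken on the moment curve, off the finitely many hyperplanes annihilated by left
  eigenvectors. The orthogonal complement of its Krylov space is invariant under the transpose, so
  it would contain such an eigenvector.\<close>

theorem nonderogatory_cyclic:
  fixes A G :: "real^'n^'n::finite"
  assumes nd: "nonderogatory A" and G: "invertible G"
    and AG: "Finite_Cartesian_Product.transpose A ** G = G ** A"
  obtains v where "cyclic_for ((*v) A) v"
proof -
  let ?B = "cmat (Finite_Cartesian_Product.transpose A)"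
  obtain H where H: "G ** H = Finite_Cartesian_Product.mat 1" "H ** G = Finite_Cartesian_Product.mat 1" using G by (auto simp: invertible_def)
  have cmul: "cmat (X ** Y) = cmat X ** cmat Y" for X Y :: "real^'n^'n"
    by (simp add: cmat_def matrix_matrix_mult_def vec_eq_iff)
  have c1: "cmat (Finite_Cartesian_Product.mat 1 :: real^'n^'n) = Finite_Cartesian_Product.mat 1"
    by (simp add: cmat_def Finite_Cartesian_Product.mat_def vec_eq_iff)
  have GH: "cmat G *v (cmat H *v x) = x" "cmat H *v (cmat G *v x) = x" for x
    by (simp_all add: matrix_vector_mul_assoc cmul[symmetric] H c1)
  have BG: "cmat G *v (cmat A *v x) = ?B *v (cmat G *v x)" for x
    by (simp add: matrix_vector_mul_assoc cmul[symmetric] AG)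
  \<comment> \<open>\<open>H\<close> inverts \<open>G\<close>, so it carries eigenvectors of the
    transpose to eigenvectors of \<open>A\<close>; the eigenspaces of the transpose are therefore
    also one-dimensional and finite in number.\<close>
  have left: "cmat A *v (cmat H *v f) = z *s (cmat H *v f)" if "?B *v f = z *s f" for f z
  proof -
    have "cmat G *v (cmat A *v (cmat H *v f)) = z *s f" using that by (simp add: BG GH)
    then have "cmat H *v (cmat G *v (cmat A *v (cmat H *v f))) = cmat H *v (z *s f)" by simp
    then show ?thesis by (simp add: GH vec.scale)
  qed
  define E where "E = {z. \<exists>f. f \<noteq> 0 \<and> ?B *v f = z *s f}"
  have "E \<subseteq> {z. \<exists>x. x \<noteq> 0 \<and> cmat A *v x = z *s x}"
  proof
    fix z assume "z \<in> E"
    then obtain f where f: "f \<noteq> 0" "?B *v f = z *s f" by (auto simp: E_def)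
    have "cmat H *v f \<noteq> 0" using f(1) GH(1)[of f] by (metis vec.zero)
    then show "z \<in> {z. \<exists>x. x \<noteq> 0 \<and> cmat A *v x = z *s x}" using left[OF f(2)] by blast
  qed
  then have finE: "finite E" using nd finite_subset by (auto simp: nonderogatory_def)
  define F where "F z = (SOME f. f \<noteq> 0 \<and> ?B *v f = z *s f)" for z
  have F: "F z \<noteq> 0" "?B *v F z = z *s F z" if "z \<in> E" for z
  proof -
    have "\<exists>f. f \<noteq> 0 \<and> ?B *v f = z *s f" using that by (auto simp: E_def)
    from someI_ex[OF this, folded F_def] show "F z \<noteq> 0" "?B *v F z = z *s F z" by auto
  qed
  have mult: "\<exists>c. f = c *s F z" if z: "z \<in> E" and f: "?B *v f = z *s f" for f z
  proof -
    have "cmat H *v F z \<noteq> 0" using F(1)[OF z] GH(1)[of "F z"] by (metis vec.zero)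
    then obtain c where "cmat H *v f = c *s (cmat H *v F z)"
      using nd left[OF F(2)[OF z]] left[OF f] unfolding nonderogatory_def by blast
    then have "cmat G *v (cmat H *v f) = cmat G *v (c *s (cmat H *v F z))" by simp
    then show ?thesis by (auto simp: vec.scale GH)
  qed
  \<comment> \<open>Paired with the curve \<open>w\<close>, a vector \<open>f\<close> becomes a
    polynomial in \<open>t\<close> whose coefficients are the entries of \<open>f\<close>, so each
    hyperplane excludes only finitely many \<open>t\<close>.\<close>
  define w where "w t = (\<chi> i::'n. t ^ to_nat_on UNIV i)" for t :: real
  have fin: "finite {t. cdot f (cvec (w t)) = 0}" if f0: "f \<noteq> 0" for f
  proof -
    define p where "p = (\<Sum>i\<in>UNIV. Polynomial.monom (f $ i) (to_nat_on UNIV i))"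
    have inj: "to_nat_on UNIV i = to_nat_on UNIV j \<longleftrightarrow> i = j" for i j :: 'n
      using inj_on_to_nat_on[of "UNIV :: 'n set"] by (auto simp: inj_on_def countable_finite)
    obtain i where i: "f $ i \<noteq> 0" using f0 by (metis vec_eq_iff zero_index)
    have "coeff p (to_nat_on UNIV i) = f $ i"
      by (simp add: p_def coeff_sum inj)
    then have "p \<noteq> 0" using i by auto
    then have "finite {z. poly p z = 0}" by (rule poly_roots_finite)
    moreover have ev: "poly p (complex_of_real t) = cdot f (cvec (w t))" for t
      by (simp add: p_def poly_sum poly_monom cdot_def cvec_def w_def)
    ultimately have "finite (complex_of_real -` {z. poly p z = 0})"
      by (intro finite_vimageI) (auto simp: inj_on_def)
    then show ?thesis by (simp add: vimage_def ev)
  qed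
  have "finite (\<Union>z\<in>E. {t. cdot (F z) (cvec (w t)) = 0})"
    using finE fin F(1) by blast
  then obtain t where t: "t \<notin> (\<Union>z\<in>E. {t. cdot (F z) (cvec (w t)) = 0})"
    using ex_new_if_finite[OF infinite_UNIV_char_0] by blast
  have "span (range (\<lambda>k. ((*v) A ^^ k) (w t))) = UNIV"
  proof (rule ccontr)
    assume ne: "span (range (\<lambda>k. ((*v) A ^^ k) (w t))) \<noteq> UNIV"
    then obtain x where "x \<notin> span (range (\<lambda>k. ((*v) A ^^ k) (w t)))" by blast
    from separating_vector[OF this] obtain y where
      y: "y \<bullet> x = 1" "\<And>u. u \<in> span (range (\<lambda>k. ((*v) A ^^ k) (w t))) \<Longrightarrow> y \<bullet> u = 0" by blast
    have y0: "y \<noteq> 0" using y(1) by auto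
    have tr: "(((*v) (Finite_Cartesian_Product.transpose A) ^^ k) a) \<bullet> b = a \<bullet> (((*v) A ^^ k) b)" for k a b
    proof (induction k arbitrary: a b)
      case (Suc k)
      have "((*v) (Finite_Cartesian_Product.transpose A) ^^ Suc k) a \<bullet> b
          = ((*v) (Finite_Cartesian_Product.transpose A) ^^ k) a \<bullet> (A *v b)"
        by (simp only: funpow.simps o_apply) (simp only: transpose_matrix_vector dot_lmul_matrix)
      also have "\<dots> = a \<bullet> (((*v) A ^^ k) (A *v b))" by (rule Suc.IH)
      also have "\<dots> = a \<bullet> (((*v) A ^^ Suc k) b)" by (simp only: funpow_Suc_right o_apply)
      finally show ?case .
    qed simp
    have 0: "cdot (((*v) ?B ^^ k) (cvec y)) (cvec (w t)) = 0" for k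
    proof -
      have "y \<bullet> (((*v) A ^^ k) (w t)) = 0" by (intro y(2) span_base) auto
      then show ?thesis by (simp add: cvec_funpow cdot_cvec tr)
    qed
    obtain p where p: "p \<noteq> 0" "act ?B (cvec y) p = 0" using real_annihilator by blast
    obtain q z where qz: "act ?B (cvec y) q \<noteq> 0" "?B *v act ?B (cvec y) q = z *s act ?B (cvec y) q"
      by (rule invariant_eigenvector[OF _ p]) (use y0 in \<open>auto simp: cvec_simps\<close>)
    then have zE: "z \<in> E" by (auto simp: E_def)
    obtain c where c: "act ?B (cvec y) q = c *s F z" using mult[OF zE qz(2)] by blast
    have "cdot (act ?B (cvec y) q) (cvec (w t)) = 0"
      using cdot_act_eq_0[OF 0, of 0 q] by simp
    then have "c * cdot (F z) (cvec (w t)) = 0"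
      by (simp add: c cdot_def sum_distrib_left mult.assoc)
    moreover have "c \<noteq> 0" using qz(1) c by auto
    ultimately show False using t zE by auto
  qed
  then show ?thesis using that by (simp add: cyclic_for_def)
qed

text \<open>Row \<open>i\<close> of the equation reads \<open>a x_i + x_(i+1) = z x_i\<close>,
  without the term \<open>x_(i+1)\<close> in the last row. For \<open>z \<noteq> a\<close> the
  coordinates vanish from the last one backwards; for \<open>z = a\<close> the rows say directly
  that all but coordinate 0 vanish.\<close>

lemma jordan_block_eigen:
  fixes x :: "complex Matrix.vec"
  assumes x: "x \<in> carrier_vec n" and e: "mult_mat_vec (jordan_block n a) x = z \<cdot>\<^sub>v x"
  shows "z \<noteq> a \<Longrightarrow> x = 0\<^sub>v n" and "z = a \<Longrightarrow> 0 < i \<Longrightarrow> i < n \<Longrightarrow> vec_index x i = 0"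
proof -
  have comp: "a * vec_index x i + (if Suc i < n then vec_index x (Suc i) else 0) = z * vec_index x i" if i: "i < n" for i
  proof -
    have "vec_index (mult_mat_vec (jordan_block n a) x) i = (\<Sum>j = 0..<n. (if i = j then a else if Suc i = j then 1 else 0) * vec_index x j)"
      using i x by (simp add: jordan_block_def scalar_prod_def row_def)
    also have "\<dots> = (\<Sum>j = 0..<n. (if i = j then a * vec_index x j else 0) + (if Suc i = j then vec_index x j else 0))"
      by (rule sum.cong) auto
    also have "\<dots> = a * vec_index x i + (if Suc i < n then vec_index x (Suc i) else 0)"
      using i by (simp add: sum.distrib)
    finally show ?thesis using e i x by simp
  qed
  show "x = 0\<^sub>v n" if ne: "z \<noteq> a"
  proof -
    have "vec_index x (n - Suc k) = 0" if "k < n" for k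
      using that
    proof (induction k)
      case 0
      then show ?case using comp[of "n - 1"] ne by (auto simp: algebra_simps)
    next
      case (Suc k)
      then have "Suc (n - Suc (Suc k)) = n - Suc k" by simp
      then show ?case using comp[of "n - Suc (Suc k)"] Suc ne by (auto simp: algebra_simps split: if_splits)
    qed
    then have "vec_index x i = 0" if "i < n" for i using that
      by (metis Suc_diff_Suc diff_diff_cancel diff_less_Suc less_imp_le_nat diff_less zero_less_Suc
          less_nat_zero_code not_gr_zero Suc_pred diff_Suc_less Suc_leI)
    then show ?thesis using x by (intro eq_vecI) auto
  qed
  show "vec_index x i = 0" if "z = a" "0 < i" "i < n"
    using comp[of "i - 1"] that by simp
qed

lemma four_block_eigen:
  fixes B C :: "complex mat"
  assumes B: "B \<in> carrier_mat n n" and C: "C \<in> carrier_mat m m"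
    and x: "x \<in> carrier_vec (n + m)"
    and e: "mult_mat_vec (four_block_mat B (0\<^sub>m n m) (0\<^sub>m m n) C) x = z \<cdot>\<^sub>v x"
  shows "mult_mat_vec B (vec_first x n) = z \<cdot>\<^sub>v vec_first x n"
    and "mult_mat_vec C (vec_last x m) = z \<cdot>\<^sub>v vec_last x m"
proof -
  let ?x1 = "vec_first x n" and ?x2 = "vec_last x m"
  have c: "?x1 \<in> carrier_vec n" "?x2 \<in> carrier_vec m" by auto
  have xe: "x = ?x1 @\<^sub>v ?x2" using x by simp
  have "mult_mat_vec (four_block_mat B (0\<^sub>m n m) (0\<^sub>m m n) C) (?x1 @\<^sub>v ?x2)
      = (mult_mat_vec B ?x1 + mult_mat_vec (0\<^sub>m n m) ?x2) @\<^sub>v (mult_mat_vec (0\<^sub>m m n) ?x1 + mult_mat_vec C ?x2)"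
    by (rule four_block_mat_mult_vec[OF B _ _ C]) (use c in auto)
  also have "mult_mat_vec (0\<^sub>m n m) ?x2 = 0\<^sub>v n"
    using c by (intro eq_vecI) (auto simp: scalar_prod_def)
  also have "mult_mat_vec (0\<^sub>m m n) ?x1 = 0\<^sub>v m"
    using c by (intro eq_vecI) (auto simp: scalar_prod_def)
  also have "(mult_mat_vec B ?x1 + 0\<^sub>v n) @\<^sub>v (0\<^sub>v m + mult_mat_vec C ?x2)
      = mult_mat_vec B ?x1 @\<^sub>v mult_mat_vec C ?x2" using B C c by simp
  finally have "mult_mat_vec B ?x1 @\<^sub>v mult_mat_vec C ?x2 = z \<cdot>\<^sub>v (?x1 @\<^sub>v ?x2)" using e xe by metis
  also have "\<dots> = (z \<cdot>\<^sub>v ?x1) @\<^sub>v (z \<cdot>\<^sub>v ?x2)" by (rule eq_vecI) auto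
  finally have "mult_mat_vec B ?x1 @\<^sub>v mult_mat_vec C ?x2 = (z \<cdot>\<^sub>v ?x1) @\<^sub>v (z \<cdot>\<^sub>v ?x2)" .
  then show "mult_mat_vec B ?x1 = z \<cdot>\<^sub>v ?x1" "mult_mat_vec C ?x2 = z \<cdot>\<^sub>v ?x2"
    using append_vec_eq[of "mult_mat_vec B ?x1" n "z \<cdot>\<^sub>v ?x1"] B c by auto
qed

text \<open>With distinct eigenvalues at most one block meets \<open>z\<close>, and only the leading
  coordinate of that block survives. The two claims go through the induction together: if the head
  block has eigenvalue \<open>z\<close>, the first claim kills the tail.\<close>

lemma jordan_matrix_eigen:
  assumes "distinct (map snd n_as)"
  shows "z \<notin> snd ` set n_as \<Longrightarrow> x \<in> carrier_vec (sum_list (map fst n_as)) \<Longrightarrow>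
      mult_mat_vec (jordan_matrix n_as) x = z \<cdot>\<^sub>v x \<Longrightarrow> x = 0\<^sub>v (sum_list (map fst n_as))"
    and "\<exists>k. \<forall>x\<in>carrier_vec (sum_list (map fst n_as)). mult_mat_vec (jordan_matrix n_as) x = z \<cdot>\<^sub>v x \<longrightarrow>
      (\<forall>i<sum_list (map fst n_as). i \<noteq> k \<longrightarrow> vec_index x i = (0::complex))"
proof -
  have "(\<forall>x\<in>carrier_vec (sum_list (map fst n_as)). z \<notin> snd ` set n_as \<longrightarrow>
      mult_mat_vec (jordan_matrix n_as) x = z \<cdot>\<^sub>v x \<longrightarrow> x = 0\<^sub>v (sum_list (map fst n_as))) \<and>
    (\<exists>k. \<forall>x\<in>carrier_vec (sum_list (map fst n_as)). mult_mat_vec (jordan_matrix n_as) x = z \<cdot>\<^sub>v x \<longrightarrow>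
      (\<forall>i<sum_list (map fst n_as). i \<noteq> k \<longrightarrow> vec_index x i = (0::complex)))"
    using assms
  proof (induction n_as)
    case (Cons na n_as)
    obtain n a where na: "na = (n, a)" by (cases na)
    let ?m = "sum_list (map fst n_as)"
    have IH0: "x = 0\<^sub>v ?m" if "x \<in> carrier_vec ?m" "z \<notin> snd ` set n_as"
      "mult_mat_vec (jordan_matrix n_as) x = z \<cdot>\<^sub>v x" for x using Cons that by simp
    obtain k where k: "\<And>x i. x \<in> carrier_vec ?m \<Longrightarrow> mult_mat_vec (jordan_matrix n_as) x = z \<cdot>\<^sub>v x \<Longrightarrow>
      i < ?m \<Longrightarrow> i \<noteq> k \<Longrightarrow> vec_index x i = 0" using Cons by auto
    have a: "a \<notin> snd ` set n_as" using Cons.prems by (simp add: na)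
    have N: "sum_list (map fst (na # n_as)) = n + ?m" by (simp add: na)
    have sp: "mult_mat_vec (jordan_block n a) (vec_first x n) = z \<cdot>\<^sub>v vec_first x n"
      "mult_mat_vec (jordan_matrix n_as) (vec_last x ?m) = z \<cdot>\<^sub>v vec_last x ?m"
      "x = vec_first x n @\<^sub>v vec_last x ?m"
      if "x \<in> carrier_vec (n + ?m)" "mult_mat_vec (jordan_matrix (na # n_as)) x = z \<cdot>\<^sub>v x" for x
      using four_block_eigen[OF jordan_block_carrier jordan_matrix_carrier that(1)] that
      by (simp_all add: na jordan_matrix_Cons)
    have c: "vec_first x n \<in> carrier_vec n" "vec_last x ?m \<in> carrier_vec ?m" for x :: "complex Matrix.vec"
      by auto
    have idx: "vec_index x i = (if i < n then vec_index (vec_first x n) i else vec_index (vec_last x ?m) (i - n))"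
      if "x = vec_first x n @\<^sub>v vec_last x ?m" "i < n + ?m" for x :: "complex Matrix.vec" and i
    proof -
      have "vec_index x i = vec_index (vec_first x n @\<^sub>v vec_last x ?m) i" using that(1) by simp
      also have "\<dots> = (if i < n then vec_index (vec_first x n) i else vec_index (vec_last x ?m) (i - n))"
        using that(2) c[of x] by (subst index_append_vec) auto
      finally show ?thesis .
    qed
    show ?case unfolding N
    proof (intro conjI ballI impI)
      fix x assume x: "x \<in> carrier_vec (n + ?m)" and z: "z \<notin> snd ` set (na # n_as)"
        and e: "mult_mat_vec (jordan_matrix (na # n_as)) x = z \<cdot>\<^sub>v x"
      have "vec_first x n = 0\<^sub>v n"
        by (rule jordan_block_eigen(1)[OF c(1) sp(1)[OF x e]]) (use z na in auto)
      moreover have "vec_last x ?m = 0\<^sub>v ?m"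
        by (rule IH0[OF c(2) _ sp(2)[OF x e]]) (use z in auto)
      ultimately show "x = 0\<^sub>v (n + ?m)"
        using x idx[OF sp(3)[OF x e]] by (intro eq_vecI) auto
    next
      show "\<exists>k. \<forall>x\<in>carrier_vec (n + ?m). mult_mat_vec (jordan_matrix (na # n_as)) x = z \<cdot>\<^sub>v x \<longrightarrow>
        (\<forall>i<n + ?m. i \<noteq> k \<longrightarrow> vec_index x i = 0)"
      proof (cases "z = a")
        case True
        show ?thesis
        proof (intro exI[of _ 0] ballI impI allI)
          fix x i assume x: "x \<in> carrier_vec (n + ?m)" and i: "i < n + ?m" "i \<noteq> 0"
            and e: "mult_mat_vec (jordan_matrix (na # n_as)) x = z \<cdot>\<^sub>v x"
          have "vec_last x ?m = 0\<^sub>v ?m"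
            by (rule IH0[OF c(2) _ sp(2)[OF x e]]) (use a True in auto)
          moreover have "vec_index (vec_first x n) i = 0" if "i < n"
            by (rule jordan_block_eigen(2)[OF c(1) sp(1)[OF x e] True _ that]) (use i in auto)
          ultimately show "vec_index x i = 0" using idx[OF sp(3)[OF x e] i(1)] i by auto
        qed
      next
        case False
        show ?thesis
        proof (intro exI[of _ "n + k"] ballI impI allI)
          fix x i assume x: "x \<in> carrier_vec (n + ?m)" and i: "i < n + ?m" "i \<noteq> n + k"
            and e: "mult_mat_vec (jordan_matrix (na # n_as)) x = z \<cdot>\<^sub>v x"
          have "vec_first x n = 0\<^sub>v n"
            by (rule jordan_block_eigen(1)[OF c(1) sp(1)[OF x e] False])
          moreover have "vec_index (vec_last x ?m) (i - n) = 0" if "\<not> i < n"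
            by (rule k[OF c(2) sp(2)[OF x e]]) (use i that in auto)
          ultimately show "vec_index x i = 0" using idx[OF sp(3)[OF x e] i(1)] i by auto
        qed
      qed
    qed
  qed auto
  then show "z \<notin> snd ` set n_as \<Longrightarrow> x \<in> carrier_vec (sum_list (map fst n_as)) \<Longrightarrow>
      mult_mat_vec (jordan_matrix n_as) x = z \<cdot>\<^sub>v x \<Longrightarrow> x = 0\<^sub>v (sum_list (map fst n_as))"
    and "\<exists>k. \<forall>x\<in>carrier_vec (sum_list (map fst n_as)). mult_mat_vec (jordan_matrix n_as) x = z \<cdot>\<^sub>v x \<longrightarrow>
      (\<forall>i<sum_list (map fst n_as). i \<noteq> k \<longrightarrow> vec_index x i = 0)"
    by blast+
qed

text \<open>In Jordan coordinates all eigenvectors for \<open>z\<close> are supported on one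
  coordinate \<open>k\<close>, hence proportional, and the similarity carries this back.
  \<open>vx\<close> and \<open>e\<close> translate between the two matrix types along the
  enumeration of the index type.\<close>

theorem distinct_jordan_nonderogatory:
  fixes A :: "real^'n^'n::finite"
  assumes jnf: "jordan_nf (Matrix.mat CARD('n) CARD('n)
       (\<lambda>(i, j). complex_of_real (A $ from_nat_into UNIV i $ from_nat_into UNIV j))) n_as"
    and dis: "distinct (map snd n_as)"
  shows "nonderogatory A"
proof -
  define n where "n = CARD('n)"
  define e where "e = (from_nat_into UNIV :: nat \<Rightarrow> 'n)"
  define M where "M = Matrix.mat n n (\<lambda>(i, j). complex_of_real (A $ e i $ e j))"
  let ?J = "jordan_matrix n_as"
  have Mc: "M \<in> carrier_mat n n" by (simp add: M_def)
  have "similar_mat M ?J" using jnf by (simp add: jordan_nf_def M_def n_def e_def)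
  then obtain P Q where w: "similar_mat_wit M ?J P Q" unfolding similar_mat_def by blast
  from similar_mat_witD2[OF Mc w]
  have PQ: "P * Q = 1\<^sub>m n" "Q * P = 1\<^sub>m n" and MPJQ: "M = P * ?J * Q"
    and Jc: "?J \<in> carrier_mat n n" and Pc: "P \<in> carrier_mat n n" and Qc: "Q \<in> carrier_mat n n" by auto
  have N: "sum_list (map fst n_as) = n" using Jc jordan_matrix_carrier[of n_as] by auto
  have bij: "bij_betw e {0..<n} UNIV"
    unfolding e_def n_def using bij_betw_from_nat_into_finite[of "UNIV :: 'n set"] by (simp add: lessThan_atLeast0)
  define vx where "vx x = Matrix.vec n (\<lambda>i. x $ e i)" for x :: "complex^'n"
  have vxc: "vx x \<in> carrier_vec n" for x by (simp add: vx_def)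
  have vx_eq: "vx x = vx y \<longleftrightarrow> x = y" for x y
  proof
    assume "vx x = vx y"
    then have "x $ e i = y $ e i" if "i < n" for i using that
      by (metis index_vec vx_def)
    moreover have "\<exists>i<n. j = e i" for j using bij by (metis UNIV_I atLeastLessThan_iff bij_betw_iff_bijections)
    ultimately show "x = y" by (metis vec_eq_iff)
  qed simp
  have vx_s: "vx (c *s x) = c \<cdot>\<^sub>v vx x" for c x by (auto simp: vx_def)
  have Mvx: "mult_mat_vec M (vx x) = vx (cmat A *v x)" for x
  proof (rule eq_vecI)
    fix i assume "i < dim_vec (vx (cmat A *v x))"
    then have i: "i < n" by (simp add: vx_def)
    have "vec_index (mult_mat_vec M (vx x)) i = (\<Sum>j = 0..<n. complex_of_real (A $ e i $ e j) * x $ e j)"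
      using i by (simp add: M_def vx_def scalar_prod_def row_def)
    also have "\<dots> = (\<Sum>j\<in>UNIV. complex_of_real (A $ e i $ j) * x $ j)"
      by (rule sum.reindex_bij_betw[OF bij])
    also have "\<dots> = vec_index (vx (cmat A *v x)) i"
      using i by (simp add: vx_def matrix_vector_mult_def cmat_def)
    finally show "vec_index (mult_mat_vec M (vx x)) i = vec_index (vx (cmat A *v x)) i" .
  qed (simp_all add: M_def vx_def)
  have JQ: "mult_mat_vec ?J (mult_mat_vec Q (vx x)) = z \<cdot>\<^sub>v mult_mat_vec Q (vx x)" if "cmat A *v x = z *s x" for x z
  proof -
    have QM: "Q * M = ?J * Q"
    proof -
      have "Q * M = Q * (P * (?J * Q))" unfolding MPJQ using Pc Qc Jc by (simp add: assoc_mult_mat[of _ n n _ n _ n])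
      also have "\<dots> = (Q * P) * (?J * Q)" using Pc Qc Jc by (subst assoc_mult_mat[of _ n n _ n _ n]) auto
      also have "\<dots> = ?J * Q" unfolding PQ(2) by (rule left_mult_one_mat[OF mult_carrier_mat[OF Jc Qc]])
      finally show ?thesis .
    qed
    have "mult_mat_vec ?J (mult_mat_vec Q (vx x)) = mult_mat_vec (?J * Q) (vx x)"
      using assoc_mult_mat_vec[OF Jc Qc vxc] by simp
    also have "\<dots> = mult_mat_vec Q (mult_mat_vec M (vx x))"
      unfolding QM[symmetric] by (rule assoc_mult_mat_vec[OF Qc Mc vxc])
    also have "\<dots> = mult_mat_vec Q (z \<cdot>\<^sub>v vx x)" by (simp add: Mvx that vx_s)
    also have "\<dots> = z \<cdot>\<^sub>v mult_mat_vec Q (vx x)" by (rule mult_mat_vec[OF Qc vxc])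
    finally show ?thesis .
  qed
  have QvC: "mult_mat_vec Q (vx x) \<in> carrier_vec n" for x using Qc vxc by simp
  have PQv: "mult_mat_vec P (mult_mat_vec Q (vx x)) = vx x" for x
    using assoc_mult_mat_vec[OF Pc Qc vxc, of x] PQ vxc[of x] by simp
  have Qinj: "mult_mat_vec Q (vx x) = mult_mat_vec Q (vx y) \<longleftrightarrow> x = y" for x y
    by (metis PQv vx_eq)
  have Q0: "mult_mat_vec Q (vx 0) = 0\<^sub>v n"
  proof -
    have "vx 0 = 0\<^sub>v n" by (auto simp: vx_def)
    then show ?thesis using Qc by (auto intro!: eq_vecI simp: scalar_prod_def)
  qed
  have "{z. \<exists>x. x \<noteq> 0 \<and> cmat A *v x = z *s x} \<subseteq> snd ` set n_as"
  proof clarify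
    fix z x assume x: "x \<noteq> 0" "cmat A *v x = z *s x"
    show "z \<in> snd ` set n_as"
    proof (rule ccontr)
      assume "z \<notin> snd ` set n_as"
      from jordan_matrix_eigen(1)[OF dis this, unfolded N, OF QvC JQ[OF x(2)]]
      show False using Qinj[of x 0] Q0 x(1) by simp
    qed
  qed
  then have fin: "finite {z. \<exists>x. x \<noteq> 0 \<and> cmat A *v x = z *s x}" by (rule finite_subset) simp
  have "\<exists>c. y = c *s x" if xy: "cmat A *v x = z *s x" "cmat A *v y = z *s y" "x \<noteq> 0" for x y z
  proof -
    obtain k where k: "\<And>v i. v \<in> carrier_vec n \<Longrightarrow> mult_mat_vec ?J v = z \<cdot>\<^sub>v v \<Longrightarrow> i < n \<Longrightarrow> i \<noteq> k \<Longrightarrow> vec_index v i = 0"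
      using jordan_matrix_eigen(2)[OF dis, of z, unfolded N] by blast
    let ?x = "mult_mat_vec Q (vx x)" and ?y = "mult_mat_vec Q (vx y)"
    have zx: "vec_index ?x i = 0" if "i < n" "i \<noteq> k" for i by (rule k[OF QvC JQ[OF xy(1)] that])
    have zy: "vec_index ?y i = 0" if "i < n" "i \<noteq> k" for i by (rule k[OF QvC JQ[OF xy(2)] that])
    have "?x \<noteq> 0\<^sub>v n" using Qinj[of x 0] Q0 xy(3) by simp
    then have kn: "k < n \<and> vec_index ?x k \<noteq> 0"
      using zx QvC[of x] by (metis carrier_vecD eq_vecI index_zero_vec)
    define c where "c = vec_index ?y k / vec_index ?x k"
    have "?y = c \<cdot>\<^sub>v ?x"
    proof (rule eq_vecI)
      fix i assume "i < dim_vec (c \<cdot>\<^sub>v ?x)"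
      then have i: "i < n" using carrier_matD(1)[OF Qc] by simp
      show "vec_index ?y i = vec_index (c \<cdot>\<^sub>v ?x) i"
        using i carrier_matD(1)[OF Qc] zx[OF i] zy[OF i] kn by (cases "i = k") (auto simp: c_def)
    qed (use Qc in simp)
    also have "\<dots> = mult_mat_vec Q (vx (c *s x))" unfolding vx_s by (rule mult_mat_vec[OF Qc vxc, symmetric])
    finally show ?thesis using Qinj by blast
  qed
  then show ?thesis using fin unfolding nonderogatory_def by blast
qed

section \<open>Metrics in a coordinate domain\<close>

lemma dd_linear: "smooth_on U f \<Longrightarrow> open U \<Longrightarrow> x \<in> U \<Longrightarrow> linear (dd f x)"
  by (rule has_derivative_linear[OF smooth_on_deriv])

lemma dd_compose:
  fixes f :: "'a::euclidean_space \<Rightarrow> 'c::euclidean_space" and g :: "'c \<Rightarrow> 'b::euclidean_space"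
  assumes f: "smooth_on W f" "open W" "p \<in> W" and g: "smooth_on U g" "open U" "f p \<in> U"
  shows "dd (\<lambda>q. g (f q)) p v = dd g (f p) (dd f p v)"
  using dd_eq[OF has_derivative_compose[OF smooth_on_deriv[OF f] smooth_on_deriv[OF g]]] by simp

lemma dd_bilinear:
  assumes B: "bounded_bilinear B" and f: "smooth_on U f" and g: "smooth_on U g" and U: "open U" "x \<in> U"
  shows "dd (\<lambda>y. B (f y) (g y)) x v = B (f x) (dd g x v) + B (dd f x v) (g x)"
  using dd_eq[OF bounded_bilinear.FDERIV[OF B smooth_on_deriv[OF f U] smooth_on_deriv[OF g U]]]
  by simp

lemma dd_add:
  assumes f: "smooth_on U f" and g: "smooth_on U g" and U: "open U" "x \<in> U"
  shows "dd (\<lambda>y. f y + g y) x v = dd f x v + dd g x v"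
  using dd_eq[OF has_derivative_add[OF smooth_on_deriv[OF f U] smooth_on_deriv[OF g U]]]
  by simp

lemma open_preimage: "continuous_on S f \<Longrightarrow> open S \<Longrightarrow> open T \<Longrightarrow> open {x \<in> S. f x \<in> T}"
  using continuous_open_preimage[of S f T] by (simp add: vimage_def Int_def)

lemma constant_on_ball:
  fixes f :: "'a::euclidean_space \<Rightarrow> real"
  assumes f: "smooth_on V f" and V: "open V" "ball x r \<subseteq> V" and r: "r > 0"
    and z: "\<And>y u. y \<in> V \<Longrightarrow> dd f y u = 0" and y: "y \<in> ball x r"
  shows "f y = f x"
proof (rule has_derivative_zero_unique[OF convex_ball _ y])
  show "x \<in> ball x r" using r by simp
  fix s assume "s \<in> ball x r"
  then have s: "s \<in> V" using V by blast
  have "dd f s = (\<lambda>h. 0)" using z[OF s] by (rule ext)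
  then show "(f has_derivative (\<lambda>h. 0)) (at s within ball x r)"
    using smooth_on_deriv[OF f V(1) s] by (auto intro: has_derivative_at_withinI)
qed

lemma slice_derivative:
  fixes H :: "real \<times> 'a::euclidean_space \<Rightarrow> 'b::euclidean_space"
  assumes H: "smooth_on W H" and W: "open W" and q: "(t, x) \<in> W"
  shows "((\<lambda>t. H (t, x)) has_vector_derivative dd H (t, x) (1, 0)) (at t)"
proof -
  have "((\<lambda>t. (t, x)) has_derivative (\<lambda>h. (h, 0))) (at t)" by (auto intro!: derivative_eq_intros)
  from has_derivative_compose[OF this smooth_on_deriv[OF H W q]]
  have d: "((\<lambda>t. H (t, x)) has_derivative (\<lambda>h. dd H (t, x) (h, 0))) (at t)" .
  have "dd H (t, x) (h, 0) = h *\<^sub>R dd H (t, x) (1, 0)" for h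
    using linear_scale[OF dd_linear[OF H W q], of h "(1, 0)"] by simp
  then show ?thesis unfolding has_vector_derivative_def by (intro has_derivative_eq_rhs[OF d] ext)
qed

lemma smooth_on_linear_family:
  fixes \<Phi> :: "'a::euclidean_space \<Rightarrow> 'e::euclidean_space \<Rightarrow> 'b::euclidean_space"
  assumes U: "open U" and lin: "\<And>y. y \<in> U \<Longrightarrow> linear (\<Phi> y)" and sm: "\<And>v. smooth_on U (\<lambda>y. \<Phi> y v)"
    and p: "smooth_on U p"
  shows "smooth_on U (\<lambda>y. \<Phi> y (p y))"
proof (rule smooth_on_cong[OF U])
  show "(\<Sum>i\<in>Basis. (p y \<bullet> i) *\<^sub>R \<Phi> y i) = \<Phi> y (p y)" if "y \<in> U" for y
    by (rule linear_basis_expansion[OF lin[OF that], symmetric])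
  show "smooth_on U (\<lambda>y. \<Sum>i\<in>Basis. (p y \<bullet> i) *\<^sub>R \<Phi> y i)"
    by (rule smooth_on_sum[OF U], rule smooth_on_bilinear[OF U bounded_bilinear_scaleR _ sm],
        rule smooth_on_linear_compose[OF U bounded_linear_inner_left p])
qed

text \<open>The product rule for a linear map varying with the point, applied to a moving vector.
  Expansion in a basis avoids treating \<open>\<Phi>\<close> as operator valued; Christoffel symbols
  and the derivatives of vector fields and transition maps are all used in this form.\<close>

lemma dd_linear_family:
  fixes \<Phi> :: "'a::euclidean_space \<Rightarrow> 'e::euclidean_space \<Rightarrow> 'b::euclidean_space"
  assumes U: "open U" and lin: "\<And>y. y \<in> U \<Longrightarrow> linear (\<Phi> y)" and sm: "\<And>v. smooth_on U (\<lambda>y. \<Phi> y v)"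
    and p: "smooth_on U p" and x: "x \<in> U"
  shows "dd (\<lambda>y. \<Phi> y (p y)) x u = dd (\<lambda>y. \<Phi> y (p x)) x u + \<Phi> x (dd p x u)"
proof -
  have 1: "dd (\<lambda>y. \<Phi> y c) x u = (\<Sum>i\<in>Basis. (c \<bullet> i) *\<^sub>R dd (\<lambda>y. \<Phi> y i) x u)" for c
  proof -
    have "dd (\<lambda>y. \<Phi> y c) x = dd (\<lambda>y. \<Sum>i\<in>Basis. (c \<bullet> i) *\<^sub>R \<Phi> y i) x"
      by (rule dd_cong_open[OF U x]) (rule linear_basis_expansion[OF lin])
    also have "\<dots> = (\<lambda>u. \<Sum>i\<in>Basis. (c \<bullet> i) *\<^sub>R dd (\<lambda>y. \<Phi> y i) x u)"
      by (rule dd_eq, rule has_derivative_sum, rule has_derivative_scaleR_right,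
          rule smooth_on_deriv[OF sm U x])
    finally show ?thesis by simp
  qed
  have "dd (\<lambda>y. \<Phi> y (p y)) x = dd (\<lambda>y. \<Sum>i\<in>Basis. (p y \<bullet> i) *\<^sub>R \<Phi> y i) x"
    by (rule dd_cong_open[OF U x]) (rule linear_basis_expansion[OF lin])
  also have "\<dots> = (\<lambda>u. \<Sum>i\<in>Basis. (p x \<bullet> i) *\<^sub>R dd (\<lambda>y. \<Phi> y i) x u + (dd p x u \<bullet> i) *\<^sub>R \<Phi> x i)"
    by (rule dd_eq, rule has_derivative_sum, rule has_derivative_scaleR,
        rule bounded_linear.has_derivative[OF bounded_linear_inner_left smooth_on_deriv[OF p U x]],
        rule smooth_on_deriv[OF sm U x])
  finally have f: "dd (\<lambda>y. \<Phi> y (p y)) x u = (\<Sum>i\<in>Basis. (p x \<bullet> i) *\<^sub>R dd (\<lambda>y. \<Phi> y i) x u + (dd p x u \<bullet> i) *\<^sub>R \<Phi> x i)"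
    by (rule fun_cong)
  show ?thesis
    unfolding f sum.distrib linear_basis_expansion[OF lin[OF x], of "dd p x u", symmetric] 1[of "p x", symmetric]
    by (rule refl)
qed

lemma bounded_bilinear_mv: "bounded_bilinear ((*v) :: real^'n::finite^'m::finite \<Rightarrow> real^'n \<Rightarrow> real^'m)"
  unfolding bilinear_conv_bounded_bilinear[symmetric] bilinear_def linear_iff
  by (simp add: matrix_vector_mult_add_rdistrib matrix_vector_right_distrib
      scaleR_matrix_vector_assoc[symmetric] matrix_vector_mult_scaleR)

section \<open>Matrices as bilinear forms\<close>

definition bf :: "real^'n^'n::finite \<Rightarrow> real^'n \<Rightarrow> real^'n \<Rightarrow> real" where
  "bf M v w = v \<bullet> (M *v w)"

lemma bf_simps:
  "bf M (u + v) w = bf M u w + bf M v w" "bf M u (v + w) = bf M u v + bf M u w"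
  "bf M (u - v) w = bf M u w - bf M v w" "bf M u (v - w) = bf M u v - bf M u w"
  "bf M (c *\<^sub>R u) w = c * bf M u w" "bf M u (c *\<^sub>R w) = c * bf M u w"
  "bf M (- u) w = - bf M u w" "bf M u (- w) = - bf M u w" "bf M 0 w = 0" "bf M u 0 = 0"
  by (simp_all add: bf_def matrix_vector_right_distrib matrix_vector_mult_diff_distrib
      matrix_vector_mult_scaleR inner_add inner_diff linear_neg[OF matrix_vector_mul_linear])

lemma bf_mat_simps: "bf (M + N) u w = bf M u w + bf N u w" "bf (M - N) u w = bf M u w - bf N u w"
  "bf (c *\<^sub>R M) u w = c * bf M u w" "bf 0 u w = 0"
  by (simp_all add: bf_def matrix_vector_mult_add_rdistrib matrix_vector_mult_diff_rdistrib
      scaleR_matrix_vector_assoc[symmetric] inner_add_right inner_diff_right)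

lemma bounded_linear_bf: "bounded_linear (\<lambda>M. bf M u w)"
  unfolding linear_conv_bounded_linear[symmetric] by (rule linearI) (simp_all add: bf_mat_simps)

lemma bf_axis: "bf M (axis i 1) (axis j 1) = M $ i $ j"
  by (simp add: bf_def matrix_vector_mult_basis column_def inner_axis')

lemma bf_expand: "bf M u w = (\<Sum>i\<in>UNIV. \<Sum>j\<in>UNIV. u $ i * M $ i $ j * w $ j)"
  by (simp add: bf_def inner_vec_def matrix_vector_mult_def sum_distrib_left mult.assoc)

lemma bf_eqI: "(\<And>u w. bf M u w = bf N u w) \<Longrightarrow> M = N"
  by (metis bf_axis vec_eq_iff)

lemma smooth_on_bf:
  assumes U: "open U" and T: "smooth_on U T" and p: "smooth_on U p" and q: "smooth_on U q"
  shows "smooth_on U (\<lambda>y. bf (T y) (p y) (q y))"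
  unfolding bf_def
  by (rule smooth_on_bilinear[OF U bounded_bilinear_inner p smooth_on_bilinear[OF U bounded_bilinear_mv T q]])

lemma dd_bf:
  assumes U: "open U" "x \<in> U" and T: "smooth_on U T" and p: "smooth_on U p" and q: "smooth_on U q"
  shows "dd (\<lambda>y. bf (T y) (p y) (q y)) x z =
    bf (dd T x z) (p x) (q x) + bf (T x) (dd p x z) (q x) + bf (T x) (p x) (dd q x z)"
  unfolding bf_def
  by (simp add: dd_bilinear[OF bounded_bilinear_inner p smooth_on_bilinear[OF U(1) bounded_bilinear_mv T q] U]
      dd_bilinear[OF bounded_bilinear_mv T q U] inner_add_right algebra_simps)

lemma dd_bf_const:
  assumes U: "open U" "x \<in> U" and T: "smooth_on U T"
  shows "dd (\<lambda>y. bf (T y) v w) x z = bf (dd T x z) v w"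
  by (rule dd_linear_compose[OF bounded_linear_bf T U])

lemma smooth_on_mult:
  fixes f g :: "'a::euclidean_space \<Rightarrow> real"
  shows "open U \<Longrightarrow> smooth_on U f \<Longrightarrow> smooth_on U g \<Longrightarrow> smooth_on U (\<lambda>x. f x * g x)"
  by (rule smooth_on_bilinear[OF _ bounded_bilinear_mult])

lemma dd_mult:
  fixes f g :: "'a::euclidean_space \<Rightarrow> real"
  assumes "smooth_on U f" "smooth_on U g" "open U" "x \<in> U"
  shows "dd (\<lambda>y. f y * g y) x v = f x * dd g x v + dd f x v * g x"
  by (rule dd_bilinear[OF bounded_bilinear_mult assms])

lemma smooth_on_cmult: "open U \<Longrightarrow> smooth_on U f \<Longrightarrow> smooth_on U (\<lambda>x. c * (f x :: real))"
  by (rule smooth_on_linear_compose[OF _ bounded_linear_mult_right])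

lemma smooth_on_diff:
  "open S \<Longrightarrow> smooth_on S f \<Longrightarrow> smooth_on S g \<Longrightarrow> smooth_on S (\<lambda>x. f x - g x)"
  using smooth_on_add[of S f "\<lambda>x. - g x"] smooth_on_linear_compose[OF _ bounded_linear_minus[OF bounded_linear_ident], of S g]
  by simp

lemma smooth_on_prod:
  fixes f :: "'i \<Rightarrow> 'a::euclidean_space \<Rightarrow> real"
  assumes U: "open U" and "\<And>i. i \<in> I \<Longrightarrow> smooth_on U (f i)"
  shows "smooth_on U (\<lambda>x. \<Prod>i\<in>I. f i x)"
  using assms(2)
  by (induction I rule: infinite_finite_induct) (simp_all add: smooth_on_const[OF U] smooth_on_mult[OF U])

lemma smooth_on_det:
  fixes A :: "'a::euclidean_space \<Rightarrow> real^'n^'n::finite"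
  assumes U: "open U" and A: "\<And>i j. smooth_on U (\<lambda>x. A x $ i $ j)"
  shows "smooth_on U (\<lambda>x. det (A x))"
  unfolding det_def
  by (rule smooth_on_sum[OF U], rule smooth_on_cmult[OF U], rule smooth_on_prod[OF U], rule A)

lemma smooth_on_vecI:
  fixes f :: "'a::euclidean_space \<Rightarrow> 'b::euclidean_space^'n::finite"
  assumes U: "open U" and f: "\<And>i. smooth_on U (\<lambda>x. f x $ i)"
  shows "smooth_on U f"
proof -
  have "f x = (\<Sum>i\<in>UNIV. axis i (f x $ i))" for x
    by (simp add: vec_eq_iff axis_def)
  moreover have "smooth_on U (\<lambda>x. \<Sum>i\<in>UNIV. axis i (f x $ i))"
    by (rule smooth_on_sum[OF U], rule smooth_on_linear_compose[OF U _ f])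
      (simp add: linear_conv_bounded_linear[symmetric] linear_iff vec_eq_iff axis_def)
  ultimately show ?thesis by simp
qed

lemma smooth_on_nth: "open U \<Longrightarrow> smooth_on U f \<Longrightarrow> smooth_on U (\<lambda>x. f x $ i)"
  by (rule smooth_on_linear_compose[OF _ bounded_linear_vec_nth])

lemma mat_inv_right: "invertible A \<Longrightarrow> A ** matrix_inv A = Finite_Cartesian_Product.mat 1"
  and mat_inv_left: "invertible A \<Longrightarrow> matrix_inv A ** A = Finite_Cartesian_Product.mat 1"
  unfolding invertible_def matrix_inv_def by (rule someI2_ex, blast, simp)+

text \<open>Cramer's rule makes the solution a quotient of determinants, which are polynomial in the
  entries.\<close>

lemma smooth_on_matrix_inv_mv:
  fixes A :: "'a::euclidean_space \<Rightarrow> real^'n^'n::finite"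
  assumes U: "open U" and A: "smooth_on U A" and inv: "\<And>x. x \<in> U \<Longrightarrow> invertible (A x)" and b: "smooth_on U b"
  shows "smooth_on U (\<lambda>x. matrix_inv (A x) *v b x)"
proof (rule smooth_on_cong[OF U])
  let ?f = "\<lambda>x. (\<chi> k. det (\<chi> i j. if j = k then b x $ i else A x $ i $ j) * inverse (det (A x)))"
  have ent: "smooth_on U (\<lambda>x. A x $ i $ j)" for i j
    by (rule smooth_on_nth[OF U smooth_on_nth[OF U A]])
  show "?f x = matrix_inv (A x) *v b x" if "x \<in> U" for x
  proof -
    have "A x *v (matrix_inv (A x) *v b x) = b x"
      using mat_inv_right[OF inv[OF that]] by (simp add: matrix_vector_mul_assoc)
    moreover have "det (A x) \<noteq> 0" using inv[OF that] by (simp add: invertible_det_nz)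
    ultimately show ?thesis using cramer[of "A x" "matrix_inv (A x) *v b x" "b x"] by (simp add: divide_inverse)
  qed
  have "smooth_on U (\<lambda>x. det (\<chi> i j. if j = k then b x $ i else A x $ i $ j))" for k
  proof (rule smooth_on_det[OF U])
    fix i j
    show "smooth_on U (\<lambda>x. (\<chi> i j. if j = k then b x $ i else A x $ i $ j) $ i $ j)"
      by (cases "j = k") (simp_all add: ent smooth_on_nth[OF U b])
  qed
  moreover have "smooth_on U (\<lambda>x. inverse (det (A x)))"
    by (rule smooth_on_inverse[OF U smooth_on_det[OF U ent]]) (use inv in \<open>simp add: invertible_det_nz\<close>)
  ultimately show "smooth_on U ?f"
    by (intro smooth_on_vecI[OF U]) (simp add: smooth_on_mult[OF U])
qed

text \<open>
  \<open>chr G x u v\<close> is \<open>\<Gamma>(u, v)\<close>, obtained from the Koszul formula \<open>kos\<close>; \<open>curv G x z u v\<close> is \<open>R(z, u) v\<close>; \<open>hess\<close> is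
  the covariant derivative of a covector field \<open>\<psi>\<close>. Covectors are represented through the standard inner
  product, so in \<open>eisen\<close> the covector \<open>\<psi>\<close> plays the role of \<open>d\<phi>\<close>.
\<close>

definition kos :: "(real^'n \<Rightarrow> real^'n^'n::finite) \<Rightarrow> real^'n \<Rightarrow> real^'n \<Rightarrow> real^'n \<Rightarrow> real^'n \<Rightarrow> real" where
  "kos G x u v w = (bf (dd G x u) v w + bf (dd G x v) u w - bf (dd G x w) u v) / 2"

definition chr :: "(real^'n \<Rightarrow> real^'n^'n::finite) \<Rightarrow> real^'n \<Rightarrow> real^'n \<Rightarrow> real^'n \<Rightarrow> real^'n" where
  "chr G x u v = matrix_inv (G x) *v (\<chi> l. kos G x u v (axis l 1))"

definition curv :: "(real^'n \<Rightarrow> real^'n^'n::finite) \<Rightarrow> real^'n \<Rightarrow> real^'n \<Rightarrow> real^'n \<Rightarrow> real^'n \<Rightarrow> real^'n" where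
  "curv G x z u v = dd (\<lambda>y. chr G y u v) x z - dd (\<lambda>y. chr G y z v) x u
     + chr G x z (chr G x u v) - chr G x u (chr G x z v)"

definition hess :: "(real^'n \<Rightarrow> real^'n^'n::finite) \<Rightarrow> (real^'n \<Rightarrow> real^'n) \<Rightarrow> real^'n \<Rightarrow> real^'n \<Rightarrow> real^'n \<Rightarrow> real" where
  "hess G \<psi> x u v = dd \<psi> x u \<bullet> v - \<psi> x \<bullet> chr G x u v"

definition eisen :: "(real^'n) set \<Rightarrow> (real^'n \<Rightarrow> real^'n^'n::finite) \<Rightarrow> (real^'n \<Rightarrow> real^'n^'n) \<Rightarrow> (real^'n \<Rightarrow> real^'n) \<Rightarrow> bool" where
  "eisen U G T \<psi> \<longleftrightarrow> (\<forall>x\<in>U. \<forall>u v w. bf (dd T x u) v w =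
     bf (T x) (chr G x u v) w + bf (T x) v (chr G x u w) +
     2 * (\<psi> x \<bullet> u) * bf (G x) v w + (\<psi> x \<bullet> v) * bf (G x) u w + (\<psi> x \<bullet> w) * bf (G x) u v)"

locale chart_metric =
  fixes U :: "(real^'n::finite) set" and G :: "real^'n \<Rightarrow> real^'n^'n"
  assumes U: "open U" and G: "smooth_on U G"
    and Gsym: "x \<in> U \<Longrightarrow> bf (G x) v w = bf (G x) w v" and Ginv: "x \<in> U \<Longrightarrow> invertible (G x)"
begin

lemma nondeg: "x \<in> U \<Longrightarrow> (\<And>w. bf (G x) v w = 0) \<Longrightarrow> v = 0"
proof -
  assume x: "x \<in> U" and 0: "\<And>w. bf (G x) v w = 0"
  have "bf (G x) v (matrix_inv (G x) *v v) = v \<bullet> v"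
    using mat_inv_right[OF Ginv[OF x]] by (simp add: bf_def matrix_vector_mul_assoc)
  then show "v = 0" using 0 by simp
qed

lemma G_eqI: "x \<in> U \<Longrightarrow> (\<And>w. bf (G x) u w = bf (G x) v w) \<Longrightarrow> u = v"
  using nondeg[of x "u - v"] by (simp add: bf_simps)

lemma dd_sym:
  assumes T: "smooth_on U T" "\<And>x v w. x \<in> U \<Longrightarrow> bf (T x) v w = bf (T x) w v" and x: "x \<in> U"
  shows "bf (dd T x z) v w = bf (dd T x z) w v"
proof -
  have "dd (\<lambda>y. bf (T y) v w) x = dd (\<lambda>y. bf (T y) w v) x"
    by (rule dd_cong_open[OF U x T(2)])
  then show ?thesis by (simp add: dd_bf_const[OF U x T(1)] fun_eq_iff)
qed

lemma ddG: "x \<in> U \<Longrightarrow> linear (dd G x)"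
  by (rule dd_linear[OF G U])

lemma kos_linear:
  assumes "x \<in> U"
  shows "linear (\<lambda>w. kos G x u v w)" "linear (\<lambda>v. kos G x u v w)" "linear (\<lambda>u. kos G x u v w)"
  unfolding kos_def
  by (rule linearI; simp add: linear_add[OF ddG[OF assms]] linear_scale[OF ddG[OF assms]] bf_simps bf_mat_simps field_simps)+

lemma chr_kos: assumes x: "x \<in> U" shows "bf (G x) w (chr G x u v) = kos G x u v w"
proof -
  have "bf (G x) w (chr G x u v) = w \<bullet> (\<chi> l. kos G x u v (axis l 1))"
    using mat_inv_right[OF Ginv[OF x]] by (simp add: bf_def chr_def matrix_vector_mul_assoc)
  also have "\<dots> = (\<Sum>l\<in>UNIV. w $ l * kos G x u v (axis l 1))" by (simp add: inner_vec_def)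
  also have "\<dots> = kos G x u v (\<Sum>l\<in>UNIV. w $ l *\<^sub>R axis l 1)"
    by (simp add: linear_sum[OF kos_linear(1)[OF x]] linear_scale[OF kos_linear(1)[OF x]])
  also have "(\<Sum>l\<in>UNIV. w $ l *\<^sub>R axis l 1) = w" by (simp add: vec_eq_iff axis_def if_distrib cong: if_cong)
  finally show ?thesis .
qed

lemma chr_kos': "x \<in> U \<Longrightarrow> bf (G x) (chr G x u v) w = kos G x u v w"
  using Gsym chr_kos by metis

lemma chr_linear: assumes "x \<in> U" shows "linear (chr G x u)" "linear (\<lambda>u. chr G x u v)"
proof -
  show "linear (chr G x u)"
    by (rule linearI; rule G_eqI[OF assms])
      (simp_all add: bf_simps chr_kos'[OF assms] linear_add[OF kos_linear(2)[OF assms]] linear_scale[OF kos_linear(2)[OF assms]])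
  show "linear (\<lambda>u. chr G x u v)"
    by (rule linearI; rule G_eqI[OF assms])
      (simp_all add: bf_simps chr_kos'[OF assms] linear_add[OF kos_linear(3)[OF assms]] linear_scale[OF kos_linear(3)[OF assms]])
qed

lemma chr_sym: assumes x: "x \<in> U" shows "chr G x u v = chr G x v u"
proof (rule G_eqI[OF x])
  show "bf (G x) (chr G x u v) w = bf (G x) (chr G x v u) w" for w
    unfolding chr_kos'[OF x] kos_def using dd_sym[OF G Gsym x, of w u v] by simp
qed

lemma compat:
  assumes x: "x \<in> U"
  shows "bf (dd G x u) v w = bf (G x) (chr G x u v) w + bf (G x) v (chr G x u w)"
  unfolding chr_kos'[OF x] chr_kos[OF x] kos_def
  using dd_sym[OF G Gsym x, of u v w] by (simp add: field_simps)

lemma smooth_kos: "smooth_on U (\<lambda>x. kos G x u v w)"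
  unfolding kos_def divide_inverse
  by (intro smooth_on_mult[OF U] smooth_on_const[OF U] smooth_on_diff[OF U] smooth_on_add[OF U]
      smooth_on_linear_compose[OF U bounded_linear_bf] smooth_on_dd[OF G])

lemma smooth_chr: "smooth_on U (\<lambda>x. chr G x u v)"
  unfolding chr_def
  by (rule smooth_on_matrix_inv_mv[OF U G Ginv], assumption, rule smooth_on_vecI[OF U]) (simp add: smooth_kos)

lemma curv_linear: assumes x: "x \<in> U" shows "linear (curv G x z u)"
proof -
  have d: "linear (\<lambda>v. dd (\<lambda>y. chr G y u v) x z)" for u z
  proof (rule linearI)
    fix v w and c :: real
    have "dd (\<lambda>y. chr G y u (v + w)) x = dd (\<lambda>y. chr G y u v + chr G y u w) x"
      by (rule dd_cong_open[OF U x]) (rule linear_add[OF chr_linear(1)])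
    then show "dd (\<lambda>y. chr G y u (v + w)) x z = dd (\<lambda>y. chr G y u v) x z + dd (\<lambda>y. chr G y u w) x z"
      by (simp add: dd_add[OF smooth_chr smooth_chr U x])
    have "dd (\<lambda>y. chr G y u (c *\<^sub>R v)) x = dd (\<lambda>y. c *\<^sub>R chr G y u v) x"
      by (rule dd_cong_open[OF U x]) (rule linear_scale[OF chr_linear(1)])
    then show "dd (\<lambda>y. chr G y u (c *\<^sub>R v)) x z = c *\<^sub>R dd (\<lambda>y. chr G y u v) x z"
      by (simp add: dd_linear_compose[OF bounded_linear_scaleR_right smooth_chr U x])
  qed
  have c: "linear (\<lambda>v. chr G x z (chr G x u v))" for z u
    using linear_compose[OF chr_linear(1)[OF x] chr_linear(1)[OF x]] by (simp add: o_def)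
  show ?thesis unfolding curv_def by (intro linear_compose_add linear_compose_sub d c)
qed

lemma dd_eisen_rhs:
  assumes T: "smooth_on U T" and \<psi>: "smooth_on U \<psi>" and x: "x \<in> U"
  shows "dd (\<lambda>x. bf (T x) (chr G x u v) w + bf (T x) v (chr G x u w) +
     2 * (\<psi> x \<bullet> u) * bf (G x) v w + (\<psi> x \<bullet> v) * bf (G x) u w + (\<psi> x \<bullet> w) * bf (G x) u v) x z =
     bf (dd T x z) (chr G x u v) w + bf (T x) (dd (\<lambda>y. chr G y u v) x z) w +
     bf (dd T x z) v (chr G x u w) + bf (T x) v (dd (\<lambda>y. chr G y u w) x z) +
     2 * ((dd \<psi> x z \<bullet> u) * bf (G x) v w + (\<psi> x \<bullet> u) * bf (dd G x z) v w) +
     ((dd \<psi> x z \<bullet> v) * bf (G x) u w + (\<psi> x \<bullet> v) * bf (dd G x z) u w) +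
     ((dd \<psi> x z \<bullet> w) * bf (G x) u v + (\<psi> x \<bullet> w) * bf (dd G x z) u v)"
proof -
  have d: "(f has_derivative dd f x) (at x)" if "smooth_on U f" for f :: "real^'n \<Rightarrow> 'b::real_normed_vector"
    by (rule smooth_on_deriv[OF that U x])
  have t: "((\<lambda>y. bf (M y) (p y) (q y)) has_derivative
     (\<lambda>z. bf (dd M x z) (p x) (q x) + bf (M x) (dd p x z) (q x) + bf (M x) (p x) (dd q x z))) (at x)"
    if "smooth_on U M" "smooth_on U p" "smooth_on U q" for M p q
  proof -
    have "dd (\<lambda>y. bf (M y) (p y) (q y)) x =
       (\<lambda>z. bf (dd M x z) (p x) (q x) + bf (M x) (dd p x z) (q x) + bf (M x) (p x) (dd q x z))"
      by (rule ext) (rule dd_bf[OF U x that])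
    with d[OF smooth_on_bf[OF U that]] show ?thesis by (simp only:)
  qed
  have i: "((\<lambda>y. \<psi> y \<bullet> c) has_derivative (\<lambda>z. dd \<psi> x z \<bullet> c)) (at x)" for c
    by (rule has_derivative_inner_left[OF d[OF \<psi>]])
  have k: "smooth_on U (\<lambda>y. c)" for c :: "real^'n" by (rule smooth_on_const[OF U])
  note c0 = frechet_derivative_const
  have "((\<lambda>x. bf (T x) (chr G x u v) w + bf (T x) v (chr G x u w) +
     2 * (\<psi> x \<bullet> u) * bf (G x) v w + (\<psi> x \<bullet> v) * bf (G x) u w + (\<psi> x \<bullet> w) * bf (G x) u v) has_derivative (\<lambda>z.
     bf (dd T x z) (chr G x u v) w + bf (T x) (dd (\<lambda>y. chr G y u v) x z) w +
     bf (dd T x z) v (chr G x u w) + bf (T x) v (dd (\<lambda>y. chr G y u w) x z) +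
     2 * ((dd \<psi> x z \<bullet> u) * bf (G x) v w + (\<psi> x \<bullet> u) * bf (dd G x z) v w) +
     ((dd \<psi> x z \<bullet> v) * bf (G x) u w + (\<psi> x \<bullet> v) * bf (dd G x z) u w) +
     ((dd \<psi> x z \<bullet> w) * bf (G x) u v + (\<psi> x \<bullet> w) * bf (dd G x z) u v))) (at x)"
    by (rule derivative_eq_intros t[OF T smooth_chr k] t[OF T k smooth_chr] t[OF G k k] i refl)+
      (simp add: bf_simps algebra_simps)
  from dd_eq[OF this] show ?thesis by simp
qed

text \<open>Second derivatives of \<open>T\<close> commute. Replacing first derivatives by the
  Eisenhart equation in both orders leaves the curvature terms and the Hessian terms; closedness of
  \<open>\<psi>\<close> cancels the terms with \<open>bf (G x) v w\<close>.\<close>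

lemma ricci:
  assumes T: "smooth_on U T" and Ts: "\<And>x v w. x \<in> U \<Longrightarrow> bf (T x) v w = bf (T x) w v"
    and \<psi>: "smooth_on U \<psi>" and cl: "\<And>x u v. x \<in> U \<Longrightarrow> dd \<psi> x u \<bullet> v = dd \<psi> x v \<bullet> u"
    and E: "eisen U G T \<psi>" and x: "x \<in> U"
  shows "bf (T x) (curv G x z u v) w + bf (T x) v (curv G x z u w)
     + bf (G x) u w * hess G \<psi> x z v - bf (G x) z w * hess G \<psi> x u v
     + bf (G x) u v * hess G \<psi> x z w - bf (G x) z v * hess G \<psi> x u w = 0"
proof -
  have E': "bf (dd T x u) v w =
     bf (T x) (chr G x u v) w + bf (T x) v (chr G x u w) +
     2 * (\<psi> x \<bullet> u) * bf (G x) v w + (\<psi> x \<bullet> v) * bf (G x) u w + (\<psi> x \<bullet> w) * bf (G x) u v" if "x \<in> U" for x u v w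
    using E that unfolding eisen_def by blast
  have D: "bf (dd (\<lambda>y. dd T y u) x z) v w =
     bf (dd T x z) (chr G x u v) w + bf (T x) (dd (\<lambda>y. chr G y u v) x z) w +
     bf (dd T x z) v (chr G x u w) + bf (T x) v (dd (\<lambda>y. chr G y u w) x z) +
     2 * ((dd \<psi> x z \<bullet> u) * bf (G x) v w + (\<psi> x \<bullet> u) * bf (dd G x z) v w) +
     ((dd \<psi> x z \<bullet> v) * bf (G x) u w + (\<psi> x \<bullet> v) * bf (dd G x z) u w) +
     ((dd \<psi> x z \<bullet> w) * bf (G x) u v + (\<psi> x \<bullet> w) * bf (dd G x z) u v)" for u z
  proof -
    have "bf (dd (\<lambda>y. dd T y u) x z) v w = dd (\<lambda>y. bf (dd T y u) v w) x z"
      by (rule dd_bf_const[OF U x smooth_on_dd[OF T], symmetric])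
    also have "\<dots> = dd (\<lambda>x. bf (T x) (chr G x u v) w + bf (T x) v (chr G x u w) +
     2 * (\<psi> x \<bullet> u) * bf (G x) v w + (\<psi> x \<bullet> v) * bf (G x) u w + (\<psi> x \<bullet> w) * bf (G x) u v) x z"
      by (rule fun_cong[OF dd_cong_open[OF U x E']])
    finally show ?thesis unfolding dd_eisen_rhs[OF T \<psi> x] .
  qed
  have sw: "bf (dd (\<lambda>y. dd T y u) x z) v w = bf (dd (\<lambda>y. dd T y z) x u) v w"
    by (simp add: dd_commute[OF T U x, of u z])
  have s: "chr G x u z = chr G x z u" by (rule chr_sym[OF x])
  have gs: "bf (G x) u z = bf (G x) z u" "bf (G x) v (chr G x z w) = bf (G x) (chr G x z w) v"
    "bf (G x) v (chr G x u w) = bf (G x) (chr G x u w) v"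
    "bf (G x) u (chr G x z w) = bf (G x) (chr G x z w) u" "bf (G x) u (chr G x z v) = bf (G x) (chr G x z v) u"
    "bf (G x) z (chr G x u w) = bf (G x) (chr G x u w) z" "bf (G x) z (chr G x u v) = bf (G x) (chr G x u v) z"
    by (rule Gsym[OF x])+
  have "bf (T x) (curv G x z u v) w + bf (T x) v (curv G x z u w)
     + bf (G x) u w * hess G \<psi> x z v - bf (G x) z w * hess G \<psi> x u v
     + bf (G x) u v * hess G \<psi> x z w - bf (G x) z v * hess G \<psi> x u w =
     bf (dd (\<lambda>y. dd T y u) x z) v w - bf (dd (\<lambda>y. dd T y z) x u) v w"
    unfolding D E'[OF x] compat[OF x] curv_def hess_def bf_simps gs s cl[OF x, of z u]
    by (simp add: algebra_simps)
  then show ?thesis using sw by simp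
qed

text \<open>By compatibility the metric itself solves the Eisenhart equation with zero covector, and
  its Ricci identity is the skewness.\<close>

lemma curv_skew: assumes x: "x \<in> U" shows "bf (G x) (curv G x z u v) w = - bf (G x) v (curv G x z u w)"
proof -
  have "eisen U G G (\<lambda>x. 0)" by (simp add: eisen_def compat)
  from ricci[OF G Gsym smooth_on_const[OF U] _ this x, of z u v w]
  show ?thesis by (simp add: hess_def)
qed

text \<open>The antisymmetrized second covariant derivative of \<open>\<psi>\<close>. The terms with
  \<Gamma>(z, u) do not appear since they cancel by symmetry of the connection.\<close>

lemma ricci_covector:
  assumes \<psi>: "smooth_on U \<psi>" and x: "x \<in> U"
  shows "\<psi> x \<bullet> curv G x z u v + (dd (\<lambda>y. hess G \<psi> y u v) x z + hess G \<psi> x z (chr G x u v))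
    - (dd (\<lambda>y. hess G \<psi> y z v) x u + hess G \<psi> x u (chr G x z v)) = 0"
proof -
  have D: "dd (\<lambda>y. hess G \<psi> y u v) x z = dd (\<lambda>y. dd \<psi> y u) x z \<bullet> v -
     (\<psi> x \<bullet> dd (\<lambda>y. chr G y u v) x z + dd \<psi> x z \<bullet> chr G x u v)" for u z
    unfolding hess_def
    by (rule fun_cong[OF dd_eq[OF has_derivative_diff[OF
      has_derivative_inner_left[OF smooth_on_deriv[OF smooth_on_dd[OF \<psi>] U x]]
      bounded_bilinear.FDERIV[OF bounded_bilinear_inner smooth_on_deriv[OF \<psi> U x] smooth_on_deriv[OF smooth_chr U x]]]]])
  show ?thesis unfolding D dd_commute[OF \<psi> U x, of u z]
    by (simp add: hess_def curv_def inner_add_right inner_diff_right)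
qed

end

section \<open>Lie derivatives and variations of curves\<close>

lemma bf_matrix_mult: "bf (M ** J) v w = bf M v (J *v w)"
  "bf (Finite_Cartesian_Product.transpose J ** M) v w = bf M (J *v v) w"
proof -
  show "bf (M ** J) v w = bf M v (J *v w)" by (simp add: bf_def matrix_vector_mul_assoc)
  have "bf (Finite_Cartesian_Product.transpose J ** M) v w = v \<bullet> ((M *v w) v* J)"
    by (simp only: bf_def matrix_vector_mul_assoc[symmetric] transpose_matrix_vector)
  also have "\<dots> = bf M (J *v v) w"
    unfolding bf_def inner_commute[of v] dot_lmul_matrix by (rule inner_commute)
  finally show "bf (Finite_Cartesian_Product.transpose J ** M) v w = bf M (J *v v) w" .
qed

text \<open>
  \<open>lieG\<close> and \<open>lie_chr\<close> are the Lie derivatives of the metric and of its connection. For a map \<open>p\<close> with several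
  parameters, \<open>acc G p d\<close> is the covariant acceleration of its curves in the parameter direction \<open>d\<close>.
\<close>

definition lieG :: "(real^'n \<Rightarrow> real^'n^'n::finite) \<Rightarrow> (real^'n \<Rightarrow> real^'n) \<Rightarrow> real^'n \<Rightarrow> real^'n^'n" where
  "lieG G X x = dd G x (X x) + Finite_Cartesian_Product.transpose (matrix (dd X x)) ** G x + G x ** matrix (dd X x)"

definition lie_chr :: "(real^'n \<Rightarrow> real^'n^'n::finite) \<Rightarrow> (real^'n \<Rightarrow> real^'n) \<Rightarrow> real^'n \<Rightarrow> real^'n \<Rightarrow> real^'n \<Rightarrow> real^'n" where
  "lie_chr G X x u v = dd (\<lambda>y. dd X y v) x u + dd (\<lambda>y. chr G y u v) x (X x)
     + chr G x (dd X x u) v + chr G x u (dd X x v) - dd X x (chr G x u v)"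

definition acc :: "(real^'n \<Rightarrow> real^'n^'n::finite) \<Rightarrow> ('a::euclidean_space \<Rightarrow> real^'n) \<Rightarrow> 'a \<Rightarrow> 'a \<Rightarrow> real^'n" where
  "acc G p d q = dd (\<lambda>q. dd p q d) q d + chr G (p q) (dd p q d) (dd p q d)"

context chart_metric
begin

lemma bf_lieG:
  assumes X: "smooth_on U X" and x: "x \<in> U"
  shows "bf (lieG G X x) v w = bf (dd G x (X x)) v w + bf (G x) (dd X x v) w + bf (G x) v (dd X x w)"
  unfolding lieG_def bf_mat_simps bf_matrix_mult(2)
  unfolding bf_matrix_mult(1) matrix_vector_mul(2)[OF dd_linear[OF X U x]] by (rule refl)

lemma smooth_dd_vec:
  fixes f :: "real^'n \<Rightarrow> 'b::euclidean_space"
  assumes f: "smooth_on U f" and X: "smooth_on U X"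
  shows "smooth_on U (\<lambda>y. dd f y (X y))"
  by (rule smooth_on_linear_family[where \<Phi>="\<lambda>y. dd f y", OF U dd_linear[OF f U] smooth_on_dd[OF f] X])

lemma dd_dd_vec:
  fixes f :: "real^'n \<Rightarrow> 'b::euclidean_space"
  assumes f: "smooth_on U f" and X: "smooth_on U X" and x: "x \<in> U"
  shows "dd (\<lambda>y. dd f y (X y)) x u = dd (\<lambda>y. dd f y (X x)) x u + dd f x (dd X x u)"
  by (rule dd_linear_family[where \<Phi>="\<lambda>y. dd f y", OF U dd_linear[OF f U] smooth_on_dd[OF f] X x])

lemma lieG_sym: "smooth_on U X \<Longrightarrow> x \<in> U \<Longrightarrow> bf (lieG G X x) v w = bf (lieG G X x) w v"
  using dd_sym[OF G Gsym, of x "X x" v w] Gsym[of x v "dd X x w"] Gsym[of x "dd X x v" w]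
  by (simp add: bf_lieG)

lemma smooth_lieG:
  assumes X: "smooth_on U X" shows "smooth_on U (lieG G X)"
proof (rule smooth_on_vecI[OF U], rule smooth_on_vecI[OF U], rule smooth_on_cong[OF U])
  fix i j :: 'n
  let ?v = "axis i 1 :: real^'n" and ?w = "axis j 1 :: real^'n"
  show "bf (dd G y (X y)) ?v ?w + bf (G y) (dd X y ?v) ?w + bf (G y) ?v (dd X y ?w) = lieG G X y $ i $ j"
    if "y \<in> U" for y
    unfolding bf_lieG[OF X that, symmetric] by (rule bf_axis)
  show "smooth_on U (\<lambda>y. bf (dd G y (X y)) ?v ?w + bf (G y) (dd X y ?v) ?w + bf (G y) ?v (dd X y ?w))"
    by (intro smooth_on_add[OF U] smooth_on_bf[OF U] smooth_dd_vec[OF G X] smooth_on_const[OF U] G smooth_on_dd[OF X])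
qed

text \<open>Lie differentiation of \<open>compat\<close>: the covariant derivative of the Lie
  derivative of the metric is the Lie derivative of the connection with its upper index lowered,
  symmetrized in \<open>v\<close> and \<open>w\<close>.\<close>

lemma lie_cov:
  assumes X: "smooth_on U X" and x: "x \<in> U"
  shows "bf (dd (lieG G X) x u) v w = bf (lieG G X x) (chr G x u v) w + bf (lieG G X x) v (chr G x u w) +
     bf (G x) (lie_chr G X x u v) w + bf (G x) v (lie_chr G X x u w)"
proof -
  have k: "smooth_on U (\<lambda>y. c)" for c :: "real^'n" by (rule smooth_on_const[OF U])
  have "bf (dd (lieG G X) x u) v w = dd (\<lambda>y. bf (lieG G X y) v w) x u"
    by (rule dd_bf_const[OF U x smooth_lieG[OF X], symmetric])
  also have "\<dots> = dd (\<lambda>y. bf (dd G y (X y)) v w + bf (G y) (dd X y v) w + bf (G y) v (dd X y w)) x u"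
    by (rule fun_cong[OF dd_cong_open[OF U x bf_lieG[OF X]]])
  also have "\<dots> = bf (dd (\<lambda>y. dd G y (X y)) x u) v w
     + (bf (dd G x u) (dd X x v) w + bf (G x) (dd (\<lambda>y. dd X y v) x u) w)
     + (bf (dd G x u) v (dd X x w) + bf (G x) v (dd (\<lambda>y. dd X y w) x u))"
    by (simp add: dd_add[OF smooth_on_add[OF U] _ U x] dd_add[OF _ _ U x] smooth_on_bf[OF U] smooth_dd_vec[OF G X] k G smooth_on_dd[OF X]
        dd_bf[OF U x smooth_dd_vec[OF G X] k k] dd_bf[OF U x G smooth_on_dd[OF X] k] dd_bf[OF U x G k smooth_on_dd[OF X]] bf_simps)
  also have "dd (\<lambda>y. dd G y (X y)) x u = dd (\<lambda>y. dd G y u) x (X x) + dd G x (dd X x u)"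
    unfolding dd_dd_vec[OF G X x] dd_commute[OF G U x, of "X x" u] by (rule refl)
  finally have 1: "bf (dd (lieG G X) x u) v w = bf (dd (\<lambda>y. dd G y u) x (X x)) v w + bf (dd G x (dd X x u)) v w
     + (bf (dd G x u) (dd X x v) w + bf (G x) (dd (\<lambda>y. dd X y v) x u) w)
     + (bf (dd G x u) v (dd X x w) + bf (G x) v (dd (\<lambda>y. dd X y w) x u))" unfolding bf_mat_simps .
  have "bf (dd (\<lambda>y. dd G y u) x (X x)) v w = dd (\<lambda>y. bf (dd G y u) v w) x (X x)"
    by (rule dd_bf_const[OF U x smooth_on_dd[OF G], symmetric])
  also have "\<dots> = dd (\<lambda>y. bf (G y) (chr G y u v) w + bf (G y) v (chr G y u w)) x (X x)"
    by (rule fun_cong[OF dd_cong_open[OF U x compat]])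
  also have "\<dots> = bf (dd G x (X x)) (chr G x u v) w + bf (G x) (dd (\<lambda>y. chr G y u v) x (X x)) w +
      (bf (dd G x (X x)) v (chr G x u w) + bf (G x) v (dd (\<lambda>y. chr G y u w) x (X x)))"
    by (simp add: dd_add[OF _ _ U x] smooth_on_bf[OF U] k G smooth_chr
        dd_bf[OF U x G smooth_chr k] dd_bf[OF U x G k smooth_chr] bf_simps)
  finally have 2: "bf (dd (\<lambda>y. dd G y u) x (X x)) v w = \<dots>" .
  show ?thesis
    unfolding 1 2 bf_lieG[OF X x] lie_chr_def bf_simps compat[OF x, of "dd X x u"] compat[OF x, of u] by simp
qed

lemma lie_chr_sym:
  assumes X: "smooth_on U X" and x: "x \<in> U" shows "lie_chr G X x u v = lie_chr G X x v u"
proof -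
  have "dd (\<lambda>y. chr G y u v) x = dd (\<lambda>y. chr G y v u) x"
    by (rule dd_cong_open[OF U x chr_sym])
  then show ?thesis
    unfolding lie_chr_def dd_commute[OF X U x, of v u] chr_sym[OF x, of u v]
      chr_sym[OF x, of "dd X x u" v] chr_sym[OF x, of u "dd X x v"] by simp
qed

lemma smooth_lie_chr: assumes X: "smooth_on U X" shows "smooth_on U (\<lambda>x. lie_chr G X x u v)"
proof -
  have 1: "smooth_on U (\<lambda>y. chr G y u (p y))" if "smooth_on U p" for p u
    by (rule smooth_on_linear_family[where \<Phi>="\<lambda>y. chr G y u", OF U chr_linear(1) smooth_chr that])
  have 2: "smooth_on U (\<lambda>y. chr G y (p y) v)" if "smooth_on U p" for p v
    by (rule smooth_on_linear_family[where \<Phi>="\<lambda>y u. chr G y u v", OF U chr_linear(2) smooth_chr that])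
  show ?thesis unfolding lie_chr_def
    by (intro smooth_on_add[OF U] smooth_on_diff[OF U] smooth_on_dd[OF smooth_on_dd[OF X]]
      smooth_dd_vec[OF smooth_chr X] smooth_dd_vec[OF X smooth_chr] 1 2 smooth_on_dd[OF X])
qed

text \<open>As for the uniqueness of the Levi-Civita connection: the difference \<open>A\<close> of
  the two sides is symmetric in its arguments, while \<open>bf (G x) (A u v) w\<close> is skew in
  \<open>v\<close> and \<open>w\<close>; six exchanges bring the expression back with the opposite
  sign.\<close>

lemma eisen_lieG_iff:
  assumes X: "smooth_on U X"
  shows "eisen U G (lieG G X) \<psi> \<longleftrightarrow> (\<forall>x\<in>U. \<forall>u v. lie_chr G X x u v = (\<psi> x \<bullet> u) *\<^sub>R v + (\<psi> x \<bullet> v) *\<^sub>R u)"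
    (is "_ \<longleftrightarrow> ?R")
proof
  assume ?R
  then show "eisen U G (lieG G X) \<psi>"
    unfolding eisen_def
  proof (intro ballI allI)
    fix x u v w assume r: ?R and x: "x \<in> U"
    show "bf (dd (lieG G X) x u) v w = bf (lieG G X x) (chr G x u v) w + bf (lieG G X x) v (chr G x u w) +
       2 * (\<psi> x \<bullet> u) * bf (G x) v w + (\<psi> x \<bullet> v) * bf (G x) u w + (\<psi> x \<bullet> w) * bf (G x) u v"
      unfolding lie_cov[OF X x] r[rule_format, OF x] bf_simps Gsym[OF x, of v u] by (simp add: algebra_simps)
  qed
next
  assume E: "eisen U G (lieG G X) \<psi>"
  show ?R
  proof (intro ballI allI)
    fix x u v assume x: "x \<in> U"
    define A where "A u v = lie_chr G X x u v - ((\<psi> x \<bullet> u) *\<^sub>R v + (\<psi> x \<bullet> v) *\<^sub>R u)" for u v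
    have sy: "A u v = A v u" for u v unfolding A_def by (simp add: lie_chr_sym[OF X x, of u v])
    have sk: "bf (G x) (A u v) w = - bf (G x) (A u w) v" for u v w
    proof -
      have "bf (G x) (lie_chr G X x u v) w + bf (G x) v (lie_chr G X x u w) =
         2 * (\<psi> x \<bullet> u) * bf (G x) v w + (\<psi> x \<bullet> v) * bf (G x) u w + (\<psi> x \<bullet> w) * bf (G x) u v"
        using E[unfolded eisen_def, rule_format, OF x, of u v w] unfolding lie_cov[OF X x] by simp
      then show ?thesis unfolding A_def bf_simps
        using Gsym[OF x, of v "lie_chr G X x u w"] Gsym[OF x, of v w] Gsym[OF x, of u v] Gsym[OF x, of u w]
        by (simp add: algebra_simps)
    qed
    have "bf (G x) (A u v) w = 0" for w
    proof -
      have "bf (G x) (A u v) w = - bf (G x) (A u w) v" by (rule sk)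
      also have "\<dots> = - bf (G x) (A w u) v" by (simp add: sy[of u w])
      also have "\<dots> = bf (G x) (A w v) u" using sk[of w u v] by simp
      also have "\<dots> = bf (G x) (A v w) u" by (simp add: sy[of w v])
      also have "\<dots> = - bf (G x) (A v u) w" by (rule sk)
      also have "\<dots> = - bf (G x) (A u v) w" by (simp add: sy[of u v])
      finally show ?thesis by simp
    qed
    then have "A u v = 0" by (rule nondeg[OF x])
    then show "lie_chr G X x u v = (\<psi> x \<bullet> u) *\<^sub>R v + (\<psi> x \<bullet> v) *\<^sub>R u" by (simp add: A_def)
  qed
qed

text \<open>Contraction with the inverse metric: the derivative of the trace of the endomorphism is
  \<open>2 * (n + 1)\<close> times \<open>\<psi>\<close>, where the first term of the equation
  contributes \<open>2 * n\<close> and the other two contribute 1 each. So the covector of any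
  solution is a gradient, although \<open>eisen\<close> does not say so.\<close>

lemma eisen_potential:
  assumes B: "smooth_on U B" and E: "eisen U G B \<psi>"
  defines "\<phi> \<equiv> \<lambda>x. (\<Sum>i\<in>Basis. (matrix_inv (G x) *v (B x *v i)) \<bullet> i) / (2 * (real CARD('n) + 1))"
  shows "smooth_on U \<phi>" "x \<in> U \<Longrightarrow> dd \<phi> x u = \<psi> x \<bullet> u"
proof -
  define L where "L x v = matrix_inv (G x) *v (B x *v v)" for x v
  have sL: "smooth_on U (\<lambda>x. L x v)" for v
    unfolding L_def
    by (rule smooth_on_matrix_inv_mv[OF U G Ginv], assumption,
        rule smooth_on_bilinear[OF U bounded_bilinear_mv B smooth_on_const[OF U]])
  define c where "c = inverse (2 * (real CARD('n) + 1))"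
  have \<phi>: "\<phi> = (\<lambda>x. c * (\<Sum>i\<in>Basis. L x i \<bullet> i))"
    by (simp add: \<phi>_def c_def L_def divide_inverse mult.commute)
  have s: "smooth_on U (\<lambda>x. \<Sum>i\<in>Basis. L x i \<bullet> i)"
    by (rule smooth_on_sum[OF U], rule smooth_on_linear_compose[OF U bounded_linear_inner_left sL])
  show "smooth_on U \<phi>" unfolding \<phi> by (rule smooth_on_cmult[OF U s])
  assume x: "x \<in> U"
  have GL: "bf (G y) w (L y v) = bf (B y) w v" if "y \<in> U" for y v w
    using mat_inv_right[OF Ginv[OF that]] by (simp add: bf_def L_def matrix_vector_mul_assoc matrix_mul_assoc)
  define f where "f i = matrix_inv (G x) *v i" for i
  have Gf: "bf (G x) z (f i) = z \<bullet> i" for z i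
    using mat_inv_right[OF Ginv[OF x]] by (simp add: bf_def f_def matrix_vector_mul_assoc)
  have Gf': "bf (G x) (f i) z = i \<bullet> z" for z i using Gf[of z i] Gsym[OF x, of "f i" z] by (simp add: inner_commute)
  have k: "smooth_on U (\<lambda>y. c)" for c :: "real^'n" by (rule smooth_on_const[OF U])
  have dGL: "bf (dd G x u) w (L x v) + bf (G x) w (dd (\<lambda>y. L y v) x u) = bf (dd B x u) w v" for w v
  proof -
    have "dd (\<lambda>y. bf (G y) w (L y v)) x u = dd (\<lambda>y. bf (B y) w v) x u"
      by (rule fun_cong[OF dd_cong_open[OF U x GL]])
    then show ?thesis by (simp add: dd_bf[OF U x G k sL] dd_bf_const[OF U x B] bf_simps)
  qed
  have each: "dd (\<lambda>y. L y i) x u \<bullet> i = L x (chr G x u i) \<bullet> i - chr G x u (L x i) \<bullet> i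
      + 2 * (\<psi> x \<bullet> u) * (i \<bullet> i) + (\<psi> x \<bullet> f i) * bf (G x) u i + (\<psi> x \<bullet> i) * (u \<bullet> i)" for i
  proof -
    have "dd (\<lambda>y. L y i) x u \<bullet> i = bf (G x) (f i) (dd (\<lambda>y. L y i) x u)" by (simp add: Gf' inner_commute)
    also have "\<dots> = bf (dd B x u) (f i) i - bf (dd G x u) (f i) (L x i)" using dGL[of "f i" i] by simp
    also have "bf (dd B x u) (f i) i = bf (B x) (chr G x u (f i)) i + bf (B x) (f i) (chr G x u i) +
     2 * (\<psi> x \<bullet> u) * bf (G x) (f i) i + (\<psi> x \<bullet> f i) * bf (G x) u i + (\<psi> x \<bullet> i) * bf (G x) u (f i)"
      using E[unfolded eisen_def, rule_format, OF x] by blast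
    also have "bf (dd G x u) (f i) (L x i) = bf (G x) (chr G x u (f i)) (L x i) + bf (G x) (f i) (chr G x u (L x i))"
      by (rule compat[OF x])
    finally have 1: "dd (\<lambda>y. L y i) x u \<bullet> i = bf (B x) (chr G x u (f i)) i + bf (B x) (f i) (chr G x u i) +
     2 * (\<psi> x \<bullet> u) * bf (G x) (f i) i + (\<psi> x \<bullet> f i) * bf (G x) u i + (\<psi> x \<bullet> i) * bf (G x) u (f i)
     - (bf (G x) (chr G x u (f i)) (L x i) + bf (G x) (f i) (chr G x u (L x i)))" .
    have e1: "bf (G x) (chr G x u (f i)) (L x i) = bf (B x) (chr G x u (f i)) i" by (rule GL[OF x])
    have e2: "bf (B x) (f i) (chr G x u i) = i \<bullet> L x (chr G x u i)" using GL[OF x, of "f i" "chr G x u i"] Gf' by simp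
    show ?thesis unfolding 1 e1 e2 Gf Gf' by (simp add: inner_commute)
  qed
  have linL: "linear (L x)" unfolding L_def
    using linear_compose[OF matrix_vector_mul_linear[of "B x"] matrix_vector_mul_linear[of "matrix_inv (G x)"]]
    by (simp add: o_def)
  \<comment> \<open>The Christoffel terms cancel, being the traces of the two products of
    \<open>L x\<close> and \<open>chr G x u\<close>.\<close>
  have tr: "(\<Sum>i\<in>Basis. L x (chr G x u i) \<bullet> i) = (\<Sum>i\<in>Basis. chr G x u (L x i) \<bullet> i)"
    using trace_of_commute[OF linL chr_linear(1)[OF x, of u]] by (simp add: trace_of_def)
  have s1: "(\<Sum>i\<in>Basis. (\<psi> x \<bullet> f i) * bf (G x) u i) = \<psi> x \<bullet> u"
  proof -
    have l: "linear (\<lambda>z. \<psi> x \<bullet> (matrix_inv (G x) *v z))"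
      by (intro linearI) (simp_all add: matrix_vector_right_distrib inner_add_right matrix_vector_mult_scaleR)
    have "(\<Sum>i\<in>Basis. (\<psi> x \<bullet> f i) * bf (G x) u i) = (\<Sum>i\<in>Basis. ((G x *v u) \<bullet> i) *\<^sub>R (\<psi> x \<bullet> (matrix_inv (G x) *v i)))"
      by (rule sum.cong) (simp_all add: f_def Gsym[OF x, of u] , simp add: bf_def inner_commute)
    also have "\<dots> = \<psi> x \<bullet> (matrix_inv (G x) *v (G x *v u))"
      using linear_basis_expansion[OF l, of "G x *v u"] by simp
    also have "\<dots> = \<psi> x \<bullet> u" using mat_inv_left[OF Ginv[OF x]] by (simp add: matrix_vector_mul_assoc)
    finally show ?thesis .
  qed
  have s2: "(\<Sum>i\<in>Basis. (\<psi> x \<bullet> i) * (u \<bullet> i)) = \<psi> x \<bullet> u" by (rule euclidean_inner[symmetric])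
  have s3: "(\<Sum>i\<in>(Basis::(real^'n) set). i \<bullet> i) = real CARD('n)" by simp
  have "dd (\<lambda>x. \<Sum>i\<in>Basis. L x i \<bullet> i) x u = (\<Sum>i\<in>Basis. dd (\<lambda>y. L y i) x u \<bullet> i)"
    by (rule fun_cong[OF dd_eq]) (rule has_derivative_sum, rule has_derivative_inner_left, rule smooth_on_deriv[OF sL U x])
  also have "\<dots> = 2 * (\<psi> x \<bullet> u) * real CARD('n) + 2 * (\<psi> x \<bullet> u)"
    unfolding each sum.distrib sum_subtractf tr s1 s2 sum_distrib_left[symmetric] s3 by simp
  also have "\<dots> = (2 * (real CARD('n) + 1)) * (\<psi> x \<bullet> u)" by (simp add: algebra_simps)
  finally have "dd (\<lambda>x. \<Sum>i\<in>Basis. L x i \<bullet> i) x u = (2 * (real CARD('n) + 1)) * (\<psi> x \<bullet> u)" .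
  then show "dd \<phi> x u = \<psi> x \<bullet> u"
    unfolding \<phi> using dd_linear_compose[OF bounded_linear_mult_right s U x, of c u] by (simp add: c_def)
qed

lemma smooth_chr_along:
  fixes p :: "'a::euclidean_space \<Rightarrow> real^'n"
  assumes W: "open W" and p: "smooth_on W p" "p ` W \<subseteq> U" and a: "smooth_on W a" and b: "smooth_on W b"
  shows "smooth_on W (\<lambda>q. chr G (p q) (a q) (b q))"
proof -
  have pU: "p q \<in> U" if "q \<in> W" for q using that p by auto
  have 1: "smooth_on W (\<lambda>q. chr G (p q) u v)" for u v by (rule smooth_on_compose[OF W U p(1) smooth_chr p(2)])
  have 2: "smooth_on W (\<lambda>q. chr G (p q) (a q) v)" for v
    by (rule smooth_on_linear_family[where \<Phi>="\<lambda>q u. chr G (p q) u v", OF W chr_linear(2)[OF pU] 1 a])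
  show ?thesis
    by (rule smooth_on_linear_family[where \<Phi>="\<lambda>q. chr G (p q) (a q)", OF W chr_linear(1)[OF pU] 2 b])
qed

lemma dd_chr_along:
  fixes p :: "'a::euclidean_space \<Rightarrow> real^'n"
  assumes W: "open W" and p: "smooth_on W p" "p ` W \<subseteq> U" and a: "smooth_on W a" and b: "smooth_on W b" and q: "q \<in> W"
  shows "dd (\<lambda>q. chr G (p q) (a q) (b q)) q \<tau> = dd (\<lambda>y. chr G y (a q) (b q)) (p q) (dd p q \<tau>)
     + chr G (p q) (dd a q \<tau>) (b q) + chr G (p q) (a q) (dd b q \<tau>)"
proof -
  have pU: "p q \<in> U" if "q \<in> W" for q using that p by auto
  have 1: "smooth_on W (\<lambda>q. chr G (p q) u v)" for u v by (rule smooth_on_compose[OF W U p(1) smooth_chr p(2)])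
  have "dd (\<lambda>q. chr G (p q) (a q) (b q)) q \<tau> = dd (\<lambda>r. chr G (p r) (a r) (b q)) q \<tau> + chr G (p q) (a q) (dd b q \<tau>)"
    by (rule dd_linear_family[where \<Phi>="\<lambda>q. chr G (p q) (a q)", OF W chr_linear(1)[OF pU]
        smooth_chr_along[OF W p a smooth_on_const[OF W]] b q])
  also have "dd (\<lambda>r. chr G (p r) (a r) (b q)) q \<tau> = dd (\<lambda>r. chr G (p r) (a q) (b q)) q \<tau> + chr G (p q) (dd a q \<tau>) (b q)"
    by (rule dd_linear_family[where \<Phi>="\<lambda>r u. chr G (p r) u (b q)", OF W chr_linear(2)[OF pU] 1 a q])
  also have "dd (\<lambda>r. chr G (p r) (a q) (b q)) q \<tau> = dd (\<lambda>y. chr G y (a q) (b q)) (p q) (dd p q \<tau>)"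
    by (rule dd_compose[OF p(1) W q smooth_chr U pU[OF q]])
  finally show ?thesis .
qed

lemma smooth_acc:
  fixes p :: "'a::euclidean_space \<Rightarrow> real^'n"
  assumes W: "open W" and p: "smooth_on W p" "p ` W \<subseteq> U"
  shows "smooth_on W (acc G p d)"
  unfolding acc_def
  by (rule smooth_on_add[OF W smooth_on_dd[OF smooth_on_dd[OF p(1)]]
        smooth_chr_along[OF W p smooth_on_dd[OF p(1)] smooth_on_dd[OF p(1)]]])

text \<open>\<open>\<tau>\<close> is the flow direction and \<open>d\<close> the direction of the
  curves. Since partial derivatives commute, transported velocities obey the linearized flow, and
  accelerations obey it up to the Lie derivative of the connection on the velocity. Both directions
  of the characterization of projective motions rest on this.\<close>

lemma variation:
  fixes p :: "'a::euclidean_space \<Rightarrow> real^'n"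
  assumes W: "open W" and p: "smooth_on W p" "p ` W \<subseteq> U" and X: "smooth_on U X"
    and fl: "\<And>q. q \<in> W \<Longrightarrow> dd p q \<tau> = X (p q)" and q: "q \<in> W"
  shows "dd (\<lambda>q. dd p q d) q \<tau> = dd X (p q) (dd p q d)"
    and "dd (acc G p d) q \<tau> = dd X (p q) (acc G p d q) + lie_chr G X (p q) (dd p q d) (dd p q d)"
proof -
  have pU: "p q \<in> U" if "q \<in> W" for q using that p by auto
  have u: "smooth_on W (\<lambda>q. dd p q d)" by (rule smooth_on_dd[OF p(1)])
  have du: "dd (\<lambda>q. dd p q d) q \<tau> = dd X (p q) (dd p q d)" if q: "q \<in> W" for q
  proof -
    have "dd (\<lambda>q. dd p q d) q \<tau> = dd (\<lambda>q. dd p q \<tau>) q d" by (rule dd_commute[OF p(1) W q])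
    also have "\<dots> = dd (\<lambda>q. X (p q)) q d" by (rule fun_cong[OF dd_cong_open[OF W q fl]])
    also have "\<dots> = dd X (p q) (dd p q d)" by (rule dd_compose[OF p(1) W q X U pU[OF q]])
    finally show ?thesis .
  qed
  show "dd (\<lambda>q. dd p q d) q \<tau> = dd X (p q) (dd p q d)" by (rule du[OF q])
  have "dd (\<lambda>q. dd (\<lambda>q. dd p q d) q d) q \<tau> = dd (\<lambda>q. dd (\<lambda>q. dd p q d) q \<tau>) q d"
    by (rule dd_commute[OF u W q])
  also have "\<dots> = dd (\<lambda>q. dd X (p q) (dd p q d)) q d" by (rule fun_cong[OF dd_cong_open[OF W q du]])
  also have "\<dots> = dd (\<lambda>r. dd X (p r) (dd p q d)) q d + dd X (p q) (dd (\<lambda>q. dd p q d) q d)"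
    by (rule dd_linear_family[where \<Phi>="\<lambda>r. dd X (p r)", OF W dd_linear[OF X U pU]
        smooth_on_compose[OF W U p(1) smooth_on_dd[OF X] p(2)] u q])
  also have "dd (\<lambda>r. dd X (p r) (dd p q d)) q d = dd (\<lambda>y. dd X y (dd p q d)) (p q) (dd p q d)"
    by (rule dd_compose[OF p(1) W q smooth_on_dd[OF X] U pU[OF q]])
  finally have 1: "dd (\<lambda>q. dd (\<lambda>q. dd p q d) q d) q \<tau> =
    dd (\<lambda>y. dd X y (dd p q d)) (p q) (dd p q d) + dd X (p q) (dd (\<lambda>q. dd p q d) q d)" .
  have "dd (acc G p d) q \<tau> = dd (\<lambda>q. dd (\<lambda>q. dd p q d) q d) q \<tau> + dd (\<lambda>q. chr G (p q) (dd p q d) (dd p q d)) q \<tau>"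
    unfolding acc_def by (rule dd_add[OF smooth_on_dd[OF u] smooth_chr_along[OF W p u u] W q])
  also have "\<dots> = dd X (p q) (acc G p d q) + lie_chr G X (p q) (dd p q d) (dd p q d)"
    unfolding 1 dd_chr_along[OF W p u u q] du[OF q] fl[OF q] acc_def lie_chr_def
      linear_add[OF dd_linear[OF X U pU[OF q]]] by simp
  finally show "dd (acc G p d) q \<tau> = dd X (p q) (acc G p d q) + lie_chr G X (p q) (dd p q d) (dd p q d)" .
qed

text \<open>With all three arguments equal to the velocity, the Eisenhart equation has the
  coefficient 2 + 1 + 1, and the metric square of the velocity is constant; hence the factor
  4.\<close>

lemma killing_conserved:
  fixes p :: "'a::euclidean_space \<Rightarrow> real^'n"
  assumes W: "open W" and p: "smooth_on W p" "p ` W \<subseteq> U" and q: "q \<in> W"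
    and T: "smooth_on U T" and Ts: "\<And>x v w. x \<in> U \<Longrightarrow> bf (T x) v w = bf (T x) w v"
    and E: "eisen U G T \<psi>" and \<phi>: "smooth_on U \<phi>" "\<And>x u. x \<in> U \<Longrightarrow> dd \<phi> x u = \<psi> x \<bullet> u"
    and geo: "acc G p d q = 0"
  shows "dd (\<lambda>q. bf (T (p q)) (dd p q d) (dd p q d) - 4 * \<phi> (p q) * bf (G (p q)) (dd p q d) (dd p q d)) q d = 0"
proof -
  have pU: "p q \<in> U" using q p by auto
  have u: "smooth_on W (\<lambda>q. dd p q d)" by (rule smooth_on_dd[OF p(1)])
  have sT: "smooth_on W (\<lambda>q. T (p q))" and sG: "smooth_on W (\<lambda>q. G (p q))" and s\<phi>: "smooth_on W (\<lambda>q. \<phi> (p q))"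
    by (rule smooth_on_compose[OF W U p(1) T p(2)], rule smooth_on_compose[OF W U p(1) G p(2)],
        rule smooth_on_compose[OF W U p(1) \<phi>(1) p(2)])
  let ?u = "dd p q d" and ?a = "dd (\<lambda>q. dd p q d) q d"
  have a: "?a = - chr G (p q) ?u ?u" using geo by (simp add: acc_def eq_neg_iff_add_eq_0)
  have dT: "dd (\<lambda>q. bf (T (p q)) (dd p q d) (dd p q d)) q d = 4 * (\<psi> (p q) \<bullet> ?u) * bf (G (p q)) ?u ?u"
    unfolding dd_bf[OF W q sT u u] dd_compose[OF p(1) W q T U pU] a
    using E[unfolded eisen_def, rule_format, OF pU, of ?u ?u ?u] by (simp add: bf_simps)
  have dG: "dd (\<lambda>q. bf (G (p q)) (dd p q d) (dd p q d)) q d = 0"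
    unfolding dd_bf[OF W q sG u u] dd_compose[OF p(1) W q G U pU] a
    using compat[OF pU, of ?u ?u ?u] by (simp add: bf_simps)
  have "dd (\<lambda>q. bf (T (p q)) (dd p q d) (dd p q d) - 4 * \<phi> (p q) * bf (G (p q)) (dd p q d) (dd p q d)) q d
    = dd (\<lambda>q. bf (T (p q)) (dd p q d) (dd p q d)) q d - dd (\<lambda>q. (4 * \<phi> (p q)) * bf (G (p q)) (dd p q d) (dd p q d)) q d"
    by (rule fun_cong[OF dd_eq]) (rule has_derivative_diff; rule smooth_on_deriv[OF _ W q];
      intro smooth_on_bf[OF W] smooth_on_mult[OF W] smooth_on_cmult[OF W] sT sG s\<phi> u)
  also have "dd (\<lambda>q. (4 * \<phi> (p q)) * bf (G (p q)) (dd p q d) (dd p q d)) q d =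
      4 * (\<psi> (p q) \<bullet> ?u) * bf (G (p q)) ?u ?u"
    unfolding dd_mult[OF smooth_on_cmult[OF W s\<phi>] smooth_on_bf[OF W sG u u] W q] dG
      dd_linear_compose[OF bounded_linear_mult_right s\<phi> W q] dd_compose[OF p(1) W q \<phi>(1) U pU] \<phi>(2)[OF pU]
    by simp
  finally show ?thesis by (simp add: dT)
qed

end

text \<open>The multiplier \<open>f\<close> with \<open>A v v = f v *\<^sub>R v\<close> is
  homogeneous, and the parallelogram identity makes it additive; so it is linear, and polarization
  gives \<open>A\<close>. The covector is half of \<open>f\<close>, written out by its values on the
  basis so that it visibly depends smoothly on \<open>A\<close>.\<close>

lemma projective_algebra:
  fixes A :: "'a::euclidean_space \<Rightarrow> 'a \<Rightarrow> 'a"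
  assumes bil: "\<And>u. linear (A u)" and sym: "\<And>u v. A u v = A v u"
    and par: "\<And>v. \<exists>f. A v v = f *\<^sub>R v"
  shows "A u v = ((\<Sum>i\<in>Basis. ((A i i \<bullet> i) / 2) *\<^sub>R i) \<bullet> u) *\<^sub>R v + ((\<Sum>i\<in>Basis. ((A i i \<bullet> i) / 2) *\<^sub>R i) \<bullet> v) *\<^sub>R u"
proof -
  define f where "f v = (A v v \<bullet> v) / (v \<bullet> v)" for v
  have Af: "A v v = f v *\<^sub>R v" for v
  proof (cases "v = 0")
    case True
    then show ?thesis using linear_0[OF bil] by simp
  next
    case False
    obtain c where "A v v = c *\<^sub>R v" using par by blast
    then show ?thesis using False by (simp add: f_def)
  qed
  have lin2: "linear (\<lambda>u. A u v)" for v using bil[of v] by (simp add: sym[of _ v])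
  have quad: "A (c *\<^sub>R v) (c *\<^sub>R v) = (c * c) *\<^sub>R A v v" for c v
    using linear_scale[OF bil, of "c *\<^sub>R v" c v] linear_scale[OF lin2, of c v v] by simp
  have f_scale: "f (c *\<^sub>R v) = c * f v" for c v
  proof (cases "v = 0 \<or> c = 0")
    case False
    have "f (c *\<^sub>R v) *\<^sub>R (c *\<^sub>R v) = (c * c) *\<^sub>R (f v *\<^sub>R v)"
      using quad[of c v] by (simp add: Af)
    then have "(f (c *\<^sub>R v) * c) *\<^sub>R v = (c * c * f v) *\<^sub>R v" by simp
    then show ?thesis using False by simp
  qed (auto simp: f_def)
  have f_add: "f (u + v) = f u + f v" for u v
  proof (cases "\<exists>a b. (a \<noteq> 0 \<or> b \<noteq> 0) \<and> a *\<^sub>R u + b *\<^sub>R v = 0")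
    case True
    then obtain a b where ab: "a \<noteq> 0 \<or> b \<noteq> 0" "a *\<^sub>R u + b *\<^sub>R v = 0" by blast
    show ?thesis
    proof (cases "b = 0")
      case True
      then have "u = 0" using ab by simp
      then show ?thesis by (simp add: f_def)
    next
      case False
      define c where "c = - a / b"
      have "v = (1 / b) *\<^sub>R (b *\<^sub>R v)" using False by simp
      also have "b *\<^sub>R v = - (a *\<^sub>R u)" using ab(2) by (simp add: add_eq_0_iff)
      finally have v: "v = c *\<^sub>R u" by (simp add: c_def)
      have "u + v = (1 + c) *\<^sub>R u" by (simp add: v algebra_simps)
      then have "f (u + v) = (1 + c) * f u" by (simp only: f_scale)
      then show ?thesis by (simp add: v f_scale algebra_simps)
    qed
  next
    case False
    \<comment> \<open>Comparing the coefficients of the independent vectors \<open>u\<close> and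
      \<open>v\<close> gives two equations whose sum is twice the additivity of
      \<open>f\<close>.\<close>
    have "A (u + v) (u + v) + A (u - v) (u - v) = 2 *\<^sub>R A u u + 2 *\<^sub>R A v v"
      by (simp add: linear_add[OF bil] linear_diff[OF bil] linear_add[OF lin2] linear_diff[OF lin2] scaleR_2 algebra_simps)
    then have "(f (u + v) + f (u - v) - 2 * f u) *\<^sub>R u + (f (u + v) - f (u - v) - 2 * f v) *\<^sub>R v = 0"
      by (simp add: Af algebra_simps)
    then have "f (u + v) + f (u - v) - 2 * f u = 0" "f (u + v) - f (u - v) - 2 * f v = 0" using False by blast+
    then show ?thesis by simp
  qed
  have lf: "linear f" by (rule linearI) (simp_all add: f_add f_scale)
  have fi: "f i = A i i \<bullet> i" if "i \<in> Basis" for i using that by (simp add: f_def)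
  have fexp: "(\<Sum>i\<in>Basis. ((A i i \<bullet> i) / 2) *\<^sub>R i) \<bullet> w = f w / 2" for w
  proof -
    have "(\<Sum>i\<in>Basis. ((A i i \<bullet> i) / 2) *\<^sub>R i) \<bullet> w = (\<Sum>i\<in>Basis. (w \<bullet> i) *\<^sub>R f i) / 2"
      unfolding inner_sum_left inner_scaleR_left sum_divide_distrib
      by (rule sum.cong[OF refl]) (simp add: fi inner_commute)
    then show ?thesis using linear_basis_expansion[OF lf, of w] by simp
  qed
  have "A (u + v) (u + v) = A u u + 2 *\<^sub>R A u v + A v v"
    by (simp add: linear_add[OF bil] linear_add[OF lin2] sym[of v u] scaleR_2)
  then have "2 *\<^sub>R A u v = f u *\<^sub>R v + f v *\<^sub>R u" by (simp add: Af f_add algebra_simps)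
  then have "(1/2) *\<^sub>R (2 *\<^sub>R A u v) = (1/2) *\<^sub>R (f u *\<^sub>R v + f v *\<^sub>R u)" by simp
  then show ?thesis unfolding fexp by (simp add: scaleR_add_right)
qed

text \<open>Two coordinate expressions \<open>G\<close>, \<open>G2\<close> of one metric, related by the coordinate change \<open>f\<close> on \<open>W\<close>.\<close>

locale chart_change = chart_metric U G + c2: chart_metric U2 G2
  for U :: "(real^'n::finite) set" and G and U2 :: "(real^'n) set" and G2 +
  fixes W :: "(real^'n) set" and f :: "real^'n \<Rightarrow> real^'n"
  assumes W: "open W" "W \<subseteq> U" and f: "smooth_on W f" "f ` W \<subseteq> U2"
    and pull: "x \<in> W \<Longrightarrow> bf (G x) v w = bf (G2 (f x)) (dd f x v) (dd f x w)"
begin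

lemma fU: "x \<in> W \<Longrightarrow> f x \<in> U2" using f by auto

lemma df_linear: "x \<in> W \<Longrightarrow> linear (dd f x)" by (rule dd_linear[OF f(1) W(1)])

lemma df_surj: assumes x: "x \<in> W" shows "surj (dd f x)"
proof -
  have "inj (dd f x)" unfolding linear_injective_0[OF df_linear[OF x]]
  proof (intro allI impI)
    fix v assume "dd f x v = 0"
    then have "bf (G x) v w = 0" for w by (simp add: pull[OF x] bf_simps)
    then show "v = 0" using nondeg x W by blast
  qed
  then show ?thesis using linear_injective_imp_surjective[OF df_linear[OF x]] by simp
qed

lemma dd_pull:
  assumes T: "smooth_on U T" and T2: "smooth_on U2 T2" and x: "x \<in> W"
    and p: "\<And>x v w. x \<in> W \<Longrightarrow> bf (T x) v w = bf (T2 (f x)) (dd f x v) (dd f x w)"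
  shows "bf (dd T x u) v w = bf (dd T2 (f x) (dd f x u)) (dd f x v) (dd f x w)
    + bf (T2 (f x)) (dd (\<lambda>y. dd f y v) x u) (dd f x w) + bf (T2 (f x)) (dd f x v) (dd (\<lambda>y. dd f y w) x u)"
proof -
  have "bf (dd T x u) v w = dd (\<lambda>y. bf (T y) v w) x u"
    using dd_bf_const[OF U _ T, of x v w u] x W by auto
  also have "\<dots> = dd (\<lambda>y. bf (T2 (f y)) (dd f y v) (dd f y w)) x u"
    by (rule fun_cong[OF dd_cong_open[OF W(1) x p]])
  also have "\<dots> = bf (dd (\<lambda>y. T2 (f y)) x u) (dd f x v) (dd f x w)
    + bf (T2 (f x)) (dd (\<lambda>y. dd f y v) x u) (dd f x w) + bf (T2 (f x)) (dd f x v) (dd (\<lambda>y. dd f y w) x u)"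
    by (rule dd_bf[OF W(1) x smooth_on_compose[OF W(1) c2.U f(1) T2 f(2)] smooth_on_dd[OF f(1)] smooth_on_dd[OF f(1)]])
  also have "dd (\<lambda>y. T2 (f y)) x u = dd T2 (f x) (dd f x u)"
    by (rule dd_compose[OF f(1) W(1) x T2 c2.U fU[OF x]])
  finally show ?thesis .
qed

text \<open>Since \<open>dd f x\<close> is onto, it suffices to pair with vectors
  \<open>dd f x w\<close>; in the Koszul expression all second derivatives of \<open>f\<close>
  cancel except the one in directions \<open>u\<close> and \<open>v\<close>.\<close>

lemma chr_change:
  assumes x: "x \<in> W"
  shows "dd f x (chr G x u v) = chr G2 (f x) (dd f x u) (dd f x v) + dd (\<lambda>y. dd f y v) x u"
proof (rule c2.G_eqI[OF fU[OF x]])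
  fix w'
  obtain w where w: "w' = dd f x w" using df_surj[OF x] by (metis surjD)
  have xU: "x \<in> U" using x W by auto
  have d: "bf (dd G x u) v w = bf (dd G2 (f x) (dd f x u)) (dd f x v) (dd f x w)
    + bf (G2 (f x)) (dd (\<lambda>y. dd f y v) x u) (dd f x w) + bf (G2 (f x)) (dd f x v) (dd (\<lambda>y. dd f y w) x u)" for u v w
    by (rule dd_pull[OF G c2.G x pull])
  note c = dd_commute[OF f(1) W(1) x]
  have "bf (G2 (f x)) (dd f x (chr G x u v)) w' = kos G x u v w"
    unfolding w pull[OF x, symmetric] by (rule chr_kos'[OF xU])
  also have "\<dots> = kos G2 (f x) (dd f x u) (dd f x v) (dd f x w) + bf (G2 (f x)) (dd (\<lambda>y. dd f y v) x u) (dd f x w)"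
    unfolding kos_def d c[of u v] c[of w u] c[of w v]
    using c2.Gsym[OF fU[OF x], of "dd f x v" "dd (\<lambda>y. dd f y u) x w"] c2.Gsym[OF fU[OF x], of "dd f x u" "dd (\<lambda>y. dd f y v) x w"]
    by (simp add: field_simps)
  also have "\<dots> = bf (G2 (f x)) (chr G2 (f x) (dd f x u) (dd f x v) + dd (\<lambda>y. dd f y v) x u) w'"
    unfolding bf_simps c2.chr_kos'[OF fU[OF x]] w by (rule refl)
  finally show "bf (G2 (f x)) (dd f x (chr G x u v)) w' =
     bf (G2 (f x)) (chr G2 (f x) (dd f x u) (dd f x v) + dd (\<lambda>y. dd f y v) x u) w'" .
qed

text \<open>The inhomogeneous term of \<open>chr_change\<close> cancels against the second
  derivative of \<open>f\<close> along the curve, so the acceleration is a vector and the geodesic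
  equation does not depend on the chart.\<close>

lemma acc_change:
  fixes p :: "'a::euclidean_space \<Rightarrow> real^'n"
  assumes Q: "open Q" and p: "smooth_on Q p" "p ` Q \<subseteq> W" and q: "q \<in> Q"
  shows "acc G2 (\<lambda>q. f (p q)) d q = dd f (p q) (acc G p d q)"
proof -
  have pW: "p q \<in> W" if "q \<in> Q" for q using that p by auto
  have 1: "dd (\<lambda>q. f (p q)) q d = dd f (p q) (dd p q d)" if "q \<in> Q" for q
    by (rule dd_compose[OF p(1) Q that f(1) W(1) pW[OF that]])
  have "dd (\<lambda>q. dd (\<lambda>q. f (p q)) q d) q d = dd (\<lambda>q. dd f (p q) (dd p q d)) q d"
    by (rule fun_cong[OF dd_cong_open[OF Q q 1]])
  also have "\<dots> = dd (\<lambda>r. dd f (p r) (dd p q d)) q d + dd f (p q) (dd (\<lambda>q. dd p q d) q d)"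
    by (rule dd_linear_family[where \<Phi>="\<lambda>r. dd f (p r)", OF Q df_linear[OF pW]
        smooth_on_compose[OF Q W(1) p(1) smooth_on_dd[OF f(1)] p(2)] smooth_on_dd[OF p(1)] q])
  also have "dd (\<lambda>r. dd f (p r) (dd p q d)) q d = dd (\<lambda>y. dd f y (dd p q d)) (p q) (dd p q d)"
    by (rule dd_compose[OF p(1) Q q smooth_on_dd[OF f(1)] W(1) pW[OF q]])
  finally show ?thesis
    unfolding acc_def 1[OF q] linear_add[OF df_linear[OF pW[OF q]]] chr_change[OF pW[OF q]] by simp
qed

lemma hess_change:
  assumes \<psi>: "smooth_on U \<psi>" "smooth_on U2 \<psi>2" and x: "x \<in> W"
    and r: "\<And>x v. x \<in> W \<Longrightarrow> \<psi> x \<bullet> v = \<psi>2 (f x) \<bullet> dd f x v"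
  shows "hess G \<psi> x u v = hess G2 \<psi>2 (f x) (dd f x u) (dd f x v)"
proof -
  have xU: "x \<in> U" using x W by auto
  have "dd \<psi> x u \<bullet> v = dd (\<lambda>y. \<psi> y \<bullet> v) x u"
    by (rule dd_linear_compose[OF bounded_linear_inner_left \<psi>(1) U xU, symmetric])
  also have "\<dots> = dd (\<lambda>y. \<psi>2 (f y) \<bullet> dd f y v) x u"
    by (rule fun_cong[OF dd_cong_open[OF W(1) x r]])
  also have "\<dots> = \<psi>2 (f x) \<bullet> dd (\<lambda>y. dd f y v) x u + dd (\<lambda>y. \<psi>2 (f y)) x u \<bullet> dd f x v"
    by (rule dd_bilinear[OF bounded_bilinear_inner smooth_on_compose[OF W(1) c2.U f(1) \<psi>(2) f(2)] smooth_on_dd[OF f(1)] W(1) x])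
  also have "dd (\<lambda>y. \<psi>2 (f y)) x u = dd \<psi>2 (f x) (dd f x u)"
    by (rule dd_compose[OF f(1) W(1) x \<psi>(2) c2.U fU[OF x]])
  finally show ?thesis unfolding hess_def r[OF x] chr_change[OF x] by (simp add: inner_add_right)
qed

lemma lieG_change:
  assumes X: "smooth_on U X" "smooth_on U2 X2" and x: "x \<in> W"
    and r: "\<And>x. x \<in> W \<Longrightarrow> X2 (f x) = dd f x (X x)"
  shows "bf (lieG G X x) v w = bf (lieG G2 X2 (f x)) (dd f x v) (dd f x w)"
proof -
  have xU: "x \<in> U" using x W by auto
  have XW: "smooth_on W X" using X(1) W(2) by (rule smooth_on_subset)
  have d: "dd X2 (f x) (dd f x v) = dd (\<lambda>y. dd f y v) x (X x) + dd f x (dd X x v)" for v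
  proof -
    have "dd X2 (f x) (dd f x v) = dd (\<lambda>y. X2 (f y)) x v"
      by (rule dd_compose[OF f(1) W(1) x X(2) c2.U fU[OF x], symmetric])
    also have "\<dots> = dd (\<lambda>y. dd f y (X y)) x v" by (rule fun_cong[OF dd_cong_open[OF W(1) x r]])
    also have "\<dots> = dd (\<lambda>y. dd f y (X x)) x v + dd f x (dd X x v)"
      by (rule dd_linear_family[where \<Phi>="\<lambda>y. dd f y", OF W(1) df_linear smooth_on_dd[OF f(1)] XW x])
    also have "dd (\<lambda>y. dd f y (X x)) x v = dd (\<lambda>y. dd f y v) x (X x)" by (rule dd_commute[OF f(1) W(1) x])
    finally show ?thesis .
  qed
  have p: "bf (dd G x u) v w = bf (dd G2 (f x) (dd f x u)) (dd f x v) (dd f x w)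
    + bf (G2 (f x)) (dd (\<lambda>y. dd f y v) x u) (dd f x w) + bf (G2 (f x)) (dd f x v) (dd (\<lambda>y. dd f y w) x u)" for u v w
    by (rule dd_pull[OF G c2.G x pull])
  show ?thesis
    unfolding bf_lieG[OF X(1) xU] c2.bf_lieG[OF X(2) fU[OF x]] p r[OF x] d bf_simps
      pull[OF x, of _ w] pull[OF x, of v] by simp
qed

end

section \<open>Geodesics and unique continuation\<close>

text \<open>Gronwall on the compact segment from \<open>t0\<close> to \<open>t\<close>, where the
  coefficients are bounded.\<close>

lemma linear_ode_zero:
  fixes y :: "real \<Rightarrow> 'a::euclidean_space"
  assumes S: "convex S" "open S" and t0: "t0 \<in> S" "y t0 = 0" and t: "t \<in> S"
    and ode: "\<And>t. t \<in> S \<Longrightarrow> (y has_vector_derivative \<Phi> t (y t)) (at t)"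
    and lin: "\<And>t. t \<in> S \<Longrightarrow> linear (\<Phi> t)" and cont: "\<And>v. continuous_on S (\<lambda>t. \<Phi> t v)"
  shows "y t = 0"
proof -
  let ?C = "closed_segment t0 t"
  have sub: "?C \<subseteq> S" using S(1) t0(1) t by (rule closed_segment_subset[rotated 2])
  have "\<exists>b. \<forall>s\<in>?C. norm (\<Phi> s i) \<le> b" for i
  proof -
    have "compact ((\<lambda>s. \<Phi> s i) ` ?C)"
      by (intro compact_continuous_image continuous_on_subset[OF cont sub]) simp
    then show ?thesis using compact_imp_bounded bounded_iff by (metis imageI)
  qed
  then obtain b where b: "\<And>i s. s \<in> ?C \<Longrightarrow> norm (\<Phi> s i) \<le> b i" by metis
  define A where "A = (\<Sum>i\<in>Basis. \<bar>b i\<bar>)"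
  have A: "A \<ge> 0" by (simp add: A_def sum_nonneg)
  have bd: "norm (\<Phi> s v) \<le> A * norm v + 0" if s: "s \<in> ?C" for s v
  proof -
    have "norm (\<Phi> s v) = norm (\<Sum>i\<in>Basis. (v \<bullet> i) *\<^sub>R \<Phi> s i)"
      using linear_basis_expansion[OF lin, of s v] s sub by auto
    also have "\<dots> \<le> (\<Sum>i\<in>Basis. norm v * \<bar>b i\<bar>)"
    proof (rule sum_norm_le)
      fix i :: 'a assume i: "i \<in> Basis"
      have "norm ((v \<bullet> i) *\<^sub>R \<Phi> s i) = \<bar>v \<bullet> i\<bar> * norm (\<Phi> s i)" by simp
      also have "\<dots> \<le> norm v * \<bar>b i\<bar>"
        using Basis_le_norm[OF i, of v] b[OF s, of i] by (intro mult_mono) auto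
      finally show "norm ((v \<bullet> i) *\<^sub>R \<Phi> s i) \<le> norm v * \<bar>b i\<bar>" .
    qed
    finally show ?thesis by (simp add: A_def sum_distrib_left mult.commute)
  qed
  have "norm (y t) \<le> exp (A * \<bar>t - t0\<bar> + 1/2) * (norm (y t0) + 0 * \<bar>t - t0\<bar>)"
  proof (rule gronwall[where S="?C" and y=y and y'="\<lambda>s. \<Phi> s (y s)" and A=A and B=0 and s=t0 and t=t])
    show "(y has_vector_derivative \<Phi> s (y s)) (at s within ?C)" if "s \<in> ?C" for s
      by (rule has_vector_derivative_at_within[OF ode]) (use that sub in auto)
  qed (use A bd in auto)
  then show ?thesis by (simp add: t0)
qed

lemma smooth_on_real_deriv:
  fixes c :: "real \<Rightarrow> 'b::real_normed_vector"
  assumes "smooth_on S c" "open S" "t \<in> S"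
  shows "(c has_vector_derivative dd c t 1) (at t)"
proof -
  have d: "(c has_derivative dd c t) (at t)" by (rule smooth_on_deriv[OF assms])
  have "dd c t = (\<lambda>r. r *\<^sub>R dd c t 1)"
  proof (rule ext)
    show "dd c t r = r *\<^sub>R dd c t 1" for r
      by (rule linear_scale[OF has_derivative_linear[OF d], of r 1, simplified real_scaleR_def mult_1_right])
  qed
  then show ?thesis unfolding has_vector_derivative_def by (rule has_derivative_eq_rhs[OF d])
qed

lemma dd_real_eq: "(c has_vector_derivative c') (at (t::real)) \<Longrightarrow> dd c t r = r *\<^sub>R c'"
  unfolding has_vector_derivative_def by (drule dd_eq) simp

context chart_metric
begin

text \<open>Along a fixed geodesic the velocity solves a linear equation, with one of the two
  velocity arguments of \<Gamma> regarded as a coefficient.\<close>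

lemma velocity_zero:
  fixes c :: "real \<Rightarrow> real^'n"
  assumes S: "open S" "convex S" and c: "smooth_on S c" "c ` S \<subseteq> U" and geo: "\<And>t. t \<in> S \<Longrightarrow> acc G c 1 t = 0"
    and t0: "t0 \<in> S" "dd c t0 1 = 0" and t: "t \<in> S"
  shows "dd c t 1 = 0"
proof (rule linear_ode_zero[where y="\<lambda>t. dd c t 1" and \<Phi>="\<lambda>t w. - chr G (c t) (dd c t 1) w" and S=S and ?t0.0=t0])
  have cU: "c t \<in> U" if "t \<in> S" for t using c that by auto
  have s: "smooth_on S (\<lambda>t. dd c t 1)" by (rule smooth_on_dd[OF c(1)])
  show "((\<lambda>t. dd c t 1) has_vector_derivative - chr G (c t) (dd c t 1) (dd c t 1)) (at t)" if "t \<in> S" for t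
  proof -
    have "dd (\<lambda>t. dd c t 1) t 1 = - chr G (c t) (dd c t 1) (dd c t 1)"
      using geo[OF that] by (simp add: acc_def eq_neg_iff_add_eq_0)
    then show ?thesis using smooth_on_real_deriv[OF s S(1) that] by (simp only:)
  qed
  show "linear (\<lambda>w. - chr G (c t) (dd c t 1) w)" if "t \<in> S" for t
    by (rule linear_compose_neg[OF chr_linear(1)[OF cU[OF that]]])
  show "continuous_on S (\<lambda>t. - chr G (c t) (dd c t 1) v)" for v
    by (intro continuous_on_minus smooth_on_continuous[OF smooth_chr_along[OF S(1) c s smooth_on_const[OF S(1)]]])
qed (use assms in auto)

definition spray :: "(real^'n) \<times> (real^'n) \<Rightarrow> (real^'n) \<times> (real^'n)" where
  "spray p = (snd p, - chr G (fst p) (snd p) (snd p))"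

lemma open_UU: "open (U \<times> (UNIV :: (real^'n) set))" by (intro open_Times U) simp

lemma smooth_spray: "smooth_on (U \<times> UNIV) spray"
proof -
  have f: "smooth_on (U \<times> UNIV) (fst :: (real^'n) \<times> (real^'n) \<Rightarrow> _)" by (rule smooth_on_linear[OF open_UU bounded_linear_fst])
  have s: "smooth_on (U \<times> UNIV) (snd :: (real^'n) \<times> (real^'n) \<Rightarrow> _)" by (rule smooth_on_linear[OF open_UU bounded_linear_snd])
  have "smooth_on (U \<times> UNIV) (\<lambda>p. - chr G (fst p) (snd p) (snd p))"
    by (rule smooth_on_linear_compose[OF open_UU bounded_linear_minus[OF bounded_linear_ident]
        smooth_chr_along[OF open_UU f _ s s]]) auto
  then show ?thesis unfolding spray_def by (rule smooth_on_Pair[OF open_UU s])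
qed

text \<open>For initial data \<open>p = (y, v)\<close> the position part of \<open>\<theta>\<close>
  is the geodesic from \<open>y\<close> with velocity \<open>v\<close>. The predicate collects what
  later arguments use of the flow of \<open>spray\<close>.\<close>

definition geodesic_family where
  "geodesic_family e r x0 v0 \<theta> \<longleftrightarrow> (\<forall>p\<in>ball (x0, v0 :: real^'n) r. \<theta> (0 :: real, p) = p \<and>
     smooth_on {-e<..<e} (\<lambda>s. fst (\<theta> (s, p))) \<and> (\<forall>t\<in>{-e<..<e}. fst (\<theta> (t, p)) \<in> U \<and>
     dd (\<lambda>s. fst (\<theta> (s, p))) t 1 = snd (\<theta> (t, p)) \<and> acc G (\<lambda>s. fst (\<theta> (s, p))) 1 t = 0))"

lemma geodesic_familyD:
  assumes "geodesic_family e r x0 v0 \<theta>" "p \<in> ball (x0, v0) r"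
  shows "\<theta> (0, p) = p" "t \<in> {-e<..<e} \<Longrightarrow> fst (\<theta> (t, p)) \<in> U" "smooth_on {-e<..<e} (\<lambda>s. fst (\<theta> (s, p)))"
    "t \<in> {-e<..<e} \<Longrightarrow> dd (\<lambda>s. fst (\<theta> (s, p))) t 1 = snd (\<theta> (t, p))"
    "t \<in> {-e<..<e} \<Longrightarrow> acc G (\<lambda>s. fst (\<theta> (s, p))) 1 t = 0"
  using assms unfolding geodesic_family_def by blast+

lemma geodesic_flow:
  assumes x0: "x0 \<in> U"
  obtains e :: real and r \<theta> where "e > 0" "r > 0" "smooth_on ({-e<..<e} \<times> ball (x0, v0) r) \<theta>"
    "\<And>p t. p \<in> ball (x0, v0) r \<Longrightarrow> t \<in> {-e<..<e} \<Longrightarrow> ((\<lambda>s. \<theta> (s, p)) has_vector_derivative spray (\<theta> (t, p))) (at t)"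
    "geodesic_family e r x0 v0 \<theta>"
proof -
  have m: "(x0, v0) \<in> U \<times> UNIV" using x0 by simp
  obtain e :: real and r \<theta> where f: "e > 0" "r > 0" "smooth_on ({-e<..<e} \<times> ball (x0, v0) r) \<theta>"
    "\<And>p. p \<in> ball (x0, v0) r \<Longrightarrow> \<theta> (0, p) = p"
    "\<And>t p. t \<in> {-e<..<e} \<Longrightarrow> p \<in> ball (x0, v0) r \<Longrightarrow> \<theta> (t, p) \<in> U \<times> UNIV"
    "\<And>t p. t \<in> {-e<..<e} \<Longrightarrow> p \<in> ball (x0, v0) r \<Longrightarrow> ((\<lambda>s. \<theta> (s, p)) has_vector_derivative spray (\<theta> (t, p))) (at t)"
    by (rule smooth_local_flow[OF open_UU smooth_spray m]) (rule that)
  let ?J = "{-e<..<e}" and ?B = "ball (x0, v0) r"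
  have J: "open ?J" by simp
  have s\<theta>: "smooth_on ?J (\<lambda>s. \<theta> (s, p))" if p: "p \<in> ?B" for p
    by (rule smooth_on_compose[where f="\<lambda>s. (s, p)", OF J _ smooth_on_Pair[OF J smooth_on_id[OF J] smooth_on_const[OF J]] f(3)])
      (use p in \<open>auto intro: open_Times\<close>)
  have s1: "smooth_on ?J (\<lambda>s. fst (\<theta> (s, p)))" if p: "p \<in> ?B" for p
    by (rule smooth_on_linear_compose[OF J bounded_linear_fst s\<theta>[OF p]])
  have d1: "dd (\<lambda>s. fst (\<theta> (s, p))) t 1 = snd (\<theta> (t, p))" if p: "p \<in> ?B" and t: "t \<in> ?J" for p t
    using dd_real_eq[OF bounded_linear.has_vector_derivative[OF bounded_linear_fst f(6)[OF t p]], of 1]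
    by (simp add: spray_def)
  have d2: "dd (\<lambda>s. snd (\<theta> (s, p))) t 1 = - chr G (fst (\<theta> (t, p))) (snd (\<theta> (t, p))) (snd (\<theta> (t, p)))"
    if p: "p \<in> ?B" and t: "t \<in> ?J" for p t
    using dd_real_eq[OF bounded_linear.has_vector_derivative[OF bounded_linear_snd f(6)[OF t p]], of 1]
    by (simp add: spray_def)
  have ac: "acc G (\<lambda>s. fst (\<theta> (s, p))) 1 t = 0" if p: "p \<in> ?B" and t: "t \<in> ?J" for p t
  proof -
    have "dd (\<lambda>t. dd (\<lambda>s. fst (\<theta> (s, p))) t 1) t = dd (\<lambda>s. snd (\<theta> (s, p))) t"
      by (rule dd_cong_open[OF J t]) (rule d1[OF p])
    then show ?thesis by (simp add: acc_def d1[OF p t] d2[OF p t])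
  qed
  show ?thesis
  proof (rule that[OF f(1-3) f(6)])
    show "geodesic_family e r x0 v0 \<theta>"
      unfolding geodesic_family_def using f(4,5) s1 d1 ac by (simp add: mem_Times_iff)
  qed
qed

text \<open>At zero velocity the flow of \<open>spray\<close> is constant, and its linearization
  there is free motion. So the position at a fixed time depends on the initial velocity with
  derivative that time times the identity, and an open mapping theorem shows that geodesics from
  \<open>x0\<close> reach a whole neighbourhood.\<close>

lemma exponential_map_open:
  assumes x0: "x0 \<in> U"
  obtains e :: real and r \<theta> N where "e > 0" "r > 0" "continuous_on (ball (x0, 0) r) (\<lambda>p. fst (\<theta> (e, p)))"
    "open N" "x0 \<in> N" "N \<subseteq> U" "\<And>y. y \<in> N \<Longrightarrow> \<exists>v. (x0, v) \<in> ball (x0, 0) r \<and> fst (\<theta> (e, (x0, v))) = y"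
    "geodesic_family (2 * e) r x0 0 \<theta>"
proof -
  obtain e :: real and r \<theta> where f0: "e > 0" "r > 0" "smooth_on ({-e<..<e} \<times> ball (x0, 0) r) \<theta>"
    "\<And>p t. p \<in> ball (x0, 0) r \<Longrightarrow> t \<in> {-e<..<e} \<Longrightarrow> ((\<lambda>s. \<theta> (s, p)) has_vector_derivative spray (\<theta> (t, p))) (at t)"
    and fam: "geodesic_family e r x0 0 \<theta>"
    by (rule geodesic_flow[OF x0, of 0]) (rule that)
  note f = f0(1-3) geodesic_familyD(1,2)[OF fam] f0(4) geodesic_familyD(3-5)[OF fam]
  let ?J = "{-e<..<e}" and ?B = "ball (x0, 0 :: real^'n) r"
  have J: "open ?J" "convex ?J" "0 \<in> ?J" using f(1) by auto
  have JB: "open (?J \<times> ?B)" by (intro open_Times) auto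
  have p0: "(x0, 0) \<in> ?B" using f(2) by simp
  have v0: "snd (\<theta> (t, (x0, 0))) = 0" if "t \<in> ?J" for t
  proof -
    have "dd (\<lambda>s. fst (\<theta> (s, (x0, 0)))) t 1 = 0"
      by (rule velocity_zero[OF J(1,2) f(7)[OF p0] _ f(9)[OF p0] J(3) _ that])
        (use f(5)[OF p0] f(8)[OF p0 J(3)] f(4)[OF p0] in auto)
    then show ?thesis using f(8)[OF p0 that] by simp
  qed
  have x0c: "fst (\<theta> (t, (x0, 0))) = x0" if t: "t \<in> ?J" for t
  proof -
    have "((\<lambda>s. fst (\<theta> (s, (x0, 0)))) has_derivative (\<lambda>h. 0)) (at s within ?J)" if s: "s \<in> ?J" for s
    proof -
      have "((\<lambda>s. fst (\<theta> (s, (x0, 0)))) has_vector_derivative 0) (at s)"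
        using smooth_on_real_deriv[OF f(7)[OF p0] J(1) s] f(8)[OF p0 s] v0[OF s] by simp
      then show ?thesis by (auto simp: has_vector_derivative_def intro: has_derivative_at_withinI)
    qed
    from has_derivative_zero_unique[OF J(2) this t J(3)] show ?thesis by (simp add: f(4)[OF p0])
  qed
  have \<theta>c: "\<theta> (t, (x0, 0)) = (x0, 0)" if "t \<in> ?J" for t
    using v0[OF that] x0c[OF that] by (simp add: prod_eq_iff)
  have "dd (\<lambda>q. fst (\<theta> q)) (t, (x0, 0)) (0, (0, w)) = t *\<^sub>R w" if t: "t \<in> ?J" for t w
  proof -
    define z where "z t = dd \<theta> (t, (x0, 0)) (0, (0, w))" for t
    have tJ: "(t, (x0, 0)) \<in> ?J \<times> ?B" if "t \<in> ?J" for t using that p0 by simp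
    have fl: "dd \<theta> q (1, 0) = spray (\<theta> q)" if "q \<in> ?J \<times> ?B" for q
    proof -
      obtain t p where q1: "q = (t, p)" by (cases q)
      then have q: "t \<in> ?J" "p \<in> ?B" using that by auto
      show ?thesis unfolding q1
        by (rule vector_derivative_unique_at[OF slice_derivative[OF f(3) JB] f(6)[OF q(2,1)]]) (use q in simp)
    qed
    have "\<theta> q \<in> U \<times> UNIV" if "q \<in> ?J \<times> ?B" for q
      using f(5)[of "snd q" "fst q"] that by (simp add: mem_Times_iff)
    then have \<theta>U: "\<theta> ` (?J \<times> ?B) \<subseteq> U \<times> UNIV" by blast
    \<comment> \<open>The term \<Gamma>(v, v) is quadratic in the velocity, so its derivative
      vanishes at velocity 0.\<close>
    have spd: "dd spray (x0, 0) u = (snd u, 0)" for u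
    proof -
      have xU: "(x0, 0) \<in> U \<times> (UNIV :: (real^'n) set)" using x0 by simp
      have f1: "smooth_on (U \<times> UNIV) (fst :: (real^'n) \<times> (real^'n) \<Rightarrow> _)" by (rule smooth_on_linear[OF open_UU bounded_linear_fst])
      have s1: "smooth_on (U \<times> UNIV) (snd :: (real^'n) \<times> (real^'n) \<Rightarrow> _)"
        by (rule smooth_on_linear[OF open_UU bounded_linear_snd])
      have fi: "fst ` (U \<times> UNIV) \<subseteq> U" by auto
      have d0: "dd (\<lambda>y. chr G y 0 (0 :: real^'n)) x0 = (\<lambda>_. 0)"
      proof -
        have "dd (\<lambda>y. chr G y 0 (0 :: real^'n)) x0 = dd (\<lambda>y. 0) x0"
          by (rule dd_cong_open[OF U x0]) (rule linear_0[OF chr_linear(1)])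
        then show ?thesis by simp
      qed
      have sc: "smooth_on (U \<times> UNIV) (\<lambda>p. chr G (fst p) (snd p) (snd p))"
        by (rule smooth_chr_along[OF open_UU f1 fi s1 s1])
      have "dd (\<lambda>p. chr G (fst p) (snd p) (snd p)) (x0, 0) u = 0"
        unfolding dd_chr_along[OF open_UU f1 fi s1 s1 xU]
        by (simp add: d0 linear_0[OF chr_linear(1)[OF x0]] linear_0[OF chr_linear(2)[OF x0]])
      moreover have hd: "(spray has_derivative (\<lambda>u. (snd u, - dd (\<lambda>p. chr G (fst p) (snd p) (snd p)) (x0, 0) u))) (at (x0, 0))"
        unfolding spray_def
        by (intro has_derivative_Pair has_derivative_minus has_derivative_snd has_derivative_ident
            smooth_on_deriv[OF sc open_UU xU])
      ultimately show ?thesis unfolding dd_eq[OF hd] by simp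
    qed
    have dz: "(z has_vector_derivative (snd (z t), 0)) (at t)" if t: "t \<in> ?J" for t
    proof -
      have "dd (\<lambda>q. dd \<theta> q (0, (0, w))) (t, (x0, 0)) (1, 0) = dd (\<lambda>q. dd \<theta> q (1, 0)) (t, (x0, 0)) (0, (0, w))"
        by (rule dd_commute[OF f(3) JB tJ[OF t]])
      also have "\<dots> = dd (\<lambda>q. spray (\<theta> q)) (t, (x0, 0)) (0, (0, w))"
        by (rule fun_cong[OF dd_cong_open[OF JB tJ[OF t] fl]])
      also have "\<dots> = dd spray (\<theta> (t, (x0, 0))) (z t)"
        unfolding z_def by (rule dd_compose[OF f(3) JB tJ[OF t] smooth_spray open_UU]) (use \<theta>U tJ[OF t] in blast)
      also have "\<dots> = (snd (z t), 0)" by (simp add: \<theta>c[OF t] spd)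
      finally have e: "dd (\<lambda>q. dd \<theta> q (0, (0, w))) (t, (x0, 0)) (1, 0) = (snd (z t), 0)" .
      show ?thesis unfolding z_def
        using slice_derivative[OF smooth_on_dd[OF f(3), of "(0, (0, w))"] JB tJ[OF t]] unfolding e z_def .
    qed
    have z0: "z 0 = (0, w)"
    proof -
      have "((\<lambda>p. (0::real, p)) has_derivative (\<lambda>h. (0, h))) (at (x0, 0 :: real^'n))" by (auto intro!: derivative_eq_intros)
      from has_derivative_compose[OF this smooth_on_deriv[OF f(3) JB tJ[OF J(3)]]]
      have "((\<lambda>p. \<theta> (0, p)) has_derivative (\<lambda>h. dd \<theta> (0, (x0, 0)) (0, h))) (at (x0, 0))" .
      moreover have "((\<lambda>p. \<theta> (0, p)) has_derivative (\<lambda>h. h)) (at (x0, 0))"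
        by (rule has_derivative_transform_within_open[OF has_derivative_ident open_ball p0]) (simp add: f(4))
      ultimately have "(\<lambda>h. dd \<theta> (0, (x0, 0)) (0, h)) = (\<lambda>h. h)" by (rule has_derivative_unique)
      from fun_cong[OF this, of "(0, w)"] show ?thesis by (simp add: z_def)
    qed
    have sz: "snd (z t) = w" if t: "t \<in> ?J" for t
    proof -
      have "((\<lambda>s. snd (z s)) has_derivative (\<lambda>h. 0)) (at s within ?J)" if "s \<in> ?J" for s
        using bounded_linear.has_vector_derivative[OF bounded_linear_snd dz[OF that]]
        by (auto simp: has_vector_derivative_def intro: has_derivative_at_withinI)
      from has_derivative_zero_unique[OF J(2) this t J(3)] show ?thesis by (simp add: z0)
    qed
    have "fst (z t) - t *\<^sub>R w = fst (z 0) - 0 *\<^sub>R w"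
    proof (rule has_derivative_zero_unique[OF J(2) _ t J(3), where f="\<lambda>s. fst (z s) - s *\<^sub>R w"])
      fix s assume s: "s \<in> ?J"
      have "((\<lambda>s. fst (z s) - s *\<^sub>R w) has_vector_derivative snd (z s) - 1 *\<^sub>R w) (at s)"
        using bounded_linear.has_vector_derivative[OF bounded_linear_fst dz[OF s]]
        by (auto intro!: derivative_eq_intros)
      then show "((\<lambda>s. fst (z s) - s *\<^sub>R w) has_derivative (\<lambda>h. 0)) (at s within ?J)"
        by (auto simp: has_vector_derivative_def sz[OF s] intro: has_derivative_at_withinI)
    qed
    then have "fst (z t) = t *\<^sub>R w" by (simp add: z0)
    then show ?thesis
      using dd_linear_compose[OF bounded_linear_fst f(3) JB tJ[OF t], of "(0, (0, w))"] by (simp add: z_def)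
  qed
  note D = this
  \<comment> \<open>Half of the time of existence, so that \<open>h\<close> is an interior time and
    the family can be stated for times below \<open>2 * h\<close>.\<close>
  define h where "h = e / 2"
  have h: "h > 0" "h \<in> ?J" using f(1) by (auto simp: h_def)
  define Ex where "Ex v = fst (\<theta> (h, (x0, v)))" for v
  have bv: "(x0, v) \<in> ?B" if "v \<in> ball 0 r" for v using that by (simp add: dist_prod_def dist_norm)
  have sE: "continuous_on ?B (\<lambda>p. fst (\<theta> (h, p)))"
    by (rule continuous_on_fst[OF continuous_on_compose2[OF smooth_on_continuous[OF f(3)]
        continuous_on_Pair[OF continuous_on_const continuous_on_id]]]) (use h(2) in blast)
  have cE: "continuous_on (ball 0 r) Ex" unfolding Ex_def
    by (rule continuous_on_compose2[OF sE]) (use bv in \<open>auto intro!: continuous_intros\<close>)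
  have hp: "(h, (x0, 0)) \<in> ?J \<times> ?B" using h p0 by simp
  have "((\<lambda>v. (h, (x0, v))) has_derivative (\<lambda>w. (0, (0, w)))) (at (0 :: real^'n))" by (auto intro!: derivative_eq_intros)
  from has_derivative_compose[OF this smooth_on_deriv[OF smooth_on_linear_compose[OF JB bounded_linear_fst f(3)] JB hp]]
  have dE: "(Ex has_derivative (\<lambda>w. h *\<^sub>R w)) (at 0)"
    unfolding Ex_def D[OF h(2)] by simp
  have "Ex 0 \<in> interior (Ex ` ball 0 r)"
    by (rule sussmann_open_mapping[OF open_ball cE _ dE, of "\<lambda>w. (1/h) *\<^sub>R w"])
      (use f(2) h(1) in \<open>auto simp: fun_eq_iff bounded_linear_scaleR_right interior_open\<close>)
  then have x0N: "x0 \<in> interior (Ex ` ball 0 r)" by (simp add: Ex_def \<theta>c[OF h(2)])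
  define N where "N = interior (Ex ` ball 0 r) \<inter> U"
  show ?thesis
  proof (rule that[of h r \<theta> N, OF h(1) f(2) sE])
    show "open N" "x0 \<in> N" "N \<subseteq> U" using U x0 x0N by (auto simp: N_def)
    show "\<exists>v. (x0, v) \<in> ?B \<and> fst (\<theta> (h, (x0, v))) = y" if "y \<in> N" for y
    proof -
      have "y \<in> Ex ` ball 0 r" using that interior_subset unfolding N_def by blast
      then obtain v where v: "y = Ex v" "v \<in> ball 0 r" by (rule imageE)
      show ?thesis using bv[OF v(2)] v(1) by (intro exI[of _ v]) (simp add: Ex_def)
    qed
    show "geodesic_family (2 * h) r x0 0 \<theta>" using fam by (simp add: h_def)
  qed
qed

section \<open>Unique continuation along geodesics\<close>

lemma bf_polarize:
  assumes s: "\<And>v w. bf M v w = bf M w v" and d: "d > 0" and z: "\<And>v. norm (v - v1) < d \<Longrightarrow> bf M v v = 0"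
  shows "bf M v w = 0"
proof -
  have q: "bf M u u = 0" for u
  proof (cases "u = 0")
    case False
    define t where "t = d / (2 * norm u)"
    have t: "t > 0" "t * norm u < d" using False d by (auto simp: t_def)
    have b: "bf M (v1 + t *\<^sub>R u) (v1 + t *\<^sub>R u) = 0" "bf M (v1 - t *\<^sub>R u) (v1 - t *\<^sub>R u) = 0" "bf M v1 v1 = 0"
      using t d by (auto intro!: z)
    \<comment> \<open>Adding the values at \<open>v1 + t u\<close> and \<open>v1 - t u\<close>
      cancels the mixed term and isolates \<open>bf M u u\<close>.\<close>
    have "2 * (t * bf M v1 u) + t * (t * bf M u u) = 0" "- 2 * (t * bf M v1 u) + t * (t * bf M u u) = 0"
      using b unfolding bf_simps s[of u v1] by (simp_all add: algebra_simps)
    then have "t * (t * bf M u u) = 0" by linarith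
    then show ?thesis using t by simp
  qed (simp add: bf_simps)
  have "bf M (v + w) (v + w) = 0" by (rule q)
  then show ?thesis using q[of v] q[of w] s[of v w] by (simp add: bf_simps)
qed

text \<open>\<open>a = 2\<close> arises where \<open>T = 0\<close>, and \<open>a = -2\<close> where
  \<open>T = 4 (\<phi> - c) G\<close>. Exchanging \<open>u\<close> and \<open>v\<close> and
  subtracting leaves the nonzero factor \<open>a - 1\<close>, so
  \<open>(p \<bullet> u) v = (p \<bullet> v) u\<close>; taking \<open>u = p\<close> and a nonzero
  \<open>v\<close> orthogonal to \<open>p\<close> refutes \<open>p \<noteq> 0\<close>.\<close>

lemma eisen_gradient_zero:
  assumes x: "x \<in> U" and n: "2 \<le> CARD('n)"
    and e: "\<And>u v w. a * ((p \<bullet> u) * bf (G x) v w) + (p \<bullet> v) * bf (G x) u w + (p \<bullet> w) * bf (G x) u v = 0"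
    and a: "a = 2 \<or> a = - 2"
  shows "p = 0"
proof (rule ccontr)
  assume p: "p \<noteq> 0"
  have PQ: "(p \<bullet> u) * bf (G x) v w = (p \<bullet> v) * bf (G x) u w" for u v w
    using e[of u v w] e[of v u w] a Gsym[OF x, of v u] by auto
  have "(p \<bullet> u) *\<^sub>R v = (p \<bullet> v) *\<^sub>R u" for u v
    by (rule G_eqI[OF x]) (simp add: bf_simps PQ)
  moreover obtain v where v: "v \<noteq> 0" "orthogonal p v"
  proof -
    have "dim {p} \<le> card {p}" by (rule dim_le_card') simp
    then have "dim {p} < DIM(real^'n)" using n by simp
    then obtain v where "v \<noteq> 0" "\<And>y. y \<in> span {p} \<Longrightarrow> orthogonal v y" by (rule orthogonal_to_subspace_exists) blast
    then show thesis using that[of v] by (simp add: span_base orthogonal_commute)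
  qed
  ultimately have "(p \<bullet> p) *\<^sub>R v = (p \<bullet> v) *\<^sub>R p" by blast
  then show False using p v by (simp add: orthogonal_def)
qed

text \<open>A geodesic from \<open>x0\<close> ends in \<open>V\<close>, and so do all geodesics
  starting near \<open>x0\<close> with nearby velocity. Their conserved quantity vanishes at the
  end, hence at the start, for an open set of velocities, and polarization gives the relation at the
  start. \<open>N\<close> is fixed before \<open>c0\<close> and \<open>V\<close>, which the
  connectedness argument requires.\<close>

lemma unique_continuation_local:
  assumes x0: "x0 \<in> U"
    and T: "smooth_on U T" and Ts: "\<And>x v w. x \<in> U \<Longrightarrow> bf (T x) v w = bf (T x) w v"
    and E: "eisen U G T \<psi>" and \<phi>: "smooth_on U \<phi>" "\<And>x u. x \<in> U \<Longrightarrow> dd \<phi> x u = \<psi> x \<bullet> u"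
  shows "\<exists>N. open N \<and> x0 \<in> N \<and> N \<subseteq> U \<and>
    (\<forall>c0 V. open V \<longrightarrow> V \<subseteq> N \<longrightarrow> V \<noteq> {} \<longrightarrow> (\<forall>y\<in>V. T y = (4 * (\<phi> y - c0)) *\<^sub>R G y) \<longrightarrow>
      (\<exists>\<eta>>0. \<forall>y\<in>ball x0 \<eta>. y \<in> U \<and> T y = (4 * (\<phi> y - c0)) *\<^sub>R G y))"
proof -
  obtain e :: real and r \<theta> N where f0: "e > 0" "r > 0" "continuous_on (ball (x0, 0) r) (\<lambda>p. fst (\<theta> (e, p)))"
    "open N" "x0 \<in> N" "N \<subseteq> U" "\<And>y. y \<in> N \<Longrightarrow> \<exists>v. (x0, v) \<in> ball (x0, 0) r \<and> fst (\<theta> (e, (x0, v))) = y"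
    and fam: "geodesic_family (2 * e) r x0 0 \<theta>"
    by (rule exponential_map_open[OF x0]) (rule that)
  note f = f0 geodesic_familyD(1,2,3,4,5)[OF fam]
  let ?J = "{-(2*e)<..<2*e}" and ?B = "ball (x0, 0 :: real^'n) r"
  have J: "open ?J" "convex ?J" "0 \<in> ?J" "e \<in> ?J" using f(1) by auto
  show ?thesis
  proof (intro exI[of _ N] conjI allI impI f(4,5,6))
    fix c0 V assume V: "open V" "V \<subseteq> N" "V \<noteq> {}" and Z: "\<forall>y\<in>V. T y = (4 * (\<phi> y - c0)) *\<^sub>R G y"
    have 0: "T y = (4 * (\<phi> y - c0)) *\<^sub>R G y" if "y \<in> V" for y using Z that by blast
    obtain y1 where y1: "y1 \<in> V" using V by blast
    obtain v1 where v1: "(x0, v1) \<in> ?B" "fst (\<theta> (e, (x0, v1))) = y1" using f(7) y1 V by blast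
    have "open {p \<in> ?B. fst (\<theta> (e, p)) \<in> V}"
      by (rule open_preimage[OF f(3) open_ball V(1)])
    moreover have "(x0, v1) \<in> {p \<in> ?B. fst (\<theta> (e, p)) \<in> V}" using v1 y1 by simp
    ultimately obtain d where d: "d > 0" "ball (x0, v1) d \<subseteq> {p \<in> ?B. fst (\<theta> (e, p)) \<in> V}"
      using openE by blast
    obtain d' where d': "d' > 0" "ball x0 d' \<subseteq> U" using U x0 openE by blast
    define \<eta> where "\<eta> = min (d / 2) d'"
    have \<eta>: "\<eta> > 0" using d d' by (simp add: \<eta>_def)
    have near: "(y, v) \<in> ?B \<and> fst (\<theta> (e, (y, v))) \<in> V" if "y \<in> ball x0 \<eta>" "norm (v - v1) < d / 2" for y v
    proof -
      have "dist (x0, v1) (y, v) \<le> dist x0 y + dist v1 v"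
        unfolding dist_prod_def by (simp add: sqrt_sum_squares_le_sum)
      also have "\<dots> < d" using that by (simp add: \<eta>_def dist_norm norm_minus_commute)
      finally show ?thesis using d(2) by auto
    qed
    show "\<exists>\<eta>>0. \<forall>y\<in>ball x0 \<eta>. y \<in> U \<and> T y = (4 * (\<phi> y - c0)) *\<^sub>R G y"
    proof (intro exI conjI ballI, rule \<eta>)
      fix y assume y: "y \<in> ball x0 \<eta>"
      then show yU: "y \<in> U" using d' by (auto simp: \<eta>_def)
      define M where "M = T y - (4 * (\<phi> y - c0)) *\<^sub>R G y"
      have Mz: "bf M v v = 0" if v: "norm (v - v1) < d / 2" for v
      proof -
        have p: "(y, v) \<in> ?B" and pV: "fst (\<theta> (e, (y, v))) \<in> V" using near[OF y v] by auto
        define c where "c s = fst (\<theta> (s, (y, v)))" for s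
        have c: "smooth_on ?J c" unfolding c_def[abs_def] by (rule f(10)[OF p])
        have cU: "c ` ?J \<subseteq> U" unfolding c_def using f(9)[OF p] by auto
        define k where "k s = bf (T (c s)) (dd c s 1) (dd c s 1) - 4 * (\<phi> (c s) - c0) * bf (G (c s)) (dd c s 1) (dd c s 1)" for s
        \<comment> \<open>\<open>\<phi> - c0\<close> is as good a potential as
          \<open>\<phi>\<close>; with it the conserved quantity vanishes on
          \<open>V\<close>.\<close>
        have \<phi>c: "smooth_on U (\<lambda>x. \<phi> x - c0)" by (rule smooth_on_diff[OF U \<phi>(1) smooth_on_const[OF U]])
        have d\<phi>c: "dd (\<lambda>x. \<phi> x - c0) x u = \<psi> x \<bullet> u" if "x \<in> U" for x u
          using dd_eq[OF has_derivative_diff[OF smooth_on_deriv[OF \<phi>(1) U that] has_derivative_const[of c0]]] \<phi>(2)[OF that]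
          by simp
        have "dd k s 1 = 0" if s: "s \<in> ?J" for s
          unfolding k_def[abs_def]
          by (rule killing_conserved[OF J(1) c cU s T Ts E \<phi>c d\<phi>c])
            (use f(12)[OF p s] in \<open>simp_all add: c_def[abs_def]\<close>)
        moreover have sk: "smooth_on ?J k" unfolding k_def[abs_def]
          by (intro smooth_on_diff[OF J(1)] smooth_on_mult[OF J(1)] smooth_on_cmult[OF J(1)] smooth_on_bf[OF J(1)]
              smooth_on_dd[OF c] smooth_on_compose[OF J(1) U c _ cU] T G \<phi>c)
        ultimately have "(k has_derivative (\<lambda>h. 0)) (at s within ?J)" if "s \<in> ?J" for s
          using smooth_on_real_deriv[OF sk J(1) that] that
          by (auto simp: has_vector_derivative_def intro: has_derivative_at_withinI)
        from has_derivative_zero_unique[OF J(2) this J(3,4)] have "k 0 = k e" .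
        also have "k e = 0" using 0[of "c e"] pV by (simp add: k_def bf_mat_simps c_def)
        finally have "k 0 = 0" .
        moreover have "c 0 = y" "dd c 0 1 = v"
          using f(8)[OF p] f(11)[OF p J(3)] by (simp_all add: c_def[abs_def])
        ultimately show ?thesis by (simp add: k_def M_def bf_mat_simps)
      qed
      have Msym: "bf M v w = bf M w v" for v w
        by (simp add: M_def bf_mat_simps Ts[OF yU, of v w] Gsym[OF yU, of v w])
      have "bf M v w = 0" for v w
        by (rule bf_polarize[where d="d / 2" and ?v1.0=v1, OF Msym]) (use d Mz in simp_all)
      then have "M = 0" by (intro bf_eqI) (simp add: bf_mat_simps)
      then show "T y = (4 * (\<phi> y - c0)) *\<^sub>R G y" by (simp add: M_def)
    qed
  qed
qed

lemma eisen_zero_gradient: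
  assumes n: "2 \<le> CARD('n)" and V: "open V" "V \<subseteq> U" "x \<in> V"
    and E: "eisen U G T \<psi>" and z: "\<And>y. y \<in> V \<Longrightarrow> T y = 0"
  shows "\<psi> x = 0"
proof (rule eisen_gradient_zero[OF _ n])
  show xU: "x \<in> U" using V by auto
  have "dd T x = dd (\<lambda>y. 0) x" by (rule dd_cong_open[OF V(1,3) z])
  then have "dd T x u = 0" for u by simp
  then show "2 * ((\<psi> x \<bullet> u) * bf (G x) v w) + (\<psi> x \<bullet> v) * bf (G x) u w + (\<psi> x \<bullet> w) * bf (G x) u v = 0" for u v w
    using E[unfolded eisen_def, rule_format, OF xU, of u v w] z[OF V(3)] by (simp add: bf_mat_simps)
qed simp

text \<open>On a ball in \<open>V\<close> the potential is a constant \<open>c0\<close>, so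
  \<open>T = 4 (\<phi> - c0) G\<close> holds there, and this is the relation that passes along
  geodesics. On all of \<open>S\<close> it makes the gradient vanish by
  \<open>eisen_gradient_zero\<close>; hence the potential is \<open>c0\<close> throughout and
  \<open>T = 0\<close>.\<close>

lemma unique_continuation:
  assumes n: "2 \<le> CARD('n)" and S: "open S" "connected S" "S \<subseteq> U"
    and T: "smooth_on U T" and Ts: "\<And>x v w. x \<in> U \<Longrightarrow> bf (T x) v w = bf (T x) w v"
    and E: "eisen U G T \<psi>" and \<phi>: "smooth_on U \<phi>" "\<And>x u. x \<in> U \<Longrightarrow> dd \<phi> x u = \<psi> x \<bullet> u"
    and V: "open V" "V \<subseteq> S" "V \<noteq> {}" "\<And>y. y \<in> V \<Longrightarrow> T y = 0" and x: "x \<in> S"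
  shows "T x = 0"
proof -
  obtain y0 where y0: "y0 \<in> V" using V by blast
  obtain r where r: "r > 0" "ball y0 r \<subseteq> V" using V(1) y0 openE by blast
  define c0 where "c0 = \<phi> y0"
  have \<phi>V: "\<phi> y = c0" if "y \<in> ball y0 r" for y
    unfolding c0_def
  proof (rule constant_on_ball[OF smooth_on_subset[OF \<phi>(1)] open_ball order_refl r(1) _ that])
    show "ball y0 r \<subseteq> U" using r V(2) S(3) by blast
    fix s u assume "s \<in> ball y0 r"
    then have sV: "s \<in> V" using r by blast
    then have sU: "s \<in> U" using V(2) S(3) by blast
    have "\<psi> s = 0" by (rule eisen_zero_gradient[OF n V(1) _ sV E V(4)]) (use V(2) S(3) in auto)
    then show "dd \<phi> s u = 0" using \<phi>(2)[OF sU] by simp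
  qed
  define P where "P x \<longleftrightarrow> (\<exists>\<eta>>0. \<forall>y\<in>ball x \<eta>. y \<in> U \<and> T y = (4 * (\<phi> y - c0)) *\<^sub>R G y)" for x
  have allP: "P x" if x: "x \<in> S" for x
  proof (rule connected_induction_simple[OF S(2) _ x, of y0])
    show "y0 \<in> S" using y0 V by auto
    show "P y0" unfolding P_def using r \<phi>V V S by (intro exI[of _ r]) auto
    fix a assume a: "a \<in> S"
    then have aU: "a \<in> U" using S by auto
    obtain N where N': "open N \<and> a \<in> N \<and> N \<subseteq> U \<and>
      (\<forall>c0 V. open V \<longrightarrow> V \<subseteq> N \<longrightarrow> V \<noteq> {} \<longrightarrow> (\<forall>y\<in>V. T y = (4 * (\<phi> y - c0)) *\<^sub>R G y) \<longrightarrow>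
      (\<exists>\<eta>>0. \<forall>y\<in>ball a \<eta>. y \<in> U \<and> T y = (4 * (\<phi> y - c0)) *\<^sub>R G y))"
      using unique_continuation_local[OF aU T Ts E \<phi>] ..
    then have N: "open N" "a \<in> N" "N \<subseteq> U" by auto
    have N4: "\<exists>\<eta>>0. \<forall>y\<in>ball a \<eta>. y \<in> U \<and> T y = (4 * (\<phi> y - c0)) *\<^sub>R G y"
      if "open V" "V \<subseteq> N" "V \<noteq> {}" "\<forall>y\<in>V. T y = (4 * (\<phi> y - c0)) *\<^sub>R G y" for V
      using N'[THEN conjunct2, THEN conjunct2, THEN conjunct2, rule_format, OF that(1,2,3)] that(4) by simp
    have Pa: "P a" if xN: "x \<in> N" and Px: "P x" for x
    proof -
      obtain \<eta> where \<eta>: "\<eta> > 0" "\<forall>y\<in>ball x \<eta>. y \<in> U \<and> T y = (4 * (\<phi> y - c0)) *\<^sub>R G y"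
        using Px unfolding P_def by blast
      have "x \<in> ball x \<eta> \<inter> N" using xN \<eta>(1) by simp
      then show ?thesis unfolding P_def
        by (intro N4[of "ball x \<eta> \<inter> N"]) (use N(1) \<eta>(2) \<open>x \<in> ball x \<eta> \<inter> N\<close> in blast)+
    qed
    show "\<exists>T. openin (top_of_set S) T \<and> a \<in> T \<and> (\<forall>x\<in>T. \<forall>y\<in>T. P x \<longrightarrow> P y)"
    \<comment> \<open>Either the relation holds somewhere in \<open>N\<close>, and then on a ball
      around \<open>a\<close>, or nowhere in \<open>N\<close>; in both cases \<open>P\<close> has
      one truth value near \<open>a\<close>.\<close>
    proof (cases "\<exists>x\<in>N. P x")
      case True
      then have "P a" using Pa by blast
      then obtain \<eta> where \<eta>: "\<eta> > 0" "\<forall>y\<in>ball a \<eta>. y \<in> U \<and> T y = (4 * (\<phi> y - c0)) *\<^sub>R G y"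
        unfolding P_def by blast
      have "P y" if y: "y \<in> ball a \<eta>" for y
      proof -
        obtain d where "d > 0" "ball y d \<subseteq> ball a \<eta>" using openE[OF open_ball y] by blast
        then show ?thesis unfolding P_def using \<eta>(2) by blast
      qed
      then show ?thesis using \<eta>(1) a S(1)
        by (intro exI[of _ "S \<inter> ball a \<eta>"]) (auto intro: openin_open_Int)
    next
      case False
      then show ?thesis using N(1,2) a
        by (intro exI[of _ "S \<inter> N"]) (auto intro: openin_open_Int)
    qed
  qed
  have \<psi>0: "\<psi> y = 0" if y: "y \<in> S" for y
  proof (rule eisen_gradient_zero[OF _ n])
    show yU: "y \<in> U" using y S by auto
    obtain \<eta> where \<eta>': "\<eta> > 0" "\<forall>z\<in>ball y \<eta>. z \<in> U \<and> T z = (4 * (\<phi> z - c0)) *\<^sub>R G z"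
      using allP[OF y] unfolding P_def by blast
    then have \<eta>: "\<eta> > 0" "\<And>z. z \<in> ball y \<eta> \<Longrightarrow> T z = (4 * (\<phi> z - c0)) *\<^sub>R G z" by auto
    have "((\<lambda>z. (4 * (\<phi> z - c0)) *\<^sub>R G z) has_derivative (\<lambda>u. (4 * (\<phi> y - c0)) *\<^sub>R dd G y u + (4 * (dd \<phi> y u - 0)) *\<^sub>R G y)) (at y)"
      by (intro has_derivative_scaleR has_derivative_mult_right has_derivative_diff has_derivative_const
          smooth_on_deriv[OF \<phi>(1) U yU] smooth_on_deriv[OF G U yU])
    note hd = this
    define k where "k = 4 * (\<phi> y - c0)"
    have "dd T y = dd (\<lambda>z. (4 * (\<phi> z - c0)) *\<^sub>R G z) y"
      by (rule dd_cong_open[OF open_ball[of y \<eta>]]) (use \<eta> in auto)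
    then have dT: "dd T y u = k *\<^sub>R dd G y u + (4 * (\<psi> y \<bullet> u)) *\<^sub>R G y" for u
      unfolding dd_eq[OF hd] \<phi>(2)[OF yU] k_def by simp
    have yT: "T y = k *\<^sub>R G y" using \<eta> by (simp add: k_def)
    show "- 2 * ((\<psi> y \<bullet> u) * bf (G y) v w) + (\<psi> y \<bullet> v) * bf (G y) u w + (\<psi> y \<bullet> w) * bf (G y) u v = 0" for u v w
      using E[unfolded eisen_def, rule_format, OF yU, of u v w] unfolding dT yT bf_mat_simps compat[OF yU, of u v w]
      by (simp add: algebra_simps)
  qed simp
  have "\<phi> constant_on S"
  proof (rule locally_constant_imp_constant[OF S(2)])
    fix a assume a: "a \<in> S"
    obtain d where d: "d > 0" "ball a d \<subseteq> S" using S(1) a openE by blast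
    have L: "\<phi> y = \<phi> a" if "y \<in> ball a d" for y
    proof (rule constant_on_ball[OF smooth_on_subset[OF \<phi>(1) S(3)] S(1) d(2,1) _ that])
      show "dd \<phi> z u = 0" if "z \<in> S" for z u
        using \<phi>(2)[of z u] \<psi>0[OF that] S(3) that by auto
    qed
    have "\<forall>x\<in>S \<inter> ball a d. \<phi> x = \<phi> a" using L by blast
    moreover have "a \<in> S \<inter> ball a d" using a d by simp
    ultimately show "\<exists>T. openin (top_of_set S) T \<and> a \<in> T \<and> (\<forall>x\<in>T. \<phi> x = \<phi> a)"
      using openin_open_Int[OF open_ball[of a d], of S] by blast
  qed
  then have "\<phi> x = \<phi> y0" using x y0 V(2) by (auto simp: constant_on_def)
  moreover have "T x = (4 * (\<phi> x - c0)) *\<^sub>R G x" using allP[OF x] unfolding P_def by (metis centre_in_ball)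
  ultimately show ?thesis by (simp add: c0_def)
qed

end

section \<open>The Eisenhart equation with a cyclic solution\<close>

lemma axis_expansion: "x = (\<Sum>i\<in>UNIV. x $ i *\<^sub>R axis i 1)" for x :: "real^'n"
  using basis_expansion[of x] by (simp add: scalar_mult_eq_scaleR)

lemma bilinear_bf:
  fixes b :: "real^'n \<Rightarrow> real^'n \<Rightarrow> real"
  assumes 1: "\<And>u. linear (b u)" and 2: "\<And>v. linear (\<lambda>u. b u v)"
  shows "bf (\<chi> i j. b (axis i 1) (axis j 1)) u v = b u v"
proof -
  have "b u v = (\<Sum>i\<in>UNIV. u $ i * b (axis i 1) v)"
    using arg_cong[OF axis_expansion[of u], of "\<lambda>u. b u v"] by (simp only: linear_sum[OF 2] linear_scale[OF 2] real_scaleR_def)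
  also have "\<dots> = (\<Sum>i\<in>UNIV. u $ i * (\<Sum>j\<in>UNIV. v $ j * b (axis i 1) (axis j 1)))"
    using arg_cong[OF axis_expansion[of v], of "b (axis i 1)" for i] by (simp only: linear_sum[OF 1] linear_scale[OF 1] real_scaleR_def)
  finally show ?thesis by (simp add: bf_expand sum_distrib_left mult_ac)
qed

context chart_metric
begin

lemma gradient_closed:
  assumes \<psi>: "smooth_on U \<psi>" and \<phi>: "smooth_on U \<phi>" "\<And>x u. x \<in> U \<Longrightarrow> dd \<phi> x u = \<psi> x \<bullet> u" and x: "x \<in> U"
  shows "dd \<psi> x u \<bullet> v = dd \<psi> x v \<bullet> u"
proof -
  have e: "dd \<psi> x u \<bullet> v = dd (\<lambda>y. dd \<phi> y v) x u" for u v
  proof -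
    have "dd (\<lambda>y. \<psi> y \<bullet> v) x = dd (\<lambda>y. dd \<phi> y v) x"
      by (rule dd_cong_open[OF U x]) (simp add: \<phi>(2))
    then show ?thesis using dd_linear_compose[OF bounded_linear_inner_left \<psi> U x, of v u] by simp
  qed
  show ?thesis unfolding e by (rule dd_commute[OF \<phi>(1) U x])
qed

definition raise :: "real^'n \<Rightarrow> real^'n^'n \<Rightarrow> real^'n \<Rightarrow> real^'n" where
  "raise x M = (*v) (matrix_inv (G x) ** M)"

lemma linear_raise: "linear (raise x M)"
  unfolding raise_def by (rule matrix_vector_mul_linear)

lemma G_raise: "x \<in> U \<Longrightarrow> G x *v raise x M v = M *v v"
  by (simp add: raise_def matrix_vector_mul_assoc matrix_mul_assoc mat_inv_right[OF Ginv])

lemma bf_raise: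
  assumes x: "x \<in> U" and s: "\<And>v w. bf M v w = bf M w v"
  shows "bf (G x) (raise x M v) w = bf M v w"
  unfolding Gsym[OF x, of "raise x M v"] s[of v] by (simp add: bf_def G_raise[OF x])

lemma raise_span_iff:
  assumes x: "x \<in> U"
  shows "(\<forall>v. raise x M v = a *\<^sub>R v + b *\<^sub>R raise x H v) \<longleftrightarrow> M = a *\<^sub>R G x + b *\<^sub>R H"
proof
  assume l: "\<forall>v. raise x M v = a *\<^sub>R v + b *\<^sub>R raise x H v"
  show "M = a *\<^sub>R G x + b *\<^sub>R H"
  proof (rule bf_eqI)
    fix u w
    have "bf M u w = u \<bullet> (G x *v raise x M w)" by (simp add: bf_def G_raise[OF x])
    also have "\<dots> = u \<bullet> (a *\<^sub>R (G x *v w) + b *\<^sub>R (G x *v raise x H w))"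
      by (simp add: l matrix_vector_right_distrib matrix_vector_mult_scaleR)
    finally show "bf M u w = bf (a *\<^sub>R G x + b *\<^sub>R H) u w"
      by (simp add: bf_mat_simps G_raise[OF x] inner_add_right) (simp add: bf_def)
  qed
next
  assume r: "M = a *\<^sub>R G x + b *\<^sub>R H"
  show "\<forall>v. raise x M v = a *\<^sub>R v + b *\<^sub>R raise x H v"
  proof
    fix v
    have "G x *v raise x M v = G x *v (a *\<^sub>R v + b *\<^sub>R raise x H v)"
      by (simp add: matrix_vector_right_distrib matrix_vector_mult_scaleR G_raise[OF x] r
          matrix_vector_mult_add_rdistrib scaleR_matrix_vector_assoc)
    then have "bf (G x) w (raise x M v) = bf (G x) w (a *\<^sub>R v + b *\<^sub>R raise x H v)" for w
      by (simp add: bf_def)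
    then show "raise x M v = a *\<^sub>R v + b *\<^sub>R raise x H v"
      by (intro G_eqI[OF x]) (simp add: Gsym[OF x])
  qed
qed

definition hm :: "(real^'n \<Rightarrow> real^'n) \<Rightarrow> real^'n \<Rightarrow> real^'n^'n" where
  "hm \<psi> x = (\<chi> i j. hess G \<psi> x (axis i 1) (axis j 1))"

lemma bf_hm:
  assumes \<psi>: "smooth_on U \<psi>" and x: "x \<in> U"
  shows "bf (hm \<psi> x) u v = hess G \<psi> x u v"
  unfolding hm_def
proof (rule bilinear_bf)
  note l = linear_add linear_scale
  show "linear (hess G \<psi> x u)" for u
    by (rule linearI) (simp_all add: hess_def l[OF chr_linear(1)[OF x]] inner_add_right algebra_simps)
  show "linear (\<lambda>u. hess G \<psi> x u v)" for v
    by (rule linearI) (simp_all add: hess_def l[OF chr_linear(2)[OF x]] l[OF dd_linear[OF \<psi> U x]]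
        inner_add_right inner_add_left algebra_simps)
qed

lemma smooth_hess: "smooth_on U \<psi> \<Longrightarrow> smooth_on U (\<lambda>x. hess G \<psi> x u v)"
  unfolding hess_def
  by (intro smooth_on_diff[OF U] smooth_on_bilinear[OF U bounded_bilinear_inner] smooth_on_dd smooth_on_const[OF U] smooth_chr)

lemma smooth_hm: "smooth_on U \<psi> \<Longrightarrow> smooth_on U (hm \<psi>)"
  by (intro smooth_on_vecI[OF U]) (simp add: hm_def smooth_hess)

lemma hess_sym:
  "x \<in> U \<Longrightarrow> (\<And>u v. dd \<psi> x u \<bullet> v = dd \<psi> x v \<bullet> u) \<Longrightarrow> hess G \<psi> x u v = hess G \<psi> x v u"
  unfolding hess_def using chr_sym[of x u v] by metis

end

text \<open>Rigidity is present as \<open>cyc\<close>, the existence of a cyclic vector at each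
  point; \<open>\<psi>\<close> stands for the gradient of the potential belonging to
  \<open>H\<close>.\<close>

locale cyclic_metric = chart_metric U G for U :: "(real^'n::finite) set" and G +
  fixes H :: "real^'n \<Rightarrow> real^'n^'n" and \<psi> :: "real^'n \<Rightarrow> real^'n"
  assumes dim: "4 \<le> CARD('n)" and H: "smooth_on U H" and Hsym: "x \<in> U \<Longrightarrow> bf (H x) v w = bf (H x) w v"
    and \<psi>: "smooth_on U \<psi>" and closed: "x \<in> U \<Longrightarrow> dd \<psi> x u \<bullet> v = dd \<psi> x v \<bullet> u" and EH: "eisen U G H \<psi>"
    and cyc: "x \<in> U \<Longrightarrow> \<exists>v. cyclic_for (raise x (H x)) v"
begin

lemma cyclic_curvature_at:
  assumes x: "x \<in> U" and v: "cyclic_for (raise x (H x)) v0"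
  shows "cyclic_curvature (bf (G x)) (raise x (H x)) (raise x (hm \<psi> x)) (curv G x) v0"
proof -
  have hs: "bf (hm \<psi> x) v w = bf (hm \<psi> x) w v" for v w
    unfolding bf_hm[OF \<psi> x] by (rule hess_sym[OF x closed[OF x]])
  note r = bf_raise[OF x Hsym[OF x]] bf_raise[OF x hs]
  have r': "bf (G x) u (raise x (H x) w) = bf (H x) u w" "bf (G x) u (raise x (hm \<psi> x) w) = bf (hm \<psi> x) u w" for u w
    using r(1)[of w u] r(2)[of w u] Gsym[OF x, of u] Hsym[OF x, of u w] hs[of u w] by auto
  show ?thesis
  proof (intro cyclic_curvature.intro nondeg_form.intro cyclic_curvature_axioms.intro)
    show "bilinear (bf (G x))"
      unfolding bilinear_def by (auto intro!: linearI simp: bf_simps)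
    show "bf (G x) u v = bf (G x) v u" for u v by (rule Gsym[OF x])
    show "u = 0" if "\<And>v. bf (G x) u v = 0" for u by (rule nondeg[OF x that])
    show "4 \<le> DIM(real^'n)" using dim by simp
    show "cyclic_for (raise x (H x)) v0" by (rule v)
    show "linear (raise x (H x))" "linear (raise x (hm \<psi> x))" by (rule linear_raise)+
    show "bf (G x) (raise x (H x) u) v = bf (G x) u (raise x (H x) v)" for u v by (simp add: r r')
    show "bf (G x) (raise x (hm \<psi> x) u) v = bf (G x) u (raise x (hm \<psi> x) v)" for u v by (simp add: r r')
    show "linear (curv G x z u)" for z u by (rule curv_linear[OF x])
    show "bf (G x) (curv G x z u v) w = - bf (G x) v (curv G x z u w)" for z u v w by (rule curv_skew[OF x])
    show "bf (G x) (raise x (H x) (curv G x z u v)) w + bf (G x) (raise x (H x) v) (curv G x z u w)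
      + bf (G x) u w * bf (G x) (raise x (hm \<psi> x) z) v - bf (G x) z w * bf (G x) (raise x (hm \<psi> x) u) v
      + bf (G x) u v * bf (G x) (raise x (hm \<psi> x) z) w - bf (G x) z v * bf (G x) (raise x (hm \<psi> x) u) w = 0" for z u v w
      unfolding r bf_hm[OF \<psi> x] by (rule ricci[OF H Hsym \<psi> closed EH x])
  qed
qed

lemma curvature_of_span:
  assumes x: "x \<in> U" and s: "hm \<psi> x = a *\<^sub>R G x + b *\<^sub>R H x"
  shows "curv G x z u v = (- b) *\<^sub>R (bf (G x) u v *\<^sub>R z - bf (G x) z v *\<^sub>R u)"
proof -
  obtain v0 where v0: "cyclic_for (raise x (H x)) v0" using cyc[OF x] ..
  show ?thesis
    by (rule cyclic_curvature.constant_type[OF cyclic_curvature_at[OF x v0]])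
      (rule spec[OF iffD2[OF raise_span_iff[OF x] s]])
qed

lemma independent:
  assumes x: "x \<in> U" and e: "a *\<^sub>R G x + b *\<^sub>R H x = 0" shows "a = 0 \<and> b = 0"
proof -
  obtain v where v: "cyclic_for (raise x (H x)) v" using cyc[OF x] ..
  have "raise x 0 v = a *\<^sub>R v + b *\<^sub>R raise x (H x) v"
    using raise_span_iff[OF x, of 0 a b "H x"] e by simp
  moreover have "raise x 0 v = 0" by (simp add: raise_def)
  ultimately have "a *\<^sub>R v + b *\<^sub>R raise x (H x) v + 0 *\<^sub>R raise x (H x) (raise x (H x) v)
      + 0 *\<^sub>R raise x (H x) (raise x (H x) (raise x (H x) v)) = 0" by simp
  from krylov4[OF v linear_raise _ this] dim show ?thesis by simp
qed

text \<open>Some 2 by 2 minor of the components of \<open>G\<close> and \<open>H\<close> is nonzero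
  near \<open>x0\<close>, and Cramer's rule with it defines \<open>\<alpha>\<close> and
  \<open>\<beta>\<close>. They are smooth whether or not \<open>B\<close> lies in the span, so
  failure to lie in it is an open condition.\<close>

lemma smooth_coefficients:
  assumes x0: "x0 \<in> U" and B: "smooth_on U B"
  obtains V \<alpha> \<beta> where "open V" "x0 \<in> V" "V \<subseteq> U" "smooth_on V \<alpha>" "smooth_on V (\<beta> :: _ \<Rightarrow> real)"
    "\<And>x a b. x \<in> V \<Longrightarrow> B x = a *\<^sub>R G x + b *\<^sub>R H x \<Longrightarrow> a = \<alpha> x \<and> b = \<beta> x"
proof -
  obtain u v u' v' where m: "bf (G x0) u v * bf (H x0) u' v' - bf (G x0) u' v' * bf (H x0) u v \<noteq> 0"
  proof (rule ccontr)
    assume "\<not> thesis"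
    then have z: "bf (G x0) u v * bf (H x0) u' v' - bf (G x0) u' v' * bf (H x0) u v = 0" for u v u' v'
      using that by blast
    have "(- bf (H x0) u v) *\<^sub>R G x0 + bf (G x0) u v *\<^sub>R H x0 = 0" for u v
      by (rule bf_eqI) (use z[of u v] in \<open>simp add: bf_mat_simps algebra_simps\<close>)
    from independent[OF x0 this] have "bf (G x0) u v = 0" for u v by simp
    then have "(axis undefined 1 :: real^'n) = 0" by (intro nondeg[OF x0])
    then show False by (simp add: axis_eq_0_iff)
  qed
  define D where "D x = bf (G x) u v * bf (H x) u' v' - bf (G x) u' v' * bf (H x) u v" for x
  define V where "V = {x \<in> U. D x \<noteq> 0}"
  note sb = smooth_on_bf[OF U _ smooth_on_const[OF U] smooth_on_const[OF U]]
  have sD: "smooth_on U D" unfolding D_def[abs_def] by (intro smooth_on_diff[OF U] smooth_on_mult[OF U] sb G H)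
  have V: "open V"
    using continuous_open_preimage[OF smooth_on_continuous[OF sD] U open_Compl[OF closed_singleton]] by (simp add: V_def vimage_def Int_def)
  have VU: "V \<subseteq> U" by (auto simp: V_def)
  note ss = smooth_on_subset[OF _ VU]
  define \<alpha> where "\<alpha> x = (bf (B x) u v * bf (H x) u' v' - bf (B x) u' v' * bf (H x) u v) * inverse (D x)" for x
  define \<beta> where "\<beta> x = (bf (G x) u v * bf (B x) u' v' - bf (G x) u' v' * bf (B x) u v) * inverse (D x)" for x
  have iD: "smooth_on V (\<lambda>x. inverse (D x))" by (rule smooth_on_inverse[OF V ss[OF sD]]) (simp add: V_def)
  show ?thesis
  proof (rule that[OF V _ VU])
    show "x0 \<in> V" using x0 m by (simp add: V_def D_def)
    show "smooth_on V \<alpha>" unfolding \<alpha>_def[abs_def]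
      by (intro smooth_on_mult[OF V _ iD] ss smooth_on_diff[OF U] smooth_on_mult[OF U] sb H B)
    show "smooth_on V \<beta>" unfolding \<beta>_def[abs_def]
      by (intro smooth_on_mult[OF V _ iD] ss smooth_on_diff[OF U] smooth_on_mult[OF U] sb G B)
    fix x a b assume x: "x \<in> V" and e: "B x = a *\<^sub>R G x + b *\<^sub>R H x"
    have D: "D x \<noteq> 0" using x by (simp add: V_def)
    have "(bf (B x) u v * bf (H x) u' v' - bf (B x) u' v' * bf (H x) u v) = a * D x"
      "(bf (G x) u v * bf (B x) u' v' - bf (G x) u' v' * bf (B x) u v) = b * D x"
      unfolding e bf_mat_simps D_def by (simp_all add: algebra_simps)
    then show "a = \<alpha> x \<and> b = \<beta> x" using D by (simp add: \<alpha>_def \<beta>_def)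
  qed
qed

lemma dd_span:
  assumes V: "open V" "V \<subseteq> U" and \<alpha>: "smooth_on V \<alpha>" and \<beta>: "smooth_on V (\<beta> :: _ \<Rightarrow> real)" and x: "x \<in> V"
    and B: "\<And>y. y \<in> V \<Longrightarrow> B y = \<alpha> y *\<^sub>R G y + \<beta> y *\<^sub>R H y"
  shows "bf (dd B x z) u v = dd \<alpha> x z * bf (G x) u v + \<alpha> x * bf (dd G x z) u v
    + dd \<beta> x z * bf (H x) u v + \<beta> x * bf (dd H x z) u v"
proof -
  note d = smooth_on_deriv[OF smooth_on_subset[OF _ V(2)] V(1) x]
  have dB: "dd B x = dd (\<lambda>y. \<alpha> y *\<^sub>R G y + \<beta> y *\<^sub>R H y) x" by (rule dd_cong_open[OF V(1) x B])
  have h: "((\<lambda>y. \<alpha> y *\<^sub>R G y + \<beta> y *\<^sub>R H y) has_derivative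
     (\<lambda>z. (\<alpha> x *\<^sub>R dd G x z + dd \<alpha> x z *\<^sub>R G x) + (\<beta> x *\<^sub>R dd H x z + dd \<beta> x z *\<^sub>R H x))) (at x)"
    by (intro has_derivative_add has_derivative_scaleR d[OF G] d[OF H]
        smooth_on_deriv[OF \<alpha> V(1) x] smooth_on_deriv[OF \<beta> V(1) x])
  show ?thesis unfolding dB dd_eq[OF h] bf_mat_simps by simp
qed

lemma raise_eqI:
  assumes x: "x \<in> U" and r: "\<And>v. a * bf (G x) u v + b * bf (H x) u v = bf (G x) w v"
  shows "b *\<^sub>R raise x (H x) u + a *\<^sub>R u = w"
  by (rule G_eqI[OF x]) (simp add: bf_simps bf_raise[OF x Hsym[OF x]] r[symmetric])

text \<open>The analogue of Schur's lemma: the Ricci identity for the covector field leaves an identity whose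
  two sides have ranges of different dimension.\<close>

lemma schur:
  assumes V: "open V" "V \<subseteq> U" and \<alpha>: "smooth_on V \<alpha>" and \<beta>: "smooth_on V \<beta>" and x: "x \<in> V"
    and B: "\<And>y. y \<in> V \<Longrightarrow> hm \<psi> y = \<alpha> y *\<^sub>R G y + \<beta> y *\<^sub>R H y"
  shows "dd \<beta> x z = 0"
proof -
  have xU: "x \<in> U" using x V by auto
  obtain v0 where v0: "cyclic_for (raise x (H x)) v0" using cyc[OF xU] ..
  have hd: "dd (\<lambda>y. hess G \<psi> y u v) x z = bf (dd (hm \<psi>) x z) u v" for u v z
  proof -
    have "dd (\<lambda>y. hess G \<psi> y u v) x = dd (\<lambda>y. bf (hm \<psi> y) u v) x"
      by (rule dd_cong_open[OF U xU]) (simp add: bf_hm[OF \<psi>])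
    then show ?thesis by (simp add: dd_bf_const[OF U xU smooth_hm[OF \<psi>]])
  qed
  have hx: "hess G \<psi> x u v = \<alpha> x * bf (G x) u v + \<beta> x * bf (H x) u v" for u v
    by (simp add: bf_hm[OF \<psi> xU, symmetric] B[OF x] bf_mat_simps)
  \<comment> \<open>In the Ricci identity for \<open>\<psi>\<close> with Hessian
    \<open>\<alpha> G + \<beta> H\<close>, the curvature term cancels against the \<psi> terms that
    come from differentiating \<open>H\<close>; only the differentials of \<alpha> and \<beta>
    remain.\<close>
  have key: "dd \<alpha> x z * bf (G x) u v + dd \<beta> x z * bf (H x) u v = dd \<alpha> x u * bf (G x) z v + dd \<beta> x u * bf (H x) z v" for z u v
  proof -
    have rc: "\<psi> x \<bullet> curv G x z u v = - \<beta> x * (bf (G x) u v * (\<psi> x \<bullet> z) - bf (G x) z v * (\<psi> x \<bullet> u))"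
      unfolding curvature_of_span[OF xU B[OF x]] by (simp add: inner_diff_right)
    have dh: "bf (dd (hm \<psi>) x z) u v = dd \<alpha> x z * bf (G x) u v + \<alpha> x * bf (dd G x z) u v
      + dd \<beta> x z * bf (H x) u v + \<beta> x * bf (dd H x z) u v" for z u v
      by (rule dd_span[OF V \<alpha> \<beta> x B])
    note EE = EH[unfolded eisen_def, rule_format, OF xU]
    show ?thesis
      using ricci_covector[OF \<psi> xU, of z u v]
      unfolding rc hd dh hx compat[OF xU] EE chr_sym[OF xU, of u z] Gsym[OF xU, of z u]
      by (simp add: algebra_simps)
  qed
  have r: "dd \<beta> x z *\<^sub>R raise x (H x) u + dd \<alpha> x z *\<^sub>R u \<in> span {z, raise x (H x) z}" for u
  proof -
    have "dd \<beta> x z *\<^sub>R raise x (H x) u + dd \<alpha> x z *\<^sub>R u = dd \<alpha> x u *\<^sub>R z + dd \<beta> x u *\<^sub>R raise x (H x) z"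
      by (rule raise_eqI[OF xU]) (simp add: key[of z u] bf_simps bf_raise[OF xU Hsym[OF xU]])
    then show ?thesis unfolding span_2 by blast
  qed
  show ?thesis using plane_range_eq_0[OF v0 linear_raise _ r] dim by simp
qed

text \<open>Comparing the Eisenhart equations of \<open>B\<close> and \<open>H\<close> in
  \<open>B = \<alpha> G + \<beta> H\<close> gives \<open>key\<close>. With an index raised it says
  that a combination of \<open>L\<close> and the identity, with coefficients
  \<open>d\<beta>(z)\<close> and \<open>d\<alpha>(z) - 2 \<chi>'(z)\<close>, has its range in the
  plane of \<open>z\<close> and \<open>s\<close>; so both coefficients vanish. What is left of
  \<open>key\<close> forces \<open>\<chi>' = 0\<close>, and with it
  \<open>d\<alpha> = 0\<close>.\<close>

lemma span_coefficients_constant: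
  assumes V: "open V" "V \<subseteq> U" and \<alpha>: "smooth_on V \<alpha>" and \<beta>: "smooth_on V \<beta>" and x: "x \<in> V"
    and EB: "eisen U G B \<psi>'"
    and B: "\<And>y. y \<in> V \<Longrightarrow> B y = \<alpha> y *\<^sub>R G y + \<beta> y *\<^sub>R H y"
  shows "dd \<alpha> x z = 0 \<and> dd \<beta> x z = 0"
proof -
  have xU: "x \<in> U" using x V by auto
  obtain v0 where v0: "cyclic_for (raise x (H x)) v0" using cyc[OF xU] ..
  define \<chi>' where "\<chi>' = \<psi>' x - \<beta> x *\<^sub>R \<psi> x"
  define s where "s = matrix_inv (G x) *v \<chi>'"
  have s: "bf (G x) s v = \<chi>' \<bullet> v" for v
    unfolding Gsym[OF xU, of s] by (simp add: bf_def s_def matrix_vector_mul_assoc mat_inv_right[OF Ginv[OF xU]] inner_commute)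
  have key: "dd \<alpha> x z * bf (G x) u v + dd \<beta> x z * bf (H x) u v =
      2 * (\<chi>' \<bullet> z) * bf (G x) u v + (\<chi>' \<bullet> u) * bf (G x) z v + (\<chi>' \<bullet> v) * bf (G x) z u" for z u v
  proof -
    have dB: "bf (dd B x z) u v = dd \<alpha> x z * bf (G x) u v + \<alpha> x * bf (dd G x z) u v
      + dd \<beta> x z * bf (H x) u v + \<beta> x * bf (dd H x z) u v" for z u v
      by (rule dd_span[OF V \<alpha> \<beta> x B])
    note EE = EH[unfolded eisen_def, rule_format, OF xU]
    show ?thesis
      using EB[unfolded eisen_def, rule_format, OF xU, of z u v]
      unfolding dB B[OF x] bf_mat_simps compat[OF xU] EE \<chi>'_def
      by (simp add: algebra_simps inner_diff_left)
  qed
  have z: "dd \<beta> x z = 0 \<and> dd \<alpha> x z - 2 * (\<chi>' \<bullet> z) = 0" for z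
  proof (rule plane_range_eq_0[OF v0 linear_raise])
    show "4 \<le> DIM(real^'n)" using dim by simp
    fix u
    have "dd \<beta> x z *\<^sub>R raise x (H x) u + (dd \<alpha> x z - 2 * (\<chi>' \<bullet> z)) *\<^sub>R u = (\<chi>' \<bullet> u) *\<^sub>R z + bf (G x) z u *\<^sub>R s"
      by (rule raise_eqI[OF xU]) (use key[of z u] in \<open>simp add: bf_simps s algebra_simps\<close>)
    then show "dd \<beta> x z *\<^sub>R raise x (H x) u + (dd \<alpha> x z - 2 * (\<chi>' \<bullet> z)) *\<^sub>R u \<in> span {z, s}"
      unfolding span_2 by blast
  qed
  have "\<chi>' \<bullet> u = 0" for u
  proof (rule ccontr)
    assume n: "\<chi>' \<bullet> u \<noteq> 0"
    \<comment> \<open>With two equal arguments the two remaining terms of \<open>key\<close>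
      coincide instead of cancelling, so \<open>u\<close> would be orthogonal to everything.\<close>
    have "(\<chi>' \<bullet> u) * bf (G x) u v = 0" for v
      using key[of v u u] z[of v] Gsym[OF xU, of u v] by (simp add: algebra_simps)
    then have "u = 0" using n by (intro nondeg[OF xU]) simp
    then show False using n by simp
  qed
  then show ?thesis using z[of z] by simp
qed

lemma second_solution_at:
  assumes x: "x \<in> U" and B: "smooth_on U B" "\<And>x v w. x \<in> U \<Longrightarrow> bf (B x) v w = bf (B x) w v"
    and \<psi>': "smooth_on U \<psi>'" and cl: "\<And>x u v. x \<in> U \<Longrightarrow> dd \<psi>' x u \<bullet> v = dd \<psi>' x v \<bullet> u"
    and EB: "eisen U G B \<psi>'" and n: "\<not> (\<exists>a b. hm \<psi> x = a *\<^sub>R G x + b *\<^sub>R H x)"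
  shows "\<exists>a b. B x = a *\<^sub>R G x + b *\<^sub>R H x"
proof -
  obtain v0 where v0: "cyclic_for (raise x (H x)) v0" using cyc[OF x] ..
  interpret cc: cyclic_curvature "bf (G x)" "raise x (H x)" "raise x (hm \<psi> x)" "curv G x" v0
    by (rule cyclic_curvature_at[OF x v0])
  have hs: "bf (hm \<psi>' x) v w = bf (hm \<psi>' x) w v" for v w
    unfolding bf_hm[OF \<psi>' x] by (rule hess_sym[OF x cl[OF x]])
  note r = bf_raise[OF x B(2)[OF x]] bf_raise[OF x hs]
  have s: "bf (G x) (raise x M v) w = bf (G x) v (raise x M w)" if s: "\<And>v w. bf M v w = bf M w v" for M v w
    unfolding Gsym[OF x, of v] bf_raise[OF x s] by (rule s)
  have "(\<exists>a b. \<forall>v. raise x (hm \<psi> x) v = a *\<^sub>R v + b *\<^sub>R raise x (H x) v)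
      \<or> (\<exists>a b. \<forall>v. raise x (B x) v = a *\<^sub>R v + b *\<^sub>R raise x (H x) v)"
  proof (rule cc.second_solution[OF linear_raise s[OF B(2)[OF x]] linear_raise s[OF hs]])
    fix z u v w
    show "bf (G x) (raise x (B x) (curv G x z u v)) w + bf (G x) (raise x (B x) v) (curv G x z u w)
      + bf (G x) u w * bf (G x) (raise x (hm \<psi>' x) z) v - bf (G x) z w * bf (G x) (raise x (hm \<psi>' x) u) v
      + bf (G x) u v * bf (G x) (raise x (hm \<psi>' x) z) w - bf (G x) z v * bf (G x) (raise x (hm \<psi>' x) u) w = 0"
      unfolding r bf_hm[OF \<psi>' x] by (rule ricci[OF B \<psi>' cl EB x])
  qed
  then show ?thesis using n unfolding raise_span_iff[OF x] by blast
qed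

text \<open>The Hessian stays out of the span on an open set \<open>N\<close> around
  \<open>x0\<close>. There \<open>second_solution_at\<close> puts \<open>B\<close> in the span at
  each point, and its coefficients are constant near \<open>x0\<close>.\<close>

lemma second_solution_local:
  assumes x0: "x0 \<in> U" and B: "smooth_on U B" "\<And>x v w. x \<in> U \<Longrightarrow> bf (B x) v w = bf (B x) w v"
    and \<psi>': "smooth_on U \<psi>'" and cl: "\<And>x u v. x \<in> U \<Longrightarrow> dd \<psi>' x u \<bullet> v = dd \<psi>' x v \<bullet> u"
    and EB: "eisen U G B \<psi>'" and n: "\<not> (\<exists>a b. hm \<psi> x0 = a *\<^sub>R G x0 + b *\<^sub>R H x0)"
  obtains d a b where "d > 0" "ball x0 d \<subseteq> U" "\<And>x. x \<in> ball x0 d \<Longrightarrow> B x = a *\<^sub>R G x + b *\<^sub>R H x"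
proof -
  obtain V \<alpha> \<beta> where V: "open V" "x0 \<in> V" "V \<subseteq> U" and \<alpha>: "smooth_on V \<alpha>" and \<beta>: "smooth_on V \<beta>"
    and c: "\<And>x a b. x \<in> V \<Longrightarrow> hm \<psi> x = a *\<^sub>R G x + b *\<^sub>R H x \<Longrightarrow> a = \<alpha> x \<and> b = \<beta> x"
    by (rule smooth_coefficients[OF x0 smooth_hm[OF \<psi>]]) (rule that)
  define N where "N = {x \<in> V. hm \<psi> x - (\<alpha> x *\<^sub>R G x + \<beta> x *\<^sub>R H x) \<noteq> 0}"
  note ss = smooth_on_continuous[OF smooth_on_subset[OF _ V(3)]]
  have "continuous_on V (\<lambda>x. hm \<psi> x - (\<alpha> x *\<^sub>R G x + \<beta> x *\<^sub>R H x))"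
    by (intro continuous_on_diff continuous_on_add continuous_on_scaleR smooth_on_continuous[OF \<alpha>]
        smooth_on_continuous[OF \<beta>] ss[OF G] ss[OF H] ss[OF smooth_hm[OF \<psi>]])
  from continuous_open_preimage[OF this V(1) open_Compl[OF closed_singleton[of 0]]] have N: "open N" by (simp add: N_def vimage_def Int_def)
  have nN: "\<not> (\<exists>a b. hm \<psi> x = a *\<^sub>R G x + b *\<^sub>R H x)" if "x \<in> N" for x
  proof
    assume "\<exists>a b. hm \<psi> x = a *\<^sub>R G x + b *\<^sub>R H x"
    then obtain a b where e: "hm \<psi> x = a *\<^sub>R G x + b *\<^sub>R H x" by blast
    have "x \<in> V" using that by (simp add: N_def)
    from c[OF this e] e show False using that by (simp add: N_def)
  qed
  have x0N: "x0 \<in> N" using n V(2) by (auto simp: N_def)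
  have NU: "N \<subseteq> U" using V(3) by (auto simp: N_def)
  obtain V' \<alpha>' \<beta>' where V': "open V'" "x0 \<in> V'" "V' \<subseteq> U" and \<alpha>': "smooth_on V' \<alpha>'" and \<beta>': "smooth_on V' \<beta>'"
    and c': "\<And>x a b. x \<in> V' \<Longrightarrow> B x = a *\<^sub>R G x + b *\<^sub>R H x \<Longrightarrow> a = \<alpha>' x \<and> b = \<beta>' x"
    by (rule smooth_coefficients[OF x0 B(1)]) (rule that)
  define S where "S = N \<inter> V'"
  have S: "open S" "S \<subseteq> U" "x0 \<in> S" "S \<subseteq> V'" using N V' x0N NU by (auto simp: S_def)
  have e: "B y = \<alpha>' y *\<^sub>R G y + \<beta>' y *\<^sub>R H y" if y: "y \<in> S" for y
  proof -
    have yN: "y \<in> N" "y \<in> V'" "y \<in> U" using y S by (auto simp: S_def)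
    obtain a b where ab: "B y = a *\<^sub>R G y + b *\<^sub>R H y"
      using second_solution_at[OF yN(3) B \<psi>' cl EB nN[OF yN(1)]] by blast
    from c'[OF yN(2) ab] ab show ?thesis by simp
  qed
  obtain d where d: "d > 0" "ball x0 d \<subseteq> S" using S openE by blast
  note s' = smooth_on_subset[OF \<alpha>' S(4)] smooth_on_subset[OF \<beta>' S(4)]
  have z: "dd \<alpha>' y u = 0 \<and> dd \<beta>' y u = 0" if "y \<in> S" for y u
    by (rule span_coefficients_constant[OF S(1,2) s' that EB e])
  have "\<alpha>' y = \<alpha>' x0" "\<beta>' y = \<beta>' x0" if "y \<in> ball x0 d" for y
    using constant_on_ball[OF s'(1) S(1) d(2,1) _ that] constant_on_ball[OF s'(2) S(1) d(2,1) _ that] z by blast+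
  then have "B y = \<alpha>' x0 *\<^sub>R G y + \<beta>' x0 *\<^sub>R H y" if "y \<in> ball x0 d" for y
    using e[of y] that d(2) by auto
  then show ?thesis using that[OF d(1)] d(2) S(2) by blast
qed

text \<open>Only the coefficient of \<open>H\<close> is asserted to be locally constant: its
  negative is the curvature, while the coefficient of \<open>G\<close> drops out of
  \<open>curvature_of_span\<close>.\<close>

lemma span_coefficient_locally_constant:
  assumes x0: "x0 \<in> U" and D: "open D" "x0 \<in> D" "D \<subseteq> U"
    and s: "\<And>x. x \<in> D \<Longrightarrow> \<exists>a b. hm \<psi> x = a *\<^sub>R G x + b *\<^sub>R H x"
  obtains d \<kappa> where "d > 0" "ball x0 d \<subseteq> D"
    "\<And>x. x \<in> ball x0 d \<Longrightarrow> \<exists>a. hm \<psi> x = a *\<^sub>R G x + \<kappa> *\<^sub>R H x"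
proof -
  obtain V \<alpha> \<beta> where V: "open V" "x0 \<in> V" "V \<subseteq> U" and \<alpha>: "smooth_on V \<alpha>" and \<beta>: "smooth_on V \<beta>"
    and c: "\<And>x a b. x \<in> V \<Longrightarrow> hm \<psi> x = a *\<^sub>R G x + b *\<^sub>R H x \<Longrightarrow> a = \<alpha> x \<and> b = \<beta> x"
    by (rule smooth_coefficients[OF x0 smooth_hm[OF \<psi>]]) (rule that)
  define S where "S = D \<inter> V"
  have S: "open S" "S \<subseteq> U" "x0 \<in> S" "S \<subseteq> V" "S \<subseteq> D" using V D by (auto simp: S_def)
  have e: "hm \<psi> y = \<alpha> y *\<^sub>R G y + \<beta> y *\<^sub>R H y" if y: "y \<in> S" for y
  proof -
    have yN: "y \<in> D" "y \<in> V" using y by (auto simp: S_def)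
    obtain a b where ab: "hm \<psi> y = a *\<^sub>R G y + b *\<^sub>R H y" using s[OF yN(1)] by blast
    from c[OF yN(2) ab] ab show ?thesis by simp
  qed
  obtain d where d: "d > 0" "ball x0 d \<subseteq> S" using S openE by blast
  note s' = smooth_on_subset[OF \<alpha> S(4)] smooth_on_subset[OF \<beta> S(4)]
  have z: "dd \<beta> y u = 0" if "y \<in> S" for y u
    by (rule schur[OF S(1,2) s' that e])
  have k: "\<beta> y = \<beta> x0" if "y \<in> ball x0 d" for y
    using constant_on_ball[OF s'(2) S(1) d(2,1) _ that] z by blast
  show ?thesis
  proof (rule that[OF d(1)])
    show "ball x0 d \<subseteq> D" using d S by auto
    show "\<exists>a. hm \<psi> x = a *\<^sub>R G x + \<beta> x0 *\<^sub>R H x" if "x \<in> ball x0 d" for x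
      using e[of x] k[OF that] that d(2) by auto
  qed
qed

end

section \<open>Charts of the manifold\<close>

lemma axis_eqI:
  assumes "linear f" "linear g" "\<And>i. f (axis i 1) = g (axis i (1::real))"
  shows "f = g"
  by (rule linear_eq_stdbasis[OF assms(1,2)]) (auto simp: Basis_vec_def assms(3))

lemma bf_axis_right: "bf M v (axis j 1) = (\<Sum>l\<in>UNIV. v $ l * M $ l $ j)"
  by (simp add: bf_def inner_vec_def matrix_vector_mult_basis column_def)

lemma bf_axis_left: "bf M (axis i 1) v = (\<Sum>l\<in>UNIV. M $ i $ l * v $ l)"
  by (simp add: bf_def inner_axis' matrix_vector_mult_def)

lemma has_signature_invertible:
  fixes G :: "real^'n^'n::finite"
  assumes "has_signature G r s" shows "invertible G"
proof -
  obtain P :: "real^'n^'n" and D where P: "Finite_Cartesian_Product.transpose P ** G ** P = (\<chi> i j. if i = j then D i else 0)"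
    and D: "\<And>i. D i \<noteq> 0" using assms unfolding has_signature_def by blast
  have "det (\<chi> i j. if i = j then D i else (0::real)) = (\<Prod>i\<in>UNIV. D i)"
    by (subst det_diagonal) auto
  then have "det (Finite_Cartesian_Product.transpose P ** G ** P) \<noteq> 0" unfolding P using D by simp
  then show ?thesis by (simp add: invertible_det_nz det_mul)
qed

definition loc :: "('m, 'n) chart \<Rightarrow> (('m, 'n) chart \<Rightarrow> 'm \<Rightarrow> 'b) \<Rightarrow> real^'n \<Rightarrow> 'b" where
  "loc c F x = F c (inv_coords c x)"

locale atlas =
  fixes A :: "('m::topological_space, 'n::finite) chart set"
  assumes atlas: "smooth_atlas A"
begin

lemma chart_ex: "\<exists>c\<in>A. p \<in> dom_of c"
  using atlas unfolding smooth_atlas_def by blast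

lemma chart_open: "c \<in> A \<Longrightarrow> open (dom_of c)" "c \<in> A \<Longrightarrow> open (cod_of c)"
  and chart_homeo: "c \<in> A \<Longrightarrow> homeomorphism (dom_of c) (cod_of c) (coords c) (inv_coords c)"
  using atlas unfolding smooth_atlas_def by blast+

lemma inv_coords: "c \<in> A \<Longrightarrow> p \<in> dom_of c \<Longrightarrow> inv_coords c (coords c p) = p"
  and coords_inv: "c \<in> A \<Longrightarrow> x \<in> cod_of c \<Longrightarrow> coords c (inv_coords c x) = x"
  and inv_coords_dom: "c \<in> A \<Longrightarrow> x \<in> cod_of c \<Longrightarrow> inv_coords c x \<in> dom_of c"
  and coords_cod: "c \<in> A \<Longrightarrow> p \<in> dom_of c \<Longrightarrow> coords c p \<in> cod_of c"
  and continuous_coords: "c \<in> A \<Longrightarrow> continuous_on (dom_of c) (coords c)"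
  and continuous_inv: "c \<in> A \<Longrightarrow> continuous_on (cod_of c) (inv_coords c)"
  using chart_homeo[of c] unfolding homeomorphism_def by blast+

definition tr :: "('m, 'n) chart \<Rightarrow> ('m, 'n) chart \<Rightarrow> real^'n \<Rightarrow> real^'n" where
  "tr c d x = coords d (inv_coords c x)"

definition ov :: "('m, 'n) chart \<Rightarrow> ('m, 'n) chart \<Rightarrow> (real^'n) set" where
  "ov c d = {x \<in> cod_of c. inv_coords c x \<in> dom_of d}"

lemma ov_image: "c \<in> A \<Longrightarrow> ov c d = coords c ` (dom_of c \<inter> dom_of d)"
  using inv_coords[of c] coords_cod[of c] inv_coords_dom[of c] coords_inv[of c]
  unfolding ov_def by (auto simp: image_iff) (metis IntI)

lemma ov_open: "c \<in> A \<Longrightarrow> d \<in> A \<Longrightarrow> open (ov c d)"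
  using continuous_open_preimage[OF continuous_inv chart_open(2) chart_open(1), of c d]
  by (simp add: ov_def vimage_def Int_def)

lemma smooth_tr: "c \<in> A \<Longrightarrow> d \<in> A \<Longrightarrow> smooth_on (ov c d) (tr c d)"
  using atlas unfolding smooth_atlas_def by (simp add: ov_image tr_def[abs_def] o_def)

lemma jacobian: 
  assumes "c \<in> A" "d \<in> A" "x \<in> ov c d"
  shows "jacobian_mat c d (inv_coords c x) *v v = dd (tr c d) x v"
proof -
  have "x \<in> cod_of c" using assms(3) by (simp add: ov_def)
  then have x: "coords c (inv_coords c x) = x" by (rule coords_inv[OF assms(1)])
  have "coords d \<circ> inv_coords c = tr c d" by (simp add: tr_def[abs_def] o_def)
  then show ?thesis unfolding jacobian_mat_def x
    by (simp add: matrix_vector_mul(2)[OF dd_linear[OF smooth_tr[OF assms(1,2)] ov_open[OF assms(1,2)] assms(3)]])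
qed

lemma tr_dom: "c \<in> A \<Longrightarrow> d \<in> A \<Longrightarrow> x \<in> ov c d \<Longrightarrow> tr c d x \<in> cod_of d \<and> inv_coords d (tr c d x) = inv_coords c x"
  by (simp add: ov_def tr_def coords_cod inv_coords)

lemma tr_coords: "c \<in> A \<Longrightarrow> p \<in> dom_of c \<Longrightarrow> tr c d (coords c p) = coords d p"
  by (simp add: tr_def inv_coords)

lemma smooth_loc:
  "smooth_symmetric_tensor A T \<Longrightarrow> c \<in> A \<Longrightarrow> smooth_on (cod_of c) (loc c T)"
  "smooth_vector_field A X \<Longrightarrow> c \<in> A \<Longrightarrow> smooth_on (cod_of c) (loc c X)"
  by (simp_all add: smooth_symmetric_tensor_def smooth_vector_field_def smooth_in_chart_def loc_def[abs_def] o_def)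

lemma loc_sym:
  assumes T: "smooth_symmetric_tensor A T" and c: "c \<in> A" "x \<in> cod_of c"
  shows "bf (loc c T x) v w = bf (loc c T x) w v"
proof -
  have s: "T c (inv_coords c x) $ i $ j = T c (inv_coords c x) $ j $ i" for i j
    using T inv_coords_dom[OF c] c(1) unfolding smooth_symmetric_tensor_def by blast
  show ?thesis unfolding bf_expand loc_def
    by (subst sum.swap, intro sum.cong refl) (simp add: s[symmetric] mult_ac)
qed

lemma loc_tensor:
  assumes T: "smooth_symmetric_tensor A T" and c: "c \<in> A" "d \<in> A" "x \<in> ov c d"
  shows "bf (loc c T x) v w = bf (loc d T (tr c d x)) (dd (tr c d) x v) (dd (tr c d) x w)"
proof -
  let ?p = "inv_coords c x"
  have "?p \<in> dom_of c \<inter> dom_of d" using c inv_coords_dom by (auto simp: ov_def)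
  then have "T c ?p = Finite_Cartesian_Product.transpose (jacobian_mat c d ?p) ** T d ?p ** jacobian_mat c d ?p"
    using T c unfolding smooth_symmetric_tensor_def by blast
  then have "bf (loc c T x) v w = bf (T d ?p) (jacobian_mat c d ?p *v v) (jacobian_mat c d ?p *v w)"
    by (simp only: loc_def matrix_mul_assoc[symmetric] bf_matrix_mult(2)) (simp only: bf_matrix_mult(1))
  then show ?thesis using tr_dom[OF c] by (simp add: loc_def jacobian[OF c])
qed

lemma loc_vector:
  assumes X: "smooth_vector_field A X" and c: "c \<in> A" "d \<in> A" "x \<in> ov c d"
  shows "loc d X (tr c d x) = dd (tr c d) x (loc c X x)"
proof -
  let ?p = "inv_coords c x"
  have "?p \<in> dom_of c \<inter> dom_of d" using c inv_coords_dom by (auto simp: ov_def)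
  then have "X d ?p = jacobian_mat c d ?p *v X c ?p"
    using X c unfolding smooth_vector_field_def by blast
  then show ?thesis using tr_dom[OF c] by (simp add: loc_def jacobian[OF c])
qed

lemma loc_component:
  assumes F: "smooth_on (cod_of c) (loc c F)" and c: "c \<in> A" "p \<in> dom_of c"
  shows "partial_deriv c k (\<lambda>q. F c q $ i) p = dd (loc c F) (coords c p) (axis k 1) $ i"
    using dd_linear_compose[OF bounded_linear_vec_nth[of i] F chart_open(2)[OF c(1)] coords_cod[OF c]]
    by (simp add: partial_deriv_def o_def loc_def[abs_def])

lemma loc_component2:
  fixes T :: "('m, 'n) tensor02"
  assumes F: "smooth_on (cod_of c) (loc c T)" and c: "c \<in> A" "p \<in> dom_of c"
  shows "partial_deriv c k (\<lambda>q. T c q $ i $ j) p = bf (dd (loc c T) (coords c p) (axis k 1)) (axis i 1) (axis j 1)"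
    using dd_linear_compose[OF bounded_linear_compose[OF bounded_linear_vec_nth[of j] bounded_linear_vec_nth[of i]] F
      chart_open(2)[OF c(1)] coords_cod[OF c]]
    by (simp add: partial_deriv_def o_def loc_def[abs_def] bf_axis)

end

section \<open>The tensor notions in a chart\<close>

locale pr_manifold = atlas A for A :: "('m::topological_space, 'n::finite) chart set" +
  fixes g :: "('m, 'n) tensor02" and np nm :: nat
  assumes metric: "pseudo_riemannian_metric A g np nm"
begin

lemma g_tensor: "smooth_symmetric_tensor A g"
  using metric unfolding pseudo_riemannian_metric_def by blast

abbreviation (input) "\<G> c \<equiv> loc c g"

lemma chart_metric: assumes c: "c \<in> A" shows "chart_metric (cod_of c) (\<G> c)"
proof
  show "open (cod_of c)" by (rule chart_open(2)[OF c])
  show "smooth_on (cod_of c) (\<G> c)" by (rule smooth_loc(1)[OF g_tensor c])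
  show "bf (\<G> c x) v w = bf (\<G> c x) w v" if "x \<in> cod_of c" for x v w by (rule loc_sym[OF g_tensor c that])
  show "invertible (\<G> c x)" if "x \<in> cod_of c" for x
    using metric c inv_coords_dom[OF c that] has_signature_invertible
    unfolding pseudo_riemannian_metric_def loc_def by blast
qed

lemma chart_change:
  assumes c: "c \<in> A" "d \<in> A"
  shows "chart_change (cod_of c) (\<G> c) (cod_of d) (\<G> d) (ov c d) (tr c d)"
proof (intro chart_change.intro chart_change_axioms.intro chart_metric c)
  show "open (ov c d)" by (rule ov_open[OF c])
  show "ov c d \<subseteq> cod_of c" by (auto simp: ov_def)
  show "smooth_on (ov c d) (tr c d)" by (rule smooth_tr[OF c])
  show "tr c d ` ov c d \<subseteq> cod_of d" using tr_dom[OF c] by blast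
  show "bf (\<G> c x) v w = bf (\<G> d (tr c d x)) (dd (tr c d) x v) (dd (tr c d) x w)" if "x \<in> ov c d" for x v w
    by (rule loc_tensor[OF g_tensor c that])
qed

lemma christoffel_chr:
  assumes c: "c \<in> A" "p \<in> dom_of c"
  shows "christoffel g c i j k p = chr (\<G> c) (coords c p) (axis j 1) (axis k 1) $ i"
proof -
  interpret chart_metric "cod_of c" "\<G> c" by (rule chart_metric[OF c(1)])
  note x = coords_cod[OF c]
  have G0: "\<G> c (coords c p) = g c p" by (simp add: loc_def inv_coords[OF c])
  note s = dd_sym[OF G Gsym x]
  have k: "kos (\<G> c) (coords c p) (axis j 1) (axis k 1) (axis l 1) =
      (partial_deriv c j (\<lambda>q. g c q $ l $ k) p + partial_deriv c k (\<lambda>q. g c q $ l $ j) p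
         - partial_deriv c l (\<lambda>q. g c q $ j $ k) p) / 2" for l
    unfolding kos_def loc_component2[OF G c] by (simp add: s[of _ "axis l 1"])
  have "chr (\<G> c) (coords c p) (axis j 1) (axis k 1) $ i =
      (\<Sum>l\<in>UNIV. matrix_inv (g c p) $ i $ l * kos (\<G> c) (coords c p) (axis j 1) (axis k 1) (axis l 1))"
    by (simp add: chr_def G0 matrix_vector_mult_def)
  then show ?thesis unfolding k christoffel_def by (simp only: sum_divide_distrib times_divide_eq_right)
qed

lemma chr_axis:
  assumes c: "c \<in> A" "p \<in> dom_of c"
  shows "(\<Sum>m\<in>UNIV. christoffel g c i k m p * w $ m) = chr (\<G> c) (coords c p) (axis k 1) w $ i"
proof -
  interpret chart_metric "cod_of c" "\<G> c" by (rule chart_metric[OF c(1)])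
  note x = coords_cod[OF c]
  have "chr (\<G> c) (coords c p) (axis k 1) w $ i = (\<Sum>m\<in>UNIV. w $ m *\<^sub>R chr (\<G> c) (coords c p) (axis k 1) (axis m 1)) $ i"
    using arg_cong[OF axis_expansion[of w], of "\<lambda>w. chr (\<G> c) (coords c p) (axis k 1) w $ i"]
    by (simp only: linear_sum[OF chr_linear(1)[OF x]] linear_scale[OF chr_linear(1)[OF x]])
  then show ?thesis by (simp add: christoffel_chr[OF c] mult.commute)
qed

lemma chr_axis2:
  assumes c: "c \<in> A" "p \<in> dom_of c"
  shows "(\<Sum>j\<in>UNIV. \<Sum>k\<in>UNIV. christoffel g c i j k p * v $ j * w $ k) = chr (\<G> c) (coords c p) v w $ i"
proof -
  interpret chart_metric "cod_of c" "\<G> c" by (rule chart_metric[OF c(1)])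
  note x = coords_cod[OF c]
  have "(\<Sum>j\<in>UNIV. \<Sum>k\<in>UNIV. christoffel g c i j k p * v $ j * w $ k)
      = (\<Sum>j\<in>UNIV. v $ j * (\<Sum>k\<in>UNIV. christoffel g c i j k p * w $ k))"
    by (simp add: sum_distrib_left mult_ac)
  also have "\<dots> = (\<Sum>m\<in>UNIV. v $ m *\<^sub>R chr (\<G> c) (coords c p) (axis m 1) w) $ i"
    by (simp add: chr_axis[OF c])
  also have "\<dots> = chr (\<G> c) (coords c p) v w $ i"
    using arg_cong[OF axis_expansion[of v], of "\<lambda>v. chr (\<G> c) (coords c p) v w $ i"]
    by (simp only: linear_sum[OF chr_linear(2)[OF x]] linear_scale[OF chr_linear(2)[OF x]])
  finally show ?thesis .
qed

lemma riemann_curv: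
  assumes c: "c \<in> A" "p \<in> dom_of c"
  shows "riemann g c i j k l p = curv (\<G> c) (coords c p) (axis k 1) (axis l 1) (axis j 1) $ i"
proof -
  interpret chart_metric "cod_of c" "\<G> c" by (rule chart_metric[OF c(1)])
  note x = coords_cod[OF c]
  have d: "partial_deriv c k (christoffel g c i l j) p = dd (\<lambda>y. chr (\<G> c) y (axis l 1) (axis j 1)) (coords c p) (axis k 1) $ i" for k l
  proof -
    have "dd (christoffel g c i l j \<circ> inv_coords c) (coords c p) = dd (\<lambda>y. chr (\<G> c) y (axis l 1) (axis j 1) $ i) (coords c p)"
      by (rule dd_cong_open[OF U x])
        (simp add: christoffel_chr[OF c(1) inv_coords_dom[OF c(1)]] coords_inv[OF c(1)])
    then show ?thesis
      using dd_linear_compose[OF bounded_linear_vec_nth[of i] smooth_chr U x] by (simp add: partial_deriv_def)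
  qed
  show ?thesis
    unfolding riemann_def curv_def d
    by (simp add: sum_subtractf christoffel_chr[OF c, of _ l j] christoffel_chr[OF c, of _ k j] chr_axis[OF c])
qed

lemma constant_curvatureI:
  assumes "\<And>c x z u v. c \<in> A \<Longrightarrow> x \<in> cod_of c \<Longrightarrow>
    curv (\<G> c) x z u v = K *\<^sub>R (bf (\<G> c x) u v *\<^sub>R z - bf (\<G> c x) z v *\<^sub>R u)"
  shows "constant_curvature A g"
  unfolding constant_curvature_def
proof (intro exI[of _ K] ballI allI)
  fix c p i j k l assume c: "c \<in> A" "p \<in> dom_of c"
  note x = coords_cod[OF c]
  have G0: "\<G> c (coords c p) = g c p" by (simp add: loc_def inv_coords[OF c])
  have s: "g c p $ i $ j = g c p $ j $ i" for i j
    using loc_sym[OF g_tensor c(1) x, of "axis i 1" "axis j 1"] by (simp add: bf_axis G0)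
  show "riemann g c i j k l p = K * ((if i = k then 1 else 0) * g c p $ j $ l - (if i = l then 1 else 0) * g c p $ j $ k)"
    unfolding riemann_curv[OF c] assms[OF c(1) x] G0 by (simp add: bf_axis s) (simp add: axis_def)
qed

text \<open>The component equation is the case of coordinate vectors; linearity extends it to all
  arguments, one slot at a time. The covector is the coordinate gradient of \<phi>, closed by
  symmetry of second derivatives.\<close>

lemma eisenhart_eisen:
  assumes h: "smooth_symmetric_tensor A h" and \<phi>: "smooth_function A \<phi>" and E: "eisenhart_equation A g h \<phi>"
    and c: "c \<in> A"
  defines "\<psi> \<equiv> \<lambda>x. \<chi> i. dd (\<phi> \<circ> inv_coords c) x (axis i 1)"
  shows "eisen (cod_of c) (\<G> c) (loc c h) \<psi>" and "smooth_on (cod_of c) \<psi>"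
    and "x \<in> cod_of c \<Longrightarrow> \<psi> x \<bullet> u = dd (\<phi> \<circ> inv_coords c) x u"
    and "x \<in> cod_of c \<Longrightarrow> dd \<psi> x u \<bullet> v = dd \<psi> x v \<bullet> u"
proof -
  interpret chart_metric "cod_of c" "\<G> c" by (rule chart_metric[OF c(1)])
  have s\<phi>: "smooth_on (cod_of c) (\<phi> \<circ> inv_coords c)"
    using \<phi> c unfolding smooth_function_def smooth_in_chart_def by blast
  show s\<psi>: "smooth_on (cod_of c) \<psi>"
    unfolding \<psi>_def by (rule smooth_on_vecI[OF U]) (simp add: smooth_on_dd[OF s\<phi>])
  have H: "smooth_on (cod_of c) (loc c h)" by (rule smooth_loc(1)[OF h c])
  have d\<psi>: "\<psi> x \<bullet> u = dd (\<phi> \<circ> inv_coords c) x u" if x: "x \<in> cod_of c" for x u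
  proof -
    have "(\<lambda>u. \<psi> x \<bullet> u) = dd (\<phi> \<circ> inv_coords c) x"
      by (rule axis_eqI[OF bounded_linear.linear[OF bounded_linear_inner_right] dd_linear[OF s\<phi> U x]])
        (simp add: \<psi>_def inner_axis)
    then show ?thesis by (rule fun_cong)
  qed
  show "\<psi> x \<bullet> u = dd (\<phi> \<circ> inv_coords c) x u" if "x \<in> cod_of c" by (rule d\<psi>[OF that])
  show "dd \<psi> x u \<bullet> v = dd \<psi> x v \<bullet> u" if "x \<in> cod_of c"
    by (rule gradient_closed[OF s\<psi> s\<phi> d\<psi>[symmetric] that])
  show "eisen (cod_of c) (\<G> c) (loc c h) \<psi>"
    unfolding eisen_def
  proof (intro ballI allI)
    fix x u v w assume x: "x \<in> cod_of c"
    let ?p = "inv_coords c x"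
    have p: "?p \<in> dom_of c" "coords c ?p = x" using x c inv_coords_dom coords_inv by auto
    let ?L = "\<lambda>u v w. bf (dd (loc c h) x u) v w"
    let ?R = "\<lambda>u v w. bf (loc c h x) (chr (\<G> c) x u v) w + bf (loc c h x) v (chr (\<G> c) x u w) +
     2 * (\<psi> x \<bullet> u) * bf (\<G> c x) v w + (\<psi> x \<bullet> v) * bf (\<G> c x) u w + (\<psi> x \<bullet> w) * bf (\<G> c x) u v"
    note l = linear_add[OF chr_linear(1)[OF x]] linear_scale[OF chr_linear(1)[OF x]]
      linear_add[OF chr_linear(2)[OF x]] linear_scale[OF chr_linear(2)[OF x]]
      linear_add[OF dd_linear[OF H U x]] linear_scale[OF dd_linear[OF H U x]]
    have 3: "?L (axis k 1) (axis i 1) (axis j 1) = ?R (axis k 1) (axis i 1) (axis j 1)" for i j k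
    proof -
      have pd: "partial_deriv c k \<phi> ?p = \<psi> x \<bullet> axis k 1" for k by (simp add: partial_deriv_def d\<psi>[OF x] p)
      have g0: "g c ?p $ i $ j = bf (\<G> c x) (axis i 1) (axis j 1)" for i j by (simp add: bf_axis loc_def)
      have 1: "(\<Sum>l\<in>UNIV. christoffel g c l k i ?p * h c ?p $ l $ j) = bf (loc c h x) (chr (\<G> c) x (axis k 1) (axis i 1)) (axis j 1)"
        by (simp add: christoffel_chr[OF c p(1)] p bf_axis_right loc_def)
      have 2: "(\<Sum>l\<in>UNIV. christoffel g c l k j ?p * h c ?p $ i $ l) = bf (loc c h x) (axis i 1) (chr (\<G> c) x (axis k 1) (axis j 1))"
        by (simp add: christoffel_chr[OF c p(1)] p bf_axis_left loc_def mult.commute)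
      show ?thesis
        using E[unfolded eisenhart_equation_def, rule_format, OF c p(1), of i j k]
        unfolding cov_deriv2_def loc_component2[OF H c p(1)] p(2) pd g0 1 2
          Gsym[OF x, of "axis j 1" "axis k 1"] Gsym[OF x, of "axis i 1" "axis k 1"]
        by (simp add: algebra_simps)
    qed
    have 2: "?L (axis k 1) (axis i 1) w = ?R (axis k 1) (axis i 1) w" for i k w
    proof (rule fun_cong[where x=w], rule axis_eqI)
      show "?L (axis k 1) (axis i 1) (axis j 1) = ?R (axis k 1) (axis i 1) (axis j 1)" for j by (rule 3)
    qed (auto intro!: linearI simp: bf_simps bf_mat_simps l inner_add_right algebra_simps)
    have 1: "?L (axis k 1) v w = ?R (axis k 1) v w" for k v w
    proof (rule fun_cong[where x=v], rule axis_eqI)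
      show "?L (axis k 1) (axis i 1) w = ?R (axis k 1) (axis i 1) w" for i by (rule 2)
    qed (auto intro!: linearI simp: bf_simps bf_mat_simps l inner_add_right algebra_simps)
    have "(\<lambda>u. ?L u v w) = (\<lambda>u. ?R u v w)"
    proof (rule axis_eqI)
      show "?L (axis k 1) v w = ?R (axis k 1) v w" for k by (rule 1)
    qed (auto intro!: linearI simp: bf_simps bf_mat_simps l inner_add_right algebra_simps)
    then show "?L u v w = ?R u v w" by (rule fun_cong)
  qed
qed

text \<open>Both expressions for the Lie derivative of the metric reduce to \<open>lieG\<close>: in
  the second, symmetrization and \<open>compat\<close> recombine the Christoffel terms into the
  derivative of the metric along \<open>X\<close>.\<close>

lemma lie_deriv_lieG:
  assumes X: "smooth_vector_field A X" and c: "c \<in> A" "p \<in> dom_of c"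
  shows "lie_deriv X g c i j p = bf (lieG (\<G> c) (loc c X) (coords c p)) (axis i 1) (axis j 1)" (is ?t1)
    and "cov_deriv1 g (lower_index g X) c i j p + cov_deriv1 g (lower_index g X) c j i p
      = bf (lieG (\<G> c) (loc c X) (coords c p)) (axis i 1) (axis j 1)" (is ?t2)
proof -
  interpret chart_metric "cod_of c" "\<G> c" by (rule chart_metric[OF c(1)])
  note x = coords_cod[OF c]
  let ?x = "coords c p"
  have sX: "smooth_on (cod_of c) (loc c X)" by (rule smooth_loc(2)[OF X c(1)])
  have G0: "\<G> c ?x = g c p" and X0: "loc c X ?x = X c p" by (simp_all add: loc_def inv_coords[OF c])
  have "bf (dd (\<G> c) ?x (X c p)) (axis i 1) (axis j 1) = (\<Sum>k\<in>UNIV. X c p $ k * bf (dd (\<G> c) ?x (axis k 1)) (axis i 1) (axis j 1))"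
    using arg_cong[OF axis_expansion[of "X c p"], of "\<lambda>w. bf (dd (\<G> c) ?x w) (axis i 1) (axis j 1)"]
    by (simp only: linear_sum[OF dd_linear[OF G U x]] linear_scale[OF dd_linear[OF G U x]]
        linear_sum[OF bounded_linear.linear[OF bounded_linear_bf]] linear_scale[OF bounded_linear.linear[OF bounded_linear_bf]] real_scaleR_def)
  then show ?t1
    unfolding bf_lieG[OF sX x] lie_deriv_def loc_component2[OF G c] loc_component[OF sX c] X0
    by (simp add: sum.distrib bf_axis_right bf_axis_left G0 mult.commute)
  have cd: "cov_deriv1 g (lower_index g X) c i j p = bf (\<G> c ?x) (axis i 1) (chr (\<G> c) ?x (axis j 1) (X c p))
      + bf (\<G> c ?x) (axis i 1) (dd (loc c X) ?x (axis j 1))" for i j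
  proof -
    have li: "lower_index g X c q $ i = bf (g c q) (axis i 1) (X c q)" for q i
      by (simp add: lower_index_def bf_def inner_axis')
    have "partial_deriv c j (\<lambda>q. lower_index g X c q $ i) p = dd (\<lambda>y. bf (\<G> c y) (axis i 1) (loc c X y)) ?x (axis j 1)"
      by (simp add: partial_deriv_def li o_def loc_def[abs_def])
    also have "\<dots> = bf (dd (\<G> c) ?x (axis j 1)) (axis i 1) (X c p) + bf (\<G> c ?x) (axis i 1) (dd (loc c X) ?x (axis j 1))"
      by (simp add: dd_bf[OF U x G smooth_on_const[OF U] sX] X0 bf_simps)
    finally have 1: "partial_deriv c j (\<lambda>q. lower_index g X c q $ i) p = \<dots>" .
    have 2: "(\<Sum>l\<in>UNIV. christoffel g c l j i p * lower_index g X c p $ l) = bf (\<G> c ?x) (chr (\<G> c) ?x (axis j 1) (axis i 1)) (X c p)"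
      by (simp add: christoffel_chr[OF c] lower_index_def bf_def G0 inner_vec_def)
    show ?thesis unfolding cov_deriv1_def 1 2 compat[OF x] by simp
  qed
  show ?t2
    unfolding cd bf_lieG[OF sX x] compat[OF x] X0
    by (simp add: chr_sym[OF x, of _ "X c p"] Gsym[OF x, of "axis j 1"])
qed

lemma lie_equation_iff:
  assumes X: "smooth_vector_field A X" and h: "smooth_symmetric_tensor A h"
  shows "(\<forall>c\<in>A. \<forall>p\<in>dom_of c. \<forall>i j.
       lie_deriv X g c i j p =
         cov_deriv1 g (lower_index g X) c i j p + cov_deriv1 g (lower_index g X) c j i p \<and>
       cov_deriv1 g (lower_index g X) c i j p + cov_deriv1 g (lower_index g X) c j i p =
         a1 * h c p $ i $ j + a2 * g c p $ i $ j) \<longleftrightarrow>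
    (\<forall>c\<in>A. \<forall>x\<in>cod_of c. lieG (\<G> c) (loc c X) x = a1 *\<^sub>R loc c h x + a2 *\<^sub>R \<G> c x)" (is "?l \<longleftrightarrow> ?r")
proof
  assume l: ?l
  show ?r
  proof (intro ballI)
    fix c x assume c: "c \<in> A" "x \<in> cod_of c"
    let ?p = "inv_coords c x"
    have p: "?p \<in> dom_of c" "coords c ?p = x" using c inv_coords_dom coords_inv by auto
    have "lieG (\<G> c) (loc c X) x $ i $ j = (a1 *\<^sub>R loc c h x + a2 *\<^sub>R \<G> c x) $ i $ j" for i j
      using l[rule_format, OF c(1) p(1), of i j] lie_deriv_lieG(2)[OF X c(1) p(1), of i j]
      by (simp add: p bf_axis loc_def)
    then show "lieG (\<G> c) (loc c X) x = a1 *\<^sub>R loc c h x + a2 *\<^sub>R \<G> c x" by (simp add: vec_eq_iff)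
  qed
next
  assume r: ?r
  show ?l
  proof (intro ballI allI)
    fix c p i j assume c: "c \<in> A" "p \<in> dom_of c"
    show "lie_deriv X g c i j p =
         cov_deriv1 g (lower_index g X) c i j p + cov_deriv1 g (lower_index g X) c j i p \<and>
       cov_deriv1 g (lower_index g X) c i j p + cov_deriv1 g (lower_index g X) c j i p =
         a1 * h c p $ i $ j + a2 * g c p $ i $ j"
      unfolding lie_deriv_lieG[OF X c] bspec[OF bspec[OF r c(1)] coords_cod[OF c]]
      by (simp add: bf_mat_simps bf_axis loc_def inv_coords[OF c])
  qed
qed

end

section \<open>From charts to the manifold: curvature and solutions\<close>

locale rigid_manifold = pr_manifold A g np nm for A :: "('m::topological_space, 'n::finite) chart set" and g and np nm +
  fixes h :: "('m, 'n) tensor02" and \<phi> :: "'m \<Rightarrow> real"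
  assumes h: "smooth_symmetric_tensor A h" and \<phi>: "smooth_function A \<phi>" and Eh: "eisenhart_equation A g h \<phi>"
    and rigid: "c \<in> A \<Longrightarrow> p \<in> dom_of c \<Longrightarrow> \<exists>n_as. jordan_nf (endo_mat g h c p) n_as \<and> distinct (map snd n_as)"
    and dim4: "4 \<le> CARD('n)"
begin

definition grad :: "('m, 'n) chart \<Rightarrow> real^'n \<Rightarrow> real^'n" where
  "grad c = (\<lambda>x. \<chi> i. dd (\<phi> \<circ> inv_coords c) x (axis i 1))"

text \<open>Distinct eigenvalues of the Jordan blocks make the matrix of the endomorphism
  nonderogatory; symmetry of \<open>g\<close> and \<open>h\<close> is the condition on its transpose
  under which \<open>nonderogatory_cyclic\<close> yields the cyclic vector.\<close>

lemma cyclic_metric: assumes c: "c \<in> A" shows "cyclic_metric (cod_of c) (\<G> c) (loc c h) (grad c)"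
proof (intro cyclic_metric.intro cyclic_metric_axioms.intro chart_metric c dim4)
  note e = eisenhart_eisen[OF h \<phi> Eh c, folded grad_def]
  interpret chart_metric "cod_of c" "\<G> c" by (rule chart_metric[OF c(1)])
  show "smooth_on (cod_of c) (loc c h)" by (rule smooth_loc(1)[OF h c])
  show sy: "bf (loc c h x) v w = bf (loc c h x) w v" if "x \<in> cod_of c" for x v w by (rule loc_sym[OF h c that])
  show "smooth_on (cod_of c) (grad c)" by (rule e(2))
  show "eisen (cod_of c) (\<G> c) (loc c h) (grad c)" by (rule e(1))
  show "dd (grad c) x u \<bullet> v = dd (grad c) x v \<bullet> u" if "x \<in> cod_of c" for x u v by (rule e(4)[OF that])
  show "\<exists>v. cyclic_for (chart_metric.raise (\<G> c) x (loc c h x)) v" if x: "x \<in> cod_of c" for x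
  proof -
    let ?p = "inv_coords c x" and ?B = "matrix_inv (\<G> c x) ** loc c h x"
    obtain n_as where n: "jordan_nf (endo_mat g h c ?p) n_as" "distinct (map snd n_as)"
      using rigid[OF c inv_coords_dom[OF c x]] by blast
    have nd: "nonderogatory ?B"
      using distinct_jordan_nonderogatory[OF n[unfolded endo_mat_def]] by (simp add: loc_def)
    have GB: "\<G> c x ** ?B = loc c h x"
      by (simp add: matrix_mul_assoc mat_inv_right[OF Ginv[OF x]])
    have tg: "Finite_Cartesian_Product.transpose (\<G> c x) = \<G> c x" "Finite_Cartesian_Product.transpose (loc c h x) = loc c h x"
      using Gsym[OF x, of "axis i 1" "axis j 1" for i j] sy[OF x, of "axis i 1" "axis j 1" for i j]
      by (simp_all add: vec_eq_iff Finite_Cartesian_Product.transpose_def bf_axis)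
    have "Finite_Cartesian_Product.transpose ?B ** \<G> c x = Finite_Cartesian_Product.transpose (\<G> c x ** ?B)"
      by (simp add: matrix_transpose_mul tg)
    also have "\<dots> = \<G> c x ** ?B" by (simp add: GB tg)
    finally have "Finite_Cartesian_Product.transpose ?B ** \<G> c x = \<G> c x ** ?B" .
    from nonderogatory_cyclic[OF nd Ginv[OF x] this] show ?thesis unfolding raise_def by metis
  qed
qed

end

context chart_metric
begin

lemma eisen_combine:
  assumes B: "smooth_on U B" "eisen U G B \<psi>'" and H: "smooth_on U H" "eisen U G H \<psi>"
  shows "eisen U G (\<lambda>x. B x - (a *\<^sub>R G x + b *\<^sub>R H x)) (\<lambda>x. \<psi>' x - b *\<^sub>R \<psi> x)"
  unfolding eisen_def
proof (intro ballI allI)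
  fix x u v w assume x: "x \<in> U"
  have "((\<lambda>x. B x - (a *\<^sub>R G x + b *\<^sub>R H x)) has_derivative
      (\<lambda>u. dd B x u - (a *\<^sub>R dd G x u + b *\<^sub>R dd H x u))) (at x)"
    by (intro has_derivative_diff has_derivative_add has_derivative_scaleR_right
        smooth_on_deriv[OF B(1) U x] smooth_on_deriv[OF H(1) U x] smooth_on_deriv[OF G U x])
  note d = dd_eq[OF this]
  show "bf (dd (\<lambda>x. B x - (a *\<^sub>R G x + b *\<^sub>R H x)) x u) v w =
       bf (B x - (a *\<^sub>R G x + b *\<^sub>R H x)) (chr G x u v) w + bf (B x - (a *\<^sub>R G x + b *\<^sub>R H x)) v (chr G x u w) +
       2 * ((\<psi>' x - b *\<^sub>R \<psi> x) \<bullet> u) * bf (G x) v w + ((\<psi>' x - b *\<^sub>R \<psi> x) \<bullet> v) * bf (G x) u w +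
       ((\<psi>' x - b *\<^sub>R \<psi> x) \<bullet> w) * bf (G x) u v"
    unfolding d bf_mat_simps compat[OF x] B(2)[unfolded eisen_def, rule_format, OF x]
      H(2)[unfolded eisen_def, rule_format, OF x]
    by (simp add: algebra_simps inner_diff_left)
qed

end

context chart_change
begin

lemma pull_zero:
  assumes x: "x \<in> W" and p: "\<And>u v. bf (T x) u v = bf (T2 (f x)) (dd f x u) (dd f x v)" and z: "T x = 0"
  shows "T2 (f x) = 0"
proof (rule bf_eqI)
  fix u v
  obtain u' v' where "u = dd f x u'" "v = dd f x v'" using df_surj[OF x] by (metis surjD)
  then show "bf (T2 (f x)) u v = bf 0 u v" using p[of u' v'] z by (simp add: bf_mat_simps)
qed

end

context rigid_manifold
begin

text \<open>Only the coefficient of \<open>h\<close> is recorded: it does not depend on the chart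
  and is minus the curvature.\<close>

definition in_span :: "('m, 'n) chart \<Rightarrow> real^'n \<Rightarrow> real \<Rightarrow> bool" where
  "in_span c x b \<longleftrightarrow> (\<exists>a. chart_metric.hm (\<G> c) (grad c) x = a *\<^sub>R \<G> c x + b *\<^sub>R loc c h x)"

lemma grad_dd: "c \<in> A \<Longrightarrow> x \<in> cod_of c \<Longrightarrow> grad c x \<bullet> u = dd (\<phi> \<circ> inv_coords c) x u"
  unfolding grad_def by (rule eisenhart_eisen(3)[OF h \<phi> Eh])

lemma grad_change:
  assumes c: "c \<in> A" "d \<in> A" and x: "x \<in> ov c d"
  shows "grad c x \<bullet> v = grad d (tr c d x) \<bullet> dd (tr c d) x v"
proof -
  note t = tr_dom[OF c x]
  have sd: "smooth_on (cod_of d) (\<phi> \<circ> inv_coords d)"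
    using \<phi> c unfolding smooth_function_def smooth_in_chart_def by blast
  have xc: "x \<in> cod_of c" using x by (simp add: ov_def)
  have "dd (\<phi> \<circ> inv_coords c) x = dd (\<lambda>y. (\<phi> \<circ> inv_coords d) (tr c d y)) x"
    by (rule dd_cong_open[OF ov_open[OF c] x]) (use tr_dom[OF c] in simp)
  then show ?thesis
    unfolding grad_dd[OF c(1) xc] grad_dd[OF c(2) conjunct1[OF t]]
    using dd_compose[OF smooth_tr[OF c] ov_open[OF c] x sd chart_open(2)[OF c(2)] conjunct1[OF t]] by simp
qed

lemma in_span_change:
  assumes c: "c \<in> A" "d \<in> A" and x: "x \<in> ov c d" and s: "in_span c x b"
  shows "in_span d (tr c d x) b"
proof -
  interpret m1: cyclic_metric "cod_of c" "\<G> c" "loc c h" "grad c" by (rule cyclic_metric[OF c(1)])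
  interpret m2: cyclic_metric "cod_of d" "\<G> d" "loc d h" "grad d" by (rule cyclic_metric[OF c(2)])
  interpret cc: chart_change "cod_of c" "\<G> c" "cod_of d" "\<G> d" "ov c d" "tr c d" by (rule chart_change[OF c])
  have xc: "x \<in> cod_of c" and xd: "tr c d x \<in> cod_of d" using x cc.fU[OF x] by (auto simp: ov_def)
  obtain a where a: "m1.hm (grad c) x = a *\<^sub>R \<G> c x + b *\<^sub>R loc c h x" using s unfolding in_span_def by blast
  have "m2.hm (grad d) (tr c d x) - (a *\<^sub>R \<G> d (tr c d x) + b *\<^sub>R loc d h (tr c d x)) = 0"
  proof (rule cc.pull_zero[where T="\<lambda>x. m1.hm (grad c) x - (a *\<^sub>R \<G> c x + b *\<^sub>R loc c h x)"
        and ?T2.0="\<lambda>y. m2.hm (grad d) y - (a *\<^sub>R \<G> d y + b *\<^sub>R loc d h y)", OF x])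
    show "m1.hm (grad c) x - (a *\<^sub>R \<G> c x + b *\<^sub>R loc c h x) = 0" by (simp add: a)
    show "bf (m1.hm (grad c) x - (a *\<^sub>R \<G> c x + b *\<^sub>R loc c h x)) u v =
      bf (m2.hm (grad d) (tr c d x) - (a *\<^sub>R \<G> d (tr c d x) + b *\<^sub>R loc d h (tr c d x))) (dd (tr c d) x u) (dd (tr c d) x v)" for u v
      unfolding bf_mat_simps m1.bf_hm[OF m1.\<psi> xc] m2.bf_hm[OF m2.\<psi> xd] cc.pull[OF x] loc_tensor[OF h c x]
      by (simp add: cc.hess_change[OF m1.\<psi> m2.\<psi> x grad_change[OF c]])
  qed
  then show ?thesis unfolding in_span_def by (intro exI[of _ a]) simp
qed

lemma in_span_unique:
  assumes c: "c \<in> A" and x: "x \<in> cod_of c" and s: "in_span c x b" "in_span c x b'"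
  shows "b = b'"
proof -
  interpret m1: cyclic_metric "cod_of c" "\<G> c" "loc c h" "grad c" by (rule cyclic_metric[OF c(1)])
  obtain a a' where "m1.hm (grad c) x = a *\<^sub>R \<G> c x + b *\<^sub>R loc c h x" "m1.hm (grad c) x = a' *\<^sub>R \<G> c x + b' *\<^sub>R loc c h x"
    using s unfolding in_span_def by blast
  then have "(a - a') *\<^sub>R \<G> c x + (b - b') *\<^sub>R loc c h x = 0"
    by (simp add: algebra_simps)
  then show ?thesis using m1.independent[OF x] by fastforce
qed

lemma coords_ball_open:
  assumes c: "c \<in> A"
  shows "open {p \<in> dom_of c. coords c p \<in> ball x d}"
  by (rule open_preimage[OF continuous_coords[OF c] chart_open(1)[OF c] open_ball])

text \<open>The coefficient of \<open>h\<close> is unique at each point, so charts agree on it and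
  it is a function \<open>\<kappa>\<close> of the point; the Schur argument makes it locally
  constant, and the manifold is connected.\<close>

lemma constant_curvature_if_span:
  assumes con: "connected (UNIV :: 'm set)" and s: "\<And>c x. c \<in> A \<Longrightarrow> x \<in> cod_of c \<Longrightarrow> \<exists>b. in_span c x b"
  shows "constant_curvature A g"
proof -
  define \<kappa> where "\<kappa> p = (SOME b. \<exists>c\<in>A. p \<in> dom_of c \<and> in_span c (coords c p) b)" for p
  have k: "in_span d (coords d p) (\<kappa> p)" if d: "d \<in> A" "p \<in> dom_of d" for d p
  proof -
    have "\<exists>b. \<exists>c\<in>A. p \<in> dom_of c \<and> in_span c (coords c p) b"
      using s[OF d(1) coords_cod[OF d]] d by blast
    then have "\<exists>c\<in>A. p \<in> dom_of c \<and> in_span c (coords c p) (\<kappa> p)" unfolding \<kappa>_def by (rule someI_ex)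
    then obtain c where c: "c \<in> A" "p \<in> dom_of c" "in_span c (coords c p) (\<kappa> p)" by blast
    have "coords c p \<in> ov c d" using c d coords_cod inv_coords by (simp add: ov_def)
    from in_span_change[OF c(1) d(1) this c(3)] show ?thesis by (simp add: tr_coords[OF c(1,2)])
  qed
  have "\<kappa> constant_on UNIV"
  proof (rule locally_constant_imp_constant[OF con])
    fix p :: 'm
    obtain c where c: "c \<in> A" "p \<in> dom_of c" using chart_ex by blast
    interpret m1: cyclic_metric "cod_of c" "\<G> c" "loc c h" "grad c" by (rule cyclic_metric[OF c(1)])
    note x = coords_cod[OF c]
    obtain d b where d: "d > 0" "ball (coords c p) d \<subseteq> cod_of c"
      "\<And>x. x \<in> ball (coords c p) d \<Longrightarrow> \<exists>a. m1.hm (grad c) x = a *\<^sub>R \<G> c x + b *\<^sub>R loc c h x"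
    proof (rule m1.span_coefficient_locally_constant[OF x m1.U x order_refl])
      show "\<exists>a b. m1.hm (grad c) x = a *\<^sub>R \<G> c x + b *\<^sub>R loc c h x" if "x \<in> cod_of c" for x
        using s[OF c(1) that] unfolding in_span_def by blast
    qed (rule that)
    have b: "\<kappa> q = b" if q: "q \<in> dom_of c" "coords c q \<in> ball (coords c p) d" for q
      by (rule in_span_unique[OF c(1) coords_cod[OF c(1) q(1)] k[OF c(1) q(1)]])
        (use d(3)[OF q(2)] in \<open>simp add: in_span_def\<close>)
    show "\<exists>T. openin (top_of_set UNIV) T \<and> p \<in> T \<and> (\<forall>q\<in>T. \<kappa> q = \<kappa> p)"
      using coords_ball_open[OF c(1), of "coords c p" d] c d(1) b
      by (intro exI[of _ "{q \<in> dom_of c. coords c q \<in> ball (coords c p) d}"]) auto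
  qed
  then obtain b where b: "\<And>p. \<kappa> p = b" by (auto simp: constant_on_def)
  show ?thesis
  proof (rule constant_curvatureI)
    fix c x z u v assume c: "c \<in> A" and x: "x \<in> cod_of c"
    interpret m1: cyclic_metric "cod_of c" "\<G> c" "loc c h" "grad c" by (rule cyclic_metric[OF c(1)])
    obtain a where "m1.hm (grad c) x = a *\<^sub>R \<G> c x + b *\<^sub>R loc c h x"
      using k[OF c inv_coords_dom[OF c x]] unfolding in_span_def coords_inv[OF c x] b by blast
    from m1.curvature_of_span[OF x this]
    show "curv (\<G> c) x z u v = (- b) *\<^sub>R (bf (\<G> c x) u v *\<^sub>R z - bf (\<G> c x) z v *\<^sub>R u)" .
  qed
qed

theorem lie_equation_global:
  assumes con: "connected (UNIV :: 'm set)" and ncc: "\<not> constant_curvature A g" and X: "smooth_vector_field A X"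
    and E: "\<And>c. c \<in> A \<Longrightarrow> \<exists>\<psi>. smooth_on (cod_of c) \<psi> \<and> eisen (cod_of c) (\<G> c) (lieG (\<G> c) (loc c X)) \<psi>"
  shows "\<exists>a1 a2. \<forall>c\<in>A. \<forall>x\<in>cod_of c. lieG (\<G> c) (loc c X) x = a1 *\<^sub>R loc c h x + a2 *\<^sub>R \<G> c x"
proof -
  obtain c0 x0 where c0: "c0 \<in> A" "x0 \<in> cod_of c0" and n0: "\<nexists>b. in_span c0 x0 b"
    using constant_curvature_if_span[OF con] ncc by blast
  interpret m0: cyclic_metric "cod_of c0" "\<G> c0" "loc c0 h" "grad c0" by (rule cyclic_metric[OF c0(1)])
  have sX: "smooth_on (cod_of c) (loc c X)" if "c \<in> A" for c by (rule smooth_loc(2)[OF X that])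
  obtain \<psi>' where \<psi>': "smooth_on (cod_of c0) \<psi>'" "eisen (cod_of c0) (\<G> c0) (lieG (\<G> c0) (loc c0 X)) \<psi>'"
    using E[OF c0(1)] by blast
  note sL = m0.smooth_lieG[OF sX[OF c0(1)]]
  note cl = m0.gradient_closed[OF \<psi>'(1) m0.eisen_potential[OF sL \<psi>'(2)]]
  obtain d a b where d: "d > 0" "ball x0 d \<subseteq> cod_of c0"
    "\<And>x. x \<in> ball x0 d \<Longrightarrow> lieG (\<G> c0) (loc c0 X) x = a *\<^sub>R \<G> c0 x + b *\<^sub>R loc c0 h x"
  proof (rule m0.second_solution_local[OF c0(2) sL m0.lieG_sym[OF sX[OF c0(1)]] \<psi>'(1) cl \<psi>'(2)])
    show "\<not> (\<exists>a b. m0.hm (grad c0) x0 = a *\<^sub>R \<G> c0 x0 + b *\<^sub>R loc c0 h x0)" using n0 unfolding in_span_def by blast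
  qed (assumption | rule that)+
  define T where "T c x = lieG (\<G> c) (loc c X) x - (a *\<^sub>R \<G> c x + b *\<^sub>R loc c h x)" for c x
  have change: "T d (tr c d x) = 0" if c: "c \<in> A" "d \<in> A" and x: "x \<in> ov c d" and z: "T c x = 0" for c d x
  proof -
    interpret cc: chart_change "cod_of c" "\<G> c" "cod_of d" "\<G> d" "ov c d" "tr c d" by (rule chart_change[OF c])
    show ?thesis
    proof (rule cc.pull_zero[where T="T c" and ?T2.0="T d", OF x _ z])
      show "bf (T c x) u v = bf (T d (tr c d x)) (dd (tr c d) x u) (dd (tr c d) x v)" for u v
      proof -
        have "bf (lieG (\<G> c) (loc c X) x) u v = bf (lieG (\<G> d) (loc d X) (tr c d x)) (dd (tr c d) x u) (dd (tr c d) x v)"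
          by (rule cc.lieG_change[OF sX[OF c(1)] sX[OF c(2)] x loc_vector[OF X c]])
        then show ?thesis unfolding T_def bf_mat_simps cc.pull[OF x] loc_tensor[OF h c x] by simp
      qed
    qed
  qed
  \<comment> \<open>Unique continuation is applied on coordinate balls, which are connected; the
    image of a chart domain may fail to be.\<close>
  have cont: "T c y = 0" if c: "c \<in> A" and B: "ball x r \<subseteq> cod_of c" and V: "open V" "V \<subseteq> ball x r" "V \<noteq> {}"
      "\<And>y. y \<in> V \<Longrightarrow> T c y = 0" and y: "y \<in> ball x r" for c x r V y
  proof -
    interpret m: cyclic_metric "cod_of c" "\<G> c" "loc c h" "grad c" by (rule cyclic_metric[OF c])
    obtain \<psi>' where \<psi>': "smooth_on (cod_of c) \<psi>'" "eisen (cod_of c) (\<G> c) (lieG (\<G> c) (loc c X)) \<psi>'"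
      using E[OF c] by blast
    note sL = m.smooth_lieG[OF sX[OF c]]
    have sT: "smooth_on (cod_of c) (T c)"
      unfolding T_def[abs_def]
      by (intro smooth_on_diff[OF m.U] smooth_on_add[OF m.U] sL smooth_on_linear_compose[OF m.U bounded_linear_scaleR_right]
          m.G m.H)
    have Ts: "bf (T c x) v w = bf (T c x) w v" if "x \<in> cod_of c" for x v w
      unfolding T_def bf_mat_simps by (simp add: m.lieG_sym[OF sX[OF c] that, of v] m.Gsym[OF that, of v] m.Hsym[OF that, of v])
    have ET: "eisen (cod_of c) (\<G> c) (T c) (\<lambda>x. \<psi>' x - b *\<^sub>R grad c x)"
      unfolding T_def[abs_def] by (rule m.eisen_combine[OF sL \<psi>'(2) m.H m.EH])
    have n: "2 \<le> CARD('n)" using dim4 by simp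
    show ?thesis
      by (rule m.unique_continuation[OF n open_ball convex_connected[OF convex_ball] B sT Ts ET m.eisen_potential[OF sT ET] V y])
  qed
  \<comment> \<open>Vanishing near \<open>p\<close> is required in every chart, so that the property
    belongs to the point and can be passed from chart to chart.\<close>
  define P where "P p \<longleftrightarrow> (\<exists>N. open N \<and> p \<in> N \<and> (\<forall>c\<in>A. \<forall>q\<in>N \<inter> dom_of c. T c (coords c q) = 0))" for p
  have PI: "P p" if c: "c \<in> A" and z: "\<And>y. y \<in> ball x r \<Longrightarrow> T c y = 0" and p: "p \<in> dom_of c" "coords c p \<in> ball x r" for c x r p
    unfolding P_def
  proof (intro exI conjI ballI)
    show "open {p \<in> dom_of c. coords c p \<in> ball x r}" by (rule coords_ball_open[OF c])
    show "p \<in> {p \<in> dom_of c. coords c p \<in> ball x r}" using p by simp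
    fix d q assume d: "d \<in> A" and q: "q \<in> {p \<in> dom_of c. coords c p \<in> ball x r} \<inter> dom_of d"
    have "coords c q \<in> ov c d" using q c coords_cod inv_coords by (simp add: ov_def)
    from change[OF c d this z] q show "T d (coords d q) = 0" by (simp add: tr_coords[OF c])
  qed
  have all: "P p" for p
  proof (rule connected_induction_simple[OF con UNIV_I UNIV_I, of P "inv_coords c0 x0"])
    show "P (inv_coords c0 x0)"
    proof (rule PI[OF c0(1)])
      show "T c0 y = 0" if "y \<in> ball x0 d" for y using d(3)[OF that] by (simp add: T_def)
      show "inv_coords c0 x0 \<in> dom_of c0" "coords c0 (inv_coords c0 x0) \<in> ball x0 d"
        using inv_coords_dom[OF c0] coords_inv[OF c0] d(1) by auto
    qed
    fix p :: 'm
    obtain c where c: "c \<in> A" "p \<in> dom_of c" using chart_ex by blast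
    obtain r where r: "r > 0" "ball (coords c p) r \<subseteq> cod_of c"
      using openE[OF chart_open(2)[OF c(1)] coords_cod[OF c]] by blast
    let ?T = "{q \<in> dom_of c. coords c q \<in> ball (coords c p) r}"
    have PT: "P y" if xT: "x \<in> ?T" and yT: "y \<in> ?T" and Px: "P x" for x y
    proof (rule PI[OF c(1)])
      obtain N where N: "open N" "x \<in> N" "\<And>q. q \<in> N \<inter> dom_of c \<Longrightarrow> T c (coords c q) = 0"
        using Px c(1) unfolding P_def by blast
      let ?V = "{y \<in> cod_of c. inv_coords c y \<in> N} \<inter> ball (coords c p) r"
      have oV: "open ?V"
        using continuous_open_preimage[OF continuous_inv chart_open(2) N(1), OF c(1) c(1)]
        by (intro open_Int) (simp_all add: vimage_def Int_def)
      have xV: "coords c x \<in> ?V" using xT N(2) coords_cod[OF c(1)] inv_coords[OF c(1)] by simp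
      show "T c z = 0" if z: "z \<in> ball (coords c p) r" for z
      proof (rule cont[OF c(1) r(2) oV _ _ _ z])
        show "T c y = 0" if y: "y \<in> ?V" for y
          using N(3)[of "inv_coords c y"] y inv_coords_dom[OF c(1)] coords_inv[OF c(1)] by auto
      qed (use xV in auto)
    qed (use yT in auto)
    show "\<exists>S. openin (top_of_set UNIV) S \<and> p \<in> S \<and> (\<forall>x\<in>S. \<forall>y\<in>S. P x \<longrightarrow> P y)"
    proof (intro exI[of _ ?T] conjI ballI impI)
      show "openin (top_of_set UNIV) ?T" using coords_ball_open[OF c(1)] by simp
      show "p \<in> ?T" using c r(1) by simp
    qed (rule PT)
  qed
  show ?thesis
  proof (rule exI[of _ b], rule exI[of _ a], intro ballI)
    fix c x assume c: "c \<in> A" "x \<in> cod_of c"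
    have "T c (coords c (inv_coords c x)) = 0"
      using all[of "inv_coords c x"] c inv_coords_dom[OF c] unfolding P_def by blast
    then show "lieG (\<G> c) (loc c X) x = b *\<^sub>R loc c h x + a *\<^sub>R \<G> c x"
      by (simp add: coords_inv[OF c] T_def)
  qed
qed

end

section \<open>Geodesics and flows on the manifold\<close>

lemma acc_slice:
  fixes p :: "real \<times> real \<Rightarrow> real^'n::finite"
  assumes W: "open W" and p: "smooth_on W p" and q: "(t, s) \<in> W"
  shows "dd p (t, s) (0, 1) = dd (\<lambda>s. p (t, s)) s 1" and "acc G p (0, 1) (t, s) = acc G (\<lambda>s. p (t, s)) 1 s"
proof -
  have h: "((\<lambda>s. (t, s)) has_derivative (\<lambda>h. (0, h))) (at s)" for t s :: real
    by (auto intro!: derivative_eq_intros)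
  have 1: "dd f (t, s) (0, 1) = dd (\<lambda>s. f (t, s)) s 1" if "smooth_on W f" "(t, s) \<in> W" for f :: "real \<times> real \<Rightarrow> real^'n" and s
    using dd_eq[OF has_derivative_compose[OF h smooth_on_deriv[OF that(1) W that(2)]]] by simp
  show 2: "dd p (t, s) (0, 1) = dd (\<lambda>s. p (t, s)) s 1" by (rule 1[OF p q])
  let ?S = "{s. (t, s) \<in> W}"
  have "?S = (\<lambda>s. (t, s)) -` W" by auto
  then have S: "open ?S" by (simp add: W open_vimage continuous_on_Pair)
  have "dd (\<lambda>q. dd p q (0, 1)) (t, s) (0, 1) = dd (\<lambda>s. dd p (t, s) (0, 1)) s 1"
    by (rule 1[OF smooth_on_dd[OF p] q])
  also have "dd (\<lambda>s. dd p (t, s) (0, 1)) s = dd (\<lambda>s. dd (\<lambda>s. p (t, s)) s 1) s"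
    by (rule dd_cong_open[OF S]) (use q 1[OF p] in auto)
  finally show "acc G p (0, 1) (t, s) = acc G (\<lambda>s. p (t, s)) 1 s"
    unfolding acc_def 2 by simp
qed

lemma vector_derivative_dd:
  fixes f :: "real \<Rightarrow> 'b::euclidean_space"
  assumes "smooth_on S f" "open S" "t \<in> S"
  shows "vector_derivative f (at t) = dd f t 1"
  by (rule vector_derivative_at[OF smooth_on_real_deriv[OF assms]])

context chart_metric
begin

lemma acc_cong:
  assumes "open S" "s \<in> S" "\<And>s. s \<in> S \<Longrightarrow> p s = p' s"
  shows "acc G p 1 s = acc G p' 1 s"
proof -
  have d: "dd p s = dd p' s" if "s \<in> S" for s by (rule dd_cong_open[OF assms(1) that assms(3)])
  have "dd (\<lambda>s. dd p s 1) s = dd (\<lambda>s. dd p' s 1) s" by (rule dd_cong_open[OF assms(1,2)]) (simp add: d)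
  then show ?thesis by (simp add: acc_def d[OF assms(2)] assms(3)[OF assms(2)])
qed

text \<open>A change of parameter scales the acceleration and adds a multiple of the velocity; so
  parallelism of the two is the form of the geodesic equation that ignores the parameter.\<close>

lemma acc_reparam:
  fixes p :: "real \<Rightarrow> real^'n"
  assumes I: "open I" and p: "smooth_on I p" "p ` I \<subseteq> U" and J: "open J" and \<tau>: "smooth_on J \<tau>" "\<tau> ` J \<subseteq> I" and s: "s \<in> J"
  shows "dd (\<lambda>s. p (\<tau> s)) s 1 = dd \<tau> s 1 *\<^sub>R dd p (\<tau> s) 1"
    and "acc G (\<lambda>s. p (\<tau> s)) 1 s = (dd \<tau> s 1)\<^sup>2 *\<^sub>R acc G p 1 (\<tau> s) + dd (\<lambda>s. dd \<tau> s 1) s 1 *\<^sub>R dd p (\<tau> s) 1"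
proof -
  have comp: "dd (\<lambda>s. f (\<tau> s)) s 1 = dd \<tau> s 1 *\<^sub>R dd f (\<tau> s) 1" if f: "smooth_on I f" and s: "s \<in> J" for f :: "real \<Rightarrow> real^'n" and s
  proof -
    have t: "\<tau> s \<in> I" using s \<tau> by auto
    have "dd (\<lambda>s. f (\<tau> s)) s 1 = dd f (\<tau> s) (dd \<tau> s 1)" by (rule dd_compose[OF \<tau>(1) J s f I t])
    also have "\<dots> = dd \<tau> s 1 *\<^sub>R dd f (\<tau> s) 1" by (rule dd_real_eq[OF smooth_on_real_deriv[OF f I t]])
    finally show ?thesis .
  qed
  show 1: "dd (\<lambda>s. p (\<tau> s)) s 1 = dd \<tau> s 1 *\<^sub>R dd p (\<tau> s) 1" by (rule comp[OF p(1) s])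
  have dp: "smooth_on I (\<lambda>s. dd p s 1)" by (rule smooth_on_dd[OF p(1)])
  have d\<tau>: "smooth_on J (\<lambda>s. dd \<tau> s 1)" by (rule smooth_on_dd[OF \<tau>(1)])
  have "dd (\<lambda>s. dd (\<lambda>s. p (\<tau> s)) s 1) s = dd (\<lambda>s. dd \<tau> s 1 *\<^sub>R dd p (\<tau> s) 1) s"
    by (rule dd_cong_open[OF J s]) (rule comp[OF p(1)])
  then have "dd (\<lambda>s. dd (\<lambda>s. p (\<tau> s)) s 1) s 1 = dd \<tau> s 1 *\<^sub>R (dd \<tau> s 1 *\<^sub>R dd (\<lambda>s. dd p s 1) (\<tau> s) 1)
      + dd (\<lambda>s. dd \<tau> s 1) s 1 *\<^sub>R dd p (\<tau> s) 1"
    using dd_bilinear[OF bounded_bilinear_scaleR d\<tau> smooth_on_compose[OF J I \<tau>(1) dp \<tau>(2)] J s, of 1]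
    by (simp add: comp[OF dp s])
  moreover have "\<tau> s \<in> I" using s \<tau>(2) by blast
  then have x: "p (\<tau> s) \<in> U" using p(2) by blast
  note linear_scale[OF chr_linear(1)[OF x]] linear_scale[OF chr_linear(2)[OF x]]
  ultimately show "acc G (\<lambda>s. p (\<tau> s)) 1 s = (dd \<tau> s 1)\<^sup>2 *\<^sub>R acc G p 1 (\<tau> s) + dd (\<lambda>s. dd \<tau> s 1) s 1 *\<^sub>R dd p (\<tau> s) 1"
    unfolding acc_def 1 by (simp add: power2_eq_square scaleR_add_right)
qed

lemma lie_chr_linear:
  assumes X: "smooth_on U X" and x: "x \<in> U"
  shows "linear (lie_chr G X x u)"
proof (rule linearI)
  note l = linear_add[OF chr_linear(1)] linear_scale[OF chr_linear(1)]
    linear_add[OF dd_linear[OF X U x]] linear_scale[OF dd_linear[OF X U x]]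
  have c: "dd (\<lambda>y. dd X y v) x u = dd (\<lambda>y. dd X y u) x v" for v by (rule dd_commute[OF X U x])
  note lc = linear_add[OF dd_linear[OF smooth_on_dd[OF X] U x]] linear_scale[OF dd_linear[OF smooth_on_dd[OF X] U x]]
  fix v w :: "real^'n" and k :: real
  have "dd (\<lambda>y. chr G y u (v + w)) x = dd (\<lambda>y. chr G y u v + chr G y u w) x"
    by (rule dd_cong_open[OF U x]) (simp add: l)
  then have 1: "dd (\<lambda>y. chr G y u (v + w)) x z = dd (\<lambda>y. chr G y u v) x z + dd (\<lambda>y. chr G y u w) x z" for z
    by (simp add: dd_add[OF smooth_chr smooth_chr U x])
  have "dd (\<lambda>y. chr G y u (k *\<^sub>R v)) x = dd (\<lambda>y. k *\<^sub>R chr G y u v) x"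
    by (rule dd_cong_open[OF U x]) (simp add: l)
  then have 2: "dd (\<lambda>y. chr G y u (k *\<^sub>R v)) x z = k *\<^sub>R dd (\<lambda>y. chr G y u v) x z" for z
    by (simp add: dd_linear_compose[OF bounded_linear_scaleR_right smooth_chr U x])
  show "lie_chr G X x u (v + w) = lie_chr G X x u v + lie_chr G X x u w"
    unfolding lie_chr_def c 1 by (simp add: l x lc algebra_simps)
  show "lie_chr G X x u (k *\<^sub>R v) = k *\<^sub>R lie_chr G X x u v"
    unfolding lie_chr_def c 2 by (simp add: l x lc algebra_simps)
qed

text \<open>The covector of \<open>projective_algebra\<close> is an explicit expression in
  \<open>lie_chr\<close> on basis vectors, and is therefore smooth.\<close>

lemma eisen_if_lie_chr_parallel:
  assumes X: "smooth_on U X" and par: "\<And>x v. x \<in> U \<Longrightarrow> \<exists>f. lie_chr G X x v v = f *\<^sub>R v"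
  shows "\<exists>\<psi>. smooth_on U \<psi> \<and> eisen U G (lieG G X) \<psi>"
proof (intro exI conjI)
  let ?\<psi> = "\<lambda>x. \<Sum>i\<in>Basis. ((lie_chr G X x i i \<bullet> i) / 2) *\<^sub>R i"
  show "smooth_on U ?\<psi>"
    unfolding divide_real_def
    by (intro smooth_on_sum[OF U] smooth_on_bilinear[OF U bounded_bilinear_scaleR] smooth_on_mult[OF U]
        smooth_on_bilinear[OF U bounded_bilinear_inner] smooth_on_const[OF U] smooth_lie_chr[OF X])
  show "eisen U G (lieG G X) ?\<psi>"
    unfolding eisen_lieG_iff[OF X]
    by (intro ballI allI projective_algebra lie_chr_linear[OF X] lie_chr_sym[OF X] par)
qed

end

context pr_manifold
begin

text \<open>On the open set of times spent in a chart, smoothness identifies the vector derivatives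
  of the definition with \<open>dd\<close>, so that the geodesic equation becomes the vanishing of
  \<open>acc\<close>.\<close>

lemma geodesic_iff:
  "geodesic A g I \<gamma> \<longleftrightarrow> open I \<and> connected I \<and> continuous_on I \<gamma> \<and>
    (\<forall>c\<in>A. smooth_on {t\<in>I. \<gamma> t \<in> dom_of c} (\<lambda>t. coords c (\<gamma> t)) \<and>
      (\<forall>t\<in>I. \<gamma> t \<in> dom_of c \<longrightarrow> acc (\<G> c) (\<lambda>t. coords c (\<gamma> t)) 1 t = 0))"
proof -
  have "(\<forall>i. vector_derivative (\<lambda>s. vector_derivative (coords c \<circ> \<gamma>) (at s)) (at t) $ i
        + (\<Sum>j\<in>UNIV. \<Sum>k\<in>UNIV. christoffel g c i j k (\<gamma> t) * vector_derivative (coords c \<circ> \<gamma>) (at t) $ j * vector_derivative (coords c \<circ> \<gamma>) (at t) $ k) = 0)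
      \<longleftrightarrow> acc (\<G> c) (\<lambda>t. coords c (\<gamma> t)) 1 t = 0"
    if I: "open I" and \<gamma>: "continuous_on I \<gamma>" and s: "smooth_on {t\<in>I. \<gamma> t \<in> dom_of c} (\<lambda>t. coords c (\<gamma> t))"
      and c: "c \<in> A" and t: "t \<in> I" "\<gamma> t \<in> dom_of c" for c t
  proof -
    let ?S = "{t\<in>I. \<gamma> t \<in> dom_of c}"
    have S: "open ?S" by (rule open_preimage[OF \<gamma> I chart_open(1)[OF c]])
    have tS: "t \<in> ?S" using t by simp
    have co: "coords c \<circ> \<gamma> = (\<lambda>t. coords c (\<gamma> t))" by (simp add: o_def)
    have 1: "vector_derivative (\<lambda>t. coords c (\<gamma> t)) (at t) = dd (\<lambda>t. coords c (\<gamma> t)) t 1" if "t \<in> ?S" for t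
      by (rule vector_derivative_dd[OF s S that])
    have "((\<lambda>t. vector_derivative (\<lambda>t. coords c (\<gamma> t)) (at t)) has_vector_derivative dd (\<lambda>t. dd (\<lambda>t. coords c (\<gamma> t)) t 1) t 1) (at t)"
      by (rule has_vector_derivative_transform_within_open[OF smooth_on_real_deriv[OF smooth_on_dd[OF s] S tS] S tS]) (rule 1[symmetric])
    then have 2: "vector_derivative (\<lambda>t. vector_derivative (\<lambda>t. coords c (\<gamma> t)) (at t)) (at t) = dd (\<lambda>t. dd (\<lambda>t. coords c (\<gamma> t)) t 1) t 1"
      by (rule vector_derivative_at)
    show ?thesis unfolding co 1[OF tS] 2 chr_axis2[OF c t(2)] acc_def by (simp add: vec_eq_iff)
  qed
  note E = this
  show ?thesis (is "_ \<longleftrightarrow> ?R")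
  proof
    assume "geodesic A g I \<gamma>"
    note G = this[unfolded geodesic_def smooth_curve_def Let_def]
    have I: "open I" "connected I" "continuous_on I \<gamma>" and sm: "\<And>c. c \<in> A \<Longrightarrow> smooth_on {t\<in>I. \<gamma> t \<in> dom_of c} (\<lambda>t. coords c (\<gamma> t))"
      using G by (auto simp: o_def)
    have "acc (\<G> c) (\<lambda>t. coords c (\<gamma> t)) 1 t = 0" if "c \<in> A" "t \<in> I" "\<gamma> t \<in> dom_of c" for c t
      by (rule iffD1[OF E[OF I(1,3) sm[OF that(1)] that]]) (use G that in blast)
    then show ?R using I sm by blast
  next
    assume R: ?R
    have sm: "smooth_on {t\<in>I. \<gamma> t \<in> dom_of c} (\<lambda>t. coords c (\<gamma> t))" if "c \<in> A" for c using R that by blast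
    have I: "open I" "continuous_on I \<gamma>" using R by auto
    show "geodesic A g I \<gamma>"
      unfolding geodesic_def smooth_curve_def Let_def
    proof (intro conjI ballI impI)
      show "smooth_on {t\<in>I. \<gamma> t \<in> dom_of c} (coords c \<circ> \<gamma>)" if "c \<in> A" for c
        using sm[OF that] by (simp add: o_def)
      show "\<forall>i. vector_derivative (\<lambda>s. vector_derivative (coords c \<circ> \<gamma>) (at s)) (at t) $ i
        + (\<Sum>j\<in>UNIV. \<Sum>k\<in>UNIV. christoffel g c i j k (\<gamma> t) * vector_derivative (coords c \<circ> \<gamma>) (at t) $ j * vector_derivative (coords c \<circ> \<gamma>) (at t) $ k) = 0"
        if "c \<in> A" "t \<in> I" "\<gamma> t \<in> dom_of c" for c t
        by (rule iffD2[OF E[OF I sm[OF that(1)] that]]) (use R that in blast)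
    qed (use R in auto)
  qed
qed

text \<open>One chart suffices, since transition maps carry zero acceleration to zero
  acceleration.\<close>

lemma geodesicI_chart:
  assumes c: "c \<in> A" and I: "open I" "connected I" and p: "smooth_on I p" "p ` I \<subseteq> cod_of c"
    and a: "\<And>t. t \<in> I \<Longrightarrow> acc (\<G> c) p 1 t = 0"
  shows "geodesic A g I (\<lambda>t. inv_coords c (p t))"
  unfolding geodesic_iff
proof (intro conjI I ballI impI)
  show "continuous_on I (\<lambda>t. inv_coords c (p t))"
    by (rule continuous_on_compose2[OF continuous_inv[OF c] smooth_on_continuous[OF p(1)] p(2)])
  fix d assume d: "d \<in> A"
  interpret cc: chart_change "cod_of c" "\<G> c" "cod_of d" "\<G> d" "ov c d" "tr c d" by (rule chart_change[OF c d])
  let ?S = "{t\<in>I. inv_coords c (p t) \<in> dom_of d}"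
  have S': "?S = {t\<in>I. p t \<in> ov c d}" using p(2) by (auto simp: ov_def)
  have S: "open ?S"
    unfolding S' by (rule open_preimage[OF smooth_on_continuous[OF p(1)] I(1) ov_open[OF c d]])
  have pS: "p ` ?S \<subseteq> ov c d" unfolding S' by auto
  have sp: "smooth_on ?S p" by (rule smooth_on_subset[OF p(1)]) auto
  show "smooth_on ?S (\<lambda>t. coords d (inv_coords c (p t)))"
    using smooth_on_compose[OF S ov_open[OF c d] sp smooth_tr[OF c d] pS] by (simp add: tr_def)
  fix t assume t: "t \<in> I" "inv_coords c (p t) \<in> dom_of d"
  have "acc (\<G> d) (\<lambda>q. tr c d (p q)) 1 t = dd (tr c d) (p t) (acc (\<G> c) p 1 t)"
    by (rule cc.acc_change[OF S sp pS]) (use t in simp)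
  also have "\<dots> = 0" unfolding a[OF t(1)] by (rule linear_0[OF cc.df_linear]) (use t pS in auto)
  finally show "acc (\<G> d) (\<lambda>t. coords d (inv_coords c (p t))) 1 t = 0" by (simp add: tr_def)
qed

text \<open>\<open>projective_motion\<close> quantifies over all local flows, so it yields
  information only where one exists. Near a point of a chart the flow of the coordinate field is
  carried to the manifold, and its smoothness is checked against every pair of charts.\<close>

lemma local_flow_exists:
  assumes X: "smooth_vector_field A X" and c: "c \<in> A" and x0: "x0 \<in> cod_of c"
  obtains e :: real and R \<theta> where "e > 0" "R > 0" "ball x0 R \<subseteq> cod_of c" "smooth_on ({-e<..<e} \<times> ball x0 R) \<theta>"
    "\<And>x. x \<in> ball x0 R \<Longrightarrow> \<theta> (0, x) = x"
    "\<And>t x. t \<in> {-e<..<e} \<Longrightarrow> x \<in> ball x0 R \<Longrightarrow> \<theta> (t, x) \<in> cod_of c"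
    "\<And>t x. t \<in> {-e<..<e} \<Longrightarrow> x \<in> ball x0 R \<Longrightarrow> ((\<lambda>s. \<theta> (s, x)) has_vector_derivative loc c X (\<theta> (t, x))) (at t)"
    "local_flow A X e {p \<in> dom_of c. coords c p \<in> ball x0 R} (\<lambda>t p. inv_coords c (\<theta> (t, coords c p)))"
proof -
  note sX = smooth_loc(2)[OF X c]
  obtain e :: real and r \<theta> where f: "e > 0" "r > 0" "smooth_on ({-e<..<e} \<times> ball x0 r) \<theta>"
    "\<And>x. x \<in> ball x0 r \<Longrightarrow> \<theta> (0, x) = x"
    "\<And>t x. t \<in> {-e<..<e} \<Longrightarrow> x \<in> ball x0 r \<Longrightarrow> \<theta> (t, x) \<in> cod_of c"
    "\<And>t x. t \<in> {-e<..<e} \<Longrightarrow> x \<in> ball x0 r \<Longrightarrow> ((\<lambda>s. \<theta> (s, x)) has_vector_derivative loc c X (\<theta> (t, x))) (at t)"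
    by (rule smooth_local_flow[OF chart_open(2)[OF c] sX x0]) (rule that)
  let ?J = "{-e<..<e}" and ?V = "{p \<in> dom_of c. coords c p \<in> ball x0 r}"
  have Br: "ball x0 r \<subseteq> cod_of c"
  proof
    fix x assume x: "x \<in> ball x0 r"
    show "x \<in> cod_of c" using f(5)[OF _ x, of 0] f(4)[OF x] f(1) by simp
  qed
  have c\<theta>: "continuous_on (?J \<times> ball x0 r) \<theta>" by (rule smooth_on_continuous[OF f(3)])
  have "local_flow A X e ?V (\<lambda>t p. inv_coords c (\<theta> (t, coords c p)))"
    unfolding local_flow_def
  proof (intro conjI ballI impI f(1))
    show V: "open ?V"
      by (rule open_preimage[OF continuous_coords[OF c] chart_open(1)[OF c] open_ball])
    show "continuous_on (?J \<times> ?V) (\<lambda>(t, p). inv_coords c (\<theta> (t, coords c p)))"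
      unfolding case_prod_beta
    proof (rule continuous_on_compose2[OF continuous_inv[OF c] continuous_on_compose2[OF c\<theta>]])
      show "continuous_on (?J \<times> ?V) (\<lambda>x. (fst x, coords c (snd x)))"
        by (intro continuous_on_Pair continuous_on_fst continuous_on_id
            continuous_on_compose2[OF continuous_coords[OF c] continuous_on_snd[OF continuous_on_id]]) auto
    qed (use f(5) in auto)
    show "inv_coords c (\<theta> (0, coords c p)) = p" if "p \<in> ?V" for p
      using that by (simp add: f(4) inv_coords[OF c])
    show "((\<lambda>s. coords d (inv_coords c (\<theta> (s, coords c p)))) has_vector_derivative X d (inv_coords c (\<theta> (t, coords c p)))) (at t)"
      if p: "p \<in> ?V" and t: "t \<in> ?J" and d: "d \<in> A" and m: "inv_coords c (\<theta> (t, coords c p)) \<in> dom_of d" for p t d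
    proof -
      let ?y = "\<theta> (t, coords c p)"
      have x: "coords c p \<in> ball x0 r" using p by simp
      have y: "?y \<in> ov c d" using m f(5)[OF t x] by (simp add: ov_def)
      have "((\<lambda>s. \<theta> (s, coords c p)) has_derivative (\<lambda>h. h *\<^sub>R loc c X ?y)) (at t)"
        using f(6)[OF t x] by (simp add: has_vector_derivative_def)
      from has_derivative_compose[OF this smooth_on_deriv[OF smooth_tr[OF c d] ov_open[OF c d] y]]
      have "((\<lambda>s. tr c d (\<theta> (s, coords c p))) has_derivative (\<lambda>h. h *\<^sub>R loc d X (tr c d ?y))) (at t)"
        by (simp add: linear_scale[OF dd_linear[OF smooth_tr[OF c d] ov_open[OF c d] y]] loc_vector[OF X c d y])
      moreover have "loc d X (tr c d ?y) = X d (inv_coords c ?y)" using tr_dom[OF c d y] by (simp add: loc_def)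
      ultimately show ?thesis by (simp add: has_vector_derivative_def tr_def)
    qed
    fix c' d assume c': "c' \<in> A" and d: "d \<in> A"
    let ?B = "{x \<in> ov c' c. tr c' c x \<in> ball x0 r}"
    let ?m = "\<lambda>q. \<theta> (fst q, tr c' c (snd q))"
    have B: "open ?B"
      by (rule open_preimage[OF smooth_on_continuous[OF smooth_tr[OF c' c]] ov_open[OF c' c] open_ball])
    have JB: "open (?J \<times> ?B)" by (intro open_Times B) simp
    have s1: "smooth_on (?J \<times> ?B) (\<lambda>q. (fst q, tr c' c (snd q)))"
      by (intro smooth_on_Pair[OF JB] smooth_on_linear[OF JB bounded_linear_fst]
          smooth_on_compose[OF JB ov_open[OF c' c] smooth_on_linear[OF JB bounded_linear_snd] smooth_tr[OF c' c]]) auto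
    have sm: "smooth_on (?J \<times> ?B) ?m"
      by (rule smooth_on_compose[OF JB _ s1 f(3)]) (auto intro: open_Times)
    let ?S = "{q \<in> ?J \<times> ?B. ?m q \<in> ov c d}"
    have S: "open ?S"
      by (rule open_preimage[OF smooth_on_continuous[OF sm] JB ov_open[OF c d]])
    have eq: "{(t, x). t \<in> ?J \<and> x \<in> coords c' ` (dom_of c' \<inter> ?V) \<and> inv_coords c (\<theta> (t, coords c (inv_coords c' x))) \<in> dom_of d} = ?S"
    proof -
      have "x \<in> coords c' ` (dom_of c' \<inter> ?V) \<longleftrightarrow> x \<in> ?B" for x
      proof
        assume "x \<in> coords c' ` (dom_of c' \<inter> ?V)"
        then show "x \<in> ?B" by (auto simp: ov_def tr_def inv_coords[OF c'] coords_cod[OF c'])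
      next
        assume x: "x \<in> ?B"
        then have "inv_coords c' x \<in> dom_of c' \<inter> ?V" "x = coords c' (inv_coords c' x)"
          using inv_coords_dom[OF c'] coords_inv[OF c'] by (auto simp: ov_def tr_def)
        then show "x \<in> coords c' ` (dom_of c' \<inter> ?V)" by blast
      qed
      then show ?thesis using f(5) by (auto simp: ov_def tr_def)
    qed
    have "smooth_on ?S (\<lambda>q. tr c d (?m q))"
      by (rule smooth_on_compose[OF S ov_open[OF c d] smooth_on_subset[OF sm] smooth_tr[OF c d]]) auto
    then show "smooth_on {(t, x). t \<in> ?J \<and> x \<in> coords c' ` (dom_of c' \<inter> ?V) \<and> inv_coords c (\<theta> (t, coords c (inv_coords c' x))) \<in> dom_of d}
       (\<lambda>(t, x). coords d (inv_coords c (\<theta> (t, coords c (inv_coords c' x)))))"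
      unfolding eq tr_def by (simp only: case_prod_beta')
  qed
  then show ?thesis using that[OF f(1,2) Br f(3-6)] by blast
qed

text \<open>The multiplier of \<open>a t\<close> over \<open>u t\<close> is not known to be
  differentiable, so the combination \<open>k\<close> is differentiated instead: it vanishes where
  \<open>a t\<close> is a multiple of \<open>u t\<close>, and at time 0 the condition
  \<open>a 0 = 0\<close> leaves only the terms with \<open>a'\<close>.\<close>

lemma parallel_derivative:
  fixes a u :: "real \<Rightarrow> 'a::euclidean_space"
  assumes a: "(a has_vector_derivative a') (at 0)" "a 0 = 0" and u: "(u has_vector_derivative u') (at 0)" "u 0 \<noteq> 0"
    and T: "open T" "0 \<in> T" and par: "\<And>t. t \<in> T \<Longrightarrow> \<exists>f. a t = f *\<^sub>R u t"
  shows "\<exists>f. a' = f *\<^sub>R u 0"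
proof -
  define k where "k t = (u t \<bullet> u 0) *\<^sub>R a t - (a t \<bullet> u 0) *\<^sub>R u t" for t
  have z: "k t = 0" if "t \<in> T" for t using par[OF that] by (auto simp: k_def)
  have "(k has_vector_derivative ((u 0 \<bullet> u 0) *\<^sub>R a' + (u' \<bullet> u 0) *\<^sub>R a 0) - ((a 0 \<bullet> u 0) *\<^sub>R u' + (a' \<bullet> u 0) *\<^sub>R u 0)) (at 0)"
    unfolding k_def
    by (intro has_vector_derivative_diff bounded_bilinear.has_vector_derivative[OF bounded_bilinear_scaleR]
        bounded_linear.has_vector_derivative[OF bounded_linear_inner_left] a(1) u(1))
  moreover have "(k has_vector_derivative 0) (at 0)"
    by (rule has_vector_derivative_transform_within_open[OF has_vector_derivative_const T]) (simp add: z)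
  ultimately have "((u 0 \<bullet> u 0) *\<^sub>R a' + (u' \<bullet> u 0) *\<^sub>R a 0) - ((a 0 \<bullet> u 0) *\<^sub>R u' + (a' \<bullet> u 0) *\<^sub>R u 0) = 0"
    by (rule vector_derivative_unique_at)
  then have "(u 0 \<bullet> u 0) *\<^sub>R a' = (a' \<bullet> u 0) *\<^sub>R u 0" by (simp add: a(2))
  note e = this
  have "a' = inverse (u 0 \<bullet> u 0) *\<^sub>R ((u 0 \<bullet> u 0) *\<^sub>R a')" using u(2) by simp
  also have "\<dots> = (inverse (u 0 \<bullet> u 0) * (a' \<bullet> u 0)) *\<^sub>R u 0" unfolding e by simp
  finally show ?thesis ..
qed

text \<open>Transport the geodesic with initial velocity \<open>v\<close> by the flow. The image
  curves are geodesics up to parameter, so their acceleration at parameter 0 stays parallel to the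
  velocity for all flow times; it is 0 at time 0, and its time derivative there is
  \<open>lie_chr\<close> applied to \<open>v\<close> twice.\<close>

lemma projective_lie_chr:
  assumes pm: "projective_motion A g X" and c: "c \<in> A" and x0: "x0 \<in> cod_of c"
  shows "\<exists>f. lie_chr (\<G> c) (loc c X) x0 v v = f *\<^sub>R v"
proof (cases "v = 0")
  interpret chart_metric "cod_of c" "\<G> c" by (rule chart_metric[OF c])
  have X: "smooth_vector_field A X" using pm by (simp add: projective_motion_def)
  note sX = smooth_loc(2)[OF X c]
  {
    case True
    then show ?thesis using linear_0[OF lie_chr_linear[OF sX x0]] by simp
  next
    case False
    obtain e :: real and r \<theta> where f: "e > 0" "r > 0" "ball x0 r \<subseteq> cod_of c" "smooth_on ({-e<..<e} \<times> ball x0 r) \<theta>"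
      "\<And>x. x \<in> ball x0 r \<Longrightarrow> \<theta> (0, x) = x"
      "\<And>t x. t \<in> {-e<..<e} \<Longrightarrow> x \<in> ball x0 r \<Longrightarrow> \<theta> (t, x) \<in> cod_of c"
      "\<And>t x. t \<in> {-e<..<e} \<Longrightarrow> x \<in> ball x0 r \<Longrightarrow> ((\<lambda>s. \<theta> (s, x)) has_vector_derivative loc c X (\<theta> (t, x))) (at t)"
      and lf: "local_flow A X e {p \<in> dom_of c. coords c p \<in> ball x0 r} (\<lambda>t p. inv_coords c (\<theta> (t, coords c p)))"
      by (rule local_flow_exists[OF X c x0]) (rule that)
    obtain e' :: real and r' \<eta> where g: "e' > 0" "r' > 0" and fam: "geodesic_family e' r' x0 v \<eta>"
      by (rule geodesic_flow[OF x0, of v]) (rule that)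
    define p where "p s = fst (\<eta> (s, (x0, v)))" for s
    have m: "(x0, v) \<in> ball (x0, v) r'" using g(2) by simp
    have p: "smooth_on {-e'<..<e'} p" "p 0 = x0" "dd p 0 1 = v" "\<And>s. s \<in> {-e'<..<e'} \<Longrightarrow> acc (\<G> c) p 1 s = 0"
      using geodesic_familyD(1,3)[OF fam m] geodesic_familyD(4)[OF fam m, of 0] geodesic_familyD(5)[OF fam m] g(1) by (simp_all add: p_def[abs_def])
    have "open {s \<in> {-e'<..<e'}. p s \<in> ball x0 r}"
      by (rule open_preimage[OF smooth_on_continuous[OF p(1)] open_greaterThanLessThan open_ball])
    moreover have "0 \<in> {s \<in> {-e'<..<e'}. p s \<in> ball x0 r}" using g(1) f(2) p(2) by simp
    ultimately obtain \<delta> where \<delta>: "\<delta> > 0" "ball 0 \<delta> \<subseteq> {s \<in> {-e'<..<e'}. p s \<in> ball x0 r}" using openE by blast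
    let ?I = "ball 0 \<delta> :: real set" and ?J = "{-e<..<e}"
    have I: "open ?I" "connected ?I" "0 \<in> ?I" using \<delta>(1) convex_connected[OF convex_ball] by auto
    have pI: "smooth_on ?I p" by (rule smooth_on_subset[OF p(1)]) (use \<delta>(2) in auto)
    have pB: "p ` ?I \<subseteq> ball x0 r" using \<delta>(2) by auto
    have geo: "geodesic A g ?I (\<lambda>t. inv_coords c (p t))"
      by (rule geodesicI_chart[OF c I(1,2) pI]) (use pB f(3) p(4) \<delta>(2) in auto)
    define F where "F q = \<theta> (fst q, p (snd q))" for q
    let ?W = "?J \<times> ?I"
    have W: "open ?W" by (intro open_Times) auto
    have sF: "smooth_on ?W F"
      unfolding F_def
    proof (rule smooth_on_compose[OF W _ _ f(4)])
      show "smooth_on ?W (\<lambda>q. (fst q, p (snd q)))"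
        by (intro smooth_on_Pair[OF W] smooth_on_linear[OF W bounded_linear_fst]
          smooth_on_compose[OF W I(1) smooth_on_linear[OF W bounded_linear_snd] pI]) auto
    qed (use pB in \<open>auto intro: open_Times\<close>)
    have FU: "F ` ?W \<subseteq> cod_of c" using f(6) pB by (auto simp: F_def image_subset_iff)
    have fl: "dd F q (1, 0) = loc c X (F q)" if q: "q \<in> ?W" for q
    proof -
      obtain t s where ts: "q = (t, s)" "t \<in> ?J" "s \<in> ?I" using q by blast
      have "p s \<in> ball x0 r" using ts pB by blast
      then have "((\<lambda>t. F (t, s)) has_vector_derivative loc c X (F q)) (at t)"
        using f(7)[OF ts(2)] ts(1) by (simp add: F_def)
      then show ?thesis using vector_derivative_unique_at[OF slice_derivative[OF sF W]] q ts(1) by simp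
    qed
    have W0: "(t, 0) \<in> ?W" if "t \<in> ?J" for t using that I(3) by simp
    have sl: "dd F (t, 0) (0, 1) = dd (\<lambda>s. F (t, s)) 0 1" "acc (\<G> c) F (0, 1) (t, 0) = acc (\<G> c) (\<lambda>s. F (t, s)) 1 0"
      if t: "t \<in> ?J" for t using acc_slice[OF W sF W0[OF t]] by auto
    have J0: "0 \<in> ?J" using f(1) by simp
    define a where "a t = acc (\<G> c) F (0, 1) (t, 0)" for t
    define u where "u t = dd F (t, 0) (0, 1)" for t
    have F0: "F (0, s) = p s" if "s \<in> ?I" for s 
    proof -
      have "p s \<in> ball x0 r" using pB that by blast
      then show ?thesis by (simp only: F_def fst_conv snd_conv f(5))
    qed
    have u0: "u 0 = v"
      unfolding u_def sl(1)[OF J0] using dd_cong_open[OF I(1,3) F0] p(3) by simp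
    have a0: "a 0 = 0"
      unfolding a_def sl(2)[OF J0] using acc_cong[OF I(1,3) F0] p(4)[of 0] g(1) by simp
    note var = variation[OF W sF FU sX fl W0[OF J0], where d="(0, 1)"]
    have a': "(a has_vector_derivative lie_chr (\<G> c) (loc c X) x0 v v) (at 0)"
    proof -
      have "dd (acc (\<G> c) F (0, 1)) (0, 0) (1, 0) = lie_chr (\<G> c) (loc c X) x0 v v"
        using var(2) a0 u0 F0[OF I(3)] p(2) linear_0[OF dd_linear[OF sX U x0]] by (simp add: a_def u_def)
      then show ?thesis using slice_derivative[OF smooth_acc[OF W sF FU, of "(0, 1)"] W W0[OF J0]] by (simp add: a_def[abs_def])
    qed
    have u': "(u has_vector_derivative dd (\<lambda>q. dd F q (0, 1)) (0, 0) (1, 0)) (at 0)"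
      unfolding u_def by (rule slice_derivative[OF smooth_on_dd[OF sF] W W0[OF J0]])
    have par: "\<exists>f. a t = f *\<^sub>R u t" if t: "t \<in> ?J" for t
    proof -
      have "unparametrized_geodesic A g ?I (\<lambda>s. inv_coords c (\<theta> (t, coords c (inv_coords c (p s)))))"
      proof (rule pm[unfolded projective_motion_def, THEN conjunct2, rule_format, OF lf t], rule conjI[OF geo], rule image_subsetI)
        fix s assume "s \<in> ?I"
        then have "p s \<in> ball x0 r" using pB by blast
        moreover have "p s \<in> cod_of c" using calculation f(3) by blast
        ultimately show "inv_coords c (p s) \<in> {p \<in> dom_of c. coords c p \<in> ball x0 r}"
          by (simp add: inv_coords_dom[OF c] coords_inv[OF c])
      qed
      then obtain J \<tau> where J: "open J" "smooth_on J \<tau>" "\<forall>s\<in>J. deriv \<tau> s \<noteq> 0" "\<tau> ` J = ?I"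
        and gg: "geodesic A g J ((\<lambda>s. inv_coords c (\<theta> (t, coords c (inv_coords c (p s))))) \<circ> \<tau>)"
        unfolding unparametrized_geodesic_def by blast
      obtain \<sigma> where \<sigma>: "\<sigma> \<in> J" "\<tau> \<sigma> = 0" using J(4) I(3) by (metis imageE)
      have pJ: "p (\<tau> s) \<in> ball x0 r" if "s \<in> J" for s using that J(4) pB by blast
      have cF: "coords c (inv_coords c (\<theta> (t, coords c (inv_coords c (p (\<tau> s)))))) = F (t, \<tau> s)"
        and dF: "inv_coords c (\<theta> (t, coords c (inv_coords c (p (\<tau> s))))) \<in> dom_of c" if s: "s \<in> J" for s
      proof -
        have 1: "coords c (inv_coords c (p (\<tau> s))) = p (\<tau> s)" using pJ[OF s] f(3) coords_inv[OF c] by blast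
        have 2: "\<theta> (t, p (\<tau> s)) \<in> cod_of c" by (rule f(6)[OF t pJ[OF s]])
        show "coords c (inv_coords c (\<theta> (t, coords c (inv_coords c (p (\<tau> s)))))) = F (t, \<tau> s)"
          by (simp add: 1 coords_inv[OF c 2] F_def)
        show "inv_coords c (\<theta> (t, coords c (inv_coords c (p (\<tau> s))))) \<in> dom_of c"
          by (simp add: 1 inv_coords_dom[OF c 2])
      qed
      have "acc (\<G> c) (\<lambda>s. coords c (inv_coords c (\<theta> (t, coords c (inv_coords c (p (\<tau> s))))))) 1 \<sigma> = 0"
        using gg c \<sigma>(1) dF[OF \<sigma>(1)] unfolding geodesic_iff by (auto simp: o_def)
      then have z: "acc (\<G> c) (\<lambda>s. F (t, \<tau> s)) 1 \<sigma> = 0"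
        using acc_cong[OF J(1) \<sigma>(1) cF] by simp
      have sFt: "smooth_on ?I (\<lambda>s. F (t, s))"
        by (rule smooth_on_compose[OF I(1) W smooth_on_Pair[OF I(1) smooth_on_const[OF I(1)] smooth_on_id[OF I(1)]] sF])
          (use t in auto)
      have FtU: "(\<lambda>s. F (t, s)) ` ?I \<subseteq> cod_of c" using FU t by auto
      \<comment> \<open>The reparametrized curve has zero acceleration, and
        \<open>acc_reparam\<close> rewrites this as a linear relation between \<open>a t\<close> and
        \<open>u t\<close>; it can be solved for \<open>a t\<close> because the parameter change is
        regular.\<close>
      have "(dd \<tau> \<sigma> 1)\<^sup>2 *\<^sub>R a t + dd (\<lambda>s. dd \<tau> s 1) \<sigma> 1 *\<^sub>R u t = 0"
        using acc_reparam(2)[OF I(1) sFt FtU J(1,2) _ \<sigma>(1)] J(4) z \<sigma>(2) by (simp add: a_def u_def sl[OF t])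
      moreover have "dd \<tau> \<sigma> 1 \<noteq> 0"
      proof -
        have "(\<tau> has_field_derivative dd \<tau> \<sigma> 1) (at \<sigma>)"
          using smooth_on_real_deriv[OF J(2,1) \<sigma>(1)] by (simp add: has_real_derivative_iff_has_vector_derivative)
        then show ?thesis using J(3) \<sigma>(1) DERIV_imp_deriv by metis
      qed
      ultimately have "a t = (- (dd (\<lambda>s. dd \<tau> s 1) \<sigma> 1 / (dd \<tau> \<sigma> 1)\<^sup>2)) *\<^sub>R u t"
        by (simp add: eq_neg_iff_add_eq_0 divide_inverse) (metis (no_types, lifting) add.inverse_inverse add_eq_0_iff left_inverse mult.commute power_not_zero scaleR_minus_right scaleR_one scaleR_scaleR)
      then show ?thesis ..
    qed
    show ?thesis
      using parallel_derivative[OF a' a0 u' _ _ J0 par] u0 False by simp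
  }
qed

theorem projective_eisen:
  assumes pm: "projective_motion A g X" and c: "c \<in> A"
  shows "\<exists>\<psi>. smooth_on (cod_of c) \<psi> \<and> eisen (cod_of c) (\<G> c) (lieG (\<G> c) (loc c X)) \<psi>"
proof -
  interpret chart_metric "cod_of c" "\<G> c" by (rule chart_metric[OF c])
  have X: "smooth_vector_field A X" using pm by (simp add: projective_motion_def)
  show ?thesis
    by (rule eisen_if_lie_chr_parallel[OF smooth_loc(2)[OF X c] projective_lie_chr[OF pm c]])
qed

end

section \<open>Affine parameters and the propagation of parallel acceleration\<close>

lemma antiderivative_real:
  fixes f :: "real \<Rightarrow> real"
  assumes I: "open I" "connected I" and f: "continuous_on I f"
  shows "\<exists>F. \<forall>x\<in>I. (F has_real_derivative f x) (at x)"
proof (cases "I = {}")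
  case False
  then obtain x0 where x0: "x0 \<in> I" by blast
  define F where "F x = (if x0 \<le> x then integral {x0..x} f else - integral {x..x0} f)" for x
  have cI: "{x..y} \<subseteq> I" if "x \<in> I" "y \<in> I" for x y
    using connected_contains_Icc[OF I(2) that] .
  have "(F has_real_derivative f x) (at x)" if x: "x \<in> I" for x
  proof -
    obtain d1 where d1: "d1 > 0" "cball x d1 \<subseteq> I" using I(1) x open_contains_cball by blast
    obtain d2 where d2: "d2 > 0" "cball x0 d2 \<subseteq> I" using I(1) x0 open_contains_cball by blast
    define \<alpha> where "\<alpha> = min (x - d1) (x0 - d2)"
    define \<beta> where "\<beta> = max (x + d1) (x0 + d2)"
    have "x - d1 \<in> I" "x + d1 \<in> I" "x0 - d2 \<in> I" "x0 + d2 \<in> I"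
      using d1 d2 by (auto simp: subset_iff dist_real_def)
    then have ab: "\<alpha> \<in> I" "\<beta> \<in> I" unfolding \<alpha>_def \<beta>_def min_def max_def by auto
    have o: "\<alpha> < x" "x < \<beta>" "\<alpha> < x0" "x0 < \<beta>" using d1 d2 by (auto simp: \<alpha>_def \<beta>_def)
    have ca: "continuous_on {\<alpha>..\<beta>} f" by (rule continuous_on_subset[OF f cI[OF ab]])
    have "((\<lambda>y. integral {\<alpha>..y} f) has_vector_derivative f x) (at x within {\<alpha>..\<beta>})"
      by (rule integral_has_vector_derivative[OF ca]) (use o in auto)
    then have "((\<lambda>y. integral {\<alpha>..y} f) has_vector_derivative f x) (at x)"
      using at_within_Icc_at[OF o(1,2)] by simp
    then have d: "((\<lambda>y. integral {\<alpha>..y} f - integral {\<alpha>..x0} f) has_real_derivative f x) (at x)"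
      unfolding has_real_derivative_iff_has_vector_derivative[symmetric] by (auto intro!: derivative_eq_intros)
    have int: "f integrable_on {u..v}" if "\<alpha> \<le> u" "v \<le> \<beta>" for u v
      by (rule integrable_continuous_interval[OF continuous_on_subset[OF ca]]) (use that in auto)
    have eq: "integral {\<alpha>..y} f - integral {\<alpha>..x0} f = F y" if y: "y \<in> {\<alpha><..<\<beta>}" for y
    proof (cases "x0 \<le> y")
      case True
      have "integral {\<alpha>..x0} f + integral {x0..y} f = integral {\<alpha>..y} f"
        by (rule Henstock_Kurzweil_Integration.integral_combine) (use True o y int in auto)
      then show ?thesis using True by (simp add: F_def)
    next
      case False
      have "integral {\<alpha>..y} f + integral {y..x0} f = integral {\<alpha>..x0} f"
        by (rule Henstock_Kurzweil_Integration.integral_combine) (use False o y int in auto)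
      then show ?thesis using False by (simp add: F_def)
    qed
    show ?thesis
      by (rule has_field_derivative_transform_within_open[OF d open_greaterThanLessThan]) (use o eq in auto)
  qed
  then show ?thesis by blast
qed simp

lemma smooth_on_DERIV:
  fixes f :: "real \<Rightarrow> real"
  assumes S: "open S" and d: "\<And>x. x \<in> S \<Longrightarrow> (f has_real_derivative f' x) (at x)" and s: "smooth_on S f'"
  shows "smooth_on S f"
proof (rule smooth_on_SucI[OF S])
  show "(f has_derivative (\<lambda>h. f' x * h)) (at x)" if "x \<in> S" for x
    using d[OF that] by (simp add: has_field_derivative_def)
  show "smooth_on S (\<lambda>x. f' x * v)" for v by (rule smooth_on_mult[OF S s smooth_on_const[OF S]])
qed

lemma smooth_on_exp: "smooth_on UNIV (exp :: real \<Rightarrow> real)"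
  unfolding smooth_on_def
proof
  show "Ck_on k UNIV (exp :: real \<Rightarrow> real)" for k
  proof (induction k)
    case (Suc k)
    have d: "(exp has_derivative (\<lambda>h. exp x * h)) (at x)" for x :: real
      using DERIV_exp[of x] by (simp add: has_field_derivative_def)
    show ?case
      by (rule Ck_on_SucI[OF open_UNIV d])
        (rule Ck_on_bilinear[OF open_UNIV bounded_bilinear_mult Suc Ck_on_const[OF open_UNIV]])
  qed (simp add: continuous_on_exp continuous_on_id)
qed

lemma dd_DERIV: "(f has_real_derivative f') (at x) \<Longrightarrow> dd f x 1 = f'" for f :: "real \<Rightarrow> real"
  using dd_real_eq[of f f' x 1] by (simp add: has_real_derivative_iff_has_vector_derivative)

text \<open>The inverse of a primitive of \<open>exp F\<close> with \<open>F' = f\<close> solves the equation.\<close>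

lemma affine_parameter:
  fixes f :: "real \<Rightarrow> real"
  assumes I: "open I" "connected I" and f: "smooth_on I f"
  obtains J \<tau> where "open J" "connected J" "smooth_on J \<tau>" "\<tau> ` J = I" "\<And>y. y \<in> J \<Longrightarrow> deriv \<tau> y \<noteq> 0"
    "\<And>y. y \<in> J \<Longrightarrow> dd (\<lambda>y. dd \<tau> y 1) y 1 = - f (\<tau> y) * (dd \<tau> y 1)\<^sup>2"
proof -
  obtain F where F: "\<And>x. x \<in> I \<Longrightarrow> (F has_real_derivative f x) (at x)"
    using antiderivative_real[OF I smooth_on_continuous[OF f]] by blast
  define E where "E x = exp (F x)" for x
  have E: "(E has_real_derivative f x * E x) (at x)" if "x \<in> I" for x
    unfolding E_def using DERIV_fun_exp[OF F[OF that]] by (simp add: mult.commute)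
  have sE: "smooth_on I E" unfolding E_def
    by (rule smooth_on_compose[OF I(1) open_UNIV smooth_on_DERIV[OF I(1) F f] smooth_on_exp]) auto
  have E0: "E x > 0" for x by (simp add: E_def)
  obtain \<rho> where \<rho>: "\<And>x. x \<in> I \<Longrightarrow> (\<rho> has_real_derivative E x) (at x)"
    using antiderivative_real[OF I smooth_on_continuous[OF sE]] by blast
  have c\<rho>: "continuous_on I \<rho>" by (rule smooth_on_continuous[OF smooth_on_DERIV[OF I(1) \<rho> sE]])
  have less: "\<rho> x < \<rho> y" if "x \<in> I" "y \<in> I" "x < y" for x y
  proof (rule DERIV_pos_imp_increasing_open[OF that(3)])
    have sub: "{x..y} \<subseteq> I" by (rule connected_contains_Icc[OF I(2) that(1,2)])
    show "continuous_on {x..y} \<rho>" by (rule continuous_on_subset[OF c\<rho> sub])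
    show "\<exists>d. (\<rho> has_real_derivative d) (at z) \<and> 0 < d" if "x < z" "z < y" for z
    proof -
      have "z \<in> I" using sub that by auto
      then show ?thesis using \<rho> E0 by blast
    qed
  qed
  have inj: "inj_on \<rho> I"
    using less by (intro inj_onI) (metis less_irrefl linorder_neqE)
  define J where "J = \<rho> ` I"
  define \<tau> where "\<tau> = inv_into I \<rho>"
  have J: "open J" "connected J" unfolding J_def
    by (rule injective_into_1d_imp_open_map_UNIV[OF I(1) c\<rho> inj order_refl])
      (rule connected_continuous_image[OF c\<rho> I(2)])
  have \<tau>J: "\<tau> ` J = I" unfolding J_def \<tau>_def by (rule inv_into_image_cancel[OF inj order_refl])
  have \<tau>\<rho>: "\<tau> (\<rho> x) = x" if "x \<in> I" for x unfolding \<tau>_def by (rule inv_into_f_f[OF inj that])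
  have \<tau>I: "\<tau> y \<in> I" if "y \<in> J" for y using that \<tau>J by blast
  have d: "(\<tau> has_derivative (\<lambda>h. inverse (E (\<tau> y)) * h)) (at y)" if y: "y \<in> J" for y
  proof -
    obtain x where x: "x \<in> I" "y = \<rho> x" using y by (auto simp: J_def)
    have 1: "(\<rho> has_derivative (\<lambda>h. E x * h)) (at x)" if "x \<in> I" for x
      using \<rho>[OF that] by (simp add: has_field_derivative_def)
    have 2: "(\<lambda>h. E x * h) \<circ> (\<lambda>h. inverse (E x) * h) = id" for x using E0[of x] by (auto simp: fun_eq_iff)
    show ?thesis unfolding x(2) \<tau>\<rho>[OF x(1)]
      by (rule has_derivative_inverse_on[where f=\<rho> and g=\<tau> and f'="\<lambda>x h. E x * h" and g'="\<lambda>x h. inverse (E x) * h",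
            OF I(1) 1 \<tau>\<rho> 2 x(1)])
  qed
  have c\<tau>: "continuous_on J \<tau>"
    by (rule has_derivative_continuous_on[OF has_derivative_at_withinI[OF d]])
  have D: "Ck_on k J (\<lambda>y. inverse (E (\<tau> y)))" if "Ck_on k J \<tau>" for k
    by (rule Ck_on_inverse[OF J(1) Ck_on_compose[OF J(1) I(1) that]])
      (use sE \<tau>I E0 in \<open>auto simp: smooth_on_def less_imp_neq[symmetric]\<close>)
  \<comment> \<open>Bootstrapping: the derivative of \<open>\<tau>\<close> is multiplication by
    \<open>inverse (E (\<tau> y))\<close>, which is as smooth as \<open>\<tau>\<close>.\<close>
  have s\<tau>: "smooth_on J \<tau>"
    unfolding smooth_on_def
  proof
    show "Ck_on k J \<tau>" for k
    proof (induction k)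
      case (Suc k)
      show ?case
        by (rule Ck_on_SucI[OF J(1) d], assumption)
          (rule Ck_on_bilinear[OF J(1) bounded_bilinear_mult D[OF Suc] Ck_on_const[OF J(1)]])
    qed (simp add: c\<tau>)
  qed
  have D1: "(\<tau> has_real_derivative inverse (E (\<tau> y))) (at y)" if "y \<in> J" for y
    using d[OF that] by (simp add: has_field_derivative_def)
  show ?thesis
  proof (rule that[OF J s\<tau> \<tau>J])
    fix y assume y: "y \<in> J"
    show "deriv \<tau> y \<noteq> 0" using DERIV_imp_deriv[OF D1[OF y]] E0[of "\<tau> y"] by simp
    have e: "dd (\<lambda>y. dd \<tau> y 1) y = dd (\<lambda>y. inverse (E (\<tau> y))) y"
      by (rule dd_cong_open[OF J(1) y dd_DERIV[OF D1]])
    have "((\<lambda>y. inverse (E (\<tau> y))) has_real_derivative - (f (\<tau> y) * E (\<tau> y) * inverse (E (\<tau> y)) * inverse ((E (\<tau> y))\<^sup>2))) (at y)"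
      using DERIV_inverse_fun[OF DERIV_chain2[OF E[OF \<tau>I[OF y]] D1[OF y]]] E0[of "\<tau> y"]
      by (simp add: power2_eq_square mult_ac)
    then show "dd (\<lambda>y. dd \<tau> y 1) y 1 = - f (\<tau> y) * (dd \<tau> y 1)\<^sup>2"
      unfolding e dd_DERIV[OF D1[OF y]] using E0[of "\<tau> y"]
      by (subst dd_DERIV) (auto simp: power2_eq_square field_simps)
  qed
qed

context chart_metric
begin

text \<open>If the Lie derivative of the connection is \<open>\<psi> \<otimes> id + id \<otimes> \<psi>\<close>, then for the velocity \<open>u\<close> and the
  acceleration \<open>a\<close> of the transported curves and \<open>\<lambda>' = 2 \<psi>(u)\<close>, the vector \<open>a - \<lambda> u\<close> solves the same
  linear equation as \<open>u\<close>.\<close>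

lemma flow_propagation:
  fixes p :: "real \<times> real \<Rightarrow> real^'n"
  assumes W: "open W" and p: "smooth_on W p" "p ` W \<subseteq> U" and X: "smooth_on U X"
    and fl: "\<And>q. q \<in> W \<Longrightarrow> dd p q (1, 0) = X (p q)"
    and \<psi>: "smooth_on U \<psi>" and lc: "\<And>x u. x \<in> U \<Longrightarrow> lie_chr G X x u u = (2 * (\<psi> x \<bullet> u)) *\<^sub>R u"
    and T: "open T" "convex T" "\<And>t. t \<in> T \<Longrightarrow> (t, x) \<in> W" and t: "t0 \<in> T" "t \<in> T"
  shows "dd p (t0, x) (0, 1) = 0 \<Longrightarrow> dd p (t, x) (0, 1) = 0"
    and "acc G p (0, 1) (t0, x) = f0 *\<^sub>R dd p (t0, x) (0, 1) \<Longrightarrow> \<exists>f. acc G p (0, 1) (t, x) = f *\<^sub>R dd p (t, x) (0, 1)"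
proof -
  define u where "u t = dd p (t, x) (0, 1)" for t
  define a where "a t = acc G p (0, 1) (t, x)" for t
  define D where "D t = dd X (p (t, x))" for t
  have pU: "p (t, x) \<in> U" if "t \<in> T" for t using p(2) T(3)[OF that] by blast
  have lin: "linear (D t)" if "t \<in> T" for t unfolding D_def by (rule dd_linear[OF X U pU[OF that]])
  have slT: "continuous_on T (\<lambda>t. F (t, x))" if F: "continuous_on W F" for F :: "real \<times> real \<Rightarrow> 'b::real_normed_vector"
    by (rule continuous_on_compose2[OF F continuous_on_Pair[OF continuous_on_id continuous_on_const]]) (use T(3) in auto)
  have cont: "continuous_on T (\<lambda>t. D t v)" for v
    unfolding D_def by (rule slT[OF smooth_on_continuous[OF smooth_on_compose[OF W U p(1) smooth_on_dd[OF X] p(2)]]])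
  have u': "(u has_vector_derivative D t (u t)) (at t)" if t: "t \<in> T" for t
  proof -
    have "((\<lambda>t. dd p (t, x) (0, 1)) has_vector_derivative dd (\<lambda>q. dd p q (0, 1)) (t, x) (1, 0)) (at t)"
      by (rule slice_derivative[OF smooth_on_dd[OF p(1)] W T(3)[OF t]])
    moreover have "dd (\<lambda>q. dd p q (0, 1)) (t, x) (1, 0) = D t (u t)"
      unfolding u_def D_def by (rule variation(1)[OF W p X _ T(3)[OF t]]) (rule fl)
    ultimately show ?thesis unfolding u_def by simp
  qed
  have a': "(a has_vector_derivative D t (a t) + (2 * (\<psi> (p (t, x)) \<bullet> u t)) *\<^sub>R u t) (at t)" if t: "t \<in> T" for t
  proof -
    have "((\<lambda>t. acc G p (0, 1) (t, x)) has_vector_derivative dd (acc G p (0, 1)) (t, x) (1, 0)) (at t)"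
      by (rule slice_derivative[OF smooth_acc[OF W p] W T(3)[OF t]])
    moreover have "dd (acc G p (0, 1)) (t, x) (1, 0) = D t (a t) + lie_chr G X (p (t, x)) (u t) (u t)"
      unfolding a_def u_def D_def by (rule variation(2)[OF W p X _ T(3)[OF t]]) (rule fl)
    ultimately show ?thesis unfolding a_def lc[OF pU[OF t]] by simp
  qed
  show "dd p (t, x) (0, 1) = 0" if "dd p (t0, x) (0, 1) = 0"
    using linear_ode_zero[OF T(2,1) t(1) _ t(2) u' lin cont] that by (simp add: u_def)
  assume f0: "acc G p (0, 1) (t0, x) = f0 *\<^sub>R dd p (t0, x) (0, 1)"
  have "continuous_on T (\<lambda>t. 2 * (\<psi> (p (t, x)) \<bullet> u t))"
    unfolding u_def
    by (intro continuous_on_mult continuous_on_const continuous_on_inner slT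
        smooth_on_continuous[OF smooth_on_compose[OF W U p(1) \<psi> p(2)]] smooth_on_continuous[OF smooth_on_dd[OF p(1)]])
  then obtain L where L: "\<And>t. t \<in> T \<Longrightarrow> (L has_real_derivative 2 * (\<psi> (p (t, x)) \<bullet> u t)) (at t)"
    using antiderivative_real[OF T(1) convex_connected[OF T(2)]] by blast
  \<comment> \<open>The multiplier \<open>f0 + L t - L t0\<close> has the prescribed derivative and
    the value \<open>f0\<close> at \<open>t0\<close>.\<close>
  define y where "y t = a t - (f0 + L t - L t0) *\<^sub>R u t" for t
  have "y t = 0"
  proof (rule linear_ode_zero[OF T(2,1) t(1) _ t(2) _ lin cont])
    show "y t0 = 0" using f0 by (simp add: y_def a_def u_def)
    fix t assume t: "t \<in> T"
    note Lv = L[OF t, unfolded has_real_derivative_iff_has_vector_derivative]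
    have "(y has_vector_derivative (D t (a t) + (2 * (\<psi> (p (t, x)) \<bullet> u t)) *\<^sub>R u t)
        - ((f0 + L t - L t0) *\<^sub>R D t (u t) + (0 + 2 * (\<psi> (p (t, x)) \<bullet> u t) - 0) *\<^sub>R u t)) (at t)"
      unfolding y_def
      by (intro has_vector_derivative_diff has_vector_derivative_add has_vector_derivative_const a'[OF t] Lv
          bounded_bilinear.has_vector_derivative[OF bounded_bilinear_scaleR] u'[OF t])
    then show "(y has_vector_derivative D t (y t)) (at t)"
      by (simp add: y_def linear_diff[OF lin[OF t]] linear_scale[OF lin[OF t]])
  qed
  then show "\<exists>f. acc G p (0, 1) (t, x) = f *\<^sub>R dd p (t, x) (0, 1)"
    by (intro exI[of _ "f0 + L t - L t0"]) (simp add: y_def a_def u_def)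
qed

end

section \<open>Flows and unparametrized geodesics\<close>

context pr_manifold
begin

definition scurve :: "real set \<Rightarrow> (real \<Rightarrow> 'm) \<Rightarrow> bool" where
  "scurve I \<sigma> \<longleftrightarrow> (\<forall>d\<in>A. open {x\<in>I. \<sigma> x \<in> dom_of d} \<and> smooth_on {x\<in>I. \<sigma> x \<in> dom_of d} (\<lambda>x. coords d (\<sigma> x)))"

lemma scurveD:
  assumes "scurve I \<sigma>" "d \<in> A"
  shows "open {x\<in>I. \<sigma> x \<in> dom_of d}" "smooth_on {x\<in>I. \<sigma> x \<in> dom_of d} (\<lambda>x. coords d (\<sigma> x))"
    "(\<lambda>x. coords d (\<sigma> x)) ` {x\<in>I. \<sigma> x \<in> dom_of d} \<subseteq> cod_of d"
  using assms coords_cod[OF assms(2)] by (auto simp: scurve_def)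

lemma scurve_change:
  assumes \<sigma>: "scurve I \<sigma>" and c: "c \<in> A" "d \<in> A" and x: "x \<in> I" "\<sigma> x \<in> dom_of c" "\<sigma> x \<in> dom_of d"
  shows "dd (\<lambda>x. coords d (\<sigma> x)) x 1 = dd (tr c d) (coords c (\<sigma> x)) (dd (\<lambda>x. coords c (\<sigma> x)) x 1)"
    and "acc (\<G> d) (\<lambda>x. coords d (\<sigma> x)) 1 x = dd (tr c d) (coords c (\<sigma> x)) (acc (\<G> c) (\<lambda>x. coords c (\<sigma> x)) 1 x)"
    and "linear (dd (tr c d) (coords c (\<sigma> x)))"
proof -
  interpret cc: chart_change "cod_of c" "\<G> c" "cod_of d" "\<G> d" "ov c d" "tr c d" by (rule chart_change[OF c])
  let ?S = "{x\<in>I. \<sigma> x \<in> dom_of c} \<inter> {x\<in>I. \<sigma> x \<in> dom_of d}"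
  have S: "open ?S" by (intro open_Int scurveD(1)[OF \<sigma>] c)
  have s: "smooth_on ?S (\<lambda>x. coords c (\<sigma> x))" by (rule smooth_on_subset[OF scurveD(2)[OF \<sigma> c(1)]]) auto
  have xS: "x \<in> ?S" using x by simp
  have im: "(\<lambda>x. coords c (\<sigma> x)) ` ?S \<subseteq> ov c d" using inv_coords[OF c(1)] coords_cod[OF c(1)] by (auto simp: ov_def)
  have eq: "tr c d (coords c (\<sigma> x)) = coords d (\<sigma> x)" if "x \<in> ?S" for x using that by (simp add: tr_coords[OF c(1)])
  have cx: "coords c (\<sigma> x) \<in> ov c d" using im xS by blast
  have "dd (\<lambda>x. tr c d (coords c (\<sigma> x))) x 1 = dd (tr c d) (coords c (\<sigma> x)) (dd (\<lambda>x. coords c (\<sigma> x)) x 1)"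
    by (rule dd_compose[OF s S xS cc.f(1) cc.W(1) cx])
  then show "dd (\<lambda>x. coords d (\<sigma> x)) x 1 = dd (tr c d) (coords c (\<sigma> x)) (dd (\<lambda>x. coords c (\<sigma> x)) x 1)"
    using dd_cong_open[OF S xS, of "\<lambda>x. tr c d (coords c (\<sigma> x))" "\<lambda>x. coords d (\<sigma> x)"] eq by simp
  have "acc (\<G> d) (\<lambda>x. tr c d (coords c (\<sigma> x))) 1 x = dd (tr c d) (coords c (\<sigma> x)) (acc (\<G> c) (\<lambda>x. coords c (\<sigma> x)) 1 x)"
    by (rule cc.acc_change[OF S s im xS])
  then show "acc (\<G> d) (\<lambda>x. coords d (\<sigma> x)) 1 x = dd (tr c d) (coords c (\<sigma> x)) (acc (\<G> c) (\<lambda>x. coords c (\<sigma> x)) 1 x)"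
    using cc.c2.acc_cong[OF S xS, of "\<lambda>x. tr c d (coords c (\<sigma> x))" "\<lambda>x. coords d (\<sigma> x)"] eq by simp
  show "linear (dd (tr c d) (coords c (\<sigma> x)))" by (rule cc.df_linear[OF cx])
qed

definition stationary :: "(real \<Rightarrow> 'm) \<Rightarrow> real \<Rightarrow> bool" where
  "stationary \<sigma> x \<longleftrightarrow> (\<forall>d\<in>A. \<sigma> x \<in> dom_of d \<longrightarrow> dd (\<lambda>x. coords d (\<sigma> x)) x 1 = 0)"

text \<open>One multiplier serves all charts, since velocity and acceleration both transform by the
  Jacobian; \<open>acc_multI\<close> therefore checks the condition in a single chart.\<close>

definition acc_mult :: "(real \<Rightarrow> 'm) \<Rightarrow> real \<Rightarrow> real \<Rightarrow> bool" where
  "acc_mult \<sigma> x f \<longleftrightarrow> (\<forall>d\<in>A. \<sigma> x \<in> dom_of d \<longrightarrow>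
     acc (\<G> d) (\<lambda>x. coords d (\<sigma> x)) 1 x = f *\<^sub>R dd (\<lambda>x. coords d (\<sigma> x)) x 1)"

lemma stationaryI:
  assumes \<sigma>: "scurve I \<sigma>" and c: "c \<in> A" and x: "x \<in> I" "\<sigma> x \<in> dom_of c" and z: "dd (\<lambda>x. coords c (\<sigma> x)) x 1 = 0"
  shows "stationary \<sigma> x"
  unfolding stationary_def
proof (intro ballI impI)
  fix d assume d: "d \<in> A" "\<sigma> x \<in> dom_of d"
  show "dd (\<lambda>x. coords d (\<sigma> x)) x 1 = 0"
    unfolding scurve_change(1)[OF \<sigma> c d(1) x d(2)] z by (rule linear_0[OF scurve_change(3)[OF \<sigma> c d(1) x d(2)]])
qed

lemma acc_multI:
  assumes \<sigma>: "scurve I \<sigma>" and c: "c \<in> A" and x: "x \<in> I" "\<sigma> x \<in> dom_of c"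
    and z: "acc (\<G> c) (\<lambda>x. coords c (\<sigma> x)) 1 x = f *\<^sub>R dd (\<lambda>x. coords c (\<sigma> x)) x 1"
  shows "acc_mult \<sigma> x f"
  unfolding acc_mult_def
proof (intro ballI impI)
  fix d assume d: "d \<in> A" "\<sigma> x \<in> dom_of d"
  show "acc (\<G> d) (\<lambda>x. coords d (\<sigma> x)) 1 x = f *\<^sub>R dd (\<lambda>x. coords d (\<sigma> x)) x 1"
    unfolding scurve_change(1,2)[OF \<sigma> c d(1) x d(2)] z by (rule linear_scale[OF scurve_change(3)[OF \<sigma> c d(1) x d(2)]])
qed

lemma geodesic_scurve: "geodesic A g I \<gamma> \<Longrightarrow> scurve I \<gamma>"
  unfolding geodesic_iff scurve_def
  using continuous_open_preimage[of I \<gamma>] chart_open(1) by (auto simp: vimage_def Int_def)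

text \<open>By \<open>velocity_zero\<close>, vanishing velocity spreads over each piece of the curve
  inside a chart; connectedness of the interval does the rest.\<close>

lemma geodesic_stationary:
  assumes \<gamma>: "geodesic A g I \<gamma>" and x: "x \<in> I" "y \<in> I" and z: "stationary \<gamma> x"
  shows "stationary \<gamma> y"
proof (rule connected_induction_simple[where S=I and P="stationary \<gamma>" and a=x and b=y])
  note Gd = \<gamma>[unfolded geodesic_iff]
  show "connected I" using Gd by blast
  fix a assume a: "a \<in> I"
  obtain c where c: "c \<in> A" "\<gamma> a \<in> dom_of c" using chart_ex by blast
  interpret chart_metric "cod_of c" "\<G> c" by (rule chart_metric[OF c(1)])
  note S = scurveD[OF geodesic_scurve[OF \<gamma>] c(1)]
  obtain \<delta> where \<delta>: "\<delta> > 0" "ball a \<delta> \<subseteq> {x\<in>I. \<gamma> x \<in> dom_of c}" using openE[OF S(1)] a c(2) by blast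
  have pp: "stationary \<gamma> y" if x: "x \<in> ball a \<delta>" and y: "y \<in> ball a \<delta>" and z: "stationary \<gamma> x" for x y
  proof (rule stationaryI[OF geodesic_scurve[OF \<gamma>] c(1)])
    show "y \<in> I" "\<gamma> y \<in> dom_of c" using y \<delta>(2) by auto
    show "dd (\<lambda>x. coords c (\<gamma> x)) y 1 = 0"
    proof (rule velocity_zero[OF open_ball convex_ball smooth_on_subset[OF S(2) \<delta>(2)] _ _ x _ y])
      show "(\<lambda>x. coords c (\<gamma> x)) ` ball a \<delta> \<subseteq> cod_of c" using S(3) \<delta>(2) by blast
      show "acc (\<G> c) (\<lambda>x. coords c (\<gamma> x)) 1 t = 0" if "t \<in> ball a \<delta>" for t
      proof -
        have "t \<in> I" "\<gamma> t \<in> dom_of c" using that \<delta>(2) by auto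
        then show ?thesis using Gd c(1) by blast
      qed
      have "\<gamma> x \<in> dom_of c" using x \<delta>(2) by auto
      then show "dd (\<lambda>x. coords c (\<gamma> x)) x 1 = 0" using z c(1) unfolding stationary_def by blast
    qed
  qed
  show "\<exists>T. openin (top_of_set I) T \<and> a \<in> T \<and> (\<forall>x\<in>T. \<forall>y\<in>T. stationary \<gamma> x \<longrightarrow> stationary \<gamma> y)"
  proof (intro exI[of _ "I \<inter> ball a \<delta>"] conjI ballI impI)
    show "openin (top_of_set I) (I \<inter> ball a \<delta>)" by (rule openin_open_Int[OF open_ball])
    show "a \<in> I \<inter> ball a \<delta>" using a \<delta>(1) by simp
    show "stationary \<gamma> y" if "x \<in> I \<inter> ball a \<delta>" "y \<in> I \<inter> ball a \<delta>" "stationary \<gamma> x" for x y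
      by (rule pp[OF _ _ that(3)]) (use that(1,2) in simp_all)
  qed
qed (use x z in auto)

text \<open>A curve at rest has zero acceleration and is already a geodesic. A curve never at rest
  has a smooth multiplier, a quotient of inner products, and \<open>affine_parameter\<close> removes
  it. The mixed case, which no regular change of parameter turns into a geodesic, is excluded by
  \<open>st\<close>.\<close>

lemma unparametrized_geodesicI:
  assumes I: "open I" "connected I" and \<sigma>: "scurve I \<sigma>" "continuous_on I \<sigma>"
    and ac: "\<And>x. x \<in> I \<Longrightarrow> \<exists>f. acc_mult \<sigma> x f"
    and st: "(\<forall>x\<in>I. stationary \<sigma> x) \<or> (\<forall>x\<in>I. \<not> stationary \<sigma> x)"
  shows "unparametrized_geodesic A g I \<sigma>"
  using st
proof
  assume z: "\<forall>x\<in>I. stationary \<sigma> x"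
  have "geodesic A g I \<sigma>"
    unfolding geodesic_iff
  proof (intro conjI I \<sigma>(2) ballI impI)
    show "smooth_on {t\<in>I. \<sigma> t \<in> dom_of c} (\<lambda>t. coords c (\<sigma> t))" if "c \<in> A" for c by (rule scurveD(2)[OF \<sigma>(1) that])
    show "acc (\<G> c) (\<lambda>t. coords c (\<sigma> t)) 1 t = 0" if "c \<in> A" "t \<in> I" "\<sigma> t \<in> dom_of c" for c t
      using ac[OF that(2)] z that unfolding acc_mult_def stationary_def by auto
  qed
  moreover have "smooth_on I (\<lambda>x::real. x)" by (rule smooth_on_id[OF I(1)])
  ultimately show ?thesis
    unfolding unparametrized_geodesic_def by (intro exI[of _ I] exI[of _ "\<lambda>x. x"]) (simp add: I o_def)
next
  assume nz: "\<forall>x\<in>I. \<not> stationary \<sigma> x"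
  obtain f where f: "\<And>x. x \<in> I \<Longrightarrow> acc_mult \<sigma> x (f x)" using ac by metis
  have sf: "smooth_on I f"
  proof (rule smooth_on_locally[OF I(1)])
    fix x assume x: "x \<in> I"
    obtain c where c: "c \<in> A" "\<sigma> x \<in> dom_of c" using chart_ex by blast
    interpret chart_metric "cod_of c" "\<G> c" by (rule chart_metric[OF c(1)])
    note S = scurveD[OF \<sigma>(1) c(1)]
    let ?S = "{x\<in>I. \<sigma> x \<in> dom_of c}"
    let ?u = "\<lambda>x. dd (\<lambda>x. coords c (\<sigma> x)) x 1" and ?a = "acc (\<G> c) (\<lambda>x. coords c (\<sigma> x)) 1"
    have u0: "?u y \<noteq> 0" if "y \<in> ?S" for y using nz stationaryI[OF \<sigma>(1) c(1), of y] that by blast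
    have sm: "smooth_on ?S (\<lambda>x. (?a x \<bullet> ?u x) * inverse (?u x \<bullet> ?u x))"
      by (intro smooth_on_mult[OF S(1)] smooth_on_inverse[OF S(1)] smooth_on_bilinear[OF S(1) bounded_bilinear_inner]
          smooth_on_dd[OF S(2)] smooth_acc[OF S]) (use u0 in auto)
    have "smooth_on ?S f"
    proof (rule smooth_on_cong[OF S(1) _ sm])
      show "(?a y \<bullet> ?u y) * inverse (?u y \<bullet> ?u y) = f y" if y: "y \<in> ?S" for y
        using f[of y] y c(1) u0[OF y] unfolding acc_mult_def by (simp add: inner_eq_zero_iff)
    qed
    then show "\<exists>T. open T \<and> x \<in> T \<and> smooth_on T f" using S(1) x c(2) by blast
  qed
  obtain J \<tau> where J: "open J" "connected J" "smooth_on J \<tau>" "\<tau> ` J = I" "\<And>y. y \<in> J \<Longrightarrow> deriv \<tau> y \<noteq> 0"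
    "\<And>y. y \<in> J \<Longrightarrow> dd (\<lambda>y. dd \<tau> y 1) y 1 = - f (\<tau> y) * (dd \<tau> y 1)\<^sup>2"
    by (rule affine_parameter[OF I sf]) (rule that)
  have c\<tau>: "continuous_on J \<tau>" by (rule smooth_on_continuous[OF J(3)])
  have "geodesic A g J (\<lambda>y. \<sigma> (\<tau> y))"
    unfolding geodesic_iff
  proof (intro conjI J(1,2) ballI impI)
    show "continuous_on J (\<lambda>y. \<sigma> (\<tau> y))" by (rule continuous_on_compose2[OF \<sigma>(2) c\<tau>]) (use J(4) in simp)
    fix c assume c: "c \<in> A"
    interpret chart_metric "cod_of c" "\<G> c" by (rule chart_metric[OF c])
    note S = scurveD[OF \<sigma>(1) c]
    let ?J = "{y\<in>J. \<sigma> (\<tau> y) \<in> dom_of c}"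
    have J': "?J = {y\<in>J. \<tau> y \<in> {x\<in>I. \<sigma> x \<in> dom_of c}}" using J(4) by blast
    have oJ: "open ?J" unfolding J'
      by (rule open_preimage[OF c\<tau> J(1) S(1)])
    have s\<tau>: "smooth_on ?J \<tau>" by (rule smooth_on_subset[OF J(3)]) auto
    have im: "\<tau> ` ?J \<subseteq> {x\<in>I. \<sigma> x \<in> dom_of c}" unfolding J' by blast
    show "smooth_on ?J (\<lambda>y. coords c (\<sigma> (\<tau> y)))"
      by (rule smooth_on_compose[OF oJ S(1) s\<tau> S(2) im])
    fix y assume y: "y \<in> J" "\<sigma> (\<tau> y) \<in> dom_of c"
    have yJ: "y \<in> ?J" and yI: "\<tau> y \<in> I" using y J(4) by auto
    have "acc (\<G> c) (\<lambda>x. coords c (\<sigma> x)) 1 (\<tau> y) = f (\<tau> y) *\<^sub>R dd (\<lambda>x. coords c (\<sigma> x)) (\<tau> y) 1"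
      using f[OF yI] c y(2) unfolding acc_mult_def by blast
    then show "acc (\<G> c) (\<lambda>y. coords c (\<sigma> (\<tau> y))) 1 y = 0"
      unfolding acc_reparam(2)[OF S oJ s\<tau> im yJ] J(6)[OF y(1)] by (simp add: mult.commute)
  qed
  then show ?thesis
    unfolding unparametrized_geodesic_def using J by (intro exI[of _ J] exI[of _ \<tau>]) (simp add: o_def)
qed

text \<open>Smoothness of a local flow is given only through pairs of charts. Here \<open>c\<close>
  sees the curve and \<open>d\<close> its image, and \<open>P\<close> is the resulting smooth map of
  flow time and curve parameter on the open set where both charts apply.\<close>

lemma flow_patch:
  assumes lf: "local_flow A X \<epsilon> V \<theta>" and \<gamma>: "scurve I \<gamma>" "continuous_on I \<gamma>" "open I" "\<gamma> ` I \<subseteq> V"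
    and c: "c \<in> A" "d \<in> A"
  defines "W \<equiv> {(t, x). t \<in> {-\<epsilon><..<\<epsilon>} \<and> x \<in> I \<and> \<gamma> x \<in> dom_of c \<and> \<theta> t (\<gamma> x) \<in> dom_of d}"
    and "P \<equiv> \<lambda>q. coords d (\<theta> (fst q) (\<gamma> (snd q)))"
  shows "open W" "smooth_on W P" "P ` W \<subseteq> cod_of d" "q \<in> W \<Longrightarrow> dd P q (1, 0) = loc d X (P q)"
proof -
  let ?J = "{-\<epsilon><..<\<epsilon>}"
  note L = lf[unfolded local_flow_def]
  have V: "open V" and c\<theta>: "continuous_on (?J \<times> V) (\<lambda>(t, p). \<theta> t p)" using L by auto
  let ?Vc = "{x \<in> cod_of c. inv_coords c x \<in> V}"
  have Vc: "open ?Vc"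
    by (rule open_preimage[OF continuous_inv[OF c(1)] chart_open(2)[OF c(1)] V])
  have Vc': "coords c ` (dom_of c \<inter> V) = ?Vc"
  proof
    show "coords c ` (dom_of c \<inter> V) \<subseteq> ?Vc" using coords_cod[OF c(1)] inv_coords[OF c(1)] by auto
    show "?Vc \<subseteq> coords c ` (dom_of c \<inter> V)"
    proof
      fix x assume "x \<in> ?Vc"
      then have "inv_coords c x \<in> dom_of c \<inter> V" "x = coords c (inv_coords c x)"
        using inv_coords_dom[OF c(1)] coords_inv[OF c(1)] by auto
      then show "x \<in> coords c ` (dom_of c \<inter> V)" by blast
    qed
  qed
  let ?S = "{q \<in> ?J \<times> ?Vc. \<theta> (fst q) (inv_coords c (snd q)) \<in> dom_of d}"
  let ?\<phi> = "\<lambda>q. coords d (\<theta> (fst q) (inv_coords c (snd q)))"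
  have "smooth_on {(t, x). t \<in> ?J \<and> x \<in> coords c ` (dom_of c \<inter> V) \<and> \<theta> t (inv_coords c x) \<in> dom_of d}
      (\<lambda>(t, x). coords d (\<theta> t (inv_coords c x)))" using L c by blast
  moreover have "{(t, x). t \<in> ?J \<and> x \<in> coords c ` (dom_of c \<inter> V) \<and> \<theta> t (inv_coords c x) \<in> dom_of d} = ?S"
    unfolding Vc' by auto
  ultimately have s\<phi>: "smooth_on ?S ?\<phi>" by (simp only: case_prod_beta')
  have JV: "open (?J \<times> ?Vc)" by (intro open_Times Vc) simp
  have "continuous_on (?J \<times> ?Vc) (\<lambda>q. (fst q, inv_coords c (snd q)))"
    by (intro continuous_on_Pair continuous_on_fst continuous_on_id
        continuous_on_compose2[OF continuous_inv[OF c(1)] continuous_on_snd[OF continuous_on_id]]) auto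
  then have "continuous_on (?J \<times> ?Vc) (\<lambda>q. (\<lambda>(t, p). \<theta> t p) (fst q, inv_coords c (snd q)))"
    by (rule continuous_on_compose2[OF c\<theta>]) auto
  then have "continuous_on (?J \<times> ?Vc) (\<lambda>q. \<theta> (fst q) (inv_coords c (snd q)))" by simp
  from continuous_open_preimage[OF this JV chart_open(1)[OF c(2)]]
  have S: "open ?S" by (simp add: vimage_def Int_def)
  let ?I = "{x\<in>I. \<gamma> x \<in> dom_of c}"
  note Gd = scurveD[OF \<gamma>(1) c(1)]
  have JI: "open (?J \<times> ?I)" by (intro open_Times Gd(1)) simp
  have sm: "smooth_on (?J \<times> ?I) (\<lambda>q. (fst q, coords c (\<gamma> (snd q))))"
    by (intro smooth_on_Pair[OF JI] smooth_on_linear[OF JI bounded_linear_fst]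
        smooth_on_compose[OF JI Gd(1) smooth_on_linear[OF JI bounded_linear_snd] Gd(2)]) auto
  have W: "W = {q \<in> ?J \<times> ?I. (fst q, coords c (\<gamma> (snd q))) \<in> ?S}"
    using \<gamma>(4) by (auto simp: W_def inv_coords[OF c(1)] coords_cod[OF c(1)])
  show oW: "open W" unfolding W
    by (rule open_preimage[OF smooth_on_continuous[OF sm] JI S])
  have "smooth_on W (\<lambda>q. ?\<phi> (fst q, coords c (\<gamma> (snd q))))"
    by (rule smooth_on_compose[OF oW S smooth_on_subset[OF sm] s\<phi>]) (auto simp: W)
  then show sP: "smooth_on W P"
    by (rule smooth_on_cong[OF oW, rotated]) (auto simp: W_def P_def inv_coords[OF c(1)])
  show "P ` W \<subseteq> cod_of d" using coords_cod[OF c(2)] by (auto simp: W_def P_def)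
  assume q: "q \<in> W"
  obtain t x where tx: "q = (t, x)" by (cases q)
  have m: "t \<in> ?J" "\<gamma> x \<in> V" "\<theta> t (\<gamma> x) \<in> dom_of d" using q \<gamma>(4) by (auto simp: W_def tx)
  interpret chart_metric "cod_of d" "\<G> d" by (rule chart_metric[OF c(2)])
  have "((\<lambda>t. P (t, x)) has_vector_derivative dd P (t, x) (1, 0)) (at t)"
    by (rule slice_derivative[OF sP oW]) (use q in \<open>simp add: tx\<close>)
  moreover have "((\<lambda>t. P (t, x)) has_vector_derivative X d (\<theta> t (\<gamma> x))) (at t)"
    unfolding P_def fst_conv snd_conv using L m c(2) by blast
  ultimately have "dd P (t, x) (1, 0) = X d (\<theta> t (\<gamma> x))" by (rule vector_derivative_unique_at)
  then show "dd P q (1, 0) = loc d X (P q)" by (simp add: tx P_def loc_def inv_coords[OF c(2) m(3)])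
qed

lemma flow_scurve:
  assumes lf: "local_flow A X \<epsilon> V \<theta>" and \<gamma>: "scurve I \<gamma>" "continuous_on I \<gamma>" "open I" "\<gamma> ` I \<subseteq> V" and t: "t \<in> {-\<epsilon><..<\<epsilon>}"
  shows "continuous_on I (\<lambda>x. \<theta> t (\<gamma> x))" "scurve I (\<lambda>x. \<theta> t (\<gamma> x))"
proof -
  have c\<theta>: "continuous_on ({-\<epsilon><..<\<epsilon>} \<times> V) (\<lambda>(t, p). \<theta> t p)" using lf unfolding local_flow_def by auto
  have "continuous_on I (\<lambda>x. (\<lambda>(t, p). \<theta> t p) (t, \<gamma> x))"
    by (rule continuous_on_compose2[OF c\<theta> continuous_on_Pair[OF continuous_on_const \<gamma>(2)]]) (use \<gamma>(4) t in auto)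
  then show ct: "continuous_on I (\<lambda>x. \<theta> t (\<gamma> x))" by simp
  show "scurve I (\<lambda>x. \<theta> t (\<gamma> x))"
    unfolding scurve_def
  proof (intro ballI conjI)
    fix d assume d: "d \<in> A"
    let ?S = "{x\<in>I. \<theta> t (\<gamma> x) \<in> dom_of d}"
    show S: "open ?S"
      by (rule open_preimage[OF ct \<gamma>(3) chart_open(1)[OF d]])
    show "smooth_on ?S (\<lambda>x. coords d (\<theta> t (\<gamma> x)))"
    proof (rule smooth_on_locally[OF S])
      fix x assume x: "x \<in> ?S"
      obtain c where c: "c \<in> A" "\<gamma> x \<in> dom_of c" using chart_ex by blast
      note P = flow_patch[OF lf \<gamma> c(1) d]
      let ?W = "{(t, x). t \<in> {-\<epsilon><..<\<epsilon>} \<and> x \<in> I \<and> \<gamma> x \<in> dom_of c \<and> \<theta> t (\<gamma> x) \<in> dom_of d}"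
      let ?T = "?S \<inter> {x\<in>I. \<gamma> x \<in> dom_of c}"
      have T: "open ?T" by (intro open_Int S scurveD(1)[OF \<gamma>(1) c(1)])
      have "smooth_on ?T (\<lambda>x. (\<lambda>q. coords d (\<theta> (fst q) (\<gamma> (snd q)))) (t, x))"
        by (rule smooth_on_compose[OF T P(1) smooth_on_Pair[OF T smooth_on_const[OF T] smooth_on_id[OF T]] P(2)]) (use t in auto)
      then have "smooth_on ?T (\<lambda>x. coords d (\<theta> t (\<gamma> x)))" by simp
      then show "\<exists>T. open T \<and> x \<in> T \<and> smooth_on T (\<lambda>x. coords d (\<theta> t (\<gamma> x)))" using T x c(2) by blast
    qed
  qed
qed

text \<open>For a fixed curve parameter \<open>x\<close>, being at rest and having acceleration
  parallel to the velocity both pass from one flow time to nearby ones, by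
  \<open>flow_propagation\<close> in a chart around the moved point, and then along the whole time
  interval. At time 0 the curve is a geodesic, where both are known.\<close>

theorem projective_motionI:
  assumes X: "smooth_vector_field A X"
    and E: "\<And>c. c \<in> A \<Longrightarrow> \<exists>\<psi>. smooth_on (cod_of c) \<psi> \<and> eisen (cod_of c) (\<G> c) (lieG (\<G> c) (loc c X)) \<psi>"
  shows "projective_motion A g X"
  unfolding projective_motion_def
proof (intro conjI X allI impI ballI)
  fix \<epsilon> V \<theta> t1 I \<gamma>
  assume lf: "local_flow A X \<epsilon> V \<theta>" and t1: "t1 \<in> {-\<epsilon><..<\<epsilon>}" and "geodesic A g I \<gamma> \<and> \<gamma> ` I \<subseteq> V"
  then have \<gamma>: "geodesic A g I \<gamma>" and \<gamma>V: "\<gamma> ` I \<subseteq> V" by auto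
  let ?J = "{-\<epsilon><..<\<epsilon>}"
  note Gd = \<gamma>[unfolded geodesic_iff]
  have I: "open I" "connected I" "continuous_on I \<gamma>" using Gd by auto
  note s\<gamma> = geodesic_scurve[OF \<gamma>]
  note fs = flow_scurve[OF lf s\<gamma> I(3,1) \<gamma>V]
  define \<sigma> where "\<sigma> t x = \<theta> t (\<gamma> x)" for t x
  have c\<sigma>: "continuous_on I (\<sigma> t)" and s\<sigma>: "scurve I (\<sigma> t)" if "t \<in> ?J" for t
    using fs[OF that] by (simp_all add: \<sigma>_def[abs_def])
  have c\<theta>: "continuous_on (?J \<times> V) (\<lambda>(t, p). \<theta> t p)" using lf unfolding local_flow_def by auto
  have J0: "0 \<in> ?J" using lf unfolding local_flow_def by auto
  have step: "\<exists>T. open T \<and> t \<in> T \<and> T \<subseteq> ?J \<and> (\<forall>y\<in>T. \<forall>z\<in>T. (stationary (\<sigma> y) x \<longrightarrow> stationary (\<sigma> z) x) \<and>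
      ((\<exists>f. acc_mult (\<sigma> y) x f) \<longrightarrow> (\<exists>f. acc_mult (\<sigma> z) x f)))" if t: "t \<in> ?J" and x: "x \<in> I" for t x
  proof -
    obtain c where c: "c \<in> A" "\<gamma> x \<in> dom_of c" using chart_ex by blast
    obtain d where d: "d \<in> A" "\<theta> t (\<gamma> x) \<in> dom_of d" using chart_ex by blast
    interpret chart_metric "cod_of d" "\<G> d" by (rule chart_metric[OF d(1)])
    define W where "W = {(t, x). t \<in> ?J \<and> x \<in> I \<and> \<gamma> x \<in> dom_of c \<and> \<theta> t (\<gamma> x) \<in> dom_of d}"
    define P where "P = (\<lambda>q. coords d (\<theta> (fst q) (\<gamma> (snd q))))"
    note fp = flow_patch[OF lf s\<gamma> I(3,1) \<gamma>V c(1) d(1), folded W_def P_def]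
    have "(\<lambda>y. (y, x)) -` W = {y. (y, x) \<in> W}" by auto
    then have "open {y. (y, x) \<in> W}"
      using open_vimage[OF fp(1), of "\<lambda>y. (y, x)"] by (simp add: continuous_on_Pair continuous_on_id)
    moreover have "t \<in> {y. (y, x) \<in> W}" using t x c d by (simp add: W_def)
    ultimately obtain \<delta> where \<delta>: "\<delta> > 0" "ball t \<delta> \<subseteq> {y. (y, x) \<in> W}" using openE by blast
    obtain \<psi> where \<psi>: "smooth_on (cod_of d) \<psi>" "eisen (cod_of d) (\<G> d) (lieG (\<G> d) (loc d X)) \<psi>" using E[OF d(1)] by blast
    note sX = smooth_loc(2)[OF X d(1)]
    have lc: "lie_chr (\<G> d) (loc d X) y u u = (2 * (\<psi> y \<bullet> u)) *\<^sub>R u" if "y \<in> cod_of d" for y u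
      using \<psi>(2)[unfolded eisen_lieG_iff[OF sX]] that by (simp add: scaleR_add_left[symmetric])
    have T: "\<And>y. y \<in> ball t \<delta> \<Longrightarrow> (y, x) \<in> W" using \<delta>(2) by blast
    have yJ: "y \<in> ?J" "\<sigma> y x \<in> dom_of d" if "y \<in> ball t \<delta>" for y using T[OF that] by (auto simp: W_def \<sigma>_def)
    have sl: "dd P (y, x) (0, 1) = dd (\<lambda>x. coords d (\<sigma> y x)) x 1"
      "acc (\<G> d) P (0, 1) (y, x) = acc (\<G> d) (\<lambda>x. coords d (\<sigma> y x)) 1 x" if "y \<in> ball t \<delta>" for y
      using acc_slice[OF fp(1,2) T[OF that]] by (simp_all add: P_def \<sigma>_def)
    have fl: "dd P q (1, 0) = loc d X (P q)" if "q \<in> W" for q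
      using fp(4)[OF that] unfolding P_def by simp
    note pr = flow_propagation[OF fp(1-3) sX fl \<psi>(1) lc open_ball convex_ball T]
    have pp: "(stationary (\<sigma> y) x \<longrightarrow> stationary (\<sigma> z) x) \<and> ((\<exists>f. acc_mult (\<sigma> y) x f) \<longrightarrow> (\<exists>f. acc_mult (\<sigma> z) x f))"
      if y: "y \<in> ball t \<delta>" and z: "z \<in> ball t \<delta>" for y z
    proof (intro conjI impI)
      assume "stationary (\<sigma> y) x"
      then have "dd P (y, x) (0, 1) = 0" unfolding sl(1)[OF y] using d(1) yJ(2)[OF y] by (simp add: stationary_def)
      from pr(1)[OF _ _ _ y z this]
      show "stationary (\<sigma> z) x"
        by (intro stationaryI[OF s\<sigma>[OF yJ(1)[OF z]] d(1) x yJ(2)[OF z]]) (simp add: sl(1)[OF z])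
    next
      assume "\<exists>f. acc_mult (\<sigma> y) x f"
      then obtain f where "acc_mult (\<sigma> y) x f" ..
      then have "acc (\<G> d) P (0, 1) (y, x) = f *\<^sub>R dd P (y, x) (0, 1)"
        unfolding sl[OF y] using d(1) yJ(2)[OF y] by (simp add: acc_mult_def)
      from pr(2)[OF _ _ _ y z this]
      obtain f' where "acc (\<G> d) P (0, 1) (z, x) = f' *\<^sub>R dd P (z, x) (0, 1)" by blast
      then have "acc_mult (\<sigma> z) x f'"
        by (intro acc_multI[OF s\<sigma>[OF yJ(1)[OF z]] d(1) x yJ(2)[OF z]]) (simp add: sl[OF z])
      then show "\<exists>f. acc_mult (\<sigma> z) x f" ..
    qed
    have "ball t \<delta> \<subseteq> ?J" using yJ(1) by blast
    moreover have "t \<in> ball t \<delta>" using \<delta>(1) by simp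
    ultimately show ?thesis by (intro exI[of _ "ball t \<delta>"] conjI[OF open_ball] conjI ballI pp)
  qed
  have cJ: "connected ?J" by simp
  have propagate: "Q t'" if Q: "Q t" and t: "t \<in> ?J" "t' \<in> ?J"
    and st: "\<And>t. t \<in> ?J \<Longrightarrow> \<exists>T. open T \<and> t \<in> T \<and> T \<subseteq> ?J \<and> (\<forall>y\<in>T. \<forall>z\<in>T. Q y \<longrightarrow> Q z)" for Q t t'
  proof (rule connected_induction_simple[where S="?J" and P=Q and a=t and b=t', OF cJ t(1) t(2) Q])
    fix a assume "a \<in> ?J"
    from st[OF this] obtain T where T: "open T" "a \<in> T" "T \<subseteq> ?J" "\<forall>y\<in>T. \<forall>z\<in>T. Q y \<longrightarrow> Q z" by blast
    then show "\<exists>T. openin (top_of_set ?J) T \<and> a \<in> T \<and> (\<forall>x\<in>T. \<forall>y\<in>T. Q x \<longrightarrow> Q y)"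
      using open_subset[of T ?J] by blast
  qed
  have st: "stationary (\<sigma> t') x" if "stationary (\<sigma> t) x" "t \<in> ?J" "t' \<in> ?J" "x \<in> I" for t t' x
    by (rule propagate[where Q="\<lambda>t. stationary (\<sigma> t) x", OF that(1-3)]) (use step[OF _ that(4)] in meson)
  have ac: "\<exists>f. acc_mult (\<sigma> t') x f" if "\<exists>f. acc_mult (\<sigma> t) x f" "t \<in> ?J" "t' \<in> ?J" "x \<in> I" for t t' x
    by (rule propagate[where Q="\<lambda>t. \<exists>f. acc_mult (\<sigma> t) x f", OF that(1-3)]) (use step[OF _ that(4)] in meson)
  have \<sigma>0: "\<sigma> 0 x = \<gamma> x" if "x \<in> I" for x
    using lf \<gamma>V that unfolding local_flow_def \<sigma>_def by blast
  have dd0: "dd (\<lambda>x. coords d (\<sigma> 0 x)) x = dd (\<lambda>x. coords d (\<gamma> x)) x" if "x \<in> I" for x d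
    by (rule dd_cong_open[OF I(1) that]) (simp add: \<sigma>0)
  have st0: "stationary (\<sigma> 0) x \<longleftrightarrow> stationary \<gamma> x" if "x \<in> I" for x
    unfolding stationary_def dd0[OF that] \<sigma>0[OF that] ..
  have ac0: "\<exists>f. acc_mult (\<sigma> 0) x f" if x: "x \<in> I" for x
  proof -
    obtain c where c: "c \<in> A" "\<gamma> x \<in> dom_of c" using chart_ex by blast
    interpret chart_metric "cod_of c" "\<G> c" by (rule chart_metric[OF c(1)])
    have "acc (\<G> c) (\<lambda>x. coords c (\<sigma> 0 x)) 1 x = acc (\<G> c) (\<lambda>x. coords c (\<gamma> x)) 1 x"
      by (rule acc_cong[OF I(1) x]) (simp add: \<sigma>0)
    also have "\<dots> = 0" using Gd c x by blast
    finally have "acc_mult (\<sigma> 0) x 0"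
      by (intro acc_multI[OF s\<sigma>[OF J0] c(1) x]) (simp_all add: \<sigma>0[OF x] c(2))
    then show ?thesis ..
  qed
  \<comment> \<open>Rest is propagated both from 0 to \<open>t1\<close> and back, so the alternative
    of being nowhere at rest is carried over as well.\<close>
  have "(\<forall>x\<in>I. stationary \<gamma> x) \<or> (\<forall>x\<in>I. \<not> stationary \<gamma> x)" using geodesic_stationary[OF \<gamma>] by blast
  then have "(\<forall>x\<in>I. stationary (\<sigma> t1) x) \<or> (\<forall>x\<in>I. \<not> stationary (\<sigma> t1) x)"
    using st[OF _ J0 t1] st[OF _ t1 J0] st0 by blast
  then have "unparametrized_geodesic A g I (\<sigma> t1)"
    by (intro unparametrized_geodesicI I s\<sigma> c\<sigma> t1 ac[OF ac0 J0 t1])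
  then show "unparametrized_geodesic A g I (\<lambda>s. \<theta> t1 (\<gamma> s))" by (simp add: \<sigma>_def[abs_def])
qed

end

section \<open>Projective motions of rigid h-spaces\<close>

lemma (in chart_metric) eisen_cong:
  assumes "\<And>x. x \<in> U \<Longrightarrow> T x = T' x" and E: "eisen U G T \<psi>"
  shows "eisen U G T' \<psi>"
  unfolding eisen_def
proof (intro ballI allI)
  fix x u v w assume x: "x \<in> U"
  have "dd T x = dd T' x" by (rule dd_cong_open[OF U x assms(1)])
  then show "bf (dd T' x u) v w = bf (T' x) (chr G x u v) w + bf (T' x) v (chr G x u w) +
     2 * (\<psi> x \<bullet> u) * bf (G x) v w + (\<psi> x \<bullet> v) * bf (G x) u w + (\<psi> x \<bullet> w) * bf (G x) u v"
    using E[unfolded eisen_def, rule_format, OF x, of u v w] assms(1)[OF x] by simp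
qed

theorem theorem4:
  fixes A :: "('m::{t2_space, second_countable_topology}, 6) chart set"
    and g h :: "('m, 6) tensor02"
    and \<xi> :: "('m, 6) vfield"
  assumes "connected (UNIV :: 'm set)"
    and "smooth_atlas A"
    and "pseudo_riemannian_metric A g 2 4"
    and "rigid_h_space A g h"
    and "\<not> constant_curvature A g"
    and "smooth_vector_field A \<xi>"
  shows "projective_motion A g \<xi> \<longleftrightarrow>
    (\<exists>a\<^sub>1 a\<^sub>2 :: real. \<forall>c\<in>A. \<forall>p\<in>dom_of c. \<forall>i j.
       lie_deriv \<xi> g c i j p =
         cov_deriv1 g (lower_index g \<xi>) c i j p + cov_deriv1 g (lower_index g \<xi>) c j i p \<and>
       cov_deriv1 g (lower_index g \<xi>) c i j p + cov_deriv1 g (lower_index g \<xi>) c j i p =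
         a\<^sub>1 * h c p $ i $ j + a\<^sub>2 * g c p $ i $ j)"
proof -
  obtain \<phi> where h: "smooth_symmetric_tensor A h" "smooth_function A \<phi>" "eisenhart_equation A g h \<phi>"
    using assms(4) unfolding rigid_h_space_def h_space_def by blast
  interpret rigid_manifold A g 2 4 h \<phi>
  proof
    show "\<exists>n_as. jordan_nf (endo_mat g h c p) n_as \<and> distinct (map snd n_as)" if "c \<in> A" "p \<in> dom_of c" for c p
      using assms(4) that unfolding rigid_h_space_def by blast
  qed (use assms h in simp_all)
  show ?thesis
    unfolding lie_equation_iff[OF assms(6) h(1)]
  proof
    assume "projective_motion A g \<xi>"
    from projective_eisen[OF this]
    show "\<exists>a1 a2. \<forall>c\<in>A. \<forall>x\<in>cod_of c. lieG (loc c g) (loc c \<xi>) x = a1 *\<^sub>R loc c h x + a2 *\<^sub>R loc c g x"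
      by (rule lie_equation_global[OF assms(1,5,6)])
  next
    assume "\<exists>a1 a2. \<forall>c\<in>A. \<forall>x\<in>cod_of c. lieG (loc c g) (loc c \<xi>) x = a1 *\<^sub>R loc c h x + a2 *\<^sub>R loc c g x"
    then obtain a1 a2 where e: "\<And>c x. c \<in> A \<Longrightarrow> x \<in> cod_of c \<Longrightarrow>
        lieG (loc c g) (loc c \<xi>) x = a1 *\<^sub>R loc c h x + a2 *\<^sub>R loc c g x" by blast
    show "projective_motion A g \<xi>"
    proof (rule projective_motionI[OF assms(6)])
      fix c assume c: "c \<in> A"
      interpret m: cyclic_metric "cod_of c" "loc c g" "loc c h" "grad c" by (rule cyclic_metric[OF c])
      have z: "eisen (cod_of c) (loc c g) (\<lambda>x. 0) (\<lambda>x. 0)" by (simp add: eisen_def bf_mat_simps)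
      \<comment> \<open>\<open>eisen_combine\<close> subtracts a combination of metric and
        \<open>h\<close>, so the sum is obtained as zero minus the combination with coefficients
        \<open>- a2\<close> and \<open>- a1\<close>.\<close>
      have "eisen (cod_of c) (loc c g) (lieG (loc c g) (loc c \<xi>)) (\<lambda>x. 0 - (- a1) *\<^sub>R grad c x)"
        by (rule m.eisen_cong[OF _ m.eisen_combine[OF smooth_on_const[OF m.U] z m.H m.EH, of "- a2" "- a1"]])
          (simp add: e[OF c])
      moreover have "smooth_on (cod_of c) (\<lambda>x. 0 - (- a1) *\<^sub>R grad c x)"
        by (intro smooth_on_diff[OF m.U] smooth_on_const[OF m.U]
            smooth_on_linear_compose[OF m.U bounded_linear_scaleR_right] m.\<psi>)
      ultimately show "\<exists>\<psi>. smooth_on (cod_of c) \<psi> \<and> eisen (cod_of c) (loc c g) (lieG (loc c g) (loc c \<xi>)) \<psi>" by blast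
    qed
  qed
qed

end
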